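(* Let $\Omega\subseteq\mathbb R^d$ be a domain and let $\Omega_n\subset\Omega$, $n\in\mathbb N$, be bounded, nested subdomains that exhaust $\Omega$. Let $\tau_1,\tau_2$ be differential expressions. Let $A$, $B$ be realisations of $\tau_1$, $\tau_2$, respectively, in $L^2(\Omega)$ such that $B$ is $A$-bounded and $B^*$ is $A^*$-bounded. For $n\in\mathbb N$ let $A_n$, $B_n$ be realisations of $\tau_1$, $\tau_2$, respectively, in $L^2(\Omega_n)$ such that $\operatorname{dom}(A_n)\subseteq\operatorname{dom}(B_n)$ and $\operatorname{dom}(A_n^* )\subseteq\operatorname{dom}(B_n^* )$. Assume that (a) there exists a core $\Phi\subseteq\operatorname{dom}(A^* )$ of $A^*$ such that for all $f\in\Phi$ there exists $n_f\in\mathbb N$ for which $f|_{\Omega_n}\in\operatorname{dom}(A_n^* )$, $n\ge n_f$; (b) the quadratic forms $a$ and $b$ associated with $A$ and $B$ are closable with $\operatorname{dom}(\overline a)\subseteq\operatorname{dom}(\overline b)$ and, for each $n\in\mathbb N$ and any $f_n\in\operatorname{dom}(A_n)$, the extension by zero of $f_n$ to $\Omega$ (again denoted $f_n$) lies in $\operatorname{dom}(\overline a)\subseteq\operatorname{dom}(\overline b)$, with $\langle A_nf_n,f_n\rangle=\overline a[f_n]$ and $\langle B_nf_n,f_n\rangle=\overline b[f_n]$; (c) the spectra $\sigma(A_n,B_n)$, $\sigma(A_n^*,B_n^* )$ consist entirely of eigenvalues. Let ($\ast$) denote the condition: there exists a core $\widetilde\Phi\subseteq\operatorname{dom}(A)$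 of $A$ such that for all $f\in\widetilde\Phi$ there exists $n_f\in\mathbb N$ for which $f|_{\Omega_n}\in\operatorname{dom}(A_n)$, $n\ge n_f$. Then the following holds. (i) Assume that $0\notin W_e(A)\cap W_e(B)$ or $W_e(A,B)\neq\mathbb C$. Then every spurious eigenvalue belongs to $w_e(A,B)\supseteq\overline{W_e(A,B)}$. If, in addition, ($\ast$) holds, then for every isolated $\lambda\in\sigma(A,B)$ outside $w_e(A,B)$ there exist $\lambda_n\in\sigma(A_n,B_n)$, $n\in\mathbb N$, such that $\lambda_n\to\lambda$. (ii) Assume that $B$ is bounded. Then every spurious eigenvalue belongs to $W_e(A,B)\supseteq w_e(A,B)$. If, in addition, ($\ast$) holds, then for every isolated $\lambda\in\sigma(A,B)$ outside $W_e(A,B)$ there exist $\lambda_n\in\sigma(A_n,B_n)$, $n\in\mathbb N$, such that $\lambda_n\to\lambda$. (iii) Assume that $A,B$ are selfadjoint, (at least) one of them is uniformly positive, and $A_n,B_n$ are selfadjoint as well. If ($\ast$) holds, then for every $\lambda\in\sigma_{\rm app}(A,B)$ there exist $\lambda_n\in\sigma(A_n,B_n)$, $n\in\mathbb N$, such that $\lambda_n\to\lambda$.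
   Context: A realisation of a differential expression $\tau$ in $L^2(\Omega)$ (or $L^2(\Omega_n)$) is a (densely defined) linear operator whose action on its domain is given by $\tau$; correspondingly the adjoints act by the formal adjoint expression $\tau^*$, the same expression on $\Omega$ and on all $\Omega_n$. A core of a closable operator $S$ is a subspace $\Phi\subset\operatorname{dom}(S)$ such that the closure of $S|_\Phi$ is $\overline S$. The quadratic form associated with $S$ is $s[f]=\langle Sf,f\rangle$, $\operatorname{dom}(s)=\operatorname{dom}(S)$; $\overline s$ denotes its closure. For a linear operator $S$, $W_e(S)$ is the set of all $\mu\in\mathbb C$ for which there are $x_n\in\operatorname{dom}(S)$ with $\|x_n\|=1$, $x_n\to0$ weakly and $\langle Sx_n,x_n\rangle\to\mu$. For linear operators $A,B$ with $\operatorname{dom}(A)\subseteq\operatorname{dom}(B)$ (and $A-\lambda B$ defined on $\operatorname{dom}(A)$): $\sigma(A,B)=\{\lambda:0\in\sigma(A-\lambda B)\}$, $\sigma_{\rm app}(A,B)=\{\lambda:0\in\sigma_{\rm app}(A-\lambda B)\}$ ($\sigma_{\rm app}$ the approximate point spectrum), $\lambda$ is an eigenvalue of the pencil if $0$ is an eigenvalue of $A-\lambda B$, $W_e(A,B)=\{\lambda:0\in W_e(A-\lambda B)\}$, and $w_e(A,B)$ is the set of all limits $\lim_{n\to\infty}\frac{\langle Ax_n,x_n\rangle}{\langle Bx_n,x_n\rangle}$ with $x_n\in\operatorname{dom}(A)$, $\langle Bx_n,x_n\rangle\neq0$, $\|x_n\|=1$, $x_n\to0$ weakly. A spurious eigenvalue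 is a point $\lambda\in\mathbb C\setminus\sigma(A,B)$ for which there are an infinite set $I\subseteq\mathbb N$ and $\lambda_n\in\sigma(A_n,B_n)$, $n\in I$, with $\lambda_n\to\lambda$. A selfadjoint operator $S$ is uniformly positive if $S\ge c$ for some $c>0$.
   Formalization: "Closable" quadratic forms are taken to be sectorial (any vertex and direction), as needed for their closures to be well defined; and λ_n ∈ σ(A_n,B_n) is claimed only for all sufficiently large n, since finitely many of these spectra may be empty. *)

theory Defs
  imports "HOL-Analysis.Analysis"
begin

section \<open>The Hilbert space of square-integrable functions\<close>

definition square_integrable :: "(real^'d \<Rightarrow> complex) \<Rightarrow> bool" where
  "square_integrable f \<longleftrightarrow>
     f \<in> borel_measurable lebesgue \<and> integrable lebesgue (\<lambda>x. (cmod (f x))\<^sup>2)"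

lemma square_integrable_zero [simp]: "square_integrable (\<lambda>x. 0)"
  by (simp add: square_integrable_def)

lemma square_integrable_scale:
  assumes "square_integrable f" shows "square_integrable (\<lambda>x. c * f x)"
  using assms by (auto simp: square_integrable_def norm_mult power_mult_distrib)

lemma square_integrable_add:
  assumes "square_integrable f" "square_integrable g"
  shows "square_integrable (\<lambda>x. f x + g x)"
proof -
  have [measurable]: "f \<in> borel_measurable lebesgue" "g \<in> borel_measurable lebesgue"
    using assms by (auto simp: square_integrable_def)
  have "integrable lebesgue (\<lambda>x. 2 * (cmod (f x))\<^sup>2 + 2 * (cmod (g x))\<^sup>2)"
    using assms by (auto simp: square_integrable_def)
  moreover have "(cmod (f x + g x))\<^sup>2 \<le> 2 * (cmod (f x))\<^sup>2 + 2 * (cmod (g x))\<^sup>2" for x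
  proof -
    have "(cmod (f x + g x))\<^sup>2 \<le> (cmod (f x) + cmod (g x))\<^sup>2"
      by (intro power_mono norm_triangle_ineq) auto
    also have "\<dots> \<le> 2 * (cmod (f x))\<^sup>2 + 2 * (cmod (g x))\<^sup>2"
      using zero_le_power2[of "cmod (f x) - cmod (g x)"]
      by (simp add: power2_eq_square algebra_simps)
    finally show ?thesis .
  qed
  ultimately have "integrable lebesgue (\<lambda>x. (cmod (f x + g x))\<^sup>2)"
    by (intro Bochner_Integration.integrable_bound[of lebesgue _ "\<lambda>x. (cmod (f x + g x))\<^sup>2"]) auto
  then show ?thesis by (simp add: square_integrable_def)
qed

lemma square_integrable_minus:
  "square_integrable f \<Longrightarrow> square_integrable (\<lambda>x. - f x)"
  using square_integrable_scale[of f "-1"] by simp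

lemma square_integrable_diff:
  "square_integrable f \<Longrightarrow> square_integrable g \<Longrightarrow> square_integrable (\<lambda>x. f x - g x)"
  using square_integrable_add[of f "\<lambda>x. - g x"] square_integrable_minus[of g] by simp

lemma square_integrable_mult_integrable:
  assumes "square_integrable f" "square_integrable g"
  shows "integrable lebesgue (\<lambda>x. f x * cnj (g x))"
proof -
  have [measurable]: "f \<in> borel_measurable lebesgue" "g \<in> borel_measurable lebesgue"
    using assms by (auto simp: square_integrable_def)
  have cnj_meas: "(\<lambda>x. cnj (g x)) \<in> borel_measurable lebesgue"
    using borel_measurable_continuous_onI[of cnj] measurable_compose[of g lebesgue borel cnj borel]
    by (auto intro: continuous_intros)
  have "integrable lebesgue (\<lambda>x. (cmod (f x))\<^sup>2 + (cmod (g x))\<^sup>2)"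
    using assms by (auto simp: square_integrable_def)
  moreover have "cmod (f x * cnj (g x)) \<le> (cmod (f x))\<^sup>2 + (cmod (g x))\<^sup>2" for x
    using sum_squares_bound[of "cmod (f x)" "cmod (g x)"]
      mult_nonneg_nonneg[OF norm_ge_zero[of "f x"] norm_ge_zero[of "g x"]]
    unfolding norm_mult complex_mod_cnj by linarith
  ultimately show ?thesis
    using cnj_meas
    by (intro Bochner_Integration.integrable_bound[of lebesgue _ "\<lambda>x. f x * cnj (g x)"]) auto
qed

quotient_type 'd l2 = "real^'d \<Rightarrow> complex" / partial:
  "\<lambda>f g. square_integrable f \<and> square_integrable g \<and> (AE x in lebesgue. f x = g x)"
  morphisms rep_l2 abs_l2
proof (rule part_equivpI)
  show "\<exists>f :: real^'d \<Rightarrow> complex.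
      square_integrable f \<and> square_integrable f \<and> (AE x in lebesgue. f x = f x)"
    by (rule exI[of _ "\<lambda>x. 0"]) auto
qed (auto simp: symp_def transp_def elim: AE_mp)

instantiation l2 :: (finite) ab_group_add
begin

lift_definition zero_l2 :: "'a l2" is "\<lambda>x. 0" by simp

lift_definition plus_l2 :: "'a l2 \<Rightarrow> 'a l2 \<Rightarrow> 'a l2" is "\<lambda>f g x. f x + g x"
  by (auto intro: square_integrable_add)

lift_definition minus_l2 :: "'a l2 \<Rightarrow> 'a l2 \<Rightarrow> 'a l2" is "\<lambda>f g x. f x - g x"
  by (auto intro: square_integrable_diff)

lift_definition uminus_l2 :: "'a l2 \<Rightarrow> 'a l2" is "\<lambda>f x. - f x"
  by (auto intro: square_integrable_minus)

instance
  by standard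
    (transfer; auto intro: square_integrable_add square_integrable_minus square_integrable_diff
      simp: algebra_simps)+

end

lift_definition scaleC :: "complex \<Rightarrow> 'd::finite l2 \<Rightarrow> 'd l2" (infixr \<open>*\<^sub>C\<close> 75) is "\<lambda>c f x. c * f x"
  by (auto intro: square_integrable_scale)

text \<open>The scalar product is linear in its first argument.\<close>

lift_definition cinner :: "'d::finite l2 \<Rightarrow> 'd l2 \<Rightarrow> complex" is
  "\<lambda>f g. integral\<^sup>L lebesgue (\<lambda>x. f x * cnj (g x))"
proof -
  fix f f' g g' :: "real^'d \<Rightarrow> complex"
  assume f: "square_integrable f \<and> square_integrable f' \<and> (AE x in lebesgue. f x = f' x)"
    and g: "square_integrable g \<and> square_integrable g' \<and> (AE x in lebesgue. g x = g' x)"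
  have "AE x in lebesgue. f x * cnj (g x) = f' x * cnj (g' x)"
    using f g by auto
  moreover have "integrable lebesgue (\<lambda>x. f x * cnj (g x))"
      "integrable lebesgue (\<lambda>x. f' x * cnj (g' x))"
    using f g by (auto intro: square_integrable_mult_integrable)
  ultimately show "integral\<^sup>L lebesgue (\<lambda>x. f x * cnj (g x))
      = integral\<^sup>L lebesgue (\<lambda>x. f' x * cnj (g' x))"
    by (intro integral_cong_AE) auto
qed

lemma cinner_add_left: "cinner (f + g) h = cinner f h + cinner g h"
  by transfer
    (auto simp: distrib_right intro!: Bochner_Integration.integral_add
      square_integrable_mult_integrable)

lemma cinner_scaleC_left: "cinner (c *\<^sub>C f) h = c * cinner f h"
  by transfer (simp add: mult.assoc)

lemma cinner_commute: "cinner f g = cnj (cinner g f)"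
proof (transfer, elim conjE)
  fix f g :: "real^'d \<Rightarrow> complex"
  have "(\<lambda>x. f x * cnj (g x)) = (\<lambda>x. cnj (g x * cnj (f x)))"
    by (simp add: mult.commute)
  then show "integral\<^sup>L lebesgue (\<lambda>x. f x * cnj (g x))
      = cnj (integral\<^sup>L lebesgue (\<lambda>x. g x * cnj (f x)))"
    by (simp only: Bochner_Integration.integral_cnj)
qed

lemma cinner_self: "cinner f f = of_real (Re (cinner f f)) \<and> 0 \<le> Re (cinner f f)"
proof (transfer, elim conjE)
  fix f :: "real^'d \<Rightarrow> complex"
  assume "square_integrable f"
  have *: "(\<lambda>x. f x * cnj (f x)) = (\<lambda>x. of_real ((cmod (f x))\<^sup>2))"
    by (simp add: complex_norm_square del: of_real_power)
  show "integral\<^sup>L lebesgue (\<lambda>x. f x * cnj (f x))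
      = of_real (Re (integral\<^sup>L lebesgue (\<lambda>x. f x * cnj (f x))))
      \<and> 0 \<le> Re (integral\<^sup>L lebesgue (\<lambda>x. f x * cnj (f x)))"
    unfolding * integral_complex_of_real by simp
qed

lemma cinner_self_eq_zero: "Re (cinner f f) = 0 \<Longrightarrow> f = 0"
proof (transfer, elim conjE, intro conjI)
  fix f :: "real^'d \<Rightarrow> complex"
  assume f: "square_integrable f" and 0: "Re (integral\<^sup>L lebesgue (\<lambda>x. f x * cnj (f x))) = 0"
  have *: "(\<lambda>x. f x * cnj (f x)) = (\<lambda>x. of_real ((cmod (f x))\<^sup>2))"
    by (simp add: complex_norm_square del: of_real_power)
  have "integral\<^sup>L lebesgue (\<lambda>x. (cmod (f x))\<^sup>2) = 0"
    using 0 unfolding * integral_complex_of_real by simp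
  then have "AE x in lebesgue. (cmod (f x))\<^sup>2 = 0"
    using f integral_nonneg_eq_0_iff_AE[of lebesgue "\<lambda>x. (cmod (f x))\<^sup>2"]
    by (auto simp: square_integrable_def)
  then show "AE x in lebesgue. f x = 0" by simp
qed auto

instantiation l2 :: (finite) real_vector
begin

definition scaleR_l2 :: "real \<Rightarrow> 'a l2 \<Rightarrow> 'a l2" where
  "scaleR_l2 r f = of_real r *\<^sub>C f"

instance
proof
  fix r s :: real and f g :: "'a l2"
  show "r *\<^sub>R (f + g) = r *\<^sub>R f + r *\<^sub>R g"
    unfolding scaleR_l2_def
    by transfer (auto simp: distrib_left intro!: square_integrable_add square_integrable_scale)
  show "(r + s) *\<^sub>R f = r *\<^sub>R f + s *\<^sub>R f"
    unfolding scaleR_l2_def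
    by transfer (auto simp: distrib_right intro!: square_integrable_add square_integrable_scale)
  show "r *\<^sub>R s *\<^sub>R f = (r * s) *\<^sub>R f"
    unfolding scaleR_l2_def
    by transfer (auto simp: mult.assoc intro!: square_integrable_scale)
  show "1 *\<^sub>R f = f"
    unfolding scaleR_l2_def by transfer auto
qed

end

instantiation l2 :: (finite) real_inner
begin

definition inner_l2 :: "'a l2 \<Rightarrow> 'a l2 \<Rightarrow> real" where
  "inner_l2 f g = Re (cinner f g)"

definition norm_l2 :: "'a l2 \<Rightarrow> real" where
  "norm_l2 f = sqrt (Re (cinner f f))"

definition sgn_l2 :: "'a l2 \<Rightarrow> 'a l2" where
  "sgn_l2 f = f /\<^sub>R norm f"

definition dist_l2 :: "'a l2 \<Rightarrow> 'a l2 \<Rightarrow> real" where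
  "dist_l2 f g = norm (f - g)"

definition uniformity_l2 :: "('a l2 \<times> 'a l2) filter" where
  "uniformity_l2 = (INF e\<in>{0<..}. principal {(f, g). dist f g < e})"

definition open_l2 :: "'a l2 set \<Rightarrow> bool" where
  "open_l2 U \<longleftrightarrow> (\<forall>f\<in>U. \<forall>\<^sub>F (f', g) in uniformity. f' = f \<longrightarrow> g \<in> U)"

instance
proof
  fix r :: real and f g h :: "'a l2"
  show "sgn f = inverse (norm f) *\<^sub>R f" by (rule sgn_l2_def)
  show "dist f g = norm (f - g)" by (rule dist_l2_def)
  show "uniformity = (INF e\<in>{0<..}. principal {(f, g :: 'a l2). dist f g < e})"
    by (rule uniformity_l2_def)
  show "open U \<longleftrightarrow> (\<forall>f\<in>U. \<forall>\<^sub>F (f', g) in uniformity. f' = f \<longrightarrow> g \<in> U)" for U :: "'a l2 set"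
    by (rule open_l2_def)
  show "inner f g = inner g f"
    unfolding inner_l2_def using cinner_commute[of f g] by simp
  show "inner (f + g) h = inner f h + inner g h"
    by (simp add: inner_l2_def cinner_add_left)
  show "inner (r *\<^sub>R f) g = r * inner f g"
    by (simp add: inner_l2_def scaleR_l2_def cinner_scaleC_left)
  show "0 \<le> inner f f" using cinner_self[of f] by (simp add: inner_l2_def)
  show "inner f f = 0 \<longleftrightarrow> f = 0"
  proof
    assume "f = 0"
    then have "cinner f f = 0"
      using cinner_scaleC_left[of 0 f f] cinner_add_left[of 0 0 f] by simp
    then show "inner f f = 0" by (simp add: inner_l2_def)
  qed (simp add: inner_l2_def cinner_self_eq_zero)
  show "norm f = sqrt (inner f f)" by (simp add: norm_l2_def inner_l2_def)
qed

end

text \<open>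
  For \<open>\<Omega> \<subseteq> \<real>\<^sup>d\<close>, the space \<open>L\<^sup>2(\<Omega>)\<close> is identified, through extension by zero, with the closed
  subspace of those elements of \<open>L\<^sup>2(\<real>\<^sup>d)\<close> that vanish almost everywhere outside \<open>\<Omega>\<close>. Extension by
  zero from \<open>\<Omega>\<^sub>n\<close> to \<open>\<Omega>\<close> is then the identity, and the restriction \<open>f|\<^bsub>\<Omega>\<^sub>n\<^esub>\<close> is multiplication
  by the characteristic function of \<open>\<Omega>\<^sub>n\<close>.
\<close>

definition L2_on :: "(real^'d) set \<Rightarrow> 'd l2 set" where
  "L2_on \<Omega> = {f. AE x in lebesgue. x \<notin> \<Omega> \<longrightarrow> rep_l2 f x = 0}"

definition restrict_l2 :: "(real^'d) set \<Rightarrow> 'd l2 \<Rightarrow> 'd l2" where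
  "restrict_l2 \<Omega> f = abs_l2 (\<lambda>x. indicator \<Omega> x * rep_l2 f x)"

definition weakly_null :: "(nat \<Rightarrow> 'd::finite l2) \<Rightarrow> bool" where
  "weakly_null x \<longleftrightarrow> (\<forall>g. (\<lambda>n. cinner (x n) g) \<longlonglongrightarrow> 0)"


section \<open>Unbounded operators\<close>

text \<open>
  Operators are represented by their graphs. The ambient Hilbert space, always a closed subspace
  \<open>H\<close> of \<open>L\<^sup>2(\<real>\<^sup>d)\<close>, is passed explicitly to the notions that depend on it.
\<close>

type_synonym 'd operator = "('d l2 \<times> 'd l2) set"

definition csubspace :: "'d::finite l2 set \<Rightarrow> bool" where
  "csubspace V \<longleftrightarrow> 0 \<in> V \<and> (\<forall>f\<in>V. \<forall>g\<in>V. f + g \<in> V) \<and> (\<forall>c. \<forall>f\<in>V. c *\<^sub>C f \<in> V)"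

definition linear_operator :: "'d::finite l2 set \<Rightarrow> 'd operator \<Rightarrow> bool" where
  "linear_operator H S \<longleftrightarrow> S \<subseteq> H \<times> H \<and> single_valued S \<and> (0, 0) \<in> S \<and>
     (\<forall>(f, g)\<in>S. \<forall>(f', g')\<in>S. (f + f', g + g') \<in> S) \<and>
     (\<forall>c. \<forall>(f, g)\<in>S. (c *\<^sub>C f, c *\<^sub>C g) \<in> S)"

abbreviation dom :: "'d::finite operator \<Rightarrow> 'd l2 set" where
  "dom S \<equiv> Domain S"

definition app :: "'d::finite operator \<Rightarrow> 'd l2 \<Rightarrow> 'd l2" where
  "app S f = (THE g. (f, g) \<in> S)"

definition densely_defined :: "'d::finite l2 set \<Rightarrow> 'd operator \<Rightarrow> bool" where
  "densely_defined H S \<longleftrightarrow> closure (dom S) = H"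

definition adjoint :: "'d::finite l2 set \<Rightarrow> 'd operator \<Rightarrow> 'd operator" where
  "adjoint H S = {(g, h). g \<in> H \<and> h \<in> H \<and> (\<forall>(f, k)\<in>S. cinner k g = cinner f h)}"

definition selfadjoint :: "'d::finite l2 set \<Rightarrow> 'd operator \<Rightarrow> bool" where
  "selfadjoint H S \<longleftrightarrow> adjoint H S = S"

definition uniformly_positive :: "'d::finite operator \<Rightarrow> bool" where
  "uniformly_positive S \<longleftrightarrow>
     (\<exists>c>0. \<forall>f\<in>dom S. Re (cinner (app S f) f) \<ge> c * (norm f)\<^sup>2)"

definition bounded_operator :: "'d::finite operator \<Rightarrow> bool" where
  "bounded_operator S \<longleftrightarrow> (\<exists>C. \<forall>f\<in>dom S. norm (app S f) \<le> C * norm f)"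

text \<open>\<open>relatively_bounded T S\<close> means that \<open>T\<close> is \<open>S\<close>-bounded.\<close>

definition relatively_bounded :: "'d::finite operator \<Rightarrow> 'd operator \<Rightarrow> bool" where
  "relatively_bounded T S \<longleftrightarrow> dom S \<subseteq> dom T \<and>
     (\<exists>C D. \<forall>f\<in>dom S. norm (app T f) \<le> C * norm f + D * norm (app S f))"

definition closable :: "'d::finite operator \<Rightarrow> bool" where
  "closable S \<longleftrightarrow> single_valued (closure S)"

definition core :: "'d::finite operator \<Rightarrow> 'd l2 set \<Rightarrow> bool" where
  "core S \<Phi> \<longleftrightarrow> closable S \<and> csubspace \<Phi> \<and> \<Phi> \<subseteq> dom S \<and>
     closure (S \<inter> \<Phi> \<times> UNIV) = closure S"


section \<open>Spectra and essential numerical ranges\<close>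

text \<open>The operator \<open>A - \<mu>B\<close> with domain \<open>dom(A) \<inter> dom(B)\<close>.\<close>

definition pencil :: "'d::finite operator \<Rightarrow> 'd operator \<Rightarrow> complex \<Rightarrow> 'd operator" where
  "pencil A B \<mu> = {(f, g - \<mu> *\<^sub>C h) | f g h. (f, g) \<in> A \<and> (f, h) \<in> B}"

definition boundedly_invertible :: "'d::finite l2 set \<Rightarrow> 'd operator \<Rightarrow> bool" where
  "boundedly_invertible H S \<longleftrightarrow> bij_betw (app S) (dom S) H \<and>
     (\<exists>C. \<forall>f\<in>dom S. norm f \<le> C * norm (app S f))"

definition spectrum :: "'d::finite l2 set \<Rightarrow> 'd operator \<Rightarrow> complex set" where
  "spectrum H S = {\<mu>. \<not> boundedly_invertible H (pencil S (Id_on H) \<mu>)}"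

definition eigenvalue :: "'d::finite operator \<Rightarrow> complex \<Rightarrow> bool" where
  "eigenvalue S \<mu> \<longleftrightarrow> (\<exists>f\<in>dom S. f \<noteq> 0 \<and> app S f = \<mu> *\<^sub>C f)"

definition approx_spectrum :: "'d::finite operator \<Rightarrow> complex set" where
  "approx_spectrum S = {\<mu>. \<exists>x. (\<forall>n. x n \<in> dom S \<and> norm (x n) = 1) \<and>
     (\<lambda>n. app S (x n) - \<mu> *\<^sub>C x n) \<longlonglongrightarrow> 0}"

definition ess_num_range :: "'d::finite operator \<Rightarrow> complex set" where
  "ess_num_range S = {\<mu>. \<exists>x. (\<forall>n. x n \<in> dom S \<and> norm (x n) = 1) \<and> weakly_null x \<and>
     (\<lambda>n. cinner (app S (x n)) (x n)) \<longlonglongrightarrow> \<mu>}"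

definition pencil_spectrum :: "'d::finite l2 set \<Rightarrow> 'd operator \<Rightarrow> 'd operator \<Rightarrow> complex set" where
  "pencil_spectrum H A B = {\<mu>. 0 \<in> spectrum H (pencil A B \<mu>)}"

definition pencil_eigenvalue :: "'d::finite operator \<Rightarrow> 'd operator \<Rightarrow> complex \<Rightarrow> bool" where
  "pencil_eigenvalue A B \<mu> \<longleftrightarrow> eigenvalue (pencil A B \<mu>) 0"

definition pencil_approx_spectrum :: "'d::finite operator \<Rightarrow> 'd operator \<Rightarrow> complex set" where
  "pencil_approx_spectrum A B = {\<mu>. 0 \<in> approx_spectrum (pencil A B \<mu>)}"

text \<open>The sets \<open>W\<^sub>e(A,B)\<close> and \<open>w\<^sub>e(A,B)\<close>.\<close>

definition pencil_ess_num_range :: "'d::finite operator \<Rightarrow> 'd operator \<Rightarrow> complex set" where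
  "pencil_ess_num_range A B = {\<mu>. 0 \<in> ess_num_range (pencil A B \<mu>)}"

definition pencil_ess_quotient_range :: "'d::finite operator \<Rightarrow> 'd operator \<Rightarrow> complex set" where
  "pencil_ess_quotient_range A B = {\<mu>. \<exists>x.
     (\<forall>n. x n \<in> dom A \<and> cinner (app B (x n)) (x n) \<noteq> 0 \<and> norm (x n) = 1) \<and> weakly_null x \<and>
     (\<lambda>n. cinner (app A (x n)) (x n) / cinner (app B (x n)) (x n)) \<longlonglongrightarrow> \<mu>}"

text \<open>
  \<open>\<sigma>\<close> is the limit spectrum, \<open>\<sigma>n n\<close> the spectrum of the \<open>n\<close>-th approximation; the convergence is
  along the infinite index set \<open>I\<close>.
\<close>

definition spurious :: "complex set \<Rightarrow> (nat \<Rightarrow> complex set) \<Rightarrow> complex \<Rightarrow> bool" where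
  "spurious \<sigma> \<sigma>n \<mu> \<longleftrightarrow> \<mu> \<notin> \<sigma> \<and>
     (\<exists>I l. infinite I \<and> (\<forall>n\<in>I. l n \<in> \<sigma>n n) \<and> (l \<longlongrightarrow> \<mu>) (inf sequentially (principal I)))"

text \<open>
  ``There exist \<open>\<mu>\<^sub>n \<in> \<sigma>\<^sub>n\<close> with \<open>\<mu>\<^sub>n \<rightarrow> \<mu>\<close>'' is an asymptotic statement: finitely many
  of the sets \<open>\<sigma>\<^sub>n\<close> may be empty, so membership is required for all sufficiently large \<open>n\<close>.
\<close>

definition approximated :: "(nat \<Rightarrow> complex set) \<Rightarrow> complex \<Rightarrow> bool" where
  "approximated \<sigma>n \<mu> \<longleftrightarrow> (\<exists>l. (\<forall>\<^sub>F n in sequentially. l n \<in> \<sigma>n n) \<and> l \<longlonglongrightarrow> \<mu>)"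


section \<open>Quadratic forms\<close>

text \<open>
  Closability and closure are those of T. Kato, Perturbation Theory for Linear Operators, Ch. VI,
  where they are defined for sectorial forms. The rotation \<open>\<omega>\<close> admits sectors of any direction
  (such as that of a form bounded from above); multiplication of a form by a constant
  of modulus one does not affect the convergence \<open>form_converges\<close>. Without sectoriality the limit
  defining \<open>form_closure\<close> may depend on the approximating sequence, so that there is no
  well-defined closure. Every bounded form is sectorial.
\<close>

definition qform :: "'d::finite operator \<Rightarrow> 'd l2 \<Rightarrow> complex" where
  "qform S f = cinner (app S f) f"

definition sectorial_form :: "'d::finite l2 set \<Rightarrow> ('d l2 \<Rightarrow> complex) \<Rightarrow> bool" where
  "sectorial_form D s \<longleftrightarrow> (\<exists>\<omega> \<gamma> M. cmod \<omega> = 1 \<and>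
     (\<forall>f\<in>D. Re (\<omega> * s f) \<ge> \<gamma> * (norm f)\<^sup>2 \<and>
        \<bar>Im (\<omega> * s f)\<bar> \<le> M * (Re (\<omega> * s f) - \<gamma> * (norm f)\<^sup>2)))"

definition form_converges ::
  "'d::finite l2 set \<Rightarrow> ('d l2 \<Rightarrow> complex) \<Rightarrow> (nat \<Rightarrow> 'd l2) \<Rightarrow> 'd l2 \<Rightarrow> bool" where
  "form_converges D s x f \<longleftrightarrow> (\<forall>n. x n \<in> D) \<and> x \<longlonglongrightarrow> f \<and>
     ((\<lambda>(m, n). s (x m - x n)) \<longlongrightarrow> 0) (sequentially \<times>\<^sub>F sequentially)"

definition closable_form :: "'d::finite l2 set \<Rightarrow> ('d l2 \<Rightarrow> complex) \<Rightarrow> bool" where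
  "closable_form D s \<longleftrightarrow> sectorial_form D s \<and>
     (\<forall>x. form_converges D s x 0 \<longrightarrow> (\<lambda>n. s (x n)) \<longlonglongrightarrow> 0)"

definition dom_form_closure :: "'d::finite l2 set \<Rightarrow> ('d l2 \<Rightarrow> complex) \<Rightarrow> 'd l2 set" where
  "dom_form_closure D s = {f. \<exists>x. form_converges D s x f}"

definition form_closure :: "'d::finite l2 set \<Rightarrow> ('d l2 \<Rightarrow> complex) \<Rightarrow> 'd l2 \<Rightarrow> complex" where
  "form_closure D s f =
     (THE z. \<exists>x. form_converges D s x f \<and> (\<lambda>n. s (x n)) \<longlonglongrightarrow> z)"


section \<open>Differential expressions\<close>

definition partial :: "'d \<Rightarrow> (real^'d \<Rightarrow> complex) \<Rightarrow> real^'d \<Rightarrow> complex" where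
  "partial i f x = frechet_derivative f (at x) (axis i 1)"

primrec Ck_on :: "nat \<Rightarrow> (real^'d) set \<Rightarrow> (real^'d \<Rightarrow> complex) \<Rightarrow> bool" where
  "Ck_on 0 U f \<longleftrightarrow> continuous_on U f"
| "Ck_on (Suc k) U f \<longleftrightarrow> f differentiable_on U \<and> (\<forall>i. Ck_on k U (partial i f))"

text \<open>Only used for open \<open>U\<close>.\<close>

definition smooth_on :: "(real^'d) set \<Rightarrow> (real^'d \<Rightarrow> complex) \<Rightarrow> bool" where
  "smooth_on U f \<longleftrightarrow> (\<forall>k. Ck_on k U f)"

definition test_functions :: "(real^'d) set \<Rightarrow> (real^'d \<Rightarrow> complex) set" where
  "test_functions U = {\<phi>. smooth_on UNIV \<phi> \<and>
     compact (closure {x. \<phi> x \<noteq> 0}) \<and> closure {x. \<phi> x \<noteq> 0} \<subseteq> U}"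

definition locally_integrable :: "(real^'d) set \<Rightarrow> (real^'d \<Rightarrow> complex) \<Rightarrow> bool" where
  "locally_integrable U f \<longleftrightarrow> (\<forall>K. compact K \<and> K \<subseteq> U \<longrightarrow> set_integrable lebesgue K f)"

text \<open>Distributions on \<open>U\<close> are functionals whose values matter on \<open>test_functions U\<close> only.\<close>

type_synonym 'd distribution = "(real^'d \<Rightarrow> complex) \<Rightarrow> complex"

definition regular_distribution :: "(real^'d \<Rightarrow> complex) \<Rightarrow> 'd distribution" where
  "regular_distribution f \<phi> = integral\<^sup>L lebesgue (\<lambda>x. f x * \<phi> x)"

text \<open>
  A differential expression is built from multiplications by coefficient functions and partial
  derivatives by means of sums and compositions. This covers e.g. \<open>\<Sum>\<^sub>\<alpha> c\<^sub>\<alpha> D\<^sup>\<alpha>\<close> as well as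
  \<open>- div (p grad) + q\<close>.
\<close>

datatype 'd diff_expr =
    Coeff "real^'d \<Rightarrow> complex"
  | Partial 'd
  | Sum "'d diff_expr" "'d diff_expr"
  | Comp "'d diff_expr" "'d diff_expr"

primrec formal_adjoint :: "'d::finite diff_expr \<Rightarrow> 'd diff_expr" where
  "formal_adjoint (Coeff c) = Coeff (\<lambda>x. cnj (c x))"
| "formal_adjoint (Partial i) = Comp (Coeff (\<lambda>x. -1)) (Partial i)"
| "formal_adjoint (Sum \<sigma> \<tau>) = Sum (formal_adjoint \<sigma>) (formal_adjoint \<tau>)"
| "formal_adjoint (Comp \<sigma> \<tau>) = Comp (formal_adjoint \<tau>) (formal_adjoint \<sigma>)"

text \<open>
  \<open>acts \<tau> U u v\<close> means that \<open>\<tau>u = v\<close> on the open set \<open>U\<close>, with distributional derivatives. The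
  product of a coefficient \<open>c\<close> with a distribution is defined if \<open>c\<close> is smooth, or if the
  distribution is a locally integrable function whose product with \<open>c\<close> is locally integrable. No
  regularity of the coefficients is required otherwise; e.g. in \<open>(p f')' + q f\<close> it suffices that
  \<open>f'\<close>, \<open>p f'\<close> and \<open>q f\<close> are locally integrable functions.
\<close>

primrec acts ::
  "'d::finite diff_expr \<Rightarrow> (real^'d) set \<Rightarrow> 'd distribution \<Rightarrow> 'd distribution \<Rightarrow> bool" where
  "acts (Coeff c) U u v \<longleftrightarrow>
     smooth_on U c \<and> (\<forall>\<phi>\<in>test_functions U. v \<phi> = u (\<lambda>x. c x * \<phi> x)) \<or>
     (\<exists>f. locally_integrable U f \<and> locally_integrable U (\<lambda>x. c x * f x) \<and>
        (\<forall>\<phi>\<in>test_functions U. u \<phi> = regular_distribution f \<phi> \<and>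
           v \<phi> = regular_distribution (\<lambda>x. c x * f x) \<phi>))"
| "acts (Partial i) U u v \<longleftrightarrow> (\<forall>\<phi>\<in>test_functions U. v \<phi> = - u (partial i \<phi>))"
| "acts (Sum \<sigma> \<tau>) U u v \<longleftrightarrow>
     (\<exists>v\<^sub>1 v\<^sub>2. acts \<sigma> U u v\<^sub>1 \<and> acts \<tau> U u v\<^sub>2 \<and> (\<forall>\<phi>\<in>test_functions U. v \<phi> = v\<^sub>1 \<phi> + v\<^sub>2 \<phi>))"
| "acts (Comp \<sigma> \<tau>) U u v \<longleftrightarrow> (\<exists>w. acts \<tau> U u w \<and> acts \<sigma> U w v)"

definition given_by :: "'d::finite diff_expr \<Rightarrow> (real^'d) set \<Rightarrow> 'd operator \<Rightarrow> bool" where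
  "given_by \<tau> \<Omega> S \<longleftrightarrow> (\<forall>(f, g)\<in>S.
     acts \<tau> \<Omega> (regular_distribution (rep_l2 f)) (regular_distribution (rep_l2 g)))"

definition realisation :: "'d::finite diff_expr \<Rightarrow> (real^'d) set \<Rightarrow> 'd operator \<Rightarrow> bool" where
  "realisation \<tau> \<Omega> S \<longleftrightarrow>
     linear_operator (L2_on \<Omega>) S \<and> densely_defined (L2_on \<Omega>) S \<and>
     given_by \<tau> \<Omega> S \<and> given_by (formal_adjoint \<tau>) \<Omega> (adjoint (L2_on \<Omega>) S)"

text \<open>
  \<open>S\<close> has a core each of whose elements \<open>f\<close> satisfies \<open>f|\<^bsub>\<Omega>\<^sub>n\<^esub> \<in> dom(S\<^sub>n)\<close> for all \<open>n \<ge> n\<^sub>f\<close>.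
\<close>

definition truncation_core ::
  "(nat \<Rightarrow> (real^'d) set) \<Rightarrow> 'd::finite operator \<Rightarrow> (nat \<Rightarrow> 'd operator) \<Rightarrow> bool" where
  "truncation_core \<Omega>n S Sn \<longleftrightarrow> (\<exists>\<Phi>. core S \<Phi> \<and>
     (\<forall>f\<in>\<Phi>. \<exists>n\<^sub>f. \<forall>n\<ge>n\<^sub>f. restrict_l2 (\<Omega>n n) f \<in> dom (Sn n)))"

definition domain :: "(real^'d) set \<Rightarrow> bool" where
  "domain \<Omega> \<longleftrightarrow> open \<Omega> \<and> connected \<Omega> \<and> \<Omega> \<noteq> {}"

end

theory Submission
  imports Defs "HOL-Complex_Analysis.Complex_Analysis" "HOL-Computational_Algebra.Polynomial"
    "HOL-Library.Diagonal_Subsequence"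
begin

text \<open>
  Let \<open>t\<^sub>\<mu>\<close> be the quadratic form of \<open>A - \<mu>B\<close>. A point \<open>\<mu>\<close> lies in \<open>W = W\<^sub>e(A,B) \<union> w\<^sub>e(A,B)\<close> iff there are
  weakly null unit vectors \<open>x\<^sub>n\<close> with \<open>t\<^sub>\<mu>[x\<^sub>n] / (1 + \<bar>b[x\<^sub>n]\<bar>) \<rightarrow> 0\<close>. The main step is that, for \<open>\<mu>\<close> outside
  \<open>\<sigma>(A,B) \<union> W\<close>, there are no unit vectors \<open>f\<^sub>k \<in> dom A\<^sub>n\<close> with \<open>n = n\<^sub>k \<rightarrow> \<infinity>\<close> and
  \<open>(A\<^sub>n - \<mu>\<^sub>k B\<^sub>n) f\<^sub>k \<rightarrow> 0\<close>, \<open>\<mu>\<^sub>k \<rightarrow> \<mu>\<close>. By (a) a weak limit \<open>f\<close> of such vectors annihilates the range of the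
  adjoint of the pencil, and by (b) they have approximants \<open>y\<^sub>k \<in> dom A\<close> with small \<open>t\<^sub>\<mu>[y\<^sub>k]\<close>. As
  \<open>\<mu> \<notin> W\<close>, the form \<open>t\<^sub>\<mu>\<close> is coercive on a subspace of finite codimension. Because \<open>A - \<mu>B\<close> is
  invertible, there is \<open>x \<in> dom A\<close> whose projection onto the exceptional subspace is that of \<open>f\<close> and with
  \<open>(A - \<mu>B) x\<close> in that subspace, so that \<open>t\<^sub>\<mu>[y\<^sub>k - x] \<rightarrow> 0\<close>, hence \<open>y\<^sub>k \<rightarrow> x = f\<close>. Thus \<open>(A - \<mu>B) f = 0\<close> and
  \<open>f = 0\<close>; then \<open>y\<^sub>k\<close> is a weakly null sequence that puts \<open>\<mu>\<close> into \<open>W\<close>.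

  It follows that spurious eigenvalues lie in \<open>W\<close>, and that the resolvents of the truncated pencils are
  uniformly bounded on small circles around an isolated \<open>\<lambda> \<in> \<sigma>(A,B)\<close> outside \<open>W\<close>. If \<open>\<lambda>\<close> were not
  approximated, the maximum principle and the core in (\<open>\<ast>\<close>) would extend the bound to \<open>A - \<mu>B\<close> on the whole
  disc, and \<open>\<lambda>\<close> would be a removable singularity of the resolvent. In part (iii), a Riccati
  inequality for \<open>\<langle>(A\<^sub>n - (\<lambda> + s) B\<^sub>n)\<^sup>-\<^sup>1 y, y\<rangle>\<close> bounds the resolvent by the distance to the spectrum.
\<close>

section \<open>Hilbert space structure of \<open>L\<^sup>2\<close>\<close>

text \<open>The adjoint of \<open>A - \<mu>B\<close> may be strictly larger than the adjoint
  expression on \<open>dom A'\<close>, so a vector orthogonal to the range of the latter need not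
  vanish, although \<open>A - \<mu>B\<close> is invertible. The remedy is that \<open>dom A'\<close>
  reaches into the form domain: by Lax--Milgram every vector of \<open>dom A\<close> is approximated
  by elements of \<open>dom A'\<close> in the form norm of \<open>A\<close>, so orthogonality can be
  used against \<open>dom A\<close> itself. A second obstacle is that \<open>dom (An n)\<close> lies
  only in the form closures, and that no relative bound links \<open>Bn n\<close> to
  \<open>An n\<close>. Both are met through the numerical range: a half-plane containing the values
  of the form of \<open>B\<close> is inherited by \<open>Bn n\<close>, it makes \<open>Bn n\<close>
  closable, and the closed graph theorem bounds \<open>Bn n\<close> relative to an invertible
  truncated pencil. This is why the resolvents are holomorphic. The denominator
  \<open>1 + \<bar>b\<bar>\<close> is there because \<open>b\<close> may be unbounded along a
  sequence of unit vectors: moving \<open>\<mu>\<close> changes the form by a multiple of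
  \<open>b\<close>, which the denominator absorbs.\<close>

lemma square_integrable_rep: "square_integrable (rep_l2 f)"
  using Quotient_rep_reflp[OF Quotient_l2, of f] by simp

lemma rep_abs_l2_AE: "square_integrable f \<Longrightarrow> AE x in lebesgue. rep_l2 (abs_l2 f) x = f x"
  using Quotient_rep_abs[OF Quotient_l2, of f] by simp

lemma abs_rep_l2 [simp]: "abs_l2 (rep_l2 f) = f"
  by (rule Quotient_abs_rep[OF Quotient_l2])

lemma abs_l2_eqI:
  assumes "square_integrable f" "square_integrable g" "AE x in lebesgue. f x = g x"
  shows "abs_l2 f = abs_l2 g"
  using Quotient_rel_abs[OF Quotient_l2, of f g] assms by simp

lemma l2_eqI: "AE x in lebesgue. rep_l2 f x = rep_l2 g x \<Longrightarrow> f = g"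
  using abs_l2_eqI[of "rep_l2 f" "rep_l2 g"] by (simp add: square_integrable_rep)

lemma rep_l2_measurable [measurable]: "rep_l2 f \<in> borel_measurable lebesgue"
  using square_integrable_rep[of f] by (simp add: square_integrable_def)

lemma rep_add_AE: "AE x in lebesgue. rep_l2 (f + g) x = rep_l2 f x + rep_l2 g x"
proof -
  have "f + g = abs_l2 (\<lambda>x. rep_l2 f x + rep_l2 g x)"
    using plus_l2.abs_eq[of "rep_l2 f" "rep_l2 g"] by (simp add: square_integrable_rep)
  then show ?thesis
    using rep_abs_l2_AE[OF square_integrable_add[OF square_integrable_rep square_integrable_rep]]
    by auto
qed

lemma rep_diff_AE: "AE x in lebesgue. rep_l2 (f - g) x = rep_l2 f x - rep_l2 g x"
proof -
  have "f - g = abs_l2 (\<lambda>x. rep_l2 f x - rep_l2 g x)"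
    using minus_l2.abs_eq[of "rep_l2 f" "rep_l2 g"] by (simp add: square_integrable_rep)
  then show ?thesis
    using rep_abs_l2_AE[OF square_integrable_diff[OF square_integrable_rep square_integrable_rep]]
    by auto
qed

lemma rep_scaleC_AE: "AE x in lebesgue. rep_l2 (c *\<^sub>C f) x = c * rep_l2 f x"
proof -
  have "c *\<^sub>C f = abs_l2 (\<lambda>x. c * rep_l2 f x)"
    using scaleC.abs_eq[of "rep_l2 f"] by (simp add: square_integrable_rep)
  then show ?thesis
    using rep_abs_l2_AE[OF square_integrable_scale[OF square_integrable_rep]] by auto
qed

lemma cinner_eq_integral:
  "cinner f g = integral\<^sup>L lebesgue (\<lambda>x. rep_l2 f x * cnj (rep_l2 g x))"
  using cinner.abs_eq[of "rep_l2 f" "rep_l2 g"] by (simp add: square_integrable_rep)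

lemma norm_l2_square: "(norm f)\<^sup>2 = Re (cinner f f)"
  using cinner_self[of f] by (simp add: norm_l2_def)

lemma cinner_self_norm: "cinner f f = of_real ((norm f)\<^sup>2)"
  using cinner_self[of f] norm_l2_square[of f] by simp

lemma norm_l2_square_integral: "(norm f)\<^sup>2 = integral\<^sup>L lebesgue (\<lambda>x. (cmod (rep_l2 f x))\<^sup>2)"
proof -
  have "cinner f f = integral\<^sup>L lebesgue (\<lambda>x. of_real ((cmod (rep_l2 f x))\<^sup>2))"
    unfolding cinner_eq_integral by (simp add: complex_norm_square del: of_real_power)
  then show ?thesis
    unfolding norm_l2_square integral_complex_of_real by simp
qed

lemma nn_integral_rep_l2: "(\<integral>\<^sup>+x. ennreal ((cmod (rep_l2 f x))\<^sup>2) \<partial>lebesgue) = ennreal ((norm f)\<^sup>2)"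
  unfolding norm_l2_square_integral
  using square_integrable_rep[of f] by (intro nn_integral_eq_integral) (auto simp: square_integrable_def)

lemma scaleC_add_right: "c *\<^sub>C (f + g) = c *\<^sub>C f + c *\<^sub>C g"
  by transfer (auto simp: distrib_left intro!: square_integrable_add square_integrable_scale)

lemma scaleC_add_left: "(b + c) *\<^sub>C f = b *\<^sub>C f + c *\<^sub>C f"
  by transfer (auto simp: distrib_right intro!: square_integrable_add square_integrable_scale)

lemma scaleC_scaleC [simp]: "b *\<^sub>C c *\<^sub>C f = (b * c) *\<^sub>C f"
  by transfer (auto simp: mult.assoc intro!: square_integrable_scale)

lemma scaleC_one [simp]: "1 *\<^sub>C f = f"
  by transfer auto

lemma scaleC_of_real: "of_real r *\<^sub>C f = r *\<^sub>R f"
  by (simp add: scaleR_l2_def)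

lemma cinner_scaleC_right: "cinner f (c *\<^sub>C g) = cnj c * cinner f g"
  by (subst (1 2) cinner_commute) (simp add: cinner_scaleC_left)

lemma norm_scaleC: "norm (c *\<^sub>C f) = cmod c * norm f"
proof -
  have "(norm (c *\<^sub>C f))\<^sup>2 = (cmod c * norm f)\<^sup>2"
    unfolding norm_l2_square[of "c *\<^sub>C f"] cinner_scaleC_left cinner_scaleC_right cinner_self_norm[of f]
    by (simp add: power_mult_distrib cmod_power2) (simp add: power2_eq_square algebra_simps)
  then show ?thesis by (simp add: power2_eq_iff_nonneg)
qed

lemma norm_cinner_le: "cmod (cinner f g) \<le> norm f * norm g"
proof (cases "cinner f g = 0")
  case False
  \<comment> \<open>The phase \<open>u\<close> turns the product into its modulus, which reduces the
    claim to the real Cauchy--Schwarz inequality.\<close>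
  define u where "u = cnj (cinner f g) / of_real (cmod (cinner f g))"
  have u: "cmod u = 1" using False by (simp add: u_def norm_divide)
  have "u * cinner f g = of_real (cmod (cinner f g))"
    using False complex_norm_square[of "cinner f g"]
    by (simp add: u_def field_simps power2_eq_square)
  then have "cmod (cinner f g) = inner (u *\<^sub>C f) g"
    by (simp add: inner_l2_def cinner_scaleC_left)
  also have "\<dots> \<le> norm (u *\<^sub>C f) * norm g" by (rule norm_cauchy_schwarz)
  finally show ?thesis by (simp add: norm_scaleC u)
qed simp

interpretation cinner: bounded_bilinear cinner
proof
  show "cinner (a + a') b = cinner a b + cinner a' b" for a a' b :: "'a l2"
    by (rule cinner_add_left)
  show "cinner a (b + b') = cinner a b + cinner a b'" for a b b' :: "'a l2"
    by (subst (1 2 3) cinner_commute) (simp add: cinner_add_left)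
  show "cinner (r *\<^sub>R a) b = r *\<^sub>R cinner a b" for r and a b :: "'a l2"
    by (simp add: scaleR_l2_def cinner_scaleC_left scaleR_conv_of_real)
  show "cinner a (r *\<^sub>R b) = r *\<^sub>R cinner a b" for r and a b :: "'a l2"
    by (simp add: scaleR_l2_def cinner_scaleC_right scaleR_conv_of_real)
  show "\<exists>K. \<forall>a b :: 'a l2. norm (cinner a b) \<le> norm a * norm b * K"
    by (rule exI[of _ 1]) (simp add: norm_cinner_le)
qed

interpretation scaleC: bounded_bilinear scaleC
proof
  show "scaleC (a + a') b = scaleC a b + scaleC a' b" for a a' and b :: "'a l2"
    by (rule scaleC_add_left)
  show "scaleC a (b + b') = scaleC a b + scaleC a b'" for a and b b' :: "'a l2"
    by (rule scaleC_add_right)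
  show "scaleC (r *\<^sub>R a) b = r *\<^sub>R scaleC a b" for r a and b :: "'a l2"
    by (simp add: scaleR_l2_def scaleR_conv_of_real)
  show "scaleC a (r *\<^sub>R b) = r *\<^sub>R scaleC a b" for r a and b :: "'a l2"
    by (simp add: scaleR_l2_def mult.commute)
  show "\<exists>K. \<forall>a. \<forall>b :: 'a l2. norm (scaleC a b) \<le> norm a * norm b * K"
    by (rule exI[of _ 1]) (simp add: norm_scaleC)
qed

lemma scaleC_minus_one [simp]: "(- 1) *\<^sub>C f = - f"
  by (simp add: scaleC.minus_left)

text \<open>The vector is tested against approximants of itself. Membership in the closure stands in
  for density, since operators act in the subspaces \<open>L2_on \<Omega>\<close>.\<close>

lemma cinner_eq_zeroI:
  assumes "\<And>g. g \<in> S \<Longrightarrow> cinner f g = 0" "f \<in> closure S"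
  shows "f = 0"
proof -
  obtain s where s: "\<And>n. s n \<in> S" "s \<longlonglongrightarrow> f"
    using assms(2) by (auto simp: closure_sequential)
  have "(\<lambda>n. cinner f (s n)) \<longlonglongrightarrow> cinner f f"
    by (intro cinner.tendsto tendsto_const s)
  then have "cinner f f = 0"
    using assms(1)[OF s(1)] by (simp add: LIMSEQ_const_iff)
  then show ?thesis by (simp add: cinner_self_norm)
qed

text \<open>The weights \<open>4 ^ n\<close> make the increments of a fast Cauchy sequence summable almost everywhere.\<close>

instance l2 :: (finite) complete_space
proof
  fix X :: "nat \<Rightarrow> 'a l2"
  assume "Cauchy X"
  have "\<exists>r. \<forall>n. (\<forall>i\<ge>r n. \<forall>j\<ge>r n. dist (X i) (X j) < (1/4)^n) \<and> r n < r (Suc n)"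
  proof (rule dependent_nat_choice)
    show "\<exists>m. \<forall>i\<ge>m. \<forall>j\<ge>m. dist (X i) (X j) < (1/4)^0"
      using metric_CauchyD[OF \<open>Cauchy X\<close>, of 1] by auto
  next
    fix m n :: nat
    obtain M where "\<forall>i\<ge>M. \<forall>j\<ge>M. dist (X i) (X j) < (1/4) ^ Suc n"
      using metric_CauchyD[OF \<open>Cauchy X\<close>, of "(1/4) ^ Suc n"] by auto
    then show "\<exists>m'. (\<forall>i\<ge>m'. \<forall>j\<ge>m'. dist (X i) (X j) < (1/4) ^ Suc n) \<and> m < m'"
      by (intro exI[of _ "max M (Suc m)"]) auto
  qed
  then obtain r where r: "\<And>n i j. i \<ge> r n \<Longrightarrow> j \<ge> r n \<Longrightarrow> dist (X i) (X j) < (1/4)^n"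
    and r': "strict_mono r"
    by (auto simp: strict_mono_Suc_iff)
  define f where "f n = rep_l2 (X (r n))" for n
  have [measurable]: "f n \<in> borel_measurable lebesgue" for n by (simp add: f_def)
  have nn_diff: "(\<integral>\<^sup>+x. ennreal ((cmod (f m x - f n x))\<^sup>2) \<partial>lebesgue) = ennreal ((dist (X (r m)) (X (r n)))\<^sup>2)"
    for m n
  proof -
    have "(\<integral>\<^sup>+x. ennreal ((cmod (f m x - f n x))\<^sup>2) \<partial>lebesgue) =
      (\<integral>\<^sup>+x. ennreal ((cmod (rep_l2 (X (r m) - X (r n)) x))\<^sup>2) \<partial>lebesgue)"
      using rep_diff_AE[of "X (r m)" "X (r n)"] by (intro nn_integral_cong_AE) (auto simp: f_def)
    then show ?thesis by (simp add: nn_integral_rep_l2 dist_norm)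
  qed
  have le: "(dist (X (r m)) (X (r n)))\<^sup>2 \<le> (1/16)^n" if "n \<le> m" for m n
  proof -
    have "dist (X (r m)) (X (r n)) \<le> (1/4)^n"
      using r[of n "r m" "r n"] that r' by (simp add: strict_mono_less_eq less_imp_le)
    then have "(dist (X (r m)) (X (r n)))\<^sup>2 \<le> ((1/4)^n)\<^sup>2"
      by (intro power_mono) auto
    also have "\<dots> = (1/16)^n" by (simp add: power2_eq_square flip: power_mult_distrib)
    finally show ?thesis .
  qed
  have "(\<integral>\<^sup>+x. (\<Sum>n. ennreal (4^n * (cmod (f (Suc n) x - f n x))\<^sup>2)) \<partial>lebesgue)
    = (\<Sum>n. \<integral>\<^sup>+x. ennreal (4^n * (cmod (f (Suc n) x - f n x))\<^sup>2) \<partial>lebesgue)"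
    by (rule nn_integral_suminf) measurable
  also have "\<dots> \<le> (\<Sum>n. ennreal ((1/4)^n))"
  proof (rule suminf_le)
    fix n
    have "(\<integral>\<^sup>+x. ennreal (4^n * (cmod (f (Suc n) x - f n x))\<^sup>2) \<partial>lebesgue)
      = ennreal (4^n) * ennreal ((dist (X (r (Suc n))) (X (r n)))\<^sup>2)"
      unfolding nn_diff[symmetric] by (subst nn_integral_cmult[symmetric]) (auto simp: ennreal_mult)
    also have "\<dots> = ennreal (4^n * (dist (X (r (Suc n))) (X (r n)))\<^sup>2)"
      by (simp add: ennreal_mult)
    also have "\<dots> \<le> ennreal (4^n * (1/16)^n)"
      using le[of n "Suc n"] by (intro ennreal_leI mult_left_mono) auto
    also have "4^n * (1/16)^n = (1/4 :: real)^n"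
      by (simp flip: power_mult_distrib)
    finally show "(\<integral>\<^sup>+x. ennreal (4^n * (cmod (f (Suc n) x - f n x))\<^sup>2) \<partial>lebesgue) \<le> ennreal ((1/4)^n)" .
  qed auto
  also have "\<dots> = ennreal (\<Sum>n. (1/4)^n)"
    by (rule suminf_ennreal2) auto
  also have "\<dots> < \<infinity>" by simp
  finally have "AE x in lebesgue. (\<Sum>n. ennreal (4^n * (cmod (f (Suc n) x - f n x))\<^sup>2)) \<noteq> \<infinity>"
    by (intro nn_integral_noteq_infinite) auto
  then have conv: "AE x in lebesgue. convergent (\<lambda>n. f n x)"
  proof eventually_elim
    case (elim x)
    then have "summable (\<lambda>n. 4^n * (cmod (f (Suc n) x - f n x))\<^sup>2)"
      by (intro summable_suminf_not_top) auto
    then have "Bseq (\<lambda>n. 4^n * (cmod (f (Suc n) x - f n x))\<^sup>2)"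
      by (intro convergent_imp_Bseq convergentI[OF summable_LIMSEQ_zero])
    then obtain C where C: "\<And>n. 4^n * (cmod (f (Suc n) x - f n x))\<^sup>2 \<le> C"
      by (auto simp: Bseq_def)
    have four: "(4::real)^n = 2^n * 2^n" for n by (simp flip: power_mult_distrib)
    have "cmod (f (Suc n) x - f n x) \<le> sqrt C * (1/2)^n" for n
    proof -
      have "(2^n * cmod (f (Suc n) x - f n x))\<^sup>2 \<le> C"
        using C[of n] four[of n] by (simp add: power2_eq_square mult_ac)
      then have "2^n * cmod (f (Suc n) x - f n x) \<le> sqrt C"
        by (rule real_le_rsqrt)
      then show ?thesis by (simp add: field_simps power_one_over)
    qed
    then have "summable (\<lambda>n. f (Suc n) x - f n x)"
      by (intro summable_comparison_test'[where g="\<lambda>n. sqrt C * (1/2)^n" and N=0, OF summable_mult[OF summable_geometric]])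
        auto
    then have "convergent (\<lambda>n. \<Sum>i<n. f (Suc i) x - f i x)"
      by (simp add: summable_iff_convergent)
    moreover have "(\<Sum>i<n. f (Suc i) x - f i x) = f n x - f 0 x" for n
      by (rule sum_lessThan_telescope)
    ultimately have "convergent (\<lambda>n. (f n x - f 0 x) + f 0 x)"
      by (intro convergent_add convergent_const) simp
    then show ?case by simp
  qed
  define F where "F x = lim (\<lambda>n. f n x)" for x
  have [measurable]: "F \<in> borel_measurable lebesgue"
    unfolding F_def by (rule borel_measurable_lim_metric) auto
  have lim: "AE x in lebesgue. (\<lambda>n. f n x) \<longlonglongrightarrow> F x"
    using conv by eventually_elim (simp add: F_def convergent_LIMSEQ_iff)
  \<comment> \<open>Fatou's lemma turns the limit almost everywhere into an \<open>L\<^sup>2\<close>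
    estimate, which yields both the square integrability of \<open>F\<close> and the rate of
    convergence.\<close>
  have bound: "(\<integral>\<^sup>+x. ennreal ((cmod (F x - f m x))\<^sup>2) \<partial>lebesgue) \<le> ennreal ((1/16)^m)" for m
  proof -
    have "(\<integral>\<^sup>+x. ennreal ((cmod (F x - f m x))\<^sup>2) \<partial>lebesgue)
      = (\<integral>\<^sup>+x. liminf (\<lambda>n. ennreal ((cmod (f n x - f m x))\<^sup>2)) \<partial>lebesgue)"
    proof (intro nn_integral_cong_AE, use lim in eventually_elim)
      case (elim x)
      then have "(\<lambda>n. ennreal ((cmod (f n x - f m x))\<^sup>2)) \<longlonglongrightarrow> ennreal ((cmod (F x - f m x))\<^sup>2)"
        by (intro tendsto_intros tendsto_ennrealI)
      then show ?case by (rule lim_imp_Liminf[OF trivial_limit_sequentially, symmetric])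
    qed
    also have "\<dots> \<le> liminf (\<lambda>n. \<integral>\<^sup>+x. ennreal ((cmod (f n x - f m x))\<^sup>2) \<partial>lebesgue)"
      by (rule nn_integral_liminf) auto
    also have "\<dots> \<le> ennreal ((1/16)^m)"
      unfolding nn_diff
      using le by (intro Liminf_le eventually_sequentiallyI[of m] ennreal_leI) auto
    finally show ?thesis .
  qed
  have sqd: "square_integrable (\<lambda>x. F x - f m x)" for m
    unfolding square_integrable_def
    using bound[of m] by (auto intro!: integrableI_bounded simp: le_less_trans)
  have sqF: "square_integrable F"
    using square_integrable_add[OF sqd[of 0] square_integrable_rep[of "X (r 0)"]]
    by (simp add: f_def)
  have "norm (X (r m) - abs_l2 F) \<le> (1/4)^m" for m
  proof -
    have "AE x in lebesgue. rep_l2 (X (r m) - abs_l2 F) x = f m x - F x"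
      using rep_diff_AE[of "X (r m)" "abs_l2 F"] rep_abs_l2_AE[OF sqF]
      by eventually_elim (simp add: f_def)
    then have "ennreal ((norm (X (r m) - abs_l2 F))\<^sup>2) = (\<integral>\<^sup>+x. ennreal ((cmod (F x - f m x))\<^sup>2) \<partial>lebesgue)"
      unfolding nn_integral_rep_l2[symmetric]
      by (intro nn_integral_cong_AE) (auto simp: norm_minus_commute)
    then have "ennreal ((norm (X (r m) - abs_l2 F))\<^sup>2) \<le> ennreal ((1/16)^m)"
      using bound[of m] by (rule ord_eq_le_trans)
    then have "(norm (X (r m) - abs_l2 F))\<^sup>2 \<le> (1/16)^m"
      by (rule iffD1[OF ennreal_le_iff, rotated]) simp
    also have "\<dots> = ((1/4)^m)\<^sup>2" by (simp add: power2_eq_square flip: power_mult_distrib)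
    finally show ?thesis by (rule power2_le_imp_le) simp
  qed
  then have "(\<lambda>m. X (r m) - abs_l2 F) \<longlonglongrightarrow> 0"
    by (intro Lim_null_comparison[OF always_eventually LIMSEQ_realpow_zero[of "1/4"]]) auto
  then have "(X \<circ> r) \<longlonglongrightarrow> abs_l2 F"
    by (simp add: o_def LIM_zero_iff)
  then have "X \<longlonglongrightarrow> abs_l2 F"
    using Cauchy_converges_subseq[OF \<open>Cauchy X\<close> r'] by blast
  then show "convergent X" by (rule convergentI)
qed

section \<open>Restriction to a measurable set\<close>

lemma square_integrable_restrict:
  assumes "\<Omega> \<in> sets lebesgue" "square_integrable f"
  shows "square_integrable (\<lambda>x. indicator \<Omega> x * f x)"
proof -
  have [measurable]: "\<Omega> \<in> sets lebesgue" "f \<in> borel_measurable lebesgue"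
    using assms by (auto simp: square_integrable_def)
  have "integrable lebesgue (\<lambda>x. (cmod (indicator \<Omega> x * f x))\<^sup>2)"
  proof (rule Bochner_Integration.integrable_bound)
    show "integrable lebesgue (\<lambda>x. (cmod (f x))\<^sup>2)" using assms by (simp add: square_integrable_def)
  qed (auto simp: indicator_def)
  then show ?thesis by (simp add: square_integrable_def)
qed

lemma rep_restrict_AE:
  "\<Omega> \<in> sets lebesgue \<Longrightarrow> AE x in lebesgue. rep_l2 (restrict_l2 \<Omega> f) x = indicator \<Omega> x * rep_l2 f x"
  unfolding restrict_l2_def
  by (intro rep_abs_l2_AE square_integrable_restrict square_integrable_rep)

lemma restrict_in_L2_on: "\<Omega> \<in> sets lebesgue \<Longrightarrow> restrict_l2 \<Omega> f \<in> L2_on \<Omega>"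
  using rep_restrict_AE[of \<Omega> f] by (auto simp: L2_on_def)

lemma restrict_L2_on:
  assumes "\<Omega> \<in> sets lebesgue" "f \<in> L2_on \<Omega>" shows "restrict_l2 \<Omega> f = f"
proof (rule l2_eqI)
  have "AE x in lebesgue. x \<notin> \<Omega> \<longrightarrow> rep_l2 f x = 0" using assms by (simp add: L2_on_def)
  then show "AE x in lebesgue. rep_l2 (restrict_l2 \<Omega> f) x = rep_l2 f x"
    using rep_restrict_AE[OF assms(1), of f] by eventually_elim (auto simp: indicator_def)
qed

lemma cinner_restrict:
  assumes "\<Omega> \<in> sets lebesgue"
  shows "cinner (restrict_l2 \<Omega> f) g = cinner f (restrict_l2 \<Omega> g)"
  unfolding cinner_eq_integral
proof (rule integral_cong_AE)
  show "AE x in lebesgue. rep_l2 (restrict_l2 \<Omega> f) x * cnj (rep_l2 g x)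
      = rep_l2 f x * cnj (rep_l2 (restrict_l2 \<Omega> g) x)"
    using rep_restrict_AE[OF assms, of f] rep_restrict_AE[OF assms, of g]
    by eventually_elim (auto simp: indicator_def)
qed (auto intro!: borel_measurable_integrable square_integrable_mult_integrable square_integrable_rep)

lemma cinner_L2_on_restrict:
  "\<Omega> \<in> sets lebesgue \<Longrightarrow> f \<in> L2_on \<Omega> \<Longrightarrow> cinner f (restrict_l2 \<Omega> g) = cinner f g"
  by (metis cinner_restrict restrict_L2_on)

lemma restrict_add: "\<Omega> \<in> sets lebesgue \<Longrightarrow> restrict_l2 \<Omega> (f + g) = restrict_l2 \<Omega> f + restrict_l2 \<Omega> g"
  using rep_restrict_AE[of \<Omega> f] rep_restrict_AE[of \<Omega> g] rep_restrict_AE[of \<Omega> "f + g"]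
    rep_add_AE[of f g] rep_add_AE[of "restrict_l2 \<Omega> f" "restrict_l2 \<Omega> g"]
  by (intro l2_eqI) (auto elim!: eventually_elim2 simp: algebra_simps)

lemma restrict_scaleC: "\<Omega> \<in> sets lebesgue \<Longrightarrow> restrict_l2 \<Omega> (c *\<^sub>C f) = c *\<^sub>C restrict_l2 \<Omega> f"
  using rep_restrict_AE[of \<Omega> f] rep_restrict_AE[of \<Omega> "c *\<^sub>C f"]
    rep_scaleC_AE[of c f] rep_scaleC_AE[of c "restrict_l2 \<Omega> f"]
  by (intro l2_eqI) (auto elim!: eventually_elim2 simp: algebra_simps)

lemma restrict_diff: "\<Omega> \<in> sets lebesgue \<Longrightarrow> restrict_l2 \<Omega> (f - g) = restrict_l2 \<Omega> f - restrict_l2 \<Omega> g"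
  using restrict_add[of \<Omega> f "(- 1) *\<^sub>C g"] restrict_scaleC[of \<Omega> "-1" g] by simp

text \<open>Restriction is a symmetric idempotent, that is an orthogonal projection: the squared
  norm of the restriction equals its product with \<open>f\<close>, and Cauchy--Schwarz
  applies.\<close>

lemma norm_restrict_le:
  assumes "\<Omega> \<in> sets lebesgue"
  shows "norm (restrict_l2 \<Omega> f) \<le> norm f"
proof -
  have "(norm (restrict_l2 \<Omega> f))\<^sup>2 = Re (cinner f (restrict_l2 \<Omega> f))"
    unfolding norm_l2_square cinner_restrict[OF assms]
    by (simp add: restrict_L2_on[OF assms restrict_in_L2_on[OF assms]])
  also have "\<dots> \<le> norm f * norm (restrict_l2 \<Omega> f)"
    using complex_Re_le_cmod norm_cinner_le by (rule order_trans)
  finally show ?thesis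
    by (cases "norm (restrict_l2 \<Omega> f) = 0") (auto simp: power2_eq_square)
qed

lemma csubspace_L2_on:
  assumes "\<Omega> \<in> sets lebesgue"
  shows "csubspace (L2_on \<Omega>)"
proof -
  have *: "L2_on \<Omega> = {f. restrict_l2 \<Omega> f = f}"
    using restrict_L2_on[OF assms] restrict_in_L2_on[OF assms] by (metis (mono_tags, lifting) Collect_cong Collect_mem_eq)
  show ?thesis
    unfolding csubspace_def *
    using restrict_add[OF assms] restrict_scaleC[OF assms] restrict_diff[OF assms, of 0 0] by simp
qed

text \<open>The set consists of the fixed points of the contraction
  \<open>restrict_l2 \<Omega>\<close>.\<close>

lemma closed_L2_on:
  assumes "\<Omega> \<in> sets lebesgue"
  shows "closed (L2_on \<Omega>)"
  unfolding closed_sequential_limits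
proof (intro allI impI, elim conjE)
  fix x l assume x: "\<forall>n. x n \<in> L2_on \<Omega>" "x \<longlonglongrightarrow> l"
  have "(\<lambda>n. x n - restrict_l2 \<Omega> l) \<longlonglongrightarrow> 0"
  proof (rule Lim_null_comparison)
    show "\<forall>\<^sub>F n in sequentially. norm (x n - restrict_l2 \<Omega> l) \<le> norm (x n - l)"
      using norm_restrict_le[OF assms, of "x _ - l"] x(1)
      by (auto simp: restrict_diff[OF assms] restrict_L2_on[OF assms])
    show "(\<lambda>n. norm (x n - l)) \<longlonglongrightarrow> 0"
      using x(2) by (simp add: tendsto_norm_zero LIM_zero)
  qed
  then have "x \<longlonglongrightarrow> restrict_l2 \<Omega> l" by (simp add: LIM_zero_iff)
  then have "l = restrict_l2 \<Omega> l" using x(2) LIMSEQ_unique by blast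
  then show "l \<in> L2_on \<Omega>" using restrict_in_L2_on[OF assms] by metis
qed

lemma restrict_tendsto:
  fixes f :: "'d::finite l2"
  assumes "\<And>n. \<Omega>n n \<in> sets lebesgue" "\<And>n. \<Omega>n n \<subseteq> \<Omega>n (Suc n)" "(\<Union>n. \<Omega>n n) = \<Omega>" "f \<in> L2_on \<Omega>"
  shows "(\<lambda>n. restrict_l2 (\<Omega>n n) f) \<longlonglongrightarrow> f"
proof -
  have inc: "incseq \<Omega>n" using assms(2) by (rule incseq_SucI)
  have [measurable]: "\<Omega>n n \<in> sets lebesgue" for n by fact
  have f0: "AE x in lebesgue. x \<notin> \<Omega> \<longrightarrow> rep_l2 f x = 0" using assms(4) by (simp add: L2_on_def)
  have eq: "(norm (restrict_l2 (\<Omega>n n) f - f))\<^sup>2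
    = integral\<^sup>L lebesgue (\<lambda>x. (cmod (indicator (\<Omega>n n) x * rep_l2 f x - rep_l2 f x))\<^sup>2)" for n
    unfolding norm_l2_square_integral
  proof (rule integral_cong_AE)
    show "AE x in lebesgue. (cmod (rep_l2 (restrict_l2 (\<Omega>n n) f - f) x))\<^sup>2
      = (cmod (indicator (\<Omega>n n) x * rep_l2 f x - rep_l2 f x))\<^sup>2"
      using rep_restrict_AE[OF assms(1), of n f] rep_diff_AE[of "restrict_l2 (\<Omega>n n) f" f]
      by eventually_elim simp
  qed auto
  have "(\<lambda>n. integral\<^sup>L lebesgue (\<lambda>x. (cmod (indicator (\<Omega>n n) x * rep_l2 f x - rep_l2 f x))\<^sup>2))
    \<longlonglongrightarrow> integral\<^sup>L lebesgue (\<lambda>x :: real^'d. 0)"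
  proof (rule Bochner_Integration.integral_dominated_convergence[where w="\<lambda>x. (cmod (rep_l2 f x))\<^sup>2"])
    show "integrable lebesgue (\<lambda>x. (cmod (rep_l2 f x))\<^sup>2)"
      using square_integrable_rep[of f] by (simp add: square_integrable_def)
    show "AE x in lebesgue. (\<lambda>n. (cmod (indicator (\<Omega>n n) x * rep_l2 f x - rep_l2 f x))\<^sup>2) \<longlonglongrightarrow> 0"
      using f0
    proof eventually_elim
      case (elim x)
      show ?case
      proof (cases "x \<in> \<Omega>")
        case True
        then obtain N where "x \<in> \<Omega>n N" using assms(3) by auto
        then have "x \<in> \<Omega>n n" if "n \<ge> N" for n
          using inc that by (auto simp: incseq_def)
        then have "\<forall>\<^sub>F n in sequentially. (cmod (indicator (\<Omega>n n) x * rep_l2 f x - rep_l2 f x))\<^sup>2 = 0"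
          by (auto intro!: eventually_sequentiallyI[of N])
        then show ?thesis by (rule tendsto_eventually)
      next
        case False
        then show ?thesis using elim by simp
      qed
    qed
  qed (auto simp: indicator_def)
  then have "(\<lambda>n. (norm (restrict_l2 (\<Omega>n n) f - f))\<^sup>2) \<longlonglongrightarrow> 0" by (simp add: eq)
  then have "(\<lambda>n. sqrt ((norm (restrict_l2 (\<Omega>n n) f - f))\<^sup>2)) \<longlonglongrightarrow> sqrt 0"
    by (rule tendsto_real_sqrt)
  then show ?thesis by (simp add: tendsto_norm_zero_iff LIM_zero_iff)
qed

section \<open>Real Hilbert spaces on carrier sets\<close>

text \<open>Near \<open>t = 0\<close> the linear term dominates; \<open>t = - b / d\<close> with
  \<open>d > \<bar>a\<bar>\<close> makes the value negative unless \<open>b = 0\<close>. This is the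
  device behind the variational arguments below.\<close>

lemma real_quadratic_nonneg_imp_zero:
  fixes a b :: real
  assumes "\<And>t. 0 \<le> 2 * t * b + t\<^sup>2 * a"
  shows "b = 0"
proof (rule ccontr)
  assume "b \<noteq> 0"
  define d where "d = \<bar>a\<bar> + 1"
  have d: "d > 0" "a < 2 * d" by (auto simp: d_def)
  have "0 \<le> (2 * (- b / d) * b + (- b / d)\<^sup>2 * a) * d\<^sup>2"
    using assms[of "- b / d"] by simp
  also have "\<dots> = b\<^sup>2 * (a - 2 * d)"
    using d(1) by (simp add: field_simps power2_eq_square)
  also have "\<dots> < 0"
    using \<open>b \<noteq> 0\<close> d by (intro mult_pos_neg) auto
  finally show False by simp
qed

text \<open>Carrier and product are parameters, because the same arguments serve closed subspaces of
  \<open>L\<^sup>2\<close> with \<open>inner\<close> and form domains with a symmetrised form. The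
  product is only semidefinite, so conclusions concern values of \<open>ip\<close> rather than
  equality of vectors.\<close>

locale real_preinner =
  fixes V :: "'a::real_vector set" and ip :: "'a \<Rightarrow> 'a \<Rightarrow> real"
  assumes subspace: "subspace V"
    and add_left: "x \<in> V \<Longrightarrow> y \<in> V \<Longrightarrow> z \<in> V \<Longrightarrow> ip (x + y) z = ip x z + ip y z"
    and scale_left: "x \<in> V \<Longrightarrow> y \<in> V \<Longrightarrow> ip (c *\<^sub>R x) y = c * ip x y"
    and commute: "x \<in> V \<Longrightarrow> y \<in> V \<Longrightarrow> ip x y = ip y x"
    and nonneg: "x \<in> V \<Longrightarrow> 0 \<le> ip x x"
begin

lemmas V_add = subspace_add[OF subspace]
lemmas V_scale = subspace_scale[OF subspace]
lemmas V_diff = subspace_diff[OF subspace]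
lemmas V_zero = subspace_0[OF subspace]

lemma add_right: "x \<in> V \<Longrightarrow> y \<in> V \<Longrightarrow> z \<in> V \<Longrightarrow> ip x (y + z) = ip x y + ip x z"
  using commute[of x "y + z"] commute[of x y] commute[of x z] add_left[of y z x] by (simp add: V_add)

lemma scale_right: "x \<in> V \<Longrightarrow> y \<in> V \<Longrightarrow> ip x (c *\<^sub>R y) = c * ip x y"
  using commute[of x "c *\<^sub>R y"] commute[of x y] scale_left[of y x c] by (simp add: V_scale)

lemma diff_left: "x \<in> V \<Longrightarrow> y \<in> V \<Longrightarrow> z \<in> V \<Longrightarrow> ip (x - y) z = ip x z - ip y z"
  using add_left[of x "(-1) *\<^sub>R y" z] scale_left[of y z "-1"] V_scale[of y "-1"] by simp

lemma diff_right: "x \<in> V \<Longrightarrow> y \<in> V \<Longrightarrow> z \<in> V \<Longrightarrow> ip x (y - z) = ip x y - ip x z"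
  using add_right[of x y "(-1) *\<^sub>R z"] scale_right[of x z "-1"] V_scale[of z "-1"] by simp

lemma cauchy_schwarz:
  assumes "x \<in> V" "y \<in> V"
  shows "\<bar>ip x y\<bar> \<le> sqrt (ip x x) * sqrt (ip y y)"
proof -
  let ?a = "ip y y" and ?b = "ip x y" and ?c = "ip x x"
  have q: "0 \<le> ?c + 2 * t * ?b + t\<^sup>2 * ?a" for t
  proof -
    have "0 \<le> ip (x + t *\<^sub>R y) (x + t *\<^sub>R y)"
      using assms by (intro nonneg V_add V_scale)
    also have "\<dots> = ?c + 2 * t * ?b + t\<^sup>2 * ?a"
      using assms commute[of y x]
      by (simp add: add_left add_right scale_left scale_right V_add V_scale power2_eq_square algebra_simps)
    finally show ?thesis .
  qed
  have "?b\<^sup>2 \<le> ?c * ?a"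
  proof (cases "?a = 0")
    case True
    have "?b = 0"
    proof (rule ccontr)
      assume "?b \<noteq> 0"
      \<comment> \<open>At this \<open>t\<close> the affine function takes the value
        \<open>-1\<close>.\<close>
      then show False using q[of "- (?c + 1) / (2 * ?b)"] True by (simp add: field_simps)
    qed
    then show ?thesis using True by simp
  next
    case False
    then have "?a > 0" using nonneg[OF assms(2)] by simp
    then have "0 \<le> (?c + 2 * (- ?b / ?a) * ?b + (- ?b / ?a)\<^sup>2 * ?a) * ?a"
      using q[of "- ?b / ?a"] by simp
    also have "\<dots> = ?c * ?a - ?b\<^sup>2"
      using \<open>?a > 0\<close> by (simp add: field_simps power2_eq_square)
    finally show ?thesis by simp
  qed
  then have "sqrt (?b\<^sup>2) \<le> sqrt (?c * ?a)" by (rule real_sqrt_le_mono)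
  then show ?thesis by (simp add: real_sqrt_mult)
qed

lemma triangle:
  assumes "x \<in> V" "y \<in> V"
  shows "sqrt (ip (x + y) (x + y)) \<le> sqrt (ip x x) + sqrt (ip y y)"
proof (rule real_le_lsqrt)
  have "ip (x + y) (x + y) = ip x x + 2 * ip x y + ip y y"
    using assms commute[of y x] by (simp add: add_left add_right V_add)
  also have "\<dots> \<le> ip x x + 2 * (sqrt (ip x x) * sqrt (ip y y)) + ip y y"
    using cauchy_schwarz[OF assms] by simp
  also have "\<dots> = (sqrt (ip x x) + sqrt (ip y y))\<^sup>2"
    using nonneg assms by (simp add: power2_sum)
  finally show "ip (x + y) (x + y) \<le> (sqrt (ip x x) + sqrt (ip y y))\<^sup>2" .
qed (use nonneg assms in auto)

lemma tendsto_ip_left: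
  assumes "\<And>n. X n \<in> V" "x \<in> V" "y \<in> V" "(\<lambda>n. ip (X n - x) (X n - x)) \<longlonglongrightarrow> 0"
  shows "(\<lambda>n. ip (X n) y) \<longlonglongrightarrow> ip x y"
proof -
  have "(\<lambda>n. sqrt (ip (X n - x) (X n - x)) * sqrt (ip y y)) \<longlonglongrightarrow> sqrt 0 * sqrt (ip y y)"
    using assms(4) by (intro tendsto_intros)
  then have "(\<lambda>n. sqrt (ip (X n - x) (X n - x)) * sqrt (ip y y)) \<longlonglongrightarrow> 0" by simp
  then have "(\<lambda>n. ip (X n - x) y) \<longlonglongrightarrow> 0"
    by (rule Lim_null_comparison[OF always_eventually, rotated])
      (auto intro!: cauchy_schwarz assms V_diff)
  then show ?thesis using assms by (simp add: diff_left LIM_zero_iff)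
qed

lemma ip_eq_zero: "x \<in> V \<Longrightarrow> y \<in> V \<Longrightarrow> ip y y = 0 \<Longrightarrow> ip x y = 0"
  using cauchy_schwarz[of x y] by simp

end

locale real_hilbert = real_preinner +
  assumes complete: "(\<And>n. X n \<in> V) \<Longrightarrow>
      (\<And>e. 0 < e \<Longrightarrow> \<exists>N. \<forall>m\<ge>N. \<forall>n\<ge>N. ip (X m - X n) (X m - X n) < e) \<Longrightarrow>
      \<exists>x\<in>V. (\<lambda>n. ip (X n - x) (X n - x)) \<longlonglongrightarrow> 0"
begin

lemma riesz:
  assumes add: "\<And>x y. x \<in> V \<Longrightarrow> y \<in> V \<Longrightarrow> \<phi> (x + y) = \<phi> x + \<phi> y"
    and scale: "\<And>c x. x \<in> V \<Longrightarrow> \<phi> (c *\<^sub>R x) = c * \<phi> x"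
    and bounded: "\<And>x. x \<in> V \<Longrightarrow> \<bar>\<phi> x\<bar> \<le> C * sqrt (ip x x)"
  shows "\<exists>u\<in>V. \<forall>x\<in>V. \<phi> x = ip x u"
proof -
  \<comment> \<open>Variational method: a minimiser of \<open>J\<close> represents
    \<open>\<phi>\<close>. Completing the square bounds \<open>J\<close> from below.\<close>
  define J where "J x = ip x x - 2 * \<phi> x" for x
  have J_ge: "- C\<^sup>2 \<le> J x" if "x \<in> V" for x
  proof -
    have "\<phi> x \<le> C * sqrt (ip x x)" using bounded[OF that] by simp
    then have "ip x x - 2 * (C * sqrt (ip x x)) \<le> J x" by (simp add: J_def)
    moreover have "0 \<le> (sqrt (ip x x) - C)\<^sup>2" by simp
    ultimately show ?thesis
      using nonneg[OF that] by (simp add: power2_diff algebra_simps)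
  qed
  define m where "m = Inf (J ` V)"
  have bdd: "bdd_below (J ` V)" using J_ge by (intro bdd_belowI2)
  have m_le: "m \<le> J x" if "x \<in> V" for x
    unfolding m_def using that bdd by (simp add: cInf_lower)
  have "\<exists>x\<in>V. J x < m + 1 / real (Suc n)" for n
  proof -
    have "\<exists>z\<in>J ` V. z < m + 1 / real (Suc n)"
      unfolding m_def using V_zero by (intro cInf_lessD) auto
    then show ?thesis by auto
  qed
  then obtain X where X: "\<And>n. X n \<in> V" "\<And>n. J (X n) < m + 1 / real (Suc n)" by metis
  \<comment> \<open>The parallelogram identity, with \<open>J \<ge> m\<close> at the midpoint, makes
    the minimising sequence Cauchy.\<close>
  have par: "ip (x - y) (x - y) \<le> 2 * (J x - m) + 2 * (J y - m)" if "x \<in> V" "y \<in> V" for x y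
  proof -
    have z: "(1/2) *\<^sub>R (x + y) \<in> V" using that by (intro V_scale V_add)
    have "ip (x - y) (x - y) = 2 * J x + 2 * J y - 4 * J ((1/2) *\<^sub>R (x + y))"
      using that z commute[of y x] unfolding J_def
      by (simp add: add_left add_right diff_left diff_right scale_left scale_right V_add V_diff V_scale
          add scale algebra_simps)
    then show ?thesis using m_le[OF z] by simp
  qed
  have "\<exists>N. \<forall>k\<ge>N. \<forall>n\<ge>N. ip (X k - X n) (X k - X n) < e" if e: "e > 0" for e
  proof -
    obtain N where N: "1 / real (Suc N) < e / 4"
      using reals_Archimedean[of "e / 4"] e unfolding inverse_eq_divide by (metis divide_pos_pos zero_less_numeral)
    have "ip (X k - X n) (X k - X n) < e" if "k \<ge> N" "n \<ge> N" for k n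
    proof -
      have *: "J (X j) - m < e / 4" if "j \<ge> N" for j
      proof -
        have "1 / real (Suc j) \<le> 1 / real (Suc N)"
          using that by (intro divide_left_mono) auto
        then have "1 / real (Suc j) < e / 4" using N by (rule le_less_trans)
        then show ?thesis using X(2)[of j] by argo
      qed
      have "a < e" if "a \<le> 2 * b + 2 * c" "b < e / 4" "c < e / 4" for a b c :: real
        using that by linarith
      then show ?thesis using par[OF X(1) X(1), of k n] *[OF that(1)] *[OF that(2)] by blast
    qed
    then show ?thesis by blast
  qed
  then obtain u where u: "u \<in> V" "(\<lambda>n. ip (X n - u) (X n - u)) \<longlonglongrightarrow> 0"
    using complete[of X] X(1) by blast
  have "\<phi> x = ip x u" if x: "x \<in> V" for x
  proof -
    \<comment> \<open>First variation at the limit: \<open>X n + t *\<^sub>R x\<close> cannot lie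
      below the infimum, while \<open>X n\<close> exceeds it by less than
      \<open>1 / Suc n\<close>.\<close>
    have "0 \<le> 2 * t * (ip u x - \<phi> x) + t\<^sup>2 * ip x x" for t
    proof (rule LIMSEQ_le)
      have "- (1 / real (Suc n)) \<le> 2 * t * (ip (X n) x - \<phi> x) + t\<^sup>2 * ip x x" for n
      proof -
        have "m \<le> J (X n + t *\<^sub>R x)" using x X(1) by (intro m_le V_add V_scale)
        also have "\<dots> = J (X n) + 2 * t * (ip (X n) x - \<phi> x) + t\<^sup>2 * ip x x"
          using x X(1)[of n] commute[of x "X n"] unfolding J_def
          by (simp add: add_left add_right scale_left scale_right V_add V_scale add scale
              power2_eq_square algebra_simps)
        finally show ?thesis using X(2)[of n] by simp
      qed
      then show "\<exists>N. \<forall>n\<ge>N. - (1 / real (Suc n)) \<le> 2 * t * (ip (X n) x - \<phi> x) + t\<^sup>2 * ip x x"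
        by blast
      show "(\<lambda>n. - (1 / real (Suc n))) \<longlonglongrightarrow> 0"
        using tendsto_minus[OF LIMSEQ_inverse_real_of_nat] by (simp add: inverse_eq_divide)
      show "(\<lambda>n. 2 * t * (ip (X n) x - \<phi> x) + t\<^sup>2 * ip x x)
          \<longlonglongrightarrow> 2 * t * (ip u x - \<phi> x) + t\<^sup>2 * ip x x"
        by (intro tendsto_intros tendsto_ip_left X u x)
    qed
    then have "ip u x - \<phi> x = 0" by (rule real_quadratic_nonneg_imp_zero)
    then show ?thesis using commute[OF u(1) x] by simp
  qed
  then show ?thesis using u(1) by blast
qed

text \<open>The representing elements of \<open>r(\<cdot>,y)\<close> form a complete subspace, because \<open>r\<close> is coercive.\<close>

lemma lax_milgram:
  assumes r_add_left: "\<And>x y z. x \<in> V \<Longrightarrow> y \<in> V \<Longrightarrow> z \<in> V \<Longrightarrow> r (x + y) z = r x z + r y z"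
    and r_scale_left: "\<And>c x y. x \<in> V \<Longrightarrow> y \<in> V \<Longrightarrow> r (c *\<^sub>R x) y = c * r x y"
    and r_add_right: "\<And>x y z. x \<in> V \<Longrightarrow> y \<in> V \<Longrightarrow> z \<in> V \<Longrightarrow> r x (y + z) = r x y + r x z"
    and r_scale_right: "\<And>c x y. x \<in> V \<Longrightarrow> y \<in> V \<Longrightarrow> r x (c *\<^sub>R y) = c * r x y"
    and r_bounded: "\<And>x y. x \<in> V \<Longrightarrow> y \<in> V \<Longrightarrow> \<bar>r x y\<bar> \<le> K * sqrt (ip x x) * sqrt (ip y y)"
    and coercive: "\<And>x. x \<in> V \<Longrightarrow> e * ip x x \<le> r x x" "0 < e"
    and add: "\<And>x y. x \<in> V \<Longrightarrow> y \<in> V \<Longrightarrow> \<phi> (x + y) = \<phi> x + \<phi> y"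
    and scale: "\<And>c x. x \<in> V \<Longrightarrow> \<phi> (c *\<^sub>R x) = c * \<phi> x"
    and bounded: "\<And>x. x \<in> V \<Longrightarrow> \<bar>\<phi> x\<bar> \<le> C * sqrt (ip x x)"
  shows "\<exists>u\<in>V. \<forall>x\<in>V. \<phi> x = r x u"
proof -
  define R where "R = {s\<in>V. \<exists>y\<in>V. \<forall>x\<in>V. r x y = ip x s}"
  have r_diff_right: "r x (y - z) = r x y - r x z" if "x \<in> V" "y \<in> V" "z \<in> V" for x y z
    using r_add_right[of x y "(-1) *\<^sub>R z"] r_scale_right[of x z "-1"] V_scale[of z "-1"] that by simp
  have ex: "\<exists>s\<in>R. \<forall>x\<in>V. r x y = ip x s" if y: "y \<in> V" for y
  proof -
    have "\<exists>u\<in>V. \<forall>x\<in>V. r x y = ip x u"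
    proof (rule riesz)
      show "\<bar>r x y\<bar> \<le> (K * sqrt (ip y y)) * sqrt (ip x x)" if "x \<in> V" for x
        using r_bounded[OF that y] by (simp add: mult_ac)
    qed (use y in \<open>auto simp: r_add_left r_scale_left\<close>)
    then show ?thesis using y by (auto simp: R_def)
  qed
  have RV: "R \<subseteq> V" by (auto simp: R_def)
  \<comment> \<open>Coercivity bounds \<open>y\<close> by its representative \<open>s\<close>, so a
    Cauchy sequence in \<open>R\<close> comes from a Cauchy sequence of vectors \<open>y\<close>.
    This gives the completeness of \<open>R\<close>.\<close>
  have bound: "ip y y \<le> ip s s / e\<^sup>2" if "y \<in> V" "s \<in> V" "\<forall>x\<in>V. r x y = ip x s" for y s
  proof -
    have "e * ip y y \<le> sqrt (ip y y) * sqrt (ip s s)"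
      using coercive(1)[OF that(1)] cauchy_schwarz[OF that(1,2)] that by fastforce
    then have "sqrt (ip y y) * (e * sqrt (ip y y)) \<le> sqrt (ip y y) * sqrt (ip s s)"
      using nonneg[OF that(1)] by (simp add: algebra_simps)
    then have "e * sqrt (ip y y) \<le> sqrt (ip s s)"
      using nonneg[OF that(1)] nonneg[OF that(2)] by (cases "ip y y = 0") auto
    then have "(e * sqrt (ip y y))\<^sup>2 \<le> (sqrt (ip s s))\<^sup>2"
      using coercive(2) nonneg[OF that(1)] by (intro power_mono) auto
    then show ?thesis
      using nonneg[OF that(1)] nonneg[OF that(2)] coercive(2) by (simp add: power_mult_distrib field_simps)
  qed
  have subR: "subspace R"
    unfolding subspace_def
  proof (intro conjI ballI allI)
    have "r x 0 = 0" "ip x 0 = 0" if "x \<in> V" for x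
      using r_scale_right[of x 0 0] scale_right[of x 0 0] that V_zero by auto
    then show "0 \<in> R" using V_zero by (auto simp: R_def)
  next
    fix s t assume "s \<in> R" "t \<in> R"
    then obtain y z where "y \<in> V" "z \<in> V" "s \<in> V" "t \<in> V"
      "\<forall>x\<in>V. r x y = ip x s" "\<forall>x\<in>V. r x z = ip x t" by (auto simp: R_def)
    then have "y + z \<in> V \<and> s + t \<in> V \<and> (\<forall>x\<in>V. r x (y + z) = ip x (s + t))"
      by (auto simp: V_add r_add_right add_right)
    then show "s + t \<in> R" by (auto simp: R_def)
  next
    fix c :: real and s assume "s \<in> R"
    then obtain y where "y \<in> V" "s \<in> V" "\<forall>x\<in>V. r x y = ip x s" by (auto simp: R_def)
    then have "c *\<^sub>R y \<in> V \<and> c *\<^sub>R s \<in> V \<and> (\<forall>x\<in>V. r x (c *\<^sub>R y) = ip x (c *\<^sub>R s))"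
      by (auto simp: V_scale r_scale_right scale_right)
    then show "c *\<^sub>R s \<in> R" by (auto simp: R_def)
  qed
  interpret R: real_hilbert R ip
  proof
    show "subspace R" by (rule subR)
    fix S :: "nat \<Rightarrow> 'a"
    assume S: "\<And>n. S n \<in> R"
      and cauchy: "\<And>e. 0 < e \<Longrightarrow> \<exists>N. \<forall>m\<ge>N. \<forall>n\<ge>N. ip (S m - S n) (S m - S n) < e"
    have SV: "S n \<in> V" for n using S RV by auto
    obtain s where s: "s \<in> V" "(\<lambda>n. ip (S n - s) (S n - s)) \<longlonglongrightarrow> 0"
      using complete[OF SV cauchy] by blast
    have "\<forall>n. \<exists>y\<in>V. \<forall>x\<in>V. r x y = ip x (S n)" using S by (auto simp: R_def)
    then obtain Y where Y: "\<And>n. Y n \<in> V" "\<And>n x. x \<in> V \<Longrightarrow> r x (Y n) = ip x (S n)" by metis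
    have "\<exists>N. \<forall>m\<ge>N. \<forall>n\<ge>N. ip (Y m - Y n) (Y m - Y n) < d" if d: "d > 0" for d
    proof -
      obtain N where N: "\<forall>m\<ge>N. \<forall>n\<ge>N. ip (S m - S n) (S m - S n) < d * e\<^sup>2"
        using cauchy[of "d * e\<^sup>2"] d coercive(2) by (meson mult_pos_pos zero_less_power)
      have "ip (Y m - Y n) (Y m - Y n) < d" if "m \<ge> N" "n \<ge> N" for m n
      proof -
        have "ip (Y m - Y n) (Y m - Y n) \<le> ip (S m - S n) (S m - S n) / e\<^sup>2"
          using Y SV by (intro bound) (auto simp: V_diff r_diff_right diff_right)
        also have "\<dots> < d" using N that coercive(2) by (simp add: divide_less_eq)
        finally show ?thesis .
      qed
      then show ?thesis by blast
    qed
    then obtain y where y: "y \<in> V" "(\<lambda>n. ip (Y n - y) (Y n - y)) \<longlonglongrightarrow> 0"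
      using complete[of Y] Y(1) by blast
    have "r x y = ip x s" if x: "x \<in> V" for x
    proof (rule LIMSEQ_unique)
      have "(\<lambda>n. K * sqrt (ip x x) * sqrt (ip (Y n - y) (Y n - y))) \<longlonglongrightarrow> K * sqrt (ip x x) * sqrt 0"
        using y(2) by (intro tendsto_intros)
      then have "(\<lambda>n. K * sqrt (ip x x) * sqrt (ip (Y n - y) (Y n - y))) \<longlonglongrightarrow> 0"
        by simp
      then have "(\<lambda>n. r x (Y n - y)) \<longlonglongrightarrow> 0"
        by (rule Lim_null_comparison[OF always_eventually, rotated])
          (auto intro!: r_bounded x V_diff Y(1) y(1))
      then show "(\<lambda>n. r x (Y n)) \<longlonglongrightarrow> r x y" using x y Y by (simp add: r_diff_right LIM_zero_iff)
      have "(\<lambda>n. ip (S n) x) \<longlonglongrightarrow> ip s x" by (intro tendsto_ip_left s SV x)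
      then show "(\<lambda>n. r x (Y n)) \<longlonglongrightarrow> ip x s" using Y x commute[OF x] s SV by simp
    qed
    then have "s \<in> R" using y s by (auto simp: R_def)
    then show "\<exists>x\<in>R. (\<lambda>n. ip (S n - x) (S n - x)) \<longlonglongrightarrow> 0" using s by blast
  qed (use RV in \<open>auto intro: add_left scale_left commute nonneg\<close>)
  obtain u0 where u0: "u0 \<in> V" "\<forall>x\<in>V. \<phi> x = ip x u0"
    using riesz[of \<phi> C, OF add scale bounded] by auto
  have "\<exists>s\<in>R. \<forall>x\<in>R. \<phi> x = ip x s"
    by (rule R.riesz[where C=C]) (use RV in \<open>auto simp: subset_iff intro!: add scale bounded\<close>)
  then obtain s0 where s0: "s0 \<in> R" "\<forall>x\<in>R. \<phi> x = ip x s0" by blast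
  have s0V: "s0 \<in> V" using s0 RV by auto
  \<comment> \<open>\<open>s0\<close> is the projection of \<open>u0\<close> to \<open>R\<close>, so
    \<open>?v\<close> is orthogonal to \<open>R\<close>. Since \<open>R\<close> contains the
    representative of \<open>r(\<cdot>, ?v)\<close>, it follows that \<open>r ?v ?v = 0\<close>, and
    coercivity makes \<open>?v\<close> a null vector.\<close>
  let ?v = "u0 - s0"
  have v: "?v \<in> V" using u0 s0V by (intro V_diff)
  obtain s where s: "s \<in> R" "\<forall>x\<in>V. r x ?v = ip x s" using ex[OF v] by blast
  have "r ?v ?v = ip s u0 - ip s s0"
  proof -
    have "s \<in> V" using s RV by auto
    then show ?thesis using s v u0(1) s0V commute[of ?v s] diff_right[of s u0 s0] by simp
  qed
  also have "\<dots> = 0" using u0 s0 s RV by (auto simp: subset_iff)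
  finally have "ip ?v ?v = 0"
    using coercive nonneg[OF v] coercive(1)[OF v] by (smt (verit) zero_less_mult_iff)
  then have "ip x u0 = ip x s0" if "x \<in> V" for x
    using ip_eq_zero[OF that v] that u0 s0V by (simp add: diff_right)
  moreover obtain y where "y \<in> V" "\<forall>x\<in>V. r x y = ip x s0" using s0 by (auto simp: R_def)
  ultimately show ?thesis using u0 by (intro bexI[of _ y]) auto
qed

end

section \<open>A closed graph theorem for seminorms\<close>

text \<open>Zabreiko's lemma: a countably subadditive seminorm (\<open>r_series\<close>) on a
  complete normed space is bounded. It acts as the closed graph theorem for form norms, which live
  on carrier sets. Baire's argument is followed by the halving iteration known from the open mapping
  theorem.\<close>

lemma closed_graph_seminorm:
  fixes V :: "'a::real_vector set" and p r :: "'a \<Rightarrow> real"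
  assumes V: "subspace V"
    and p_add: "\<And>x y. x \<in> V \<Longrightarrow> y \<in> V \<Longrightarrow> p (x + y) \<le> p x + p y"
    and p_scale: "\<And>c x. x \<in> V \<Longrightarrow> p (c *\<^sub>R x) = \<bar>c\<bar> * p x"
    and p_zero: "\<And>x. x \<in> V \<Longrightarrow> p x = 0 \<Longrightarrow> x = 0"
    and p_complete: "\<And>X. (\<And>n. X n \<in> V) \<Longrightarrow>
      (\<And>e. 0 < e \<Longrightarrow> \<exists>N. \<forall>m\<ge>N. \<forall>n\<ge>N. p (X m - X n) < e) \<Longrightarrow>
      \<exists>x\<in>V. (\<lambda>n. p (X n - x)) \<longlonglongrightarrow> 0"
    and r_add: "\<And>x y. x \<in> V \<Longrightarrow> y \<in> V \<Longrightarrow> r (x + y) \<le> r x + r y"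
    and r_scale: "\<And>c x. x \<in> V \<Longrightarrow> r (c *\<^sub>R x) = \<bar>c\<bar> * r x"
    and r_series: "\<And>y x S. (\<And>n. y n \<in> V) \<Longrightarrow> x \<in> V \<Longrightarrow> (\<And>n. (\<Sum>i<n. r (y i)) \<le> S) \<Longrightarrow>
      (\<lambda>n. p ((\<Sum>i<n. y i) - x)) \<longlonglongrightarrow> 0 \<Longrightarrow> r x \<le> S"
  shows "\<exists>C\<ge>0. \<forall>x\<in>V. r x \<le> C * p x"
proof -
  note V_add = subspace_add[OF V] and V_scale = subspace_scale[OF V]
    and V_diff = subspace_diff[OF V] and V_zero = subspace_0[OF V]
  have p0: "p 0 = 0" and r0: "r 0 = 0"
    using p_scale[OF V_zero, of 0] r_scale[OF V_zero, of 0] by auto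
  have p_minus: "p (x - y) = p (y - x)" if "x \<in> V" "y \<in> V" for x y
    using p_scale[of "y - x" "-1"] that by (simp add: V_diff)
  have r_minus: "r (- x) = r x" if "x \<in> V" for x
    using r_scale[of x "-1"] that by simp
  have V_neg: "- x \<in> V" if "x \<in> V" for x using V_scale[OF that, of "-1"] by simp
  have p_nonneg: "0 \<le> p x" if "x \<in> V" for x
    using p_add[OF that V_neg[OF that]] p_scale[OF that, of "-1"] p0 by simp
  have r_nonneg: "0 \<le> r x" if "x \<in> V" for x
    using r_add[OF that V_neg[OF that]] r_minus[OF that] r0 by simp
  have p_tri: "p (x - z) \<le> p (x - y) + p (y - z)" if "x \<in> V" "y \<in> V" "z \<in> V" for x y z
    using p_add[of "x - y" "y - z"] that by (simp add: V_diff)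
  \<comment> \<open>Baire: some set \<open>{r \<le> K}\<close> is \<open>p\<close>-dense in a ball.
    Otherwise there are nested balls that avoid \<open>{r \<le> n}\<close> for each \<open>n\<close>
    in turn, and the value of \<open>r\<close> at their common point would exceed every
    \<open>n\<close>.\<close>
  have "\<exists>K. \<exists>x0\<in>V. \<exists>\<rho>>0. \<forall>x\<in>V. p (x - x0) < \<rho> \<longrightarrow> (\<forall>\<delta>>0. \<exists>y\<in>V. r y \<le> K \<and> p (x - y) < \<delta>)"
  proof (rule ccontr)
    assume contra: "\<not> ?thesis"
    have no: "\<exists>x\<in>V. p (x - x0) < \<rho> \<and> (\<exists>\<delta>>0. \<forall>y\<in>V. r y \<le> K \<longrightarrow> \<delta> \<le> p (x - y))"
      if x0: "x0 \<in> V" and \<rho>: "\<rho> > 0" for K x0 \<rho>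
    proof (rule ccontr)
      assume neg: "\<not> (\<exists>x\<in>V. p (x - x0) < \<rho> \<and> (\<exists>\<delta>>0. \<forall>y\<in>V. r y \<le> K \<longrightarrow> \<delta> \<le> p (x - y)))"
      have "\<exists>y\<in>V. r y \<le> K \<and> p (x - y) < \<delta>" if "x \<in> V" "p (x - x0) < \<rho>" "\<delta> > 0" for x \<delta>
      proof (rule ccontr)
        assume "\<not> (\<exists>y\<in>V. r y \<le> K \<and> p (x - y) < \<delta>)"
        then have "\<forall>y\<in>V. r y \<le> K \<longrightarrow> \<delta> \<le> p (x - y)" by (auto simp flip: not_less)
        then show False using neg that by blast
      qed
      then show False using contra x0 \<rho> by blast
    qed
    \<comment> \<open>A pair is a ball, given by centre and radius, that avoids
      \<open>{r \<le> n}\<close> including its boundary; \<open>?Q\<close> expresses that the next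
      ball lies inside.\<close>
    let ?P = "\<lambda>n z. fst z \<in> V \<and> 0 < snd z \<and> snd z \<le> (1/2)^n \<and> (\<forall>y\<in>V. r y \<le> real n \<longrightarrow> snd z < p (fst z - y))"
    let ?Q = "\<lambda>n z z'. p (fst z' - fst z) + snd z' \<le> snd z"
    have step: "\<exists>z'. ?P n z' \<and> p (fst z' - x) + snd z' \<le> \<rho>" if x: "x \<in> V" and \<rho>: "\<rho> > 0" for n x \<rho>
    proof -
      obtain x' \<delta> where x': "x' \<in> V" "p (x' - x) < \<rho>" "\<delta> > 0" "\<forall>y\<in>V. r y \<le> real n \<longrightarrow> \<delta> \<le> p (x' - y)"
        using no[OF x \<rho>, of "real n"] by blast
      define \<rho>' where "\<rho>' = min (\<delta> / 2) (min (\<rho> - p (x' - x)) ((1/2)^n))"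
      have "\<rho>' > 0" "\<rho>' < \<delta>" "\<rho>' \<le> (1/2)^n" "\<rho>' \<le> \<rho> - p (x' - x)"
        unfolding \<rho>'_def using x' by auto
      then show ?thesis using x' by (intro exI[of _ "(x', \<rho>')"]) fastforce
    qed
    have "\<exists>z. \<forall>n. ?P n (z n) \<and> ?Q n (z n) (z (Suc n))"
    proof (rule dependent_nat_choice)
      show "\<exists>z. ?P 0 z" using step[OF V_zero, of 1 0] by auto
      show "\<exists>z'. ?P (Suc n) z' \<and> ?Q n z z'" if "?P n z" for z n
        using step[of "fst z" "snd z" "Suc n"] that by auto
    qed
    then obtain z where z: "\<And>n. ?P n (z n)" "\<And>n. ?Q n (z n) (z (Suc n))" by blast
    define x \<rho> where "x n = fst (z n)" and "\<rho> n = snd (z n)" for n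
    have x: "x n \<in> V" "0 < \<rho> n" "\<rho> n \<le> (1/2)^n" "y \<in> V \<Longrightarrow> r y \<le> real n \<Longrightarrow> \<rho> n < p (x n - y)"
      "p (x (Suc n) - x n) + \<rho> (Suc n) \<le> \<rho> n" for n y
      using z(1)[of n] z(2)[of n] by (auto simp: x_def \<rho>_def)
    have nest: "p (x (n + k) - x n) + \<rho> (n + k) \<le> \<rho> n" for n k
    proof (induction k)
      case (Suc k)
      then show ?case
        using p_tri[OF x(1) x(1) x(1), of "n + Suc k" n "n + k"] x(5)[of "n + k"] by simp
    qed (simp add: p0)
    have near: "p (x m - x n) < (1/2)^n" if "m \<ge> n" for m n
      using nest[of n "m - n"] x(2)[of m] x(3)[of n] that by simp
    have "\<exists>N. \<forall>m\<ge>N. \<forall>n\<ge>N. p (x m - x n) < e" if e: "e > 0" for e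
    proof -
      obtain N where N: "(1/2)^N < e" using real_arch_pow_inv[OF e, of "1/2"] by auto
      have "p (x m - x n) < e" if "m \<ge> N" "n \<ge> N" for m n
      proof -
        have pow: "(1/2::real)^m \<le> (1/2)^N" "(1/2::real)^n \<le> (1/2)^N"
          using that by (auto intro: power_decreasing)
        show ?thesis
        proof (cases n m rule: le_cases)
          case le
          then show ?thesis using near[OF le] pow(2) N by linarith
        next
          case ge
          then show ?thesis using near[OF ge] pow(1) N p_minus[OF x(1) x(1), of m n] by linarith
        qed
      qed
      then show ?thesis by blast
    qed
    then obtain l where l: "l \<in> V" "(\<lambda>n. p (x n - l)) \<longlonglongrightarrow> 0" using p_complete[of x] x(1) by blast
    obtain n where n: "r l \<le> real n" using real_arch_simple by blast
    have "p (x n - l) \<le> \<rho> n + p (x (n + k) - l)" for k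
      using nest[of n k] p_tri[OF x(1) x(1) l(1), of n "n + k"] p_minus[OF x(1) x(1), of n "n + k"] x(2)[of "n + k"]
      by linarith
    moreover have "(\<lambda>k. \<rho> n + p (x (n + k) - l)) \<longlonglongrightarrow> \<rho> n + 0"
      using LIMSEQ_ignore_initial_segment[OF l(2), of n] by (intro tendsto_intros) (simp add: add.commute)
    ultimately have "p (x n - l) \<le> \<rho> n + 0" by (intro LIMSEQ_le_const) auto
    then show False using x(4)[OF l(1) n] by simp
  qed
  then obtain K x0 \<rho> where K: "x0 \<in> V" "\<rho> > 0"
    "\<And>x \<delta>. x \<in> V \<Longrightarrow> p (x - x0) < \<rho> \<Longrightarrow> \<delta> > 0 \<Longrightarrow> \<exists>y\<in>V. r y \<le> K \<and> p (x - y) < \<delta>"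
    by blast
  \<comment> \<open>Differences of approximants move the ball to the origin, at the price of
    \<open>2 * K\<close>.\<close>
  have ball: "\<exists>y\<in>V. r y \<le> 2 * K \<and> p (x - y) < \<delta>" if x: "x \<in> V" "p x < \<rho>" "\<delta> > 0" for x \<delta>
  proof -
    obtain y where y: "y \<in> V" "r y \<le> K" "p (x0 + x - y) < \<delta> / 2"
      using K(3)[of "x0 + x" "\<delta> / 2"] K(1) x by (auto simp: V_add)
    obtain y' where y': "y' \<in> V" "r y' \<le> K" "p (x0 - y') < \<delta> / 2"
      using K(3)[of x0 "\<delta> / 2"] K(1,2) x by (auto simp: p0)
    have "r (y + - y') \<le> 2 * K" using r_add[of y "- y'"] y y' r_minus[of y'] V_neg[of y'] by simp
    moreover have "p (x - (y - y')) \<le> p (x0 + x - y) + p (y' - x0)"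
    proof -
      have "x - (y - y') = (x0 + x - y) + (y' - x0)" by simp
      then show ?thesis
        using p_add[of "x0 + x - y" "y' - x0"] x(1) y(1) y'(1) K(1) V_add V_diff by presburger
    qed
    moreover have "p (y' - x0) < \<delta> / 2" using y'(3) p_minus[OF y'(1) K(1)] by simp
    ultimately show ?thesis
      using y y' by (intro bexI[of _ "y - y'"] conjI V_diff) auto
  qed
  define L where "L = 4 * K / \<rho>"
  have "K \<ge> 0"
  proof -
    obtain y where "y \<in> V" "r y \<le> K" using K(3)[of x0 1] K(1,2) by (auto simp: p0)
    then show ?thesis using r_nonneg[of y] by linarith
  qed
  then have L: "L \<ge> 0" using K(2) by (simp add: L_def)
  have "\<exists>y\<in>V. r y \<le> L * p x \<and> p (x - y) \<le> p x / 2" if x: "x \<in> V" for x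
  proof (cases "p x = 0")
    case True
    then show ?thesis using p_zero[OF x] by (auto intro!: bexI[of _ 0] simp: r0 p0 V_zero)
  next
    case False
    then have px: "p x > 0" using p_nonneg[OF x] by simp
    \<comment> \<open>The factor scales \<open>x\<close> to \<open>p\<close>-norm
      \<open>\<rho> / 2\<close>, inside the ball. After scaling back, the accuracy
      \<open>\<rho> / 4\<close> becomes \<open>p x / 2\<close> and the bound \<open>2 * K\<close>
      becomes \<open>L * p x\<close>.\<close>
    define c where "c = 2 * p x / \<rho>"
    have c: "c > 0" using px K(2) by (simp add: c_def)
    obtain y where y: "y \<in> V" "r y \<le> 2 * K" "p (inverse c *\<^sub>R x - y) < \<rho> / 4"
      using ball[of "inverse c *\<^sub>R x" "\<rho> / 4"] x px K(2) by (auto simp: V_scale p_scale c_def)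
    have "r (c *\<^sub>R y) \<le> L * p x"
    proof -
      have "r (c *\<^sub>R y) = c * r y" using r_scale[OF y(1), of c] c by simp
      also have "\<dots> \<le> c * (2 * K)" using y c by (intro mult_left_mono) auto
      also have "\<dots> = L * p x" by (simp add: L_def c_def)
      finally show ?thesis .
    qed
    moreover have "p (x - c *\<^sub>R y) \<le> p x / 2"
    proof -
      have "x - c *\<^sub>R y = c *\<^sub>R (inverse c *\<^sub>R x - y)"
      proof -
        have "c *\<^sub>R inverse c *\<^sub>R x = x" using c by simp
        then show ?thesis by (simp only: scaleR_right_diff_distrib)
      qed
      then have "p (x - c *\<^sub>R y) = c * p (inverse c *\<^sub>R x - y)"
        using c p_scale[of "inverse c *\<^sub>R x - y" c] x y by (simp add: V_diff V_scale)
      also have "\<dots> \<le> c * (\<rho> / 4)" using y c by (intro mult_left_mono) auto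
      also have "\<dots> = p x / 2" using K(2) by (simp add: c_def)
      finally show ?thesis .
    qed
    ultimately show ?thesis using y by (intro bexI[of _ "c *\<^sub>R y"]) (auto simp: V_scale)
  qed
  then obtain Y where Y: "\<And>x. x \<in> V \<Longrightarrow> Y x \<in> V" "\<And>x. x \<in> V \<Longrightarrow> r (Y x) \<le> L * p x"
    "\<And>x. x \<in> V \<Longrightarrow> p (x - Y x) \<le> p x / 2" by metis
  have "r x \<le> 2 * L * p x" if x: "x \<in> V" for x
  proof -
    \<comment> \<open>The remainders \<open>z n\<close> are halved at each step, so \<open>x\<close>
      is the sum of the corrections \<open>Y (z n)\<close>, whose \<open>r\<close>-values are
      dominated by a geometric series with sum \<open>2 * L * p x\<close>.\<close>
    define z where "z n = ((\<lambda>u. u - Y u) ^^ n) x" for n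
    have z: "z n \<in> V \<and> p (z n) \<le> p x * (1/2)^n \<and> (\<Sum>i<n. Y (z i)) = x - z n" for n
    proof (induction n)
      case (Suc n)
      have "z (Suc n) = z n - Y (z n)" by (simp add: z_def)
      then show ?case using Suc Y(1)[of "z n"] Y(3)[of "z n"] by (simp add: V_diff)
    qed (simp add: z_def x)
    show ?thesis
    proof (rule r_series[of "\<lambda>n. Y (z n)"])
      show "Y (z n) \<in> V" for n using z Y by blast
      show "(\<Sum>i<n. r (Y (z i))) \<le> 2 * L * p x" for n
      proof -
        have "(\<Sum>i<n. r (Y (z i))) \<le> (\<Sum>i<n. L * p x * (1/2)^i)"
        proof (rule sum_mono)
          fix i
          have "r (Y (z i)) \<le> L * p (z i)" using z Y by blast
          also have "\<dots> \<le> L * (p x * (1/2)^i)" using z L by (intro mult_left_mono) auto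
          finally show "r (Y (z i)) \<le> L * p x * (1/2)^i" by simp
        qed
        also have "\<dots> = L * p x * (\<Sum>i<n. (1/2)^i)" by (simp add: sum_distrib_left)
        also have "\<dots> \<le> L * p x * 2"
        proof (rule mult_left_mono)
          have "(\<Sum>i<n. (1/2::real)^i) = 2 - 2 * (1/2)^n"
            by (simp add: sum_gp_strict)
          moreover have "0 \<le> (1/2::real)^n" by simp
          ultimately show "(\<Sum>i<n. (1/2::real)^i) \<le> 2" by linarith
          show "0 \<le> L * p x" using L p_nonneg[OF x] by (rule mult_nonneg_nonneg)
        qed
        finally show ?thesis by simp
      qed
      have "p ((\<Sum>i<n. Y (z i)) - x) = p (z n)" for n
        proof -
        have "p ((\<Sum>i<n. Y (z i)) - x) = p (x - (\<Sum>i<n. Y (z i)))"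
          by (rule p_minus) (use z[of n] x V_diff in auto)
        also have "x - (\<Sum>i<n. Y (z i)) = z n" using z[of n] by simp
        finally show ?thesis .
      qed
      moreover have "(\<lambda>n. p (z n)) \<longlonglongrightarrow> 0"
      proof (rule Lim_null_comparison)
        show "\<forall>\<^sub>F n in sequentially. norm (p (z n)) \<le> p x * (1/2)^n"
        proof (rule always_eventually, rule allI)
          fix n show "norm (p (z n)) \<le> p x * (1/2)^n" using z[of n] p_nonneg[of "z n"] by simp
        qed
        have "(\<lambda>n. p x * (1/2)^n) \<longlonglongrightarrow> p x * 0"
          by (intro tendsto_mult tendsto_const LIMSEQ_realpow_zero) auto
        then show "(\<lambda>n. p x * (1/2)^n) \<longlonglongrightarrow> 0" by simp
      qed
      ultimately show "(\<lambda>n. p ((\<Sum>i<n. Y (z i)) - x)) \<longlonglongrightarrow> 0" by simp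
    qed (rule x)
  qed
  then show ?thesis using L by (intro exI[of _ "2 * L"]) auto
qed

section \<open>Weak convergence in \<open>L\<^sup>2\<close>\<close>

lemma csubspace_0: "csubspace V \<Longrightarrow> 0 \<in> V"
  and csubspace_add: "csubspace V \<Longrightarrow> f \<in> V \<Longrightarrow> g \<in> V \<Longrightarrow> f + g \<in> V"
  and csubspace_scale: "csubspace V \<Longrightarrow> f \<in> V \<Longrightarrow> c *\<^sub>C f \<in> V"
  by (auto simp: csubspace_def)

lemma csubspace_diff: "csubspace V \<Longrightarrow> f \<in> V \<Longrightarrow> g \<in> V \<Longrightarrow> f - g \<in> V"
  using csubspace_add[of V f "(-1) *\<^sub>C g"] csubspace_scale[of V g "-1"] by simp

lemma csubspace_sum: "csubspace V \<Longrightarrow> (\<And>i. i \<in> I \<Longrightarrow> f i \<in> V) \<Longrightarrow> (\<Sum>i\<in>I. f i) \<in> V"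
  by (induction I rule: infinite_finite_induct) (auto intro: csubspace_add csubspace_0)

lemma csubspace_imp_subspace: "csubspace V \<Longrightarrow> subspace V"
  unfolding subspace_def using csubspace_0 csubspace_add csubspace_scale scaleC_of_real by metis

lemma csubspace_UNIV: "csubspace UNIV"
  by (simp add: csubspace_def)

lemma csubspace_closure:
  assumes "csubspace V" shows "csubspace (closure V)"
  unfolding csubspace_def
proof (intro conjI ballI allI)
  show "0 \<in> closure V" using csubspace_0[OF assms] closure_subset by blast
next
  fix f g assume "f \<in> closure V" "g \<in> closure V"
  then obtain a b where "\<And>n. a n \<in> V" "a \<longlonglongrightarrow> f" "\<And>n. b n \<in> V" "b \<longlonglongrightarrow> g"
    by (auto simp: closure_sequential)
  then have "(\<forall>n. a n + b n \<in> V) \<and> (\<lambda>n. a n + b n) \<longlonglongrightarrow> f + g"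
    using csubspace_add[OF assms] by (auto intro: tendsto_add)
  then show "f + g \<in> closure V" unfolding closure_sequential by (intro exI[of _ "\<lambda>n. a n + b n"])
next
  fix c f assume "f \<in> closure V"
  then obtain a where "\<And>n. a n \<in> V" "a \<longlonglongrightarrow> f" by (auto simp: closure_sequential)
  then have "(\<forall>n. c *\<^sub>C a n \<in> V) \<and> (\<lambda>n. c *\<^sub>C a n) \<longlonglongrightarrow> c *\<^sub>C f"
    using csubspace_scale[OF assms] by (auto intro: scaleC.tendsto)
  then show "c *\<^sub>C f \<in> closure V" unfolding closure_sequential by (intro exI[of _ "\<lambda>n. c *\<^sub>C a n"])
qed

lemma real_hilbert_closed:
  fixes V :: "'a::{real_inner,complete_space} set"
  assumes "subspace V" "closed V"
  shows "real_hilbert V inner"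
proof
  fix X :: "nat \<Rightarrow> 'a"
  assume X: "\<And>n. X n \<in> V"
    and c: "\<And>e. 0 < e \<Longrightarrow> \<exists>N. \<forall>m\<ge>N. \<forall>n\<ge>N. inner (X m - X n) (X m - X n) < e"
  have "Cauchy X"
  proof (rule CauchyI)
    fix e :: real assume "0 < e"
    then obtain N where N: "\<forall>m\<ge>N. \<forall>n\<ge>N. inner (X m - X n) (X m - X n) < e\<^sup>2"
      using c[of "e\<^sup>2"] by auto
    have "norm (X m - X n) < e" if "m \<ge> N" "n \<ge> N" for m n
    proof (rule power2_less_imp_less)
      show "(norm (X m - X n))\<^sup>2 < e\<^sup>2" using N that by (simp add: power2_norm_eq_inner)
    qed (use \<open>0 < e\<close> in simp)
    then show "\<exists>M. \<forall>m\<ge>M. \<forall>n\<ge>M. norm (X m - X n) < e" by blast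
  qed
  then obtain x where x: "X \<longlonglongrightarrow> x" using Cauchy_convergent convergentD by blast
  then have "x \<in> V" using assms(2) X closed_sequentially by blast
  moreover have "(\<lambda>n. inner (X n - x) (X n - x)) \<longlonglongrightarrow> inner (x - x) (x - x)"
    by (intro tendsto_intros x)
  ultimately show "\<exists>x\<in>V. (\<lambda>n. inner (X n - x) (X n - x)) \<longlonglongrightarrow> 0" by auto
qed (use assms in \<open>auto simp: inner_add_left intro: inner_commute\<close>)

text \<open>The real theorem represents \<open>Re (\<phi> x)\<close>; inserting
  \<open>\<i> *\<^sub>C x\<close> recovers the imaginary part.\<close>

lemma riesz_l2:
  fixes V :: "'d::finite l2 set"
  assumes V: "csubspace V" "closed V"
    and add: "\<And>x y. x \<in> V \<Longrightarrow> y \<in> V \<Longrightarrow> \<phi> (x + y) = \<phi> x + \<phi> y"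
    and scale: "\<And>c x. x \<in> V \<Longrightarrow> \<phi> (c *\<^sub>C x) = c * \<phi> x"
    and bounded: "\<And>x. x \<in> V \<Longrightarrow> cmod (\<phi> x) \<le> C * norm x"
  shows "\<exists>u\<in>V. \<forall>x\<in>V. \<phi> x = cinner x u"
proof -
  interpret real_hilbert V inner
    using real_hilbert_closed[OF csubspace_imp_subspace[OF V(1)] V(2)] .
  have "\<exists>u\<in>V. \<forall>x\<in>V. Re (\<phi> x) = inner x u"
  proof (rule riesz)
    show "\<bar>Re (\<phi> x)\<bar> \<le> C * sqrt (inner x x)" if "x \<in> V" for x
      using abs_Re_le_cmod[of "\<phi> x"] bounded[OF that] by (simp add: norm_eq_sqrt_inner)
    show "Re (\<phi> (c *\<^sub>R x)) = c * Re (\<phi> x)" if "x \<in> V" for c x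
      using scale[OF that, of "of_real c"] by (simp add: scaleC_of_real)
  qed (use add in auto)
  then obtain u where u: "u \<in> V" "\<forall>x\<in>V. Re (\<phi> x) = Re (cinner x u)" by (auto simp: inner_l2_def)
  have "\<phi> x = cinner x u" if x: "x \<in> V" for x
  proof (rule complex_eqI)
    show "Re (\<phi> x) = Re (cinner x u)" using u x by blast
    have "Re (\<phi> (\<i> *\<^sub>C x)) = Re (cinner (\<i> *\<^sub>C x) u)" using u csubspace_scale[OF V(1) x] by blast
    then show "Im (\<phi> x) = Im (cinner x u)" using scale[OF x] by (simp add: cinner_scaleC_left)
  qed
  then show ?thesis using u by blast
qed

lemma projection_l2:
  fixes V :: "'d::finite l2 set"
  assumes "csubspace V" "closed V"
  shows "\<exists>u\<in>V. \<forall>x\<in>V. cinner x g = cinner x u"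
  using assms by (rule riesz_l2[where C="norm g"])
    (auto simp: cinner_add_left cinner_scaleC_left norm_cinner_le mult.commute)

text \<open>The complex linear span. Its minimality reduces convergence statements to
  generators.\<close>

definition chull :: "'d::finite l2 set \<Rightarrow> 'd l2 set" where
  "chull X = \<Inter>{V. csubspace V \<and> X \<subseteq> V}"

lemma csubspace_chull: "csubspace (chull X)"
  unfolding chull_def csubspace_def by auto

lemma subset_chull: "X \<subseteq> chull X"
  by (auto simp: chull_def)

lemma chull_minimal: "csubspace V \<Longrightarrow> X \<subseteq> V \<Longrightarrow> chull X \<subseteq> V"
  by (auto simp: chull_def)

lemma csubspace_tendsto_0: "csubspace {s. (\<lambda>n. cinner (y n) s) \<longlonglongrightarrow> 0}"
  unfolding csubspace_def
  by (auto simp: cinner.add_right cinner_scaleC_right cinner.zero_right intro: tendsto_add_zero tendsto_mult_right_zero)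

text \<open>All \<open>y n\<close> lie in \<open>closure S\<close>, so a test vector may be replaced
  by its projection to that space; boundedness then passes from \<open>S\<close> to its
  closure.\<close>

lemma weakly_nullI:
  fixes y :: "nat \<Rightarrow> 'd::finite l2"
  assumes bounded: "\<And>n. norm (y n) \<le> C" and S: "\<And>n. y n \<in> closure S" "csubspace S"
    and lim: "\<And>s. s \<in> S \<Longrightarrow> (\<lambda>n. cinner (y n) s) \<longlonglongrightarrow> 0"
  shows "weakly_null y"
  unfolding weakly_null_def
proof
  fix g
  obtain u where u: "u \<in> closure S" "\<And>n. cinner (y n) g = cinner (y n) u"
    using projection_l2[OF csubspace_closure[OF S(2)] closed_closure, of g] S(1) by blast
  have C: "0 \<le> C" using bounded[of 0] norm_ge_zero order_trans by blast
  have "(\<lambda>n. cinner (y n) u) \<longlonglongrightarrow> 0"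
  proof (rule LIMSEQ_I)
    fix e :: real assume e: "0 < e"
    obtain s where s: "s \<in> S" "dist s u < e / (2 * (C + 1))"
      using u(1) e C closure_approachable[of u S] by (meson add_nonneg_pos divide_pos_pos mult_pos_pos zero_less_numeral zero_less_one)
    obtain N where N: "\<forall>n\<ge>N. norm (cinner (y n) s - 0) < e / 2"
      using LIMSEQ_D[OF lim[OF s(1)], of "e / 2"] e by auto
    have "norm (cinner (y n) u - 0) < e" if "n \<ge> N" for n
    proof -
      have "norm (cinner (y n) (u - s)) \<le> C * norm (u - s)"
        using norm_cinner_le[of "y n" "u - s"] mult_right_mono[OF bounded[of n], of "norm (u - s)"] by simp
      also have "\<dots> \<le> (C + 1) * norm (u - s)" by (intro mult_right_mono) auto
      also have "\<dots> < e / 2" using s(2) C by (simp add: dist_norm norm_minus_commute field_simps)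
      finally have "norm (cinner (y n) (u - s)) < e / 2" .
      moreover have "norm (cinner (y n) u) \<le> norm (cinner (y n) s) + norm (cinner (y n) (u - s))"
        using norm_triangle_ineq[of "cinner (y n) s" "cinner (y n) (u - s)"] by (simp add: cinner.diff_right)
      ultimately show ?thesis using N that by fastforce
    qed
    then show "\<exists>N. \<forall>n\<ge>N. norm (cinner (y n) u - 0) < e" by blast
  qed
  then show "(\<lambda>n. cinner (y n) g) \<longlonglongrightarrow> 0" by (simp add: u(2))
qed

text \<open>Test vectors orthogonal to the span of the sequence are invisible to every term. This
  suits sequences that are built to be nearly orthogonal.\<close>

lemma weakly_nullI_self:
  fixes y :: "nat \<Rightarrow> 'd::finite l2"
  assumes bounded: "\<And>n. norm (y n) \<le> C" and lim: "\<And>j. (\<lambda>n. cinner (y n) (y j)) \<longlonglongrightarrow> 0"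
  shows "weakly_null y"
proof (rule weakly_nullI[OF bounded _ csubspace_chull[of "range y"]])
  show "y n \<in> closure (chull (range y))" for n
    using subset_chull[of "range y"] closure_subset by blast
  show "(\<lambda>n. cinner (y n) s) \<longlonglongrightarrow> 0" if "s \<in> chull (range y)" for s
    using chull_minimal[OF csubspace_tendsto_0, of "range y" y] lim that by auto
qed

lemma weakly_null_subseq: "weakly_null x \<Longrightarrow> strict_mono r \<Longrightarrow> weakly_null (\<lambda>n. x (r n))"
  unfolding weakly_null_def
  using LIMSEQ_subseq_LIMSEQ[of _ _ r] by (fastforce simp: o_def)

lemma csubspace_convergent: "csubspace {g. convergent (\<lambda>n. cinner (y n) g)}"
  unfolding csubspace_def
  by (auto simp: cinner.add_right cinner_scaleC_right cinner.zero_right convergent_const intro: convergent_add convergent_mult)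

text \<open>The members of the sequence serve as test vectors in a diagonal argument. Their closed
  span contains every term, so convergence against it is convergence against all vectors, and Riesz
  supplies the limit.\<close>

lemma weakly_convergent_subsequence:
  fixes x :: "nat \<Rightarrow> 'd::finite l2"
  assumes bounded: "\<And>n. norm (x n) \<le> C"
  shows "\<exists>r f. strict_mono r \<and> weakly_null (\<lambda>n. x (r n) - f)"
proof -
  have C: "0 \<le> C" using bounded[of 0] norm_ge_zero order_trans by blast
  interpret subseqs "\<lambda>m s. convergent (\<lambda>k. cinner (x (s k)) (x m))"
  proof
    fix n and s :: "nat \<Rightarrow> nat"
    have "bounded (range (\<lambda>k. cinner (x (s k)) (x n)))"
      unfolding bounded_iff
    proof (intro exI ballI)
      fix z assume "z \<in> range (\<lambda>k. cinner (x (s k)) (x n))"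
      then obtain k where "z = cinner (x (s k)) (x n)" by auto
      then show "norm z \<le> C * C"
        using norm_cinner_le[of "x (s k)" "x n"] mult_mono[OF bounded[of "s k"] bounded[of n]] C by simp
    qed
    then obtain l r where "strict_mono r" "((\<lambda>k. cinner (x (s k)) (x n)) \<circ> r) \<longlonglongrightarrow> l"
      using bounded_imp_convergent_subsequence by blast
    then show "\<exists>r'. strict_mono r' \<and> convergent (\<lambda>k. cinner (x ((s \<circ> r') k)) (x n))"
      by (intro exI[of _ r]) (auto simp: o_def convergent_def)
  qed
  define r where "r = diagseq"
  have r: "strict_mono r" unfolding r_def by (rule subseq_diagseq)
  have conv_x: "convergent (\<lambda>k. cinner (x (r k)) (x m))" for m
  proof -
    have "convergent (\<lambda>k. cinner (x ((diagseq \<circ> (+) (Suc m)) k)) (x m))"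
    proof (rule diagseq_holds)
      fix r s :: "nat \<Rightarrow> nat" and n
      assume "strict_mono r" "convergent (\<lambda>k. cinner (x (s k)) (x n))"
      then show "convergent (\<lambda>k. cinner (x ((s \<circ> r) k)) (x n))"
        using convergent_subseq_convergent[of "\<lambda>k. cinner (x (s k)) (x n)" r] by (simp add: o_def)
    qed
    then have "convergent (\<lambda>k. cinner (x (r (k + Suc m))) (x m))"
      by (simp add: o_def r_def add.commute)
    then show ?thesis
      using convergent_ignore_initial_segment[of "\<lambda>k. cinner (x (r k)) (x m)" "Suc m"] by blast
  qed
  let ?T = "{g. convergent (\<lambda>n. cinner (x (r n)) g)}"
  have T: "chull (range x) \<subseteq> ?T"
    by (rule chull_minimal[OF csubspace_convergent]) (use conv_x in auto)
  have closure_T: "convergent (\<lambda>n. cinner (x (r n)) u)" if u: "u \<in> closure (chull (range x))" for u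
  proof (rule Cauchy_convergent, rule CauchyI)
    fix e :: real assume e: "0 < e"
    obtain s where s: "s \<in> chull (range x)" "dist s u < e / (4 * (C + 1))"
      using u e C closure_approachable[of u "chull (range x)"]
      by (meson add_nonneg_pos divide_pos_pos mult_pos_pos zero_less_numeral zero_less_one)
    have "Cauchy (\<lambda>n. cinner (x (r n)) s)" using s T convergent_Cauchy by auto
    then obtain N where N: "\<forall>m\<ge>N. \<forall>n\<ge>N. norm (cinner (x (r m)) s - cinner (x (r n)) s) < e / 2"
      using CauchyD[of _ "e / 2"] e by (meson half_gt_zero)
    have small: "norm (cinner (x k) (u - s)) < e / 4" for k
    proof -
      have "norm (cinner (x k) (u - s)) \<le> C * norm (u - s)"
        using norm_cinner_le[of "x k" "u - s"] mult_right_mono[OF bounded[of k], of "norm (u - s)"] by simp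
      also have "\<dots> \<le> (C + 1) * norm (u - s)" by (intro mult_right_mono) auto
      also have "\<dots> < e / 4" using s(2) C by (simp add: dist_norm norm_minus_commute field_simps)
      finally show ?thesis .
    qed
    have "norm (cinner (x (r m)) u - cinner (x (r n)) u) < e" if mn: "m \<ge> N" "n \<ge> N" for m n
    proof -
      have tri: "norm (a + (b - c)) \<le> norm a + (norm b + norm c)" for a b c :: complex
        using norm_triangle_ineq[of a "b - c"] norm_triangle_ineq4[of b c] by linarith
      have "cinner (x (r m)) u - cinner (x (r n)) u = (cinner (x (r m)) s - cinner (x (r n)) s)
        + (cinner (x (r m)) (u - s) - cinner (x (r n)) (u - s))"
        by (simp add: cinner.diff_right)
      then have "norm (cinner (x (r m)) u - cinner (x (r n)) u) \<le> norm (cinner (x (r m)) s - cinner (x (r n)) s)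
        + (norm (cinner (x (r m)) (u - s)) + norm (cinner (x (r n)) (u - s)))"
        using tri by metis
      moreover have "norm (cinner (x (r m)) s - cinner (x (r n)) s) < e / 2" using N mn by blast
      ultimately show ?thesis using small[of "r m"] small[of "r n"] by linarith
    qed
    then show "\<exists>M. \<forall>m\<ge>M. \<forall>n\<ge>M. norm (cinner (x (r m)) u - cinner (x (r n)) u) < e" by blast
  qed
  have conv: "convergent (\<lambda>n. cinner (x (r n)) g)" for g
  proof -
    obtain u where u: "u \<in> closure (chull (range x))" "\<forall>v\<in>closure (chull (range x)). cinner v g = cinner v u"
      using projection_l2[OF csubspace_closure[OF csubspace_chull] closed_closure] by blast
    have "x k \<in> closure (chull (range x))" for k
      using subset_chull[of "range x"] closure_subset by blast
    then show ?thesis using closure_T[OF u(1)] u(2) by simp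
  qed
  define \<psi> where "\<psi> g = lim (\<lambda>n. cinner (x (r n)) g)" for g
  have psi: "(\<lambda>n. cinner (x (r n)) g) \<longlonglongrightarrow> \<psi> g" for g
    using conv[of g] by (simp add: \<psi>_def convergent_LIMSEQ_iff)
  \<comment> \<open>\<open>\<psi>\<close> is conjugate-linear in the test vector, hence the
    conjugation before the theorem of Riesz is applied.\<close>
  have "\<exists>f\<in>UNIV. \<forall>g\<in>UNIV. cnj (\<psi> g) = cinner g f"
  proof (rule riesz_l2[OF csubspace_UNIV closed_UNIV, where C=C])
    show "cnj (\<psi> (g + h)) = cnj (\<psi> g) + cnj (\<psi> h)" for g h
      using LIMSEQ_unique[OF psi[of "g + h"]] tendsto_add[OF psi[of g] psi[of h]]
      by (simp add: cinner.add_right)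
    show "cnj (\<psi> (c *\<^sub>C g)) = c * cnj (\<psi> g)" for c g
      using LIMSEQ_unique[OF psi[of "c *\<^sub>C g"]] tendsto_mult[OF tendsto_const[of "cnj c"] psi[of g]]
      by (simp add: cinner_scaleC_right)
    show "cmod (cnj (\<psi> g)) \<le> C * norm g" for g
    proof -
      have "cmod (\<psi> g) \<le> C * norm g"
      proof (rule LIMSEQ_le_const2[OF tendsto_norm[OF psi]])
        have "norm (cinner (x (r n)) g) \<le> C * norm g" for n
          using norm_cinner_le[of "x (r n)" g] mult_right_mono[OF bounded[of "r n"], of "norm g"] by simp
        then show "\<exists>N. \<forall>n\<ge>N. norm (cinner (x (r n)) g) \<le> C * norm g" by blast
      qed
      then show ?thesis by simp
    qed
  qed
  then obtain f where f: "\<And>g. cnj (\<psi> g) = cinner g f" by blast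
  have "\<psi> g = cinner f g" for g
    using arg_cong[OF f[of g], of cnj] cinner_commute[of f g] by simp
  then have "(\<lambda>n. cinner (x (r n)) g) \<longlonglongrightarrow> cinner f g" for g using psi[of g] by simp
  then have "weakly_null (\<lambda>n. x (r n) - f)"
    unfolding weakly_null_def by (auto simp: cinner.diff_left LIM_zero_iff)
  then show ?thesis using r by blast
qed

lemma weak_limit_strong_limit:
  fixes x :: "nat \<Rightarrow> 'd::finite l2"
  assumes "weakly_null (\<lambda>n. x n - f)" "x \<longlonglongrightarrow> g"
  shows "f = g"
proof -
  have "(\<lambda>n. cinner (x n - f) (f - g)) \<longlonglongrightarrow> 0" using assms(1) by (simp add: weakly_null_def)
  moreover have "(\<lambda>n. cinner (x n - f) (f - g)) \<longlonglongrightarrow> cinner (g - f) (f - g)"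
    by (intro cinner.tendsto tendsto_intros assms(2))
  ultimately have "cinner (g - f) (f - g) = 0" using LIMSEQ_unique by blast
  moreover have "cinner (g - f) (f - g) = - cinner (f - g) (f - g)"
    by (simp add: cinner.diff_left cinner.diff_right)
  ultimately show ?thesis by (simp add: cinner_self_norm)
qed

section \<open>Test functions and the fundamental lemma of the calculus of variations\<close>

text \<open>Openness of \<open>U\<close> matters because \<open>partial\<close> takes the full
  derivative at a point, which depends on a neighbourhood.\<close>

lemma Ck_on_cong:
  assumes "open U" "Ck_on k U f" "\<And>x. x \<in> U \<Longrightarrow> f x = g x"
  shows "Ck_on k U g"
  using assms(2,3)
proof (induction k arbitrary: f g)
  case 0
  then show ?case using continuous_on_cong[of U U f g] by simp
next
  case (Suc k)
  have diff: "f differentiable at x" if "x \<in> U" for x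
    using Suc.prems(1) that assms(1) by (auto simp: differentiable_on_eq_differentiable_at)
  have "g differentiable_on U"
    unfolding differentiable_on_def
  proof
    fix x assume "x \<in> U"
    then have "f differentiable (at x within U)" using Suc.prems(1) by (auto simp: differentiable_on_def)
    then show "g differentiable (at x within U)"
      by (rule differentiable_transform_within[where d=1]) (use \<open>x \<in> U\<close> Suc.prems(2) in auto)
  qed
  moreover have "Ck_on k U (partial i g)" for i
  proof (rule Suc.IH[of "partial i f"])
    show "Ck_on k U (partial i f)" using Suc.prems(1) by simp
    show "partial i f x = partial i g x" if "x \<in> U" for x
      unfolding partial_def
      using frechet_derivative_transform_within_open[OF diff[OF that] assms(1) that] Suc.prems(2) by simp
  qed
  ultimately show ?case by simp
qed

lemma Ck_on_mono: "Ck_on k U f \<Longrightarrow> V \<subseteq> U \<Longrightarrow> Ck_on k V f"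
  by (induction k arbitrary: f) (auto intro: continuous_on_subset differentiable_on_subset)

lemma Ck_on_SucD: "Ck_on (Suc k) U f \<Longrightarrow> Ck_on k U f"
proof (induction k arbitrary: f)
  case 0
  then show ?case by (auto intro: differentiable_imp_continuous_on)
next
  case (Suc k)
  then show ?case by (metis Ck_on.simps(2))
qed

lemma Ck_on_const [simp]: "Ck_on k U (\<lambda>x :: real^'d. c)"
proof (induction k arbitrary: c)
  case (Suc k)
  have "partial i (\<lambda>x :: real^'d. c) = (\<lambda>x. 0)" for i
    by (simp add: partial_def fun_eq_iff)
  then show ?case using Suc by simp
qed simp

lemma smooth_on_imp_continuous_on: "smooth_on U f \<Longrightarrow> continuous_on U f"
  by (metis Ck_on.simps(1) smooth_on_def)

lemma smooth_on_measurable: "smooth_on UNIV f \<Longrightarrow> f \<in> borel_measurable lebesgue"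
  by (intro measurable_completion)
    (simp add: measurable_lborel1 borel_measurable_continuous_onI smooth_on_imp_continuous_on)

lemma Ck_on_add:
  assumes "open U" "Ck_on k U f" "Ck_on k U g"
  shows "Ck_on k U (\<lambda>x. f x + g x)"
  using assms(2,3)
proof (induction k arbitrary: f g)
  case 0
  then show ?case by (auto intro: continuous_intros)
next
  case (Suc k)
  have diff: "f differentiable at x" "g differentiable at x" if "x \<in> U" for x
    using Suc.prems that assms(1) by (auto simp: differentiable_on_eq_differentiable_at)
  have "Ck_on k U (partial i (\<lambda>x. f x + g x))" for i
  proof (rule Ck_on_cong[OF assms(1)])
    show "Ck_on k U (\<lambda>x. partial i f x + partial i g x)" using Suc by simp
    show "partial i f x + partial i g x = partial i (\<lambda>x. f x + g x) x" if "x \<in> U" for x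
    proof -
      have "((\<lambda>x. f x + g x) has_derivative (\<lambda>h. frechet_derivative f (at x) h + frechet_derivative g (at x) h)) (at x)"
        using diff[OF that] by (intro has_derivative_add) (auto simp: frechet_derivative_works[symmetric])
      then show ?thesis
        unfolding partial_def by (simp add: frechet_derivative_at[symmetric])
    qed
  qed
  then show ?case using Suc.prems by (auto intro: differentiable_on_add)
qed

lemma Ck_on_mult:
  assumes "open U" "Ck_on k U f" "Ck_on k U g"
  shows "Ck_on k U (\<lambda>x. f x * g x)"
  using assms(2,3)
proof (induction k arbitrary: f g)
  case 0
  then show ?case by (auto intro: continuous_intros)
next
  case (Suc k)
  have diff: "f differentiable at x" "g differentiable at x" if "x \<in> U" for x
    using Suc.prems that assms(1) by (auto simp: differentiable_on_eq_differentiable_at)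
  have "Ck_on k U (partial i (\<lambda>x. f x * g x))" for i
  proof (rule Ck_on_cong[OF assms(1)])
    show "Ck_on k U (\<lambda>x. f x * partial i g x + partial i f x * g x)"
      using Suc.prems by (intro Ck_on_add[OF assms(1)] Suc.IH) (auto intro: Ck_on_SucD)
    show "f x * partial i g x + partial i f x * g x = partial i (\<lambda>x. f x * g x) x" if "x \<in> U" for x
    proof -
      have "((\<lambda>x. f x * g x) has_derivative
          (\<lambda>h. f x * frechet_derivative g (at x) h + frechet_derivative f (at x) h * g x)) (at x)"
        using diff[OF that] by (intro has_derivative_mult) (auto simp: frechet_derivative_works[symmetric])
      then show ?thesis
        unfolding partial_def by (simp add: frechet_derivative_at[symmetric])
    qed
  qed
  moreover have "(\<lambda>x. f x * g x) differentiable_on U"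
    using Suc.prems by (auto intro: differentiable_on_mult)
  ultimately show ?case by simp
qed

lemma Ck_on_prod:
  assumes "open U" "\<And>i. i \<in> I \<Longrightarrow> Ck_on k U (f i)"
  shows "Ck_on k U (\<lambda>x. \<Prod>i\<in>I. f i x)"
  using assms(2) by (induction I rule: infinite_finite_induct) (auto intro: Ck_on_mult[OF assms(1)])

lemma Ck_on_Un:
  assumes "open U" "open V" "Ck_on k U f" "Ck_on k V f"
  shows "Ck_on k (U \<union> V) f"
  using assms(3,4)
proof (induction k arbitrary: f)
  case 0
  then show ?case using assms(1,2) by (auto intro: continuous_on_open_Un)
next
  case (Suc k)
  then show ?case
    using assms(1,2) by (auto simp: differentiable_on_eq_differentiable_at open_Un)
qed

section \<open>Operations on test functions and smooth bumps\<close>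

lemma test_functions_mono: "V \<subseteq> U \<Longrightarrow> test_functions V \<subseteq> test_functions U"
  by (auto simp: test_functions_def)

lemma test_functionsI:
  assumes "smooth_on UNIV \<phi>" "compact K" "K \<subseteq> U" "\<And>x. x \<notin> K \<Longrightarrow> \<phi> x = 0"
  shows "\<phi> \<in> test_functions U"
proof -
  have "closure {x. \<phi> x \<noteq> 0} \<subseteq> K"
    using assms(2,4) by (intro closure_minimal) (auto intro: compact_imp_closed)
  moreover from this have "compact (closure {x. \<phi> x \<noteq> 0})"
    using assms(2) by (metis closed_closure compact_Int_closed inf.absorb_iff2)
  ultimately show ?thesis using assms(1,3) by (auto simp: test_functions_def)
qed

lemma test_function_support:
  assumes "\<phi> \<in> test_functions U"
  shows "\<exists>K. smooth_on UNIV \<phi> \<and> compact K \<and> K \<subseteq> U \<and> (\<forall>x. x \<notin> K \<longrightarrow> \<phi> x = 0)"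
proof (intro exI conjI allI impI)
  show "\<phi> x = 0" if "x \<notin> closure {x. \<phi> x \<noteq> 0}" for x
    using that closure_subset[of "{x. \<phi> x \<noteq> 0}"] by auto
qed (use assms in \<open>auto simp: test_functions_def\<close>)

text \<open>\<open>c\<close> is smooth on \<open>U\<close> only; the product is smooth there and
  vanishes on the open complement of the support of \<open>\<phi>\<close>, and these two open sets
  cover the space.\<close>

lemma smooth_mult_test_function:
  assumes "open U" "smooth_on U c" "\<phi> \<in> test_functions U"
  shows "(\<lambda>x. c x * \<phi> x) \<in> test_functions U"
proof -
  obtain K where K: "smooth_on UNIV \<phi>" "compact K" "K \<subseteq> U" "\<And>x. x \<notin> K \<Longrightarrow> \<phi> x = 0"
    using test_function_support[OF assms(3)] by blast
  have open_K: "open (- K)" using K(2) by (simp add: compact_imp_closed open_Compl)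
  have "Ck_on k UNIV (\<lambda>x. c x * \<phi> x)" for k
  proof -
    have "Ck_on k U (\<lambda>x. c x * \<phi> x)"
      using assms(2) K(1) by (intro Ck_on_mult assms(1)) (auto simp: smooth_on_def intro: Ck_on_mono)
    moreover have "Ck_on k (- K) (\<lambda>x. c x * \<phi> x)"
      by (rule Ck_on_cong[OF open_K Ck_on_const[of _ _ 0]]) (simp add: K)
    ultimately have "Ck_on k (U \<union> - K) (\<lambda>x. c x * \<phi> x)" by (rule Ck_on_Un[OF assms(1) open_K])
    moreover have "U \<union> - K = UNIV" using K(3) by auto
    ultimately show ?thesis by simp
  qed
  then show ?thesis
    by (intro test_functionsI[of _ K]) (auto simp: smooth_on_def K)
qed

lemma partial_test_function:
  assumes "\<phi> \<in> test_functions U"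
  shows "partial i \<phi> \<in> test_functions U"
proof -
  obtain K where K: "smooth_on UNIV \<phi>" "compact K" "K \<subseteq> U" "\<And>x. x \<notin> K \<Longrightarrow> \<phi> x = 0"
    using test_function_support[OF assms] by blast
  have open_K: "open (- K)" using K(2) by (simp add: compact_imp_closed open_Compl)
  show ?thesis
  proof (rule test_functionsI[of _ K])
    show "smooth_on UNIV (partial i \<phi>)"
      unfolding smooth_on_def
    proof
      fix k
      have "Ck_on (Suc k) UNIV \<phi>" using K(1) by (auto simp: smooth_on_def simp del: Ck_on.simps)
      then show "Ck_on k UNIV (partial i \<phi>)" by simp
    qed
    show "partial i \<phi> x = 0" if "x \<notin> K" for x
    proof -
      have "frechet_derivative (\<lambda>x. 0) (at x) = frechet_derivative \<phi> (at x)"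
        by (rule frechet_derivative_transform_within_open[OF _ open_K]) (use that K in auto)
      then show ?thesis by (simp add: partial_def flip: \<open>frechet_derivative (\<lambda>x. 0) (at x) = _\<close>)
    qed
  qed (use K in auto)
qed

text \<open>Carrying a polynomial in \<open>1/t\<close> along makes the class closed under
  differentiation: the derivative belongs to the polynomial \<open>X\<^sup>2 (p - p')\<close>.
  Smoothness of \<open>exp (- 1/t)\<close> extended by zero thus becomes an induction.\<close>

definition flat_exp :: "real poly \<Rightarrow> real \<Rightarrow> real" where
  "flat_exp p t = (if 0 < t then poly p (inverse t) * exp (- inverse t) else 0)"

lemma poly_exp_tendsto_0: "((\<lambda>x. poly p x * exp (- x)) \<longlongrightarrow> (0::real)) at_top"
proof -
  have "((\<lambda>x. \<Sum>i\<le>degree p. coeff p i * (x ^ i / exp x)) \<longlongrightarrow> (\<Sum>i\<le>degree p. coeff p i * 0)) at_top"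
    by (intro tendsto_sum tendsto_mult tendsto_const tendsto_power_div_exp_0)
  then show ?thesis
    by (simp add: poly_altdef exp_minus sum_distrib_right sum_divide_distrib field_simps)
qed

lemma flat_exp_deriv:
  "(flat_exp p has_real_derivative flat_exp ([:0, 0, 1:] * (p - pderiv p)) t) (at t)"
proof -
  consider "t > 0" | "t < 0" | "t = 0" by linarith
  then show ?thesis
  proof cases
    case 1
    have "((\<lambda>t. poly p (inverse t) * exp (- inverse t)) has_real_derivative
      flat_exp ([:0, 0, 1:] * (p - pderiv p)) t) (at t)"
      using 1 by (auto intro!: derivative_eq_intros DERIV_chain2[OF poly_DERIV]
          simp: flat_exp_def power2_eq_square algebra_simps)
    then show ?thesis
      by (rule has_field_derivative_transform_within_open[of _ _ _ "{0<..}"])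
        (use 1 in \<open>auto simp: flat_exp_def\<close>)
  next
    case 2
    have "((\<lambda>t. 0) has_real_derivative flat_exp ([:0, 0, 1:] * (p - pderiv p)) t) (at t)"
      using 2 by (simp add: flat_exp_def)
    then show ?thesis
      by (rule has_field_derivative_transform_within_open[of _ _ _ "{..<0}"])
        (use 2 in \<open>auto simp: flat_exp_def\<close>)
  next
    case 3
    \<comment> \<open>Under \<open>x = 1/y\<close> the difference quotient from the right becomes
      \<open>x * poly p x * exp (- x)\<close> at infinity, whence \<open>pCons 0 p\<close>.\<close>
    have "((\<lambda>y. (flat_exp p y - flat_exp p 0) / (y - 0)) \<longlongrightarrow> 0) (at 0)"
    proof (rule filterlim_split_at)
      have "\<forall>\<^sub>F y in at_left 0. (flat_exp p y - flat_exp p 0) / (y - 0) = 0"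
        by (auto simp: flat_exp_def eventually_at_filter)
      then show "((\<lambda>y. (flat_exp p y - flat_exp p 0) / (y - 0)) \<longlongrightarrow> 0) (at_left 0)"
        by (rule tendsto_eventually)
      have "((\<lambda>x. poly (pCons 0 p) x * exp (- x)) \<longlongrightarrow> 0) at_top"
        by (rule poly_exp_tendsto_0)
      moreover have "\<forall>\<^sub>F x in at_top. poly (pCons 0 p) x * exp (- x)
        = (flat_exp p (inverse x) - flat_exp p 0) / (inverse x - 0)"
        using eventually_gt_at_top[of 0]
        by eventually_elim (auto simp: flat_exp_def field_simps)
      ultimately have "((\<lambda>x. (flat_exp p (inverse x) - flat_exp p 0) / (inverse x - 0)) \<longlongrightarrow> 0) at_top"
        by (rule Lim_transform_eventually)
      then show "((\<lambda>y. (flat_exp p y - flat_exp p 0) / (y - 0)) \<longlongrightarrow> 0) (at_right 0)"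
        by (simp only: filterlim_at_right_to_top)
    qed
    then show ?thesis
      unfolding has_field_derivative_iff using 3 by (simp add: flat_exp_def)
  qed
qed

lemma Ck_flat_exp: "Ck_on k UNIV (\<lambda>x :: real^'d. complex_of_real (flat_exp p (c * x $ i + a)))"
proof (induction k arbitrary: p)
  case 0
  have "continuous_on UNIV (flat_exp p)"
    using flat_exp_deriv DERIV_isCont by (blast intro: continuous_at_imp_continuous_on)
  moreover have "continuous_on UNIV (\<lambda>x :: real^'d. c * x $ i + a)"
    by (intro continuous_on_add continuous_on_mult continuous_on_const
        linear_continuous_on[OF bounded_linear_vec_nth])
  ultimately have "continuous_on UNIV (\<lambda>x :: real^'d. flat_exp p (c * x $ i + a))"
    by (rule continuous_on_compose2) auto
  then show ?case by (auto intro: continuous_intros)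
next
  case (Suc k)
  let ?q = "[:0, 0, 1:] * (p - pderiv p)"
  have *: "((\<lambda>x :: real^'d. complex_of_real (flat_exp p (c * x $ i + a))) has_derivative
    (\<lambda>h. complex_of_real (flat_exp ?q (c * x $ i + a) * (c * h $ i)))) (at x)" for x
  proof -
    have "((\<lambda>x :: real^'d. c * x $ i + a) has_derivative (\<lambda>h. c * h $ i)) (at x)"
      by (auto intro!: derivative_eq_intros bounded_linear.has_derivative[OF bounded_linear_vec_nth])
    then have "((\<lambda>x :: real^'d. flat_exp p (c * x $ i + a)) has_derivative
      (\<lambda>h. flat_exp ?q (c * x $ i + a) * (c * h $ i))) (at x)"
      using flat_exp_deriv[of p "c * x $ i + a", unfolded has_field_derivative_def]
      by (rule has_derivative_compose)
    then show ?thesis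
      by (rule bounded_linear.has_derivative[OF bounded_linear_of_real])
  qed
  have "partial j (\<lambda>x :: real^'d. complex_of_real (flat_exp p (c * x $ i + a)))
    = (\<lambda>x. complex_of_real (c * axis j 1 $ i) * complex_of_real (flat_exp ?q (c * x $ i + a)))" for j
    unfolding partial_def using frechet_derivative_at[OF *] by (auto simp: fun_eq_iff mult_ac)
  moreover have "(\<lambda>x :: real^'d. complex_of_real (flat_exp p (c * x $ i + a))) differentiable_on UNIV"
    using * by (auto simp: differentiable_on_def differentiable_def)
  ultimately show ?case
    using Suc by (auto intro!: Ck_on_mult)
qed

text \<open>Off the box some factor vanishes; inside, every factor is
  \<open>exp (- 1 / ((n + 1) * d))\<close>, where \<open>d\<close> is the distance to a face, and
  tends to \<open>1\<close>. So these test functions converge boundedly to the indicator of the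
  box.\<close>

definition box_bump :: "real^'d \<Rightarrow> real^'d \<Rightarrow> nat \<Rightarrow> real^'d \<Rightarrow> complex" where
  "box_bump a b n x = (\<Prod>i\<in>UNIV. complex_of_real (flat_exp 1 (real (Suc n) * x $ i + - (real (Suc n) * a $ i)))
     * complex_of_real (flat_exp 1 (- real (Suc n) * x $ i + real (Suc n) * b $ i)))"

lemma mem_box_vec: "x \<in> box a b \<longleftrightarrow> (\<forall>i. a $ i < x $ i \<and> x $ i < b $ i)"
  for a b x :: "real^'d"
  by (auto simp: mem_box_cart)

lemma box_Int_box_vec:
  fixes a b c d :: "real^'d"
  shows "box a b \<inter> box c d = box (\<chi> i. max (a $ i) (c $ i)) (\<chi> i. min (b $ i) (d $ i))"
  by (auto simp: mem_box_vec)

lemma sigma_finite_lebesgue: "sigma_finite_measure (lebesgue :: 'a::euclidean_space measure)"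
proof
  obtain A :: "'a set set" where A: "countable A" "A \<subseteq> sets lborel" "\<Union>A = space lborel"
    "\<forall>a\<in>A. emeasure lborel a \<noteq> \<infinity>"
    using lborel.sigma_finite_countable by auto
  then show "\<exists>A :: 'a set set. countable A \<and> A \<subseteq> sets lebesgue \<and> \<Union>A = space lebesgue \<and> (\<forall>a\<in>A. emeasure lebesgue a \<noteq> \<infinity>)"
    by (intro exI[of _ A]) (auto simp: emeasure_completion subset_iff)
qed

lemma box_bump_outside: "x \<notin> box a b \<Longrightarrow> box_bump a b n x = 0"
proof -
  assume "x \<notin> box a b"
  then obtain i where i: "x $ i \<le> a $ i \<or> b $ i \<le> x $ i" by (auto simp: mem_box_vec not_less)
  have *: "flat_exp 1 t = 0" if "t \<le> 0" for t using that by (simp add: flat_exp_def)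
  have "real (Suc n) * x $ i + - (real (Suc n) * a $ i) \<le> 0 \<or> - real (Suc n) * x $ i + real (Suc n) * b $ i \<le> 0"
    using i mult_left_mono[of "x $ i" "a $ i" "real (Suc n)"] mult_left_mono[of "b $ i" "x $ i" "real (Suc n)"]
    unfolding mult_minus_left by (auto simp del: of_nat_Suc)
  then have "flat_exp 1 (real (Suc n) * x $ i + - (real (Suc n) * a $ i)) = 0
    \<or> flat_exp 1 (- real (Suc n) * x $ i + real (Suc n) * b $ i) = 0"
    using * by blast
  then show ?thesis unfolding box_bump_def by (intro prod_zero) auto
qed

lemma box_bump_test_function: "cbox a b \<subseteq> U \<Longrightarrow> box_bump a b n \<in> test_functions U"
proof (rule test_functionsI[of _ "cbox a b"])
  show "smooth_on UNIV (box_bump a b n)"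
    unfolding smooth_on_def box_bump_def
    by (intro allI Ck_on_prod Ck_on_mult open_UNIV Ck_flat_exp)
qed (use box_subset_cbox in \<open>auto intro!: box_bump_outside\<close>)

lemma norm_box_bump_le: "cmod (box_bump a b n x) \<le> 1"
proof -
  have "\<bar>flat_exp 1 t\<bar> \<le> 1" for t by (simp add: flat_exp_def)
  then show ?thesis
    unfolding box_bump_def prod_norm[symmetric] norm_mult norm_of_real
    by (intro prod_le_1 conjI mult_le_one mult_nonneg_nonneg) auto
qed

lemma box_bump_tendsto:
  assumes "x \<in> box a b"
  shows "(\<lambda>n. box_bump a b n x) \<longlonglongrightarrow> 1"
proof -
  have *: "(\<lambda>n. flat_exp 1 (real (Suc n) * t)) \<longlonglongrightarrow> 1" if t: "0 < t" for t
  proof -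
    have "(\<lambda>n. exp (- (inverse (real (Suc n)) * inverse t))) \<longlonglongrightarrow> exp (- (0 * inverse t))"
      by (intro tendsto_intros LIMSEQ_inverse_real_of_nat)
    then show ?thesis using t by (simp add: flat_exp_def)
  qed
  have "(\<lambda>n. box_bump a b n x) \<longlonglongrightarrow> (\<Prod>i\<in>(UNIV::'a set). complex_of_real 1 * complex_of_real 1)"
    unfolding box_bump_def
  proof (intro tendsto_prod tendsto_mult tendsto_of_real)
    fix i
    show "(\<lambda>n. flat_exp 1 (real (Suc n) * x $ i + - (real (Suc n) * a $ i))) \<longlonglongrightarrow> 1"
      using *[of "x $ i - a $ i"] assms by (simp add: mem_box_vec algebra_simps)
    show "(\<lambda>n. flat_exp 1 (- real (Suc n) * x $ i + real (Suc n) * b $ i)) \<longlonglongrightarrow> 1"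
      using *[of "b $ i - x $ i"] assms by (simp add: mem_box_vec algebra_simps)
  qed
  then show ?thesis by simp
qed

text \<open>Dynkin's argument: open boxes are an intersection-stable generator of the Borel sets,
  and completion changes a set only by null sets.\<close>

lemma AE_zero_of_box_integrals:
  fixes g :: "real^'d \<Rightarrow> complex"
  assumes g: "integrable lebesgue g"
    and box: "\<And>a b. set_lebesgue_integral lebesgue (box a b) g = 0"
    and outside: "\<And>x. x \<notin> box c d \<Longrightarrow> g x = 0"
  shows "AE x in lebesgue. g x = 0"
proof (rule sigma_finite_measure.density_zero[OF sigma_finite_lebesgue g])
  have si: "set_integrable lebesgue A g" if "A \<in> sets lebesgue" for A
    unfolding set_integrable_def using that g by (rule integrable_mult_indicator)
  \<comment> \<open>Complements need the integral over the whole space, which reduces to a box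
    because \<open>g\<close> vanishes off \<open>box c d\<close>.\<close>
  have total: "integral\<^sup>L lebesgue g = 0"
  proof -
    have "integral\<^sup>L lebesgue g = set_lebesgue_integral lebesgue (box c d) g"
      unfolding set_lebesgue_integral_def
      by (rule Bochner_Integration.integral_cong) (use outside in \<open>auto simp: indicator_def\<close>)
    then show ?thesis using box by simp
  qed
  have borel: "set_lebesgue_integral lebesgue A g = 0" if "A \<in> sets borel" for A
  proof -
    let ?G = "range (\<lambda>(a, b). box a b :: (real^'d) set)"
    have A: "A \<in> sigma_sets UNIV ?G"
      using that unfolding borel_eq_box by simp
    have stable: "Int_stable ?G"
      unfolding Int_stable_def
    proof (intro ballI)
      fix X Y assume "X \<in> ?G" "Y \<in> ?G"
      then obtain a b c d where "X = box a b" "Y = box c d" by auto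
      then show "X \<inter> Y \<in> ?G" unfolding \<open>X = _\<close> \<open>Y = _\<close> box_Int_box_vec by auto
    qed
    have sets: "B \<in> sets lebesgue" if "B \<in> sigma_sets UNIV ?G" for B
    proof -
      have "B \<in> sets borel" using that unfolding borel_eq_box by simp
      then show ?thesis by simp
    qed
    have "?G \<subseteq> Pow UNIV" by simp
    from stable this A show ?thesis
    proof (induction rule: sigma_sets_induct_disjoint)
      case (compl B)
      have "set_lebesgue_integral lebesgue (UNIV - B) g
        = integral\<^sup>L lebesgue (\<lambda>x. g x - indicat_real B x *\<^sub>R g x)"
        unfolding set_lebesgue_integral_def
        by (rule Bochner_Integration.integral_cong) (auto simp: indicator_def)
      also have "\<dots> = integral\<^sup>L lebesgue g - set_lebesgue_integral lebesgue B g"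
        unfolding set_lebesgue_integral_def
        using si[OF sets[OF compl(1)]] g by (intro Bochner_Integration.integral_diff) (auto simp: set_integrable_def)
      finally show ?case using total compl(2) sets by simp
    next
      case (union B)
      have "set_lebesgue_integral lebesgue (\<Union>i. B i) g = (\<Sum>i. set_lebesgue_integral lebesgue (B i) g)"
      proof (rule lebesgue_integral_countable_add)
        show "B i \<in> sets lebesgue" for i using union(2) sets by auto
        then show "set_integrable lebesgue (\<Union>i. B i) g" by (intro si) auto
        show "B i \<inter> B j = {}" if "i \<noteq> j" for i j using union(1) that by (auto simp: disjoint_family_on_def)
      qed
      also have "\<dots> = 0" using union(3) sets by simp
      finally show ?case .
    qed (use box in \<open>auto simp: set_lebesgue_integral_def\<close>)
  qed
  fix A :: "(real^'d) set" assume "A \<in> sets lebesgue"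
  then obtain S N N' where A: "A = S \<union> N" "N \<subseteq> N'" "N' \<in> null_sets lborel" "S \<in> sets lborel"
    by (rule sets_completionE)
  have "AE x in lebesgue. x \<notin> N'"
    using A(3) by (intro AE_not_in) (simp add: null_sets_completionI)
  then have "set_lebesgue_integral lebesgue A g = set_lebesgue_integral lebesgue S g"
    unfolding set_lebesgue_integral_def
  proof (intro integral_cong_AE)
    show "(\<lambda>x. indicat_real A x *\<^sub>R g x) \<in> borel_measurable lebesgue"
      using si[OF \<open>A \<in> sets lebesgue\<close>] by (auto simp: set_integrable_def)
    show "(\<lambda>x. indicat_real S x *\<^sub>R g x) \<in> borel_measurable lebesgue"
      using si[of S] A(4) by (auto simp: set_integrable_def)
    show "AE x in lebesgue. indicat_real A x *\<^sub>R g x = indicat_real S x *\<^sub>R g x"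
      if "AE x in lebesgue. x \<notin> N'"
      using that by eventually_elim (use A in \<open>auto simp: indicator_def\<close>)
  qed
  then show "set_lebesgue_integral lebesgue A g = 0" using borel[of S] A(4) by simp
qed

text \<open>Bumps approximate the indicators of boxes with closure in \<open>U\<close>, so the
  integrals of \<open>f\<close> over these boxes vanish. A countable cover of \<open>U\<close> by
  closed boxes globalises the result.\<close>

lemma fundamental_lemma:
  fixes f :: "real^'d \<Rightarrow> complex"
  assumes "open U" "locally_integrable U f"
    and zero: "\<And>\<phi>. \<phi> \<in> test_functions U \<Longrightarrow> regular_distribution f \<phi> = 0"
  shows "AE x in lebesgue. x \<in> U \<longrightarrow> f x = 0"
proof -
  have int: "set_integrable lebesgue (cbox a b) f" if "cbox a b \<subseteq> U" for a b
    using assms(2) that by (auto simp: locally_integrable_def)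
  have box0: "set_lebesgue_integral lebesgue (box a b) f = 0" if ab: "cbox a b \<subseteq> U" for a b
  proof -
    have "(\<lambda>n. integral\<^sup>L lebesgue (\<lambda>x. f x * box_bump a b n x)) \<longlonglongrightarrow> integral\<^sup>L lebesgue (\<lambda>x. indicat_real (box a b) x *\<^sub>R f x)"
    proof (rule Bochner_Integration.integral_dominated_convergence)
      show "integrable lebesgue (\<lambda>x. norm (indicat_real (cbox a b) x *\<^sub>R f x))"
        using int[OF ab] by (intro integrable_norm) (simp add: set_integrable_def)
      have m: "(\<lambda>x. indicat_real (cbox a b) x *\<^sub>R f x) \<in> borel_measurable lebesgue"
        using int[OF ab] by (auto simp: set_integrable_def)
      have "(\<lambda>x. indicat_real (box a b) x *\<^sub>R (indicat_real (cbox a b) x *\<^sub>R f x)) \<in> borel_measurable lebesgue"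
        by (rule borel_measurable_scaleR[OF _ m]) (auto intro!: borel_measurable_indicator)
      moreover have "(\<lambda>x. indicat_real (box a b) x *\<^sub>R (indicat_real (cbox a b) x *\<^sub>R f x)) = (\<lambda>x. indicat_real (box a b) x *\<^sub>R f x)"
        using box_subset_cbox[of a b] by (auto simp: indicator_def fun_eq_iff)
      ultimately show "(\<lambda>x. indicat_real (box a b) x *\<^sub>R f x) \<in> borel_measurable lebesgue" by simp
      show "(\<lambda>x. f x * box_bump a b n x) \<in> borel_measurable lebesgue" for n
      proof -
        have "box_bump a b n \<in> borel_measurable lebesgue"
          using box_bump_test_function[OF ab, of n] by (intro smooth_on_measurable) (simp add: test_functions_def)
        then have "(\<lambda>x. (indicat_real (cbox a b) x *\<^sub>R f x) * box_bump a b n x) \<in> borel_measurable lebesgue"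
          using m by (intro borel_measurable_times)
        moreover have "(\<lambda>x. (indicat_real (cbox a b) x *\<^sub>R f x) * box_bump a b n x) = (\<lambda>x. f x * box_bump a b n x)"
          using box_bump_outside[of _ a b n] box_subset_cbox[of a b] by (fastforce simp: indicator_def fun_eq_iff)
        ultimately show ?thesis by simp
      qed
      show "AE x in lebesgue. (\<lambda>n. f x * box_bump a b n x) \<longlonglongrightarrow> indicat_real (box a b) x *\<^sub>R f x"
      proof (rule AE_I2)
        fix x
        show "(\<lambda>n. f x * box_bump a b n x) \<longlonglongrightarrow> indicat_real (box a b) x *\<^sub>R f x"
        proof (cases "x \<in> box a b")
          case True
          have "(\<lambda>n. f x * box_bump a b n x) \<longlonglongrightarrow> f x * 1"
            by (intro tendsto_mult tendsto_const box_bump_tendsto True)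
          then show ?thesis using True by simp
        qed (simp add: box_bump_outside)
      qed
      show "AE x in lebesgue. norm (f x * box_bump a b n x) \<le> norm (indicat_real (cbox a b) x *\<^sub>R f x)" for n
      proof (rule AE_I2)
        fix x
        show "norm (f x * box_bump a b n x) \<le> norm (indicat_real (cbox a b) x *\<^sub>R f x)"
        proof (cases "x \<in> cbox a b")
          case True
          then show ?thesis using norm_box_bump_le[of a b n x] by (simp add: norm_mult mult_left_le)
        next
          case False
          then have "x \<notin> box a b" using box_subset_cbox[of a b] by auto
          then show ?thesis by (simp add: box_bump_outside)
        qed
      qed
    qed
    moreover have "integral\<^sup>L lebesgue (\<lambda>x. f x * box_bump a b n x) = 0" for n
      using zero[OF box_bump_test_function[OF ab]] by (simp add: regular_distribution_def)
    ultimately show ?thesis by (simp add: set_lebesgue_integral_def LIMSEQ_const_iff)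
  qed
  have cbox0: "AE x in lebesgue. x \<in> cbox c d \<longrightarrow> f x = 0" if cd: "cbox c d \<subseteq> U" for c d
  proof -
    let ?g = "\<lambda>x. indicat_real (box c d) x *\<^sub>R f x"
    have "AE x in lebesgue. ?g x = 0"
    proof (rule AE_zero_of_box_integrals[of _ c d])
      have "set_integrable lebesgue (box c d) f"
        by (rule set_integrable_subset[OF int[OF cd]]) (auto simp: box_subset_cbox)
      then show "integrable lebesgue ?g" by (simp add: set_integrable_def)
      fix a b
      \<comment> \<open>The test box may leave \<open>U\<close>, but its intersection with
        \<open>box c d\<close> is a box whose closure, if it is nonempty, lies in
        \<open>cbox c d\<close>.\<close>
      obtain p q where pq: "box a b \<inter> box c d = box p q" using box_Int_box_vec by blast
      show "set_lebesgue_integral lebesgue (box a b) ?g = 0"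
      proof (cases "box p q = {}")
        case True
        then have "(\<lambda>x. indicat_real (box a b) x *\<^sub>R ?g x) = (\<lambda>x. 0)"
          using pq by (auto simp: indicator_def fun_eq_iff)
        then show ?thesis by (simp add: set_lebesgue_integral_def)
      next
        case False
        then have "cbox p q \<subseteq> cbox c d"
          using closure_mono[of "box p q" "box c d"] pq closure_box[of p q] closure_box[of c d]
          by (metis Int_lower2 closure_box inf_bot_right)
        then have "set_lebesgue_integral lebesgue (box p q) f = 0" using cd by (intro box0) auto
        moreover have "(\<lambda>x. indicat_real (box a b) x *\<^sub>R ?g x) = (\<lambda>x. indicat_real (box p q) x *\<^sub>R f x)"
          using pq[symmetric] by (auto simp: indicator_def fun_eq_iff)
        ultimately show ?thesis by (simp add: set_lebesgue_integral_def)
      qed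
    qed auto
    moreover have "AE x in lebesgue. x \<notin> cbox c d - box c d"
      using negligible_frontier_interval[of c d] by (intro AE_not_in) (simp add: negligible_iff_null_sets)
    ultimately show ?thesis by eventually_elim (auto simp: indicator_def split: if_splits)
  qed
  obtain \<D> where D: "countable \<D>" "\<D> \<subseteq> Pow U" "\<And>X. X \<in> \<D> \<Longrightarrow> \<exists>a b. X = cbox a b" "\<Union>\<D> = U"
    using open_countable_Union_open_cbox[OF assms(1)] by metis
  have "AE x in lebesgue. \<forall>X\<in>\<D>. x \<in> X \<longrightarrow> f x = 0"
    unfolding AE_ball_countable[OF D(1)] using D(2,3) cbox0 by (metis PowD subsetD)
  then show ?thesis by eventually_elim (use D(4) in auto)
qed

section \<open>Locality of differential expressions\<close>

lemma locally_integrable_mono: "locally_integrable U f \<Longrightarrow> V \<subseteq> U \<Longrightarrow> locally_integrable V f"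
  by (auto simp: locally_integrable_def)

lemma integrable_mult_test_function:
  assumes h: "locally_integrable U h" and \<phi>: "\<phi> \<in> test_functions U"
  shows "integrable lebesgue (\<lambda>x. h x * \<phi> x)"
proof -
  obtain K where K: "smooth_on UNIV \<phi>" "compact K" "K \<subseteq> U" "\<And>x. x \<notin> K \<Longrightarrow> \<phi> x = 0"
    using test_function_support[OF \<phi>] by blast
  have cont: "continuous_on UNIV \<phi>" using K(1) by (rule smooth_on_imp_continuous_on)
  then have "bounded (\<phi> ` K)"
    using K(2) by (intro compact_imp_bounded compact_continuous_image) (auto intro: continuous_on_subset)
  then obtain B where B: "\<And>x. x \<in> K \<Longrightarrow> norm (\<phi> x) \<le> B" by (auto simp: bounded_iff)
  have hK: "integrable lebesgue (\<lambda>x. indicat_real K x *\<^sub>R h x)"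
    using h K(2,3) by (auto simp: locally_integrable_def set_integrable_def)
  have "integrable lebesgue (\<lambda>x. (indicat_real K x *\<^sub>R h x) * \<phi> x)"
  proof (rule Bochner_Integration.integrable_bound[where f="\<lambda>x. \<bar>B\<bar> *\<^sub>R (indicat_real K x *\<^sub>R h x)"])
    show "integrable lebesgue (\<lambda>x. \<bar>B\<bar> *\<^sub>R (indicat_real K x *\<^sub>R h x))"
      by (rule integrable_scaleR_right) (rule hK)
    have "\<phi> \<in> borel_measurable lebesgue"
      using K(1) by (rule smooth_on_measurable)
    then show "(\<lambda>x. (indicat_real K x *\<^sub>R h x) * \<phi> x) \<in> borel_measurable lebesgue"
      using hK by (intro borel_measurable_times) auto
    show "AE x in lebesgue. norm ((indicat_real K x *\<^sub>R h x) * \<phi> x) \<le> norm (\<bar>B\<bar> *\<^sub>R (indicat_real K x *\<^sub>R h x))"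
    proof (rule AE_I2)
      fix x
      show "norm ((indicat_real K x *\<^sub>R h x) * \<phi> x) \<le> norm (\<bar>B\<bar> *\<^sub>R (indicat_real K x *\<^sub>R h x))"
        using B[of x] by (cases "x \<in> K") (auto simp: norm_mult mult.commute intro!: mult_right_mono)
    qed
  qed
  moreover have "(\<lambda>x. (indicat_real K x *\<^sub>R h x) * \<phi> x) = (\<lambda>x. h x * \<phi> x)"
    using K(4) by (auto simp: indicator_def fun_eq_iff)
  ultimately show ?thesis by simp
qed

lemma regular_distribution_unique:
  assumes "open U" "locally_integrable U f" "locally_integrable U g"
    and "\<And>\<phi>. \<phi> \<in> test_functions U \<Longrightarrow> regular_distribution f \<phi> = regular_distribution g \<phi>"
  shows "AE x in lebesgue. x \<in> U \<longrightarrow> f x = g x"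
proof -
  note int = integrable_mult_test_function
  have "AE x in lebesgue. x \<in> U \<longrightarrow> f x - g x = 0"
  proof (rule fundamental_lemma[OF assms(1)])
    show "locally_integrable U (\<lambda>x. f x - g x)"
      unfolding locally_integrable_def
    proof (intro allI impI)
      fix K assume "compact K \<and> K \<subseteq> U"
      then show "set_integrable lebesgue K (\<lambda>x. f x - g x)"
        using assms(2,3) by (intro set_integral_diff) (auto simp: locally_integrable_def)
    qed
    show "regular_distribution (\<lambda>x. f x - g x) \<phi> = 0" if "\<phi> \<in> test_functions U" for \<phi>
      using assms(4)[OF that] int[OF assms(2) that] int[OF assms(3) that]
      by (simp add: regular_distribution_def left_diff_distrib)
  qed
  then show ?thesis by simp
qed

lemma acts_mono:
  "V \<subseteq> U \<Longrightarrow> acts \<tau> U u v \<Longrightarrow> acts \<tau> V u v"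
proof (induction \<tau> arbitrary: u v)
  case (Coeff c)
  have sm: "smooth_on U c \<Longrightarrow> smooth_on V c" using Coeff(1) by (auto simp: smooth_on_def intro: Ck_on_mono)
  show ?case
    using Coeff(2) sm test_functions_mono[OF Coeff(1)] locally_integrable_mono[OF _ Coeff(1)]
    unfolding acts.simps by (meson subsetD)
next
  case (Partial i)
  then show ?case using test_functions_mono[OF Partial(1)] by auto
next
  case (Sum \<sigma> \<tau>)
  obtain v1 v2 where v: "acts \<sigma> U u v1" "acts \<tau> U u v2" "\<forall>\<phi>\<in>test_functions U. v \<phi> = v1 \<phi> + v2 \<phi>"
    using Sum.prems(2) by auto
  then have "acts \<sigma> V u v1 \<and> acts \<tau> V u v2 \<and> (\<forall>\<phi>\<in>test_functions V. v \<phi> = v1 \<phi> + v2 \<phi>)"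
    using Sum.IH Sum.prems(1) test_functions_mono[OF Sum.prems(1)] by blast
  then show ?case by auto
next
  case (Comp \<sigma> \<tau>)
  obtain w where "acts \<tau> U u w" "acts \<sigma> U w v" using Comp.prems(2) by auto
  then have "acts \<tau> V u w \<and> acts \<sigma> V w v" using Comp.IH Comp.prems(1) by blast
  then show ?case by auto
qed

text \<open>\<open>acts\<close> is a relation: compositions quantify over intermediate
  distributions, and products with a coefficient have two readings. Uniqueness is what makes the
  actions on nested sets comparable.\<close>

lemma acts_unique:
  assumes "open U"
  shows "acts \<tau> U u v \<Longrightarrow> acts \<tau> U u' v' \<Longrightarrow> (\<And>\<phi>. \<phi> \<in> test_functions U \<Longrightarrow> u \<phi> = u' \<phi>) \<Longrightarrow>
    \<phi> \<in> test_functions U \<Longrightarrow> v \<phi> = v' \<phi>"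
proof (induction \<tau> arbitrary: u v u' v' \<phi>)
  case (Coeff c)
  \<comment> \<open>The two readings of a product agree: a smooth \<open>c\<close> can be absorbed
    into the test function under the integral.\<close>
  have smooth_regular: "v \<phi> = v' \<phi>"
    if s: "smooth_on U c" "\<forall>\<phi>\<in>test_functions U. v \<phi> = u (\<lambda>x. c x * \<phi> x)"
      and r: "\<forall>\<phi>\<in>test_functions U. u' \<phi> = regular_distribution f \<phi> \<and>
           v' \<phi> = regular_distribution (\<lambda>x. c x * f x) \<phi>"
      and u: "\<And>\<phi>. \<phi> \<in> test_functions U \<Longrightarrow> u \<phi> = u' \<phi>" for u v u' v' f
  proof -
    have "(\<lambda>x. c x * \<phi> x) \<in> test_functions U"
      by (rule smooth_mult_test_function[OF assms s(1) Coeff.prems(4)])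
    then have "v \<phi> = regular_distribution f (\<lambda>x. c x * \<phi> x)" using s(2) r u Coeff.prems(4) by auto
    also have "\<dots> = v' \<phi>" using r Coeff.prems(4) by (auto simp: regular_distribution_def mult_ac)
    finally show ?thesis .
  qed
  consider (ss) "smooth_on U c" "\<forall>\<phi>\<in>test_functions U. v \<phi> = u (\<lambda>x. c x * \<phi> x)"
      "\<forall>\<phi>\<in>test_functions U. v' \<phi> = u' (\<lambda>x. c x * \<phi> x)"
    | (sr) f where "smooth_on U c" "\<forall>\<phi>\<in>test_functions U. v \<phi> = u (\<lambda>x. c x * \<phi> x)"
      "\<forall>\<phi>\<in>test_functions U. u' \<phi> = regular_distribution f \<phi> \<and> v' \<phi> = regular_distribution (\<lambda>x. c x * f x) \<phi>"
    | (rs) f where "smooth_on U c" "\<forall>\<phi>\<in>test_functions U. v' \<phi> = u' (\<lambda>x. c x * \<phi> x)"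
      "\<forall>\<phi>\<in>test_functions U. u \<phi> = regular_distribution f \<phi> \<and> v \<phi> = regular_distribution (\<lambda>x. c x * f x) \<phi>"
    | (rr) f f' where "locally_integrable U f" "locally_integrable U f'"
      "\<forall>\<phi>\<in>test_functions U. u \<phi> = regular_distribution f \<phi> \<and> v \<phi> = regular_distribution (\<lambda>x. c x * f x) \<phi>"
      "\<forall>\<phi>\<in>test_functions U. u' \<phi> = regular_distribution f' \<phi> \<and> v' \<phi> = regular_distribution (\<lambda>x. c x * f' x) \<phi>"
      "locally_integrable U (\<lambda>x. c x * f x)" "locally_integrable U (\<lambda>x. c x * f' x)"
    using Coeff.prems(1,2) unfolding acts.simps by blast
  then show ?case
  proof cases
    case ss
    then show ?thesis
      using smooth_mult_test_function[OF assms ss(1) Coeff.prems(4)] Coeff.prems(3,4) by auto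
  next
    case sr
    then show ?thesis using smooth_regular[of v u u' f v'] Coeff.prems(3) by auto
  next
    case rs
    then show ?thesis using smooth_regular[of v' u' u f v] Coeff.prems(3) by auto
  next
    case rr
    \<comment> \<open>Representing functions of the same distribution agree almost everywhere on
      \<open>U\<close>, hence so do their products with \<open>c\<close>.\<close>
    have "AE x in lebesgue. x \<in> U \<longrightarrow> f x = f' x"
      using rr Coeff.prems(3) by (intro regular_distribution_unique assms) auto
    moreover obtain K where K: "K \<subseteq> U" "\<And>x. x \<notin> K \<Longrightarrow> \<phi> x = 0"
      using test_function_support[OF Coeff.prems(4)] by blast
    ultimately have ae: "AE x in lebesgue. c x * f x * \<phi> x = c x * f' x * \<phi> x"
      by (auto elim!: eventually_mono)
    have "integral\<^sup>L lebesgue (\<lambda>x. c x * f x * \<phi> x) = integral\<^sup>L lebesgue (\<lambda>x. c x * f' x * \<phi> x)"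
      using rr(5,6) Coeff.prems(4) ae
      by (intro integral_cong_AE) (auto intro: borel_measurable_integrable integrable_mult_test_function)
    then show ?thesis using rr(3,4) Coeff.prems(4) by (simp add: regular_distribution_def)
  qed
next
  case (Partial i)
  then show ?case using partial_test_function[OF Partial.prems(4), of i] by simp
next
  case (Sum \<sigma> \<tau>)
  obtain v1 v2 where v: "acts \<sigma> U u v1" "acts \<tau> U u v2" "v \<phi> = v1 \<phi> + v2 \<phi>"
    using Sum.prems(1,4) by auto
  obtain v1' v2' where v': "acts \<sigma> U u' v1'" "acts \<tau> U u' v2'" "v' \<phi> = v1' \<phi> + v2' \<phi>"
    using Sum.prems(2,4) by auto
  show ?case
    using Sum.IH(1)[OF v(1) v'(1) Sum.prems(3,4)] Sum.IH(2)[OF v(2) v'(2) Sum.prems(3,4)] v(3) v'(3) by simp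
next
  case (Comp \<sigma> \<tau>)
  obtain w where w: "acts \<tau> U u w" "acts \<sigma> U w v" using Comp.prems(1) by auto
  obtain w' where w': "acts \<tau> U u' w'" "acts \<sigma> U w' v'" using Comp.prems(2) by auto
  show ?case
    using Comp.IH(1)[OF w(2) w'(2) Comp.IH(2)[OF w(1) w'(1) Comp.prems(3)] Comp.prems(4)] .
qed

lemma locally_integrable_rep:
  fixes f :: "'d::finite l2"
  shows "locally_integrable U (rep_l2 f)"
  unfolding locally_integrable_def set_integrable_def
proof (intro allI impI)
  fix K :: "(real^'d) set" assume K: "compact K \<and> K \<subseteq> U"
  have [measurable]: "K \<in> sets lebesgue" using K by (intro fmeasurableD lmeasurable_compact) auto
  have "integrable lebesgue (indicat_real K)"
    using K by (simp add: lmeasurable_compact flip: lmeasurable_iff_integrable)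
  then have "integrable lebesgue (\<lambda>x. indicat_real K x + (cmod (rep_l2 f x))\<^sup>2)"
    using square_integrable_rep[of f] by (auto simp: square_integrable_def)
  then show "integrable lebesgue (\<lambda>x. indicat_real K x *\<^sub>R rep_l2 f x)"
  proof (rule Bochner_Integration.integrable_bound)
    have "a \<le> 1 + a\<^sup>2" for a :: real
      using zero_le_power2[of "a - 1/2"] by (simp add: power2_eq_square algebra_simps)
    then show "AE x in lebesgue. norm (indicat_real K x *\<^sub>R rep_l2 f x)
        \<le> norm (indicat_real K x + (cmod (rep_l2 f x))\<^sup>2)"
      by (auto simp: indicator_def)
  qed auto
qed

text \<open>Locality: test functions supported in \<open>U\<close> do not see the values of
  \<open>f\<close> off \<open>U\<close>, so \<open>acts_unique\<close> makes both images agree on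
  \<open>U\<close>.\<close>

lemma given_by_restrict:
  fixes S S' :: "'d::finite operator"
  assumes "given_by \<tau> \<Omega> S" "given_by \<tau> U S'" "open U" "U \<subseteq> \<Omega>"
    and "(f, g) \<in> S" "(restrict_l2 U f, g') \<in> S'" "g' \<in> L2_on U"
  shows "g' = restrict_l2 U g"
proof -
  have U: "U \<in> sets lebesgue" using assms(3) by (simp add: borel_open)
  have 1: "acts \<tau> U (regular_distribution (rep_l2 f)) (regular_distribution (rep_l2 g))"
    using assms(1,5) acts_mono[OF assms(4)] by (auto simp: given_by_def)
  have 2: "acts \<tau> U (regular_distribution (rep_l2 (restrict_l2 U f))) (regular_distribution (rep_l2 g'))"
    using assms(2,6) by (auto simp: given_by_def)
  have "regular_distribution (rep_l2 f) \<phi> = regular_distribution (rep_l2 (restrict_l2 U f)) \<phi>"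
    if \<phi>: "\<phi> \<in> test_functions U" for \<phi>
  proof -
    obtain K where K: "smooth_on UNIV \<phi>" "K \<subseteq> U" "\<And>x. x \<notin> K \<Longrightarrow> \<phi> x = 0"
      using test_function_support[OF \<phi>] by blast
    have [measurable]: "\<phi> \<in> borel_measurable lebesgue" using K(1) by (rule smooth_on_measurable)
    show ?thesis
      unfolding regular_distribution_def
    proof (rule integral_cong_AE)
      show "AE x in lebesgue. rep_l2 f x * \<phi> x = rep_l2 (restrict_l2 U f) x * \<phi> x"
        using rep_restrict_AE[OF U, of f] by eventually_elim (use K in \<open>auto simp: indicator_def\<close>)
    qed auto
  qed
  then have "regular_distribution (rep_l2 g) \<phi> = regular_distribution (rep_l2 g') \<phi>"
    if "\<phi> \<in> test_functions U" for \<phi>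
    using acts_unique[OF assms(3) 1 2 _ that] by blast
  then have "AE x in lebesgue. x \<in> U \<longrightarrow> rep_l2 g x = rep_l2 g' x"
    by (intro regular_distribution_unique assms(3) locally_integrable_rep)
  moreover have "AE x in lebesgue. x \<notin> U \<longrightarrow> rep_l2 g' x = 0" using assms(7) by (simp add: L2_on_def)
  ultimately show ?thesis
    using rep_restrict_AE[OF U, of g]
    by (intro l2_eqI) (auto elim!: eventually_elim2 simp: indicator_def)
qed

section \<open>Completion of closable forms\<close>

lemma Cauchy_sqrt_iff:
  fixes f :: "nat \<Rightarrow> nat \<Rightarrow> real"
  shows "(\<forall>e>0. \<exists>N. \<forall>m\<ge>N. \<forall>n\<ge>N. sqrt (f m n) < e) \<longleftrightarrow> (\<forall>e>0. \<exists>N. \<forall>m\<ge>N. \<forall>n\<ge>N. f m n < e)"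
proof
  assume L: "\<forall>e>0. \<exists>N. \<forall>m\<ge>N. \<forall>n\<ge>N. sqrt (f m n) < e"
  show "\<forall>e>0. \<exists>N. \<forall>m\<ge>N. \<forall>n\<ge>N. f m n < e"
  proof (intro allI impI)
    fix e :: real assume "e > 0"
    then obtain N where "\<forall>m\<ge>N. \<forall>n\<ge>N. sqrt (f m n) < sqrt e" using L by (meson real_sqrt_gt_zero)
    then show "\<exists>N. \<forall>m\<ge>N. \<forall>n\<ge>N. f m n < e" by auto
  qed
next
  assume R: "\<forall>e>0. \<exists>N. \<forall>m\<ge>N. \<forall>n\<ge>N. f m n < e"
  show "\<forall>e>0. \<exists>N. \<forall>m\<ge>N. \<forall>n\<ge>N. sqrt (f m n) < e"
  proof (intro allI impI)
    fix e :: real assume e: "e > 0"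
    then obtain N where N: "\<forall>m\<ge>N. \<forall>n\<ge>N. f m n < e\<^sup>2" using R by (meson zero_less_power)
    have "sqrt (f m n) < e" if "m \<ge> N" "n \<ge> N" for m n
      using N that e by (intro real_less_lsqrt) auto
    then show "\<exists>N. \<forall>m\<ge>N. \<forall>n\<ge>N. sqrt (f m n) < e" by blast
  qed
qed

text \<open>In the application \<open>r\<close> is the real part of a rotated form, shifted so as to
  dominate the squared norm. It need not be symmetric: \<open>nrm\<close> sees only the symmetric
  part, whereas Lax--Milgram concerns \<open>r\<close> itself. Closability is what embeds the
  completion into \<open>L\<^sup>2\<close>, as the set \<open>V\<close>.\<close>

locale closable_real_form =
  fixes D :: "'d::finite l2 set" and r :: "'d l2 \<Rightarrow> 'd l2 \<Rightarrow> real" and K :: real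
  assumes subspace_D: "subspace D"
    and r_add_left: "x \<in> D \<Longrightarrow> y \<in> D \<Longrightarrow> z \<in> D \<Longrightarrow> r (x + y) z = r x z + r y z"
    and r_scale_left: "x \<in> D \<Longrightarrow> y \<in> D \<Longrightarrow> r (c *\<^sub>R x) y = c * r x y"
    and r_add_right: "x \<in> D \<Longrightarrow> y \<in> D \<Longrightarrow> z \<in> D \<Longrightarrow> r x (y + z) = r x y + r x z"
    and r_scale_right: "x \<in> D \<Longrightarrow> y \<in> D \<Longrightarrow> r x (c *\<^sub>R y) = c * r x y"
    and r_ge: "x \<in> D \<Longrightarrow> (norm x)\<^sup>2 \<le> r x x"
    and r_bounded: "x \<in> D \<Longrightarrow> y \<in> D \<Longrightarrow> \<bar>r x y\<bar> \<le> K * sqrt (r x x) * sqrt (r y y)"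
    and closable: "(\<And>n. X n \<in> D) \<Longrightarrow> X \<longlonglongrightarrow> 0 \<Longrightarrow>
      (\<And>e. 0 < e \<Longrightarrow> \<exists>N. \<forall>m\<ge>N. \<forall>n\<ge>N. r (X m - X n) (X m - X n) < e) \<Longrightarrow>
      (\<lambda>n. r (X n) (X n)) \<longlonglongrightarrow> 0"
begin

definition nrm :: "'d l2 \<Rightarrow> real" where
  "nrm x = sqrt (r x x)"

definition conv :: "(nat \<Rightarrow> 'd l2) \<Rightarrow> 'd l2 \<Rightarrow> bool" where
  "conv X f \<longleftrightarrow> (\<forall>n. X n \<in> D) \<and> X \<longlonglongrightarrow> f \<and> (\<forall>e>0. \<exists>N. \<forall>m\<ge>N. \<forall>n\<ge>N. nrm (X m - X n) < e)"

definition V :: "'d l2 set" where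
  "V = {f. \<exists>X. conv X f}"

text \<open>Independent of the chosen sequences by closability, see \<open>r_lim\<close>.\<close>

definition rr :: "'d l2 \<Rightarrow> 'd l2 \<Rightarrow> real" where
  "rr f g = lim (\<lambda>n. r ((SOME X. conv X f) n) ((SOME X. conv X g) n))"

definition qq :: "'d l2 \<Rightarrow> 'd l2 \<Rightarrow> real" where
  "qq f g = (rr f g + rr g f) / 2"

lemmas D_add = subspace_add[OF subspace_D]
lemmas D_scale = subspace_scale[OF subspace_D]
lemmas D_diff = subspace_diff[OF subspace_D]
lemmas D_zero = subspace_0[OF subspace_D]

lemma r_nonneg: "x \<in> D \<Longrightarrow> 0 \<le> r x x"
  using r_ge[of x] zero_le_power2[of "norm x"] by linarith

sublocale D: real_preinner D "\<lambda>x y. (r x y + r y x) / 2"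
  by standard (auto simp: subspace_D r_add_left r_add_right r_scale_left r_scale_right r_nonneg field_simps)

lemma nrm_zero: "nrm 0 = 0"
  using r_scale_left[OF D_zero D_zero, of 0] by (simp add: nrm_def)

lemma nrm_nonneg: "x \<in> D \<Longrightarrow> 0 \<le> nrm x"
  by (simp add: nrm_def r_nonneg)

lemma nrm_scale: "x \<in> D \<Longrightarrow> nrm (c *\<^sub>R x) = \<bar>c\<bar> * nrm x"
  by (simp add: nrm_def r_scale_left r_scale_right D_scale real_sqrt_mult)

lemma nrm_minus: "x \<in> D \<Longrightarrow> nrm (- x) = nrm x"
  using nrm_scale[of x "-1"] by simp

lemma nrm_minus_commute: "x \<in> D \<Longrightarrow> y \<in> D \<Longrightarrow> nrm (x - y) = nrm (y - x)"
  using nrm_minus[of "x - y"] by (simp add: D_diff)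

lemma nrm_triangle: "x \<in> D \<Longrightarrow> y \<in> D \<Longrightarrow> nrm (x + y) \<le> nrm x + nrm y"
  using D.triangle[of x y] by (simp add: nrm_def)

lemma D_neg: "x \<in> D \<Longrightarrow> - x \<in> D"
  using D_scale[of x "-1"] by simp

lemma norm_le_nrm: "x \<in> D \<Longrightarrow> norm x \<le> nrm x"
  unfolding nrm_def by (intro real_le_rsqrt r_ge)

lemma r_self: "x \<in> D \<Longrightarrow> r x x = (nrm x)\<^sup>2"
  by (simp add: nrm_def r_nonneg)

lemma r_nrm: "x \<in> D \<Longrightarrow> y \<in> D \<Longrightarrow> \<bar>r x y\<bar> \<le> K * nrm x * nrm y"
  using r_bounded by (simp add: nrm_def)

lemma r_diff_left: "x \<in> D \<Longrightarrow> y \<in> D \<Longrightarrow> z \<in> D \<Longrightarrow> r (x - y) z = r x z - r y z"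
  using r_add_left[of x "- y" z] r_scale_left[of y z "-1"] by (simp add: D_neg)

lemma r_diff_right: "x \<in> D \<Longrightarrow> y \<in> D \<Longrightarrow> z \<in> D \<Longrightarrow> r x (y - z) = r x y - r x z"
  using r_add_right[of x y "- z"] r_scale_right[of x z "-1"] by (simp add: D_neg)

lemma convD:
  assumes "conv X f"
  shows "X n \<in> D" "X \<longlonglongrightarrow> f" "0 < e \<Longrightarrow> \<exists>N. \<forall>m\<ge>N. \<forall>n\<ge>N. nrm (X m - X n) < e"
  using assms by (auto simp: conv_def)

lemma conv_const: "x \<in> D \<Longrightarrow> conv (\<lambda>n. x) x"
  by (auto simp: conv_def nrm_zero)

lemma conv_add:
  assumes "conv X f" "conv Y g"
  shows "conv (\<lambda>n. X n + Y n) (f + g)"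
  unfolding conv_def
proof (intro conjI allI impI)
  show "X n + Y n \<in> D" for n using assms convD(1) D_add by blast
  show "(\<lambda>n. X n + Y n) \<longlonglongrightarrow> f + g" by (intro tendsto_add convD(2) assms)
  fix e :: real assume "0 < e"
  then obtain M N where M: "\<forall>m\<ge>M. \<forall>n\<ge>M. nrm (X m - X n) < e / 2" and N: "\<forall>m\<ge>N. \<forall>n\<ge>N. nrm (Y m - Y n) < e / 2"
    using convD(3)[OF assms(1), of "e / 2"] convD(3)[OF assms(2), of "e / 2"] by auto
  have "nrm (X m + Y m - (X n + Y n)) < e" if "m \<ge> max M N" "n \<ge> max M N" for m n
  proof -
    have "nrm ((X m - X n) + (Y m - Y n)) \<le> nrm (X m - X n) + nrm (Y m - Y n)"
      using assms convD(1) by (intro nrm_triangle D_diff) blast+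
    also have "\<dots> < e / 2 + e / 2" using M N that by (intro add_strict_mono) auto
    finally show ?thesis by (simp add: algebra_simps)
  qed
  then show "\<exists>N. \<forall>m\<ge>N. \<forall>n\<ge>N. nrm (X m + Y m - (X n + Y n)) < e" by blast
qed

lemma conv_scale:
  assumes "conv X f"
  shows "conv (\<lambda>n. c *\<^sub>R X n) (c *\<^sub>R f)"
  unfolding conv_def
proof (intro conjI allI impI)
  show "c *\<^sub>R X n \<in> D" for n using assms convD(1) D_scale by blast
  show "(\<lambda>n. c *\<^sub>R X n) \<longlonglongrightarrow> c *\<^sub>R f" by (intro tendsto_intros convD(2) assms)
  fix e :: real assume e: "0 < e"
  then obtain N where N: "\<forall>m\<ge>N. \<forall>n\<ge>N. nrm (X m - X n) < e / (\<bar>c\<bar> + 1)"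
    using convD(3)[OF assms, of "e / (\<bar>c\<bar> + 1)"] by auto
  have "nrm (c *\<^sub>R X m - c *\<^sub>R X n) < e" if "m \<ge> N" "n \<ge> N" for m n
  proof -
    have d: "X m - X n \<in> D" using assms convD(1) D_diff by blast
    have "nrm (c *\<^sub>R X m - c *\<^sub>R X n) = \<bar>c\<bar> * nrm (X m - X n)"
      using nrm_scale[OF d, of c] by (simp add: scaleR_right_diff_distrib)
    also have "\<dots> \<le> (\<bar>c\<bar> + 1) * nrm (X m - X n)"
      using nrm_nonneg[OF d] by (intro mult_right_mono) auto
    also have "\<dots> < e" using N that by (auto simp: field_simps)
    finally show ?thesis .
  qed
  then show "\<exists>N. \<forall>m\<ge>N. \<forall>n\<ge>N. nrm (c *\<^sub>R X m - c *\<^sub>R X n) < e" by blast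
qed

lemma conv_diff: "conv X f \<Longrightarrow> conv Y g \<Longrightarrow> conv (\<lambda>n. X n - Y n) (f - g)"
  using conv_add[of X f "\<lambda>n. (-1) *\<^sub>R Y n" "(-1) *\<^sub>R g"] conv_scale[of Y g "-1"] by simp

lemma conv_zero_nrm:
  assumes "conv X 0"
  shows "(\<lambda>n. nrm (X n)) \<longlonglongrightarrow> 0"
proof -
  have "\<forall>e>0. \<exists>N. \<forall>m\<ge>N. \<forall>n\<ge>N. r (X m - X n) (X m - X n) < e"
    using convD(3)[OF assms] Cauchy_sqrt_iff[of "\<lambda>m n. r (X m - X n) (X m - X n)"]
    unfolding nrm_def by blast
  then have "(\<lambda>n. r (X n) (X n)) \<longlonglongrightarrow> 0"
    by (intro closable convD(1,2)[OF assms]) auto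
  then have "(\<lambda>n. sqrt (r (X n) (X n))) \<longlonglongrightarrow> sqrt 0" by (rule tendsto_real_sqrt)
  then show ?thesis by (simp add: nrm_def)
qed

lemma conv_bounded:
  assumes "conv X f"
  shows "\<exists>B. \<forall>n. nrm (X n) \<le> B"
proof -
  have XD: "X n \<in> D" for n using convD(1)[OF assms] .
  have "\<bar>nrm (X m) - nrm (X n)\<bar> \<le> nrm (X m - X n)" for m n
    using nrm_triangle[of "X m - X n" "X n"] nrm_triangle[of "X n - X m" "X m"]
      nrm_minus_commute[of "X m" "X n"] XD by (simp add: D_diff)
  then have "Cauchy (\<lambda>n. nrm (X n))"
    unfolding Cauchy_def dist_real_def using convD(3)[OF assms] by (meson le_less_trans)
  then have "Bseq (\<lambda>n. nrm (X n))" by (rule Cauchy_Bseq)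
  then show ?thesis unfolding Bseq_def by (metis abs_le_D1 real_norm_def)
qed

lemma r_null:
  assumes "\<And>n. Z n \<in> D" "\<And>n. W n \<in> D" "(\<lambda>n. nrm (Z n)) \<longlonglongrightarrow> 0" "\<And>n. nrm (W n) \<le> B"
  shows "(\<lambda>n. r (Z n) (W n)) \<longlonglongrightarrow> 0" "(\<lambda>n. r (W n) (Z n)) \<longlonglongrightarrow> 0"
proof -
  have bound: "\<bar>K\<bar> * nrm (Z n) * nrm (W n) \<le> \<bar>K\<bar> * B * nrm (Z n)" for n
    using mult_left_mono[OF assms(4)[of n], of "\<bar>K\<bar> * nrm (Z n)"] nrm_nonneg[OF assms(1)[of n]]
    by (simp add: mult_ac)
  have 1: "\<bar>r (Z n) (W n)\<bar> \<le> \<bar>K\<bar> * B * nrm (Z n)" for n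
  proof -
    have "K * (nrm (Z n) * nrm (W n)) \<le> \<bar>K\<bar> * (nrm (Z n) * nrm (W n))"
      using nrm_nonneg assms(1,2) by (intro mult_right_mono) auto
    then show ?thesis using r_nrm[OF assms(1)[of n] assms(2)[of n]] bound[of n] by (simp add: mult.assoc)
  qed
  have 2: "\<bar>r (W n) (Z n)\<bar> \<le> \<bar>K\<bar> * B * nrm (Z n)" for n
  proof -
    have "K * (nrm (Z n) * nrm (W n)) \<le> \<bar>K\<bar> * (nrm (Z n) * nrm (W n))"
      using nrm_nonneg assms(1,2) by (intro mult_right_mono) auto
    then show ?thesis using r_nrm[OF assms(2)[of n] assms(1)[of n]] bound[of n] by (simp add: mult_ac)
  qed
  have lim: "(\<lambda>n. \<bar>K\<bar> * B * nrm (Z n)) \<longlonglongrightarrow> 0"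
    using tendsto_mult[OF tendsto_const[of "\<bar>K\<bar> * B"] assms(3)] by simp
  show "(\<lambda>n. r (Z n) (W n)) \<longlonglongrightarrow> 0"
    by (rule Lim_null_comparison[OF _ lim]) (use 1 in auto)
  show "(\<lambda>n. r (W n) (Z n)) \<longlonglongrightarrow> 0"
    by (rule Lim_null_comparison[OF _ lim]) (use 2 in auto)
qed

lemma r_Cauchy:
  assumes X: "conv X f" and Y: "conv Y g"
  shows "Cauchy (\<lambda>n. r (X n) (Y n))"
proof (rule CauchyI)
  fix e :: real assume e: "0 < e"
  obtain A B where A: "\<And>n. nrm (X n) \<le> A" and B: "\<And>n. nrm (Y n) \<le> B"
    using conv_bounded[OF X] conv_bounded[OF Y] by blast
  note XD = convD(1)[OF X] and YD = convD(1)[OF Y]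
  have AB: "0 \<le> A" "0 \<le> B" using A[of 0] B[of 0] nrm_nonneg[OF XD[of 0]] nrm_nonneg[OF YD[of 0]] by linarith+
  define C where "C = \<bar>K\<bar> * (A + B) + 1"
  have C: "0 < C" using AB by (auto simp: C_def intro: add_nonneg_pos)
  obtain M N where M: "\<forall>m\<ge>M. \<forall>n\<ge>M. nrm (X m - X n) < e / C" and N: "\<forall>m\<ge>N. \<forall>n\<ge>N. nrm (Y m - Y n) < e / C"
    using convD(3)[OF X, of "e / C"] convD(3)[OF Y, of "e / C"] e C by auto
  have "norm (r (X m) (Y m) - r (X n) (Y n)) < e" if mn: "m \<ge> max M N" "n \<ge> max M N" for m n
  proof -
    have le: "\<bar>r x y\<bar> \<le> \<bar>K\<bar> * (s * t)" if "x \<in> D" "y \<in> D" "nrm x \<le> s" "nrm y \<le> t" for x y s t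
    proof -
      have "\<bar>r x y\<bar> \<le> \<bar>K\<bar> * (nrm x * nrm y)"
      proof -
        have "K * (nrm x * nrm y) \<le> \<bar>K\<bar> * (nrm x * nrm y)"
          using nrm_nonneg[OF that(1)] nrm_nonneg[OF that(2)] by (intro mult_right_mono) auto
        then show ?thesis using r_nrm[OF that(1,2)] by (simp add: mult.assoc)
      qed
      also have "\<dots> \<le> \<bar>K\<bar> * (s * t)"
        using that nrm_nonneg[OF that(1)] nrm_nonneg[OF that(2)] by (intro mult_left_mono mult_mono) auto
      finally show ?thesis .
    qed
    have "r (X m) (Y m) - r (X n) (Y n) = r (X m - X n) (Y m) + r (X n) (Y m - Y n)"
      using XD YD by (simp add: r_diff_left r_diff_right)
    then have "\<bar>r (X m) (Y m) - r (X n) (Y n)\<bar> \<le> \<bar>r (X m - X n) (Y m)\<bar> + \<bar>r (X n) (Y m - Y n)\<bar>"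
      by simp
    also have "\<dots> \<le> \<bar>K\<bar> * (e / C * B) + \<bar>K\<bar> * (A * (e / C))"
    proof (rule add_mono)
      show "\<bar>r (X m - X n) (Y m)\<bar> \<le> \<bar>K\<bar> * (e / C * B)"
        by (rule le[OF D_diff[OF XD XD] YD _ B]) (use M mn in \<open>auto intro: less_imp_le\<close>)
      show "\<bar>r (X n) (Y m - Y n)\<bar> \<le> \<bar>K\<bar> * (A * (e / C))"
        by (rule le[OF XD D_diff[OF YD YD] A]) (use N mn in \<open>auto intro: less_imp_le\<close>)
    qed
    also have "\<dots> = (\<bar>K\<bar> * (A + B)) * (e / C)" by (simp add: algebra_simps)
    also have "\<dots> < C * (e / C)" using e C by (intro mult_strict_right_mono) (auto simp: C_def)
    also have "\<dots> = e" using C by simp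
    finally show ?thesis by simp
  qed
  then show "\<exists>M. \<forall>m\<ge>M. \<forall>n\<ge>M. norm (r (X m) (Y m) - r (X n) (Y n)) < e" by blast
qed

text \<open>Two sequences for the same vector differ by a form-Cauchy sequence with limit
  \<open>0\<close>, which closability makes null in \<open>nrm\<close>; the other factor stays
  bounded.\<close>

lemma r_lim:
  assumes X: "conv X f" and Y: "conv Y g"
  shows "(\<lambda>n. r (X n) (Y n)) \<longlonglongrightarrow> rr f g"
proof -
  define X' Y' where "X' = (SOME X. conv X f)" and "Y' = (SOME Y. conv Y g)"
  have X': "conv X' f" unfolding X'_def using someI[of "\<lambda>X. conv X f", OF X] .
  have Y': "conv Y' g" unfolding Y'_def using someI[of "\<lambda>Y. conv Y g", OF Y] .
  note D = convD(1)[OF X] convD(1)[OF Y] convD(1)[OF X'] convD(1)[OF Y']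
  obtain A B where A: "\<And>n. nrm (X' n) \<le> A" and B: "\<And>n. nrm (Y n) \<le> B"
    using conv_bounded[OF X'] conv_bounded[OF Y] by blast
  have "(\<lambda>n. r (X' n) (Y' n)) \<longlonglongrightarrow> rr f g"
    using r_Cauchy[OF X' Y'] by (simp add: rr_def X'_def Y'_def convergent_LIMSEQ_iff Cauchy_convergent_iff)
  moreover have "(\<lambda>n. r (X n - X' n) (Y n)) \<longlonglongrightarrow> 0"
    using conv_zero_nrm[of "\<lambda>n. X n - X' n"] conv_diff[OF X X'] B D by (intro r_null) (auto intro: D_diff)
  moreover have "(\<lambda>n. r (X' n) (Y n - Y' n)) \<longlonglongrightarrow> 0"
    using conv_zero_nrm[of "\<lambda>n. Y n - Y' n"] conv_diff[OF Y Y'] A D by (intro r_null) (auto intro: D_diff)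
  ultimately have "(\<lambda>n. r (X n - X' n) (Y n) + (r (X' n) (Y n - Y' n) + r (X' n) (Y' n))) \<longlonglongrightarrow> 0 + (0 + rr f g)"
    by (intro tendsto_add)
  then show ?thesis using D by (simp add: r_diff_left r_diff_right)
qed

lemma rr_eqI: "conv X f \<Longrightarrow> conv Y g \<Longrightarrow> (\<lambda>n. r (X n) (Y n)) \<longlonglongrightarrow> l \<Longrightarrow> rr f g = l"
  using r_lim LIMSEQ_unique by blast

lemma subspace_V: "subspace V"
  unfolding subspace_def V_def using conv_const[OF D_zero] conv_add conv_scale by blast

lemmas V_add = subspace_add[OF subspace_V]
lemmas V_scale = subspace_scale[OF subspace_V]
lemmas V_diff = subspace_diff[OF subspace_V]
lemmas V_zero = subspace_0[OF subspace_V]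

lemma D_subset_V: "x \<in> D \<Longrightarrow> x \<in> V"
  unfolding V_def using conv_const by blast

lemma rr_D: "x \<in> D \<Longrightarrow> y \<in> D \<Longrightarrow> rr x y = r x y"
  using rr_eqI[OF conv_const conv_const] by blast

lemma rr_add_left: "f \<in> V \<Longrightarrow> g \<in> V \<Longrightarrow> h \<in> V \<Longrightarrow> rr (f + g) h = rr f h + rr g h"
proof -
  assume "f \<in> V" "g \<in> V" "h \<in> V"
  then obtain X Y Z where c: "conv X f" "conv Y g" "conv Z h" by (auto simp: V_def)
  note D = convD(1)[OF c(1)] convD(1)[OF c(2)] convD(1)[OF c(3)]
  show ?thesis
    using tendsto_add[OF r_lim[OF c(1,3)] r_lim[OF c(2,3)]] D
    by (intro rr_eqI[OF conv_add[OF c(1,2)] c(3)]) (simp add: r_add_left)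
qed

lemma rr_add_right: "f \<in> V \<Longrightarrow> g \<in> V \<Longrightarrow> h \<in> V \<Longrightarrow> rr f (g + h) = rr f g + rr f h"
proof -
  assume "f \<in> V" "g \<in> V" "h \<in> V"
  then obtain X Y Z where c: "conv X f" "conv Y g" "conv Z h" by (auto simp: V_def)
  note D = convD(1)[OF c(1)] convD(1)[OF c(2)] convD(1)[OF c(3)]
  show ?thesis
    using tendsto_add[OF r_lim[OF c(1,2)] r_lim[OF c(1,3)]] D
    by (intro rr_eqI[OF c(1) conv_add[OF c(2,3)]]) (simp add: r_add_right)
qed

lemma rr_scale_left: "f \<in> V \<Longrightarrow> g \<in> V \<Longrightarrow> rr (c *\<^sub>R f) g = c * rr f g"
proof -
  assume "f \<in> V" "g \<in> V"
  then obtain X Y where c: "conv X f" "conv Y g" by (auto simp: V_def)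
  note D = convD(1)[OF c(1)] convD(1)[OF c(2)]
  show ?thesis
    using tendsto_mult[OF tendsto_const r_lim[OF c]] D
    by (intro rr_eqI[OF conv_scale[OF c(1)] c(2)]) (simp add: r_scale_left)
qed

lemma rr_scale_right: "f \<in> V \<Longrightarrow> g \<in> V \<Longrightarrow> rr f (c *\<^sub>R g) = c * rr f g"
proof -
  assume "f \<in> V" "g \<in> V"
  then obtain X Y where c: "conv X f" "conv Y g" by (auto simp: V_def)
  note D = convD(1)[OF c(1)] convD(1)[OF c(2)]
  show ?thesis
    using tendsto_mult[OF tendsto_const r_lim[OF c]] D
    by (intro rr_eqI[OF c(1) conv_scale[OF c(2)]]) (simp add: r_scale_right)
qed

lemma rr_ge: "f \<in> V \<Longrightarrow> (norm f)\<^sup>2 \<le> rr f f"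
proof -
  assume "f \<in> V"
  then obtain X where c: "conv X f" by (auto simp: V_def)
  have "(\<lambda>n. (norm (X n))\<^sup>2) \<longlonglongrightarrow> (norm f)\<^sup>2" by (intro tendsto_intros convD(2)[OF c])
  then show ?thesis
    by (rule LIMSEQ_le[OF _ r_lim[OF c c]]) (use r_ge convD(1)[OF c] in auto)
qed

definition Nrm :: "'d l2 \<Rightarrow> real" where
  "Nrm f = sqrt (qq f f)"

lemma qq_self: "qq f f = rr f f"
  by (simp add: qq_def)

lemma Nrm_D: "x \<in> D \<Longrightarrow> Nrm x = nrm x"
  by (simp add: Nrm_def qq_self nrm_def rr_D)

lemma rr_nonneg: "f \<in> V \<Longrightarrow> 0 \<le> rr f f"
  using rr_ge[of f] zero_le_power2[of "norm f"] by linarith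

lemma rr_bounded: "f \<in> V \<Longrightarrow> g \<in> V \<Longrightarrow> \<bar>rr f g\<bar> \<le> K * Nrm f * Nrm g"
proof -
  assume "f \<in> V" "g \<in> V"
  then obtain X Y where c: "conv X f" "conv Y g" by (auto simp: V_def)
  have "(\<lambda>n. K * sqrt (r (X n) (X n)) * sqrt (r (Y n) (Y n))) \<longlonglongrightarrow> K * sqrt (rr f f) * sqrt (rr g g)"
    by (intro tendsto_intros r_lim c)
  from LIMSEQ_le[OF tendsto_rabs[OF r_lim[OF c]] this] show ?thesis
    using r_bounded convD(1)[OF c(1)] convD(1)[OF c(2)] by (auto simp: Nrm_def qq_self)
qed

text \<open>\<open>Nrm (X n - f)\<close> is the limit over \<open>m\<close> of
  \<open>nrm (X n - X m)\<close>, which the Cauchy property makes small.\<close>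

lemma conv_Nrm:
  assumes "conv X f"
  shows "(\<lambda>n. Nrm (X n - f)) \<longlonglongrightarrow> 0"
proof (rule LIMSEQ_I)
  note XD = convD(1)[OF assms]
  fix e :: real assume e: "0 < e"
  then obtain N where N: "\<forall>m\<ge>N. \<forall>n\<ge>N. nrm (X m - X n) < e / 2"
    using convD(3)[OF assms, of "e / 2"] by auto
  have "norm (Nrm (X n - f) - 0) < e" if n: "n \<ge> N" for n
  proof -
    have c: "conv (\<lambda>m. X n - X m) (X n - f)" by (intro conv_diff conv_const XD assms)
    then have V: "X n - f \<in> V" by (auto simp: V_def)
    have "(\<lambda>m. sqrt (r (X n - X m) (X n - X m))) \<longlonglongrightarrow> sqrt (rr (X n - f) (X n - f))"
      by (intro tendsto_intros r_lim c)
    then have "sqrt (rr (X n - f) (X n - f)) \<le> e / 2"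
      by (rule LIMSEQ_le_const2) (use N n in \<open>auto simp: nrm_def intro: less_imp_le\<close>)
    then show ?thesis using e rr_nonneg[OF V] by (simp add: Nrm_def qq_self)
  qed
  then show "\<exists>N. \<forall>n\<ge>N. norm (Nrm (X n - f) - 0) < e" by blast
qed

sublocale V0: real_preinner V qq
  by standard (auto simp: subspace_V qq_def rr_add_left rr_add_right rr_scale_left rr_scale_right rr_nonneg field_simps)

lemma Nrm_nonneg: "f \<in> V \<Longrightarrow> 0 \<le> Nrm f"
  by (simp add: Nrm_def V0.nonneg)

lemma Nrm_triangle: "f \<in> V \<Longrightarrow> g \<in> V \<Longrightarrow> Nrm (f + g) \<le> Nrm f + Nrm g"
  unfolding Nrm_def by (rule V0.triangle)

lemma Nrm_scale: "f \<in> V \<Longrightarrow> Nrm (c *\<^sub>R f) = \<bar>c\<bar> * Nrm f"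
  by (simp add: Nrm_def V0.scale_left V0.scale_right V_scale real_sqrt_mult)

lemma Nrm_minus_commute: "f \<in> V \<Longrightarrow> g \<in> V \<Longrightarrow> Nrm (f - g) = Nrm (g - f)"
  using Nrm_scale[of "f - g" "-1"] by (simp add: V_diff)

lemma Nrm_triangle3: "x \<in> V \<Longrightarrow> y \<in> V \<Longrightarrow> z \<in> V \<Longrightarrow> Nrm (x - z) \<le> Nrm (x - y) + Nrm (y - z)"
  using Nrm_triangle[of "x - y" "y - z"] by (simp add: V_diff)

lemma norm_le_Nrm: "f \<in> V \<Longrightarrow> norm f \<le> Nrm f"
  unfolding Nrm_def qq_self by (intro real_le_rsqrt rr_ge)

text \<open>Each \<open>X n\<close> is replaced by a vector of \<open>D\<close> at form distance
  below \<open>1 / Suc n\<close>. The new sequence is also Cauchy in \<open>L\<^sup>2\<close>, and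
  its limit there serves for \<open>X\<close> too.\<close>

lemma complete_Nrm:
  assumes XV: "\<And>n. X n \<in> V" and cauchy: "\<And>e. 0 < e \<Longrightarrow> \<exists>N. \<forall>m\<ge>N. \<forall>n\<ge>N. Nrm (X m - X n) < e"
  shows "\<exists>f\<in>V. (\<lambda>n. Nrm (X n - f)) \<longlonglongrightarrow> 0"
proof -
  have "\<exists>y\<in>D. Nrm (y - X n) < inverse (real (Suc n))" for n
  proof -
    obtain Y where Y: "conv Y (X n)" using XV[of n] by (auto simp: V_def)
    obtain k where "norm (Nrm (Y k - X n) - 0) < inverse (real (Suc n))"
      using LIMSEQ_D[OF conv_Nrm[OF Y], of "inverse (real (Suc n))"] by auto
    then show ?thesis using convD(1)[OF Y, of k] by (intro bexI[of _ "Y k"]) auto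
  qed
  then obtain y where y: "\<And>n. y n \<in> D" "\<And>n. Nrm (y n - X n) < inverse (real (Suc n))" by metis
  note yV = D_subset_V[OF y(1)]
  have inv: "(\<lambda>n. inverse (real (Suc n))) \<longlonglongrightarrow> 0" by (rule LIMSEQ_inverse_real_of_nat)
  have yc: "\<exists>N. \<forall>m\<ge>N. \<forall>n\<ge>N. nrm (y m - y n) < e" if e: "0 < e" for e
  proof -
    obtain M where M: "\<forall>m\<ge>M. \<forall>n\<ge>M. Nrm (X m - X n) < e / 3" using cauchy[of "e / 3"] e by auto
    obtain N where N: "\<forall>n\<ge>N. inverse (real (Suc n)) < e / 3"
      using LIMSEQ_D[OF inv, of "e / 3"] e by auto
    have "nrm (y m - y n) < e" if mn: "m \<ge> max M N" "n \<ge> max M N" for m n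
    proof -
      have "nrm (y m - y n) = Nrm (y m - y n)" using Nrm_D[of "y m - y n"] y(1) D_diff by simp
      also have "\<dots> \<le> Nrm (y m - X m) + (Nrm (X m - X n) + Nrm (X n - y n))"
        using Nrm_triangle3[OF yV[of m] XV[of m] yV[of n]] Nrm_triangle3[OF XV[of m] XV[of n] yV[of n]] by linarith
      also have "Nrm (X n - y n) = Nrm (y n - X n)" by (rule Nrm_minus_commute[OF XV yV])
      finally have "nrm (y m - y n) \<le> Nrm (y m - X m) + (Nrm (X m - X n) + Nrm (y n - X n))" .
      moreover have "Nrm (X m - X n) < e / 3" using M mn by simp
      moreover have "Nrm (y m - X m) < e / 3" using y(2)[of m] N mn by (metis less_trans max.boundedE)
      moreover have "Nrm (y n - X n) < e / 3" using y(2)[of n] N mn by (metis less_trans max.boundedE)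
      ultimately show ?thesis by linarith
    qed
    then show ?thesis by blast
  qed
  have "Cauchy y"
  proof (rule CauchyI)
    fix e :: real assume "0 < e"
    then obtain N where N: "\<forall>m\<ge>N. \<forall>n\<ge>N. nrm (y m - y n) < e" using yc by blast
    have "norm (y m - y n) < e" if "m \<ge> N" "n \<ge> N" for m n
      using N that norm_le_nrm[of "y m - y n"] y(1) D_diff by (meson le_less_trans)
    then show "\<exists>M. \<forall>m\<ge>M. \<forall>n\<ge>M. norm (y m - y n) < e" by blast
  qed
  then obtain f where "y \<longlonglongrightarrow> f" using Cauchy_convergent convergentD by blast
  then have c: "conv y f" using y yc by (simp add: conv_def)
  then have f: "f \<in> V" by (auto simp: V_def)
  have lim: "(\<lambda>n. inverse (real (Suc n)) + Nrm (y n - f)) \<longlonglongrightarrow> 0"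
    using tendsto_add[OF inv conv_Nrm[OF c]] by simp
  have "(\<lambda>n. Nrm (X n - f)) \<longlonglongrightarrow> 0"
  proof (rule Lim_null_comparison[OF _ lim], rule always_eventually, rule allI)
    fix n
    have "Nrm (X n - f) \<le> Nrm (X n - y n) + Nrm (y n - f)" by (rule Nrm_triangle3[OF XV yV f])
    also have "Nrm (X n - y n) = Nrm (y n - X n)" by (rule Nrm_minus_commute[OF XV yV])
    finally show "norm (Nrm (X n - f)) \<le> inverse (real (Suc n)) + Nrm (y n - f)"
      using y(2)[of n] Nrm_nonneg[OF V_diff[OF XV f]] by simp
  qed
  then show ?thesis using f by blast
qed

lemma Nrm_tendsto_imp_qq:
  assumes "\<And>n. X n - f \<in> V" "(\<lambda>n. Nrm (X n - f)) \<longlonglongrightarrow> 0"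
  shows "(\<lambda>n. qq (X n - f) (X n - f)) \<longlonglongrightarrow> 0"
proof -
  have "(\<lambda>n. (Nrm (X n - f))\<^sup>2) \<longlonglongrightarrow> 0\<^sup>2" by (intro tendsto_intros assms)
  then show ?thesis using V0.nonneg[OF assms(1)] by (simp add: Nrm_def)
qed

sublocale V: real_hilbert V qq
proof
  fix X :: "nat \<Rightarrow> 'd l2"
  assume X: "\<And>n. X n \<in> V"
    and c: "\<And>e. 0 < e \<Longrightarrow> \<exists>N. \<forall>m\<ge>N. \<forall>n\<ge>N. qq (X m - X n) (X m - X n) < e"
  then have "\<forall>e>0. \<exists>N. \<forall>m\<ge>N. \<forall>n\<ge>N. Nrm (X m - X n) < e"
    unfolding Nrm_def Cauchy_sqrt_iff by blast
  then have "\<exists>f\<in>V. (\<lambda>n. Nrm (X n - f)) \<longlonglongrightarrow> 0"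
    by (intro complete_Nrm X) auto
  then obtain f where f: "f \<in> V" "(\<lambda>n. Nrm (X n - f)) \<longlonglongrightarrow> 0" by blast
  then have "(\<lambda>n. qq (X n - f) (X n - f)) \<longlonglongrightarrow> 0"
    using X V_diff by (intro Nrm_tendsto_imp_qq) auto
  then show "\<exists>x\<in>V. (\<lambda>n. qq (X n - x) (X n - x)) \<longlonglongrightarrow> 0" using f(1) by blast
qed

text \<open>The elements representing functionals \<open>\<langle>\<cdot>,h\<rangle>\<close> are dense: for \<open>v\<close> orthogonal to all of them,
  Lax--Milgram gives \<open>v'\<close> with \<open>r(v',\<cdot>) = \<langle>v,\<cdot>\<rangle>\<close>, and testing with the element representing
  \<open>v'\<close> shows \<open>v' = 0\<close>.\<close>

lemma representing_dense_V:
  assumes x: "x \<in> V" and e: "0 < e"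
  shows "\<exists>g\<in>V. (\<exists>h. \<forall>y\<in>V. rr y g = inner y h) \<and> Nrm (x - g) < e"
proof -
  define G where "G = {g\<in>V. \<exists>h. \<forall>y\<in>V. rr y g = inner y h}"
  \<comment> \<open>The closure of \<open>G\<close> in the form norm. It is complete, so
    \<open>x\<close> can be projected onto it.\<close>
  define cl where "cl = {v\<in>V. \<forall>e>0. \<exists>g\<in>G. Nrm (v - g) < e}"
  have GV: "G \<subseteq> V" by (auto simp: G_def)
  have subG: "subspace G"
    unfolding subspace_def
  proof (intro conjI ballI allI)
    have "rr y 0 = 0" if "y \<in> V" for y using rr_scale_right[OF that V_zero, of 0] by simp
    then have "\<forall>y\<in>V. rr y 0 = inner y 0" by simp
    then show "0 \<in> G" using V_zero unfolding G_def by blast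
  next
    fix f g assume "f \<in> G" "g \<in> G"
    then obtain h k where "f \<in> V" "g \<in> V" "\<forall>y\<in>V. rr y f = inner y h" "\<forall>y\<in>V. rr y g = inner y k"
      by (auto simp: G_def)
    then have "f + g \<in> V \<and> (\<forall>y\<in>V. rr y (f + g) = inner y (h + k))"
      by (auto simp: V_add rr_add_right inner_add_right)
    then show "f + g \<in> G" unfolding G_def by blast
  next
    fix c :: real and f assume "f \<in> G"
    then obtain h where "f \<in> V" "\<forall>y\<in>V. rr y f = inner y h" by (auto simp: G_def)
    then have "c *\<^sub>R f \<in> V \<and> (\<forall>y\<in>V. rr y (c *\<^sub>R f) = inner y (c *\<^sub>R h))"
      by (auto simp: V_scale rr_scale_right)
    then show "c *\<^sub>R f \<in> G" unfolding G_def by blast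
  qed
  have G_cl: "G \<subseteq> cl"
  proof
    fix g assume g: "g \<in> G"
    have "Nrm (g - g) = 0" using Nrm_scale[OF V_zero, of 0] by simp
    then show "g \<in> cl" using g GV by (auto simp: cl_def intro!: bexI[of _ g])
  qed
  have clV: "cl \<subseteq> V" by (auto simp: cl_def)
  have subcl: "subspace cl"
    unfolding subspace_def
  proof (intro conjI ballI allI)
    show "0 \<in> cl" using subspace_0[OF subG] G_cl by blast
  next
    fix f g assume f: "f \<in> cl" and g: "g \<in> cl"
    have "\<exists>k\<in>G. Nrm (f + g - k) < e" if e: "0 < e" for e
    proof -
      obtain a b where ab: "a \<in> G" "b \<in> G" "Nrm (f - a) < e / 2" "Nrm (g - b) < e / 2"
        using f g e half_gt_zero[OF e] unfolding cl_def by blast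
      have "Nrm ((f - a) + (g - b)) \<le> Nrm (f - a) + Nrm (g - b)"
        using ab f g GV clV by (intro Nrm_triangle V_diff) auto
      then have "Nrm (f + g - (a + b)) < e" using ab by (simp add: algebra_simps)
      then show ?thesis using subspace_add[OF subG ab(1,2)] by blast
    qed
    then show "f + g \<in> cl" using f g clV V_add by (auto simp: cl_def)
  next
    fix c :: real and f assume f: "f \<in> cl"
    have "\<exists>k\<in>G. Nrm (c *\<^sub>R f - k) < e" if e: "0 < e" for e
    proof -
      have "0 < e / (\<bar>c\<bar> + 1)" using e by simp
      then obtain a where a: "a \<in> G" "Nrm (f - a) < e / (\<bar>c\<bar> + 1)"
        using f unfolding cl_def by blast
      have d: "f - a \<in> V" using a f GV clV V_diff by auto
      have "Nrm (c *\<^sub>R f - c *\<^sub>R a) = \<bar>c\<bar> * Nrm (f - a)"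
        using Nrm_scale[OF d, of c] by (simp add: scaleR_right_diff_distrib)
      also have "\<dots> \<le> (\<bar>c\<bar> + 1) * Nrm (f - a)" using Nrm_nonneg[OF d] by (intro mult_right_mono) auto
      also have "\<dots> < e" using a(2) by (simp add: field_simps)
      finally show ?thesis using subspace_scale[OF subG a(1)] by blast
    qed
    then show "c *\<^sub>R f \<in> cl" using f clV V_scale by (auto simp: cl_def)
  qed
  interpret C: real_hilbert cl qq
  proof
    show "subspace cl" by (rule subcl)
    fix X :: "nat \<Rightarrow> 'd l2"
    assume X: "\<And>n. X n \<in> cl"
      and c: "\<And>e. 0 < e \<Longrightarrow> \<exists>N. \<forall>m\<ge>N. \<forall>n\<ge>N. qq (X m - X n) (X m - X n) < e"
    have XV: "X n \<in> V" for n using X clV by auto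
    obtain f where f: "f \<in> V" "(\<lambda>n. qq (X n - f) (X n - f)) \<longlonglongrightarrow> 0"
      using V.complete[OF XV c] by blast
    have "f \<in> cl"
      unfolding cl_def
    proof (intro CollectI conjI allI impI f(1))
      fix e :: real assume e: "0 < e"
      have "(\<lambda>n. sqrt (qq (X n - f) (X n - f))) \<longlonglongrightarrow> sqrt 0" by (intro tendsto_intros f)
      then have "\<exists>N. \<forall>n\<ge>N. norm (sqrt (qq (X n - f) (X n - f)) - sqrt 0) < e / 2"
        using e by (intro LIMSEQ_D) auto
      then obtain n where "\<bar>Nrm (X n - f)\<bar> < e / 2" unfolding Nrm_def by fastforce
      then have n: "Nrm (X n - f) < e / 2" by linarith
      obtain g where g: "g \<in> G" "Nrm (X n - g) < e / 2"
        using X[of n] half_gt_zero[OF e] unfolding cl_def by blast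
      have gV: "g \<in> V" using g GV by auto
      have "Nrm (f - g) \<le> Nrm (f - X n) + Nrm (X n - g)" by (rule Nrm_triangle3[OF f(1) XV gV])
      then have "Nrm (f - g) < e" using n g Nrm_minus_commute[OF f(1) XV[of n]] by simp
      then show "\<exists>g\<in>G. Nrm (f - g) < e" using g by blast
    qed
    then show "\<exists>x\<in>cl. (\<lambda>n. qq (X n - x) (X n - x)) \<longlonglongrightarrow> 0" using f by blast
  next
    show "qq (a + b) c = qq a c + qq b c" if "a \<in> cl" "b \<in> cl" "c \<in> cl" for a b c
      using that clV by (intro V0.add_left) auto
    show "qq (k *\<^sub>R a) b = k * qq a b" if "a \<in> cl" "b \<in> cl" for k a b
      using that clV by (intro V0.scale_left) auto
    show "qq a b = qq b a" if "a \<in> cl" "b \<in> cl" for a b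
      using that clV by (intro V0.commute) auto
    show "0 \<le> qq a a" if "a \<in> cl" for a
      using that clV by (intro V0.nonneg) auto
  qed
  have "\<exists>u\<in>cl. \<forall>y\<in>cl. qq y x = qq y u"
  proof (rule C.riesz[where C="Nrm x"])
    show "\<bar>qq y x\<bar> \<le> Nrm x * sqrt (qq y y)" if "y \<in> cl" for y
    proof -
      have "y \<in> V" using that clV by auto
      then show ?thesis using V0.cauchy_schwarz[of y x] x by (simp add: Nrm_def mult.commute)
    qed
    show "qq (a + b) x = qq a x + qq b x" if "a \<in> cl" "b \<in> cl" for a b
      using that clV x by (intro V0.add_left) auto
    show "qq (k *\<^sub>R a) x = k * qq a x" if "a \<in> cl" for k a
      using that clV x by (intro V0.scale_left) auto
  qed
  then obtain u where u: "u \<in> cl" "\<forall>y\<in>cl. qq y x = qq y u" by blast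
  have uV: "u \<in> V" using u clV by auto
  define v where "v = x - u"
  have v: "v \<in> V" unfolding v_def by (rule V_diff[OF x uV])
  have coercive: "1 * qq a a \<le> rr a a" for a by (simp add: qq_self)
  have bounded: "\<bar>rr a b\<bar> \<le> K * sqrt (qq a a) * sqrt (qq b b)" if "a \<in> V" "b \<in> V" for a b
    using rr_bounded[OF that] by (simp add: Nrm_def)
  have "\<exists>v'\<in>V. \<forall>y\<in>V. qq v y = rr v' y"
  \<comment> \<open>The arguments of \<open>rr\<close> are exchanged because \<open>v'\<close> has
    to stand on the left.\<close>
  proof (rule V.lax_milgram[where r="\<lambda>x y. rr y x" and e=1 and K=K and C="Nrm v"])
    show "\<bar>rr b a\<bar> \<le> K * sqrt (qq a a) * sqrt (qq b b)" if "a \<in> V" "b \<in> V" for a b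
      using bounded[OF that(2,1)] by (simp add: mult_ac)
    show "\<bar>qq v a\<bar> \<le> Nrm v * sqrt (qq a a)" if "a \<in> V" for a
      using V0.cauchy_schwarz[OF v that] by (simp add: Nrm_def)
  qed (use v coercive in \<open>auto simp: rr_add_left rr_add_right rr_scale_left rr_scale_right V0.add_right V0.scale_right\<close>)
  then obtain v' where v': "v' \<in> V" "\<forall>y\<in>V. qq v y = rr v' y" by blast
  have "\<exists>g\<in>V. \<forall>y\<in>V. inner y v' = rr y g"
  proof (rule V.lax_milgram[where r=rr and e=1 and K=K and C="norm v'"])
    show "\<bar>inner a v'\<bar> \<le> norm v' * sqrt (qq a a)" if "a \<in> V" for a
    proof -
      have "\<bar>inner a v'\<bar> \<le> norm a * norm v'" by (rule Cauchy_Schwarz_ineq2)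
      also have "\<dots> \<le> Nrm a * norm v'" using norm_le_Nrm[OF that] by (rule mult_right_mono) simp
      finally show ?thesis by (simp add: Nrm_def mult.commute)
    qed
  qed (use bounded coercive in \<open>auto simp: rr_add_left rr_add_right rr_scale_left rr_scale_right inner_add_left\<close>)
  then obtain g where g: "g \<in> V" "\<forall>y\<in>V. inner y v' = rr y g" by blast
  then have "g \<in> G" by (auto simp: G_def intro!: exI[of _ v'])
  then have gcl: "g \<in> cl" using G_cl by auto
  \<comment> \<open>Both representations meet in \<open>rr v' g\<close>, and \<open>v\<close> is
    orthogonal to \<open>g \<in> cl\<close>.\<close>
  have "inner v' v' = qq v g" using g v' by auto
  also have "\<dots> = qq g v" by (rule V0.commute[OF v g(1)])
  also have "\<dots> = qq g x - qq g u" unfolding v_def by (rule V0.diff_right[OF g(1) x uV])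
  also have "\<dots> = 0" using u gcl by simp
  finally have "v' = 0" by simp
  then have "qq v v = rr 0 v" using v' v by auto
  also have "\<dots> = 0" using rr_scale_left[OF V_zero v, of 0] by simp
  finally have v0: "Nrm v = 0" by (simp add: Nrm_def)
  obtain k where k: "k \<in> G" "Nrm (u - k) < e" using u(1) e by (auto simp: cl_def)
  have kV: "k \<in> V" using k GV by auto
  have "Nrm (x - k) \<le> Nrm v + Nrm (u - k)" unfolding v_def by (rule Nrm_triangle3[OF x uV kV])
  then have "Nrm (x - k) < e" using v0 k by simp
  then show ?thesis using k by (auto simp: G_def)
qed

text \<open>Only vectors of \<open>D\<close> and limits in \<open>L\<^sup>2\<close> occur here, so
  later arguments need not mention the completion. A tail of the sequence is taken so that the
  distance stays below \<open>e\<close> throughout.\<close>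

lemma representing_dense:
  assumes x: "x \<in> D" and e: "0 < e"
  shows "\<exists>g h X. (\<forall>n. X n \<in> D \<and> nrm (x - X n) < e) \<and> X \<longlonglongrightarrow> g \<and>
    (\<forall>y\<in>D. (\<lambda>n. r y (X n)) \<longlonglongrightarrow> inner y h)"
proof -
  obtain g h where g: "g \<in> V" "\<forall>y\<in>V. rr y g = inner y h" "Nrm (x - g) < e"
    using representing_dense_V[OF D_subset_V[OF x] e] by blast
  obtain X where X: "conv X g" using g(1) by (auto simp: V_def)
  have "(\<lambda>n. sqrt (r (x - X n) (x - X n))) \<longlonglongrightarrow> sqrt (rr (x - g) (x - g))"
    by (intro tendsto_intros r_lim conv_diff conv_const x X)
  then have "(\<lambda>n. nrm (x - X n)) \<longlonglongrightarrow> Nrm (x - g)" by (simp add: nrm_def Nrm_def qq_self)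
  then have "\<forall>\<^sub>F n in sequentially. nrm (x - X n) < e" using g(3) by (rule order_tendstoD)
  then obtain N where N: "\<forall>n\<ge>N. nrm (x - X n) < e" by (auto simp: eventually_sequentially)
  have "(\<lambda>n. r y (X (n + N))) \<longlonglongrightarrow> inner y h" if "y \<in> D" for y
  proof -
    have "(\<lambda>n. r y (X n)) \<longlonglongrightarrow> rr y g" using r_lim[OF conv_const[OF that] X] .
    then show ?thesis using g(2) D_subset_V[OF that] LIMSEQ_ignore_initial_segment by fastforce
  qed
  moreover have "(\<lambda>n. X (n + N)) \<longlonglongrightarrow> g" by (rule LIMSEQ_ignore_initial_segment[OF convD(2)[OF X]])
  ultimately show ?thesis
    using N convD(1)[OF X] by (intro exI[of _ g] exI[of _ h] exI[of _ "\<lambda>n. X (n + N)"]) auto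
qed

end

text \<open>Closed graph theorem for the inclusion of one completion into the other: both norms
  dominate that of \<open>L\<^sup>2\<close>, which makes the graph closed.\<close>

lemma closable_real_form_comparison:
  assumes "closable_real_form D1 r1 K1" "closable_real_form D2 r2 K2"
    and sub: "closable_real_form.V D1 r1 \<subseteq> closable_real_form.V D2 r2" and "D1 \<subseteq> D2"
  shows "\<exists>C\<ge>0. \<forall>x\<in>D1. sqrt (r2 x x) \<le> C * sqrt (r1 x x)"
proof -
  interpret A: closable_real_form D1 r1 K1 by fact
  interpret B: closable_real_form D2 r2 K2 by fact
  have "\<exists>C\<ge>0. \<forall>x\<in>A.V. B.Nrm x \<le> C * A.Nrm x"
  proof (rule closed_graph_seminorm)
    show "x = 0" if "x \<in> A.V" "A.Nrm x = 0" for x using A.norm_le_Nrm[OF that(1)] that(2) by simp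
    show "\<exists>x\<in>A.V. (\<lambda>n. A.Nrm (X n - x)) \<longlonglongrightarrow> 0"
      if "\<And>n. X n \<in> A.V" "\<And>e. 0 < e \<Longrightarrow> \<exists>N. \<forall>m\<ge>N. \<forall>n\<ge>N. A.Nrm (X m - X n) < e" for X
      using that by (rule A.complete_Nrm)
    show "B.Nrm (x + y) \<le> B.Nrm x + B.Nrm y" if "x \<in> A.V" "y \<in> A.V" for x y
      using that sub by (intro B.Nrm_triangle) auto
    show "B.Nrm (c *\<^sub>R x) = \<bar>c\<bar> * B.Nrm x" if "x \<in> A.V" for c x
      using that sub by (intro B.Nrm_scale) auto
  next
    fix y x S
    assume y: "\<And>n. y n \<in> A.V" and x: "x \<in> A.V" and S: "\<And>n. (\<Sum>i<n. B.Nrm (y i)) \<le> S"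
      and lim: "(\<lambda>n. A.Nrm ((\<Sum>i<n. y i) - x)) \<longlonglongrightarrow> 0"
    have yV: "y n \<in> B.V" for n using y sub by auto
    have xV: "x \<in> B.V" using x sub by auto
    let ?s = "\<lambda>n. \<Sum>i<n. y i"
    have sA: "?s n \<in> A.V" for n using y by (intro subspace_sum[OF A.subspace_V])
    have sB: "?s n \<in> B.V" for n using sA sub by auto
    have Nrm_sum: "B.Nrm (\<Sum>i\<in>I. y i) \<le> (\<Sum>i\<in>I. B.Nrm (y i))" for I
    proof (induction I rule: infinite_finite_induct)
      case (insert i I)
      have "B.Nrm (y i + (\<Sum>i\<in>I. y i)) \<le> B.Nrm (y i) + B.Nrm (\<Sum>i\<in>I. y i)"
        by (intro B.Nrm_triangle yV subspace_sum[OF B.subspace_V])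
      then show ?case using insert by simp
    qed (use B.Nrm_scale[OF B.V_zero, of 0] in auto)
    have nonneg: "0 \<le> B.Nrm (y i)" for i by (rule B.Nrm_nonneg[OF yV])
    have "summable (\<lambda>i. B.Nrm (y i))"
      using nonneg S by (intro bounded_imp_summable[where B=S])
        (auto simp: lessThan_Suc_atMost[symmetric] simp del: sum.lessThan_Suc)
    then have cau: "\<exists>N. \<forall>m\<ge>N. \<forall>n\<ge>N. B.Nrm (?s m - ?s n) < e" if e: "0 < e" for e
    proof -
      obtain N where N: "\<forall>m\<ge>N. \<forall>n. norm (\<Sum>i\<in>{m..<n}. B.Nrm (y i)) < e"
        using \<open>summable _\<close> e unfolding summable_Cauchy by blast
      have *: "B.Nrm (?s n - ?s m) < e" if "m \<ge> N" "m \<le> n" for m n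
      proof -
        have "?s n - ?s m = (\<Sum>i\<in>{m..<n}. y i)"
          using sum_diff_nat_ivl[of 0 m n y] that by (simp add: atLeast0LessThan)
        then have "B.Nrm (?s n - ?s m) \<le> (\<Sum>i\<in>{m..<n}. B.Nrm (y i))" using Nrm_sum by simp
        also have "\<dots> \<le> norm (\<Sum>i\<in>{m..<n}. B.Nrm (y i))" by simp
        also have "\<dots> < e" using N that by blast
        finally show ?thesis .
      qed
      have "B.Nrm (?s m - ?s n) < e" if "m \<ge> N" "n \<ge> N" for m n
        using *[of m n] *[of n m] that B.Nrm_minus_commute[OF sB sB, of m n] by (cases "m \<le> n") auto
      then show ?thesis by blast
    qed
    \<comment> \<open>Completeness in the second norm provides a limit, which has to be
      \<open>x\<close> because both limits are also limits in \<open>L\<^sup>2\<close>.\<close>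
    obtain x' where x': "x' \<in> B.V" "(\<lambda>n. B.Nrm (?s n - x')) \<longlonglongrightarrow> 0"
      using B.complete_Nrm[of ?s] sB cau by blast
    have "?s \<longlonglongrightarrow> x"
    proof -
      have "(\<lambda>n. ?s n - x) \<longlonglongrightarrow> 0"
        by (rule Lim_null_comparison[OF _ lim], rule always_eventually)
          (auto intro!: A.norm_le_Nrm A.V_diff sA x)
      then show ?thesis by (simp add: LIM_zero_iff)
    qed
    moreover have "?s \<longlonglongrightarrow> x'"
    proof -
      have "(\<lambda>n. ?s n - x') \<longlonglongrightarrow> 0"
        by (rule Lim_null_comparison[OF _ x'(2)], rule always_eventually)
          (auto intro!: B.norm_le_Nrm B.V_diff sB x')
      then show ?thesis by (simp add: LIM_zero_iff)
    qed
    ultimately have "x' = x" using LIMSEQ_unique by blast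
    have le: "B.Nrm x \<le> S + B.Nrm (?s n - x)" for n
    proof -
      have "B.Nrm (?s n + (x - ?s n)) \<le> B.Nrm (?s n) + B.Nrm (x - ?s n)"
        by (intro B.Nrm_triangle B.V_diff sB xV)
      then have "B.Nrm x \<le> B.Nrm (?s n) + B.Nrm (?s n - x)"
        using B.Nrm_minus_commute[OF xV sB[of n]] by simp
      then show ?thesis using Nrm_sum[of "{..<n}"] S[of n] by linarith
    qed
    have "(\<lambda>n. S + B.Nrm (?s n - x)) \<longlonglongrightarrow> S + 0"
      using x'(2) \<open>x' = x\<close> by (intro tendsto_intros) simp
    then show "B.Nrm x \<le> S" using le by (intro LIMSEQ_le_const[of _ "S + 0", simplified]) auto
  qed (auto intro: A.subspace_V A.Nrm_triangle A.Nrm_scale)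
  then obtain C where C: "C \<ge> 0" "\<forall>x\<in>A.V. B.Nrm x \<le> C * A.Nrm x" by blast
  have "sqrt (r2 x x) \<le> C * sqrt (r1 x x)" if "x \<in> D1" for x
  proof -
    have "x \<in> D2" using that \<open>D1 \<subseteq> D2\<close> by auto
    then show ?thesis
      using C(2)[rule_format, OF A.D_subset_V[OF that]] A.Nrm_D[OF that] B.Nrm_D[of x]
      by (simp add: A.nrm_def B.nrm_def)
  qed
  then show ?thesis using C(1) by blast
qed

section \<open>Operators with sectorial forms\<close>

definition clinear_on :: "'d::finite l2 set \<Rightarrow> ('d l2 \<Rightarrow> 'd l2) \<Rightarrow> bool" where
  "clinear_on D A \<longleftrightarrow> csubspace D \<and> (\<forall>x\<in>D. \<forall>y\<in>D. A (x + y) = A x + A y) \<and>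
     (\<forall>c. \<forall>x\<in>D. A (c *\<^sub>C x) = c *\<^sub>C A x)"

lemma clinear_onD:
  assumes "clinear_on D A"
  shows "csubspace D"
    and "x \<in> D \<Longrightarrow> y \<in> D \<Longrightarrow> A (x + y) = A x + A y"
    and "x \<in> D \<Longrightarrow> A (c *\<^sub>C x) = c *\<^sub>C A x"
  using assms by (auto simp: clinear_on_def)

lemma clinear_on_diff:
  assumes "clinear_on D A" "x \<in> D" "y \<in> D"
  shows "A (x - y) = A x - A y"
  using clinear_onD(2)[OF assms(1,2), of "(-1) *\<^sub>C y"] clinear_onD(3)[OF assms(1,3), of "-1"]
    csubspace_scale[OF clinear_onD(1)[OF assms(1)] assms(3), of "-1"] by simp

lemma clinear_on_scaleR:
  assumes "clinear_on D A" "x \<in> D"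
  shows "A (c *\<^sub>R x) = c *\<^sub>R A x"
  using clinear_onD(3)[OF assms, of "of_real c"] by (simp add: scaleC_of_real)

lemma clinear_on_zero: "clinear_on D A \<Longrightarrow> A 0 = 0"
  using clinear_onD(3)[of D A 0 0] csubspace_0[OF clinear_onD(1)[of D A]]
  by (simp add: scaleC.zero_left)

lemma clinear_on_subset: "clinear_on D A \<Longrightarrow> csubspace D' \<Longrightarrow> D' \<subseteq> D \<Longrightarrow> clinear_on D' A"
  unfolding clinear_on_def by blast

lemma clinear_on_lincomb:
  assumes "clinear_on D A" "clinear_on D B"
  shows "clinear_on D (\<lambda>x. A x - \<mu> *\<^sub>C B x)"
  using assms unfolding clinear_on_def
  by (auto simp: scaleC.add_right scaleC.diff_right mult.commute)

lemma clinear_on_add_scale: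
  assumes "clinear_on D A" "x \<in> D" "y \<in> D"
  shows "A (x + c *\<^sub>C y) = A x + c *\<^sub>C A y"
  using clinear_onD(2)[OF assms(1,2) csubspace_scale[OF clinear_onD(1)[OF assms(1)] assms(3)]]
    clinear_onD(3)[OF assms(1,3)] by metis

lemma cinner_add_scale:
  "cinner (u + c *\<^sub>C v) (x + d *\<^sub>C y) =
    cinner u x + cnj d * cinner u y + c * cinner v x + c * cnj d * cinner v y"
  unfolding cinner.add_left cinner.add_right cinner_scaleC_left cinner_scaleC_right
  by (simp add: algebra_simps)

text \<open>Polarisation: the fourth roots of unity extract the mixed term from the diagonal, and by
  \<open>sum\<close> the functional \<open>q\<close> behaves like a squared norm under this
  averaging.\<close>

lemma sesquilinear_bound:
  assumes A: "clinear_on D A"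
    and nonneg: "\<And>x. x \<in> D \<Longrightarrow> 0 \<le> q x" and zero: "\<And>x. x \<in> D \<Longrightarrow> q x = 0 \<Longrightarrow> x = 0"
    and scale: "\<And>c x. x \<in> D \<Longrightarrow> q (c *\<^sub>R x) = c\<^sup>2 * q x"
    and sum: "\<And>x y. x \<in> D \<Longrightarrow> y \<in> D \<Longrightarrow>
      q (x + y) + q (x + \<i> *\<^sub>C y) + q (x + (-1) *\<^sub>C y) + q (x + (-\<i>) *\<^sub>C y) = 4 * (q x + q y)"
    and bound: "\<And>x. x \<in> D \<Longrightarrow> cmod (cinner (A x) x) \<le> C * q x"
    and x: "x \<in> D" and y: "y \<in> D"
  shows "cmod (cinner (A x) y) \<le> 2 * C * sqrt (q x) * sqrt (q y)"
proof -
  note D = clinear_onD(1)[OF A]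
  have *: "cmod (cinner (A x) y) \<le> C * (q x + q y)" if x: "x \<in> D" and y: "y \<in> D" for x y
  proof -
    have s: "cinner (A (x + c *\<^sub>C y)) (x + c *\<^sub>C y) = cinner (A x) x + cnj c * cinner (A x) y
      + c * cinner (A y) x + c * cnj c * cinner (A y) y" for c
      unfolding clinear_on_add_scale[OF A x y] cinner_add_scale ..
    have "4 * cinner (A x) y = cinner (A (x + 1 *\<^sub>C y)) (x + 1 *\<^sub>C y)
      + \<i> * cinner (A (x + \<i> *\<^sub>C y)) (x + \<i> *\<^sub>C y)
      - cinner (A (x + (-1) *\<^sub>C y)) (x + (-1) *\<^sub>C y)
      - \<i> * cinner (A (x + (-\<i>) *\<^sub>C y)) (x + (-\<i>) *\<^sub>C y)"
      unfolding s by (simp add: algebra_simps)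
    then have "4 * cmod (cinner (A x) y) = cmod (cinner (A (x + 1 *\<^sub>C y)) (x + 1 *\<^sub>C y)
      + \<i> * cinner (A (x + \<i> *\<^sub>C y)) (x + \<i> *\<^sub>C y)
      - cinner (A (x + (-1) *\<^sub>C y)) (x + (-1) *\<^sub>C y)
      - \<i> * cinner (A (x + (-\<i>) *\<^sub>C y)) (x + (-\<i>) *\<^sub>C y))"
      by (metis norm_mult norm_numeral)
    also have "\<dots> \<le> cmod (cinner (A (x + 1 *\<^sub>C y)) (x + 1 *\<^sub>C y))
      + cmod (cinner (A (x + \<i> *\<^sub>C y)) (x + \<i> *\<^sub>C y))
      + cmod (cinner (A (x + (-1) *\<^sub>C y)) (x + (-1) *\<^sub>C y))
      + cmod (cinner (A (x + (-\<i>) *\<^sub>C y)) (x + (-\<i>) *\<^sub>C y))"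
    proof -
      have "cmod (a + \<i> * b - c - \<i> * d) \<le> cmod a + cmod b + cmod c + cmod d" for a b c d
        using norm_triangle_ineq4[of "a + \<i> * b - c" "\<i> * d"] norm_triangle_ineq4[of "a + \<i> * b" c]
          norm_triangle_ineq[of a "\<i> * b"] by (simp add: norm_mult)
      then show ?thesis .
    qed
    also have "\<dots> \<le> C * q (x + 1 *\<^sub>C y) + C * q (x + \<i> *\<^sub>C y) + C * q (x + (-1) *\<^sub>C y) + C * q (x + (-\<i>) *\<^sub>C y)"
      by (intro add_mono bound csubspace_add[OF D x] csubspace_scale[OF D y])
    also have "\<dots> = C * (q (x + y) + q (x + \<i> *\<^sub>C y) + q (x + (-1) *\<^sub>C y) + q (x + (-\<i>) *\<^sub>C y))"
      by (simp add: algebra_simps)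
    also have "\<dots> = 4 * (C * (q x + q y))" unfolding sum[OF x y] by (rule mult.left_commute)
    finally show ?thesis by simp
  qed
  show ?thesis
  proof (cases "q x = 0 \<or> q y = 0")
    case True
    then show ?thesis using zero[OF x] zero[OF y] nonneg x y by (auto simp: clinear_on_zero[OF A] cinner.zero_left cinner.zero_right)
  next
    case False
    then have p: "0 < q x" "0 < q y" using nonneg x y by (auto simp: order_less_le)
    \<comment> \<open>Normalising both vectors to \<open>q = 1\<close> turns the bound by a sum into
      one by a product; the sum \<open>1 + 1\<close> is the factor \<open>2\<close> of the
      claim.\<close>
    let ?a = "inverse (sqrt (q x))" and ?b = "inverse (sqrt (q y))"
    have "cmod (cinner (A (?a *\<^sub>R x)) (?b *\<^sub>R y)) \<le> C * (q (?a *\<^sub>R x) + q (?b *\<^sub>R y))"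
      by (rule *) (use subspace_scale[OF csubspace_imp_subspace[OF D]] x y in auto)
    also have "\<dots> = 2 * C"
      using p x y by (simp add: scale power_inverse)
    also have "cmod (cinner (A (?a *\<^sub>R x)) (?b *\<^sub>R y)) = ?a * ?b * cmod (cinner (A x) y)"
      using p by (simp add: clinear_on_scaleR[OF A x] cinner.scaleR_left cinner.scaleR_right)
    finally show ?thesis using p by (simp add: field_simps)
  qed
qed

locale sectorial_operator =
  fixes D :: "'d::finite l2 set" and A :: "'d l2 \<Rightarrow> 'd l2" and \<omega> :: complex and \<gamma> M :: real
  assumes linear: "clinear_on D A"
    and omega: "cmod \<omega> = 1"
    and sector: "x \<in> D \<Longrightarrow> \<gamma> * (norm x)\<^sup>2 \<le> Re (\<omega> * cinner (A x) x)"
      "x \<in> D \<Longrightarrow> \<bar>Im (\<omega> * cinner (A x) x)\<bar> \<le> M * (Re (\<omega> * cinner (A x) x) - \<gamma> * (norm x)\<^sup>2)"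
    and form_closable: "form_converges D (\<lambda>x. cinner (A x) x) X 0 \<Longrightarrow> (\<lambda>n. cinner (A (X n)) (X n)) \<longlonglongrightarrow> 0"
begin

text \<open>The shift by \<open>1 - \<gamma>\<close> moves the vertex of the rotated sector to
  \<open>1\<close>, so that \<open>r x x\<close> dominates the squared norm.\<close>

definition r :: "'d l2 \<Rightarrow> 'd l2 \<Rightarrow> real" where
  "r x y = Re (\<omega> * cinner (A x) y) + (1 - \<gamma>) * inner x y"

abbreviation s :: "'d l2 \<Rightarrow> complex" where
  "s x \<equiv> cinner (A x) x"

text \<open>Twice the diagonal constant of \<open>s_le\<close>; the factor comes from
  polarisation.\<close>

definition C :: real where
  "C = 2 * (2 + \<bar>1 - \<gamma>\<bar> + \<bar>M\<bar>)"

lemmas D = clinear_onD(1)[OF linear]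

lemma subspace: "subspace D"
  by (rule csubspace_imp_subspace[OF D])

lemma r_ge: "x \<in> D \<Longrightarrow> (norm x)\<^sup>2 \<le> r x x"
  using sector(1)[of x] by (simp add: r_def power2_norm_eq_inner algebra_simps)

lemma s_le: "x \<in> D \<Longrightarrow> cmod (s x) \<le> (2 + \<bar>1 - \<gamma>\<bar> + \<bar>M\<bar>) * r x x"
proof -
  assume x: "x \<in> D"
  let ?n = "(norm x)\<^sup>2"
  have r: "Re (\<omega> * s x) = r x x - (1 - \<gamma>) * ?n" by (simp add: r_def power2_norm_eq_inner)
  have n: "0 \<le> ?n" "?n \<le> r x x" using r_ge[OF x] by auto
  have "cmod (s x) = cmod (\<omega> * s x)" by (simp add: norm_mult omega)
  also have "\<dots> \<le> \<bar>Re (\<omega> * s x)\<bar> + \<bar>Im (\<omega> * s x)\<bar>" by (rule cmod_le)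
  also have "\<bar>Re (\<omega> * s x)\<bar> \<le> r x x + \<bar>1 - \<gamma>\<bar> * r x x"
  proof -
    have "\<bar>(1 - \<gamma>) * ?n\<bar> \<le> \<bar>1 - \<gamma>\<bar> * r x x" using n by (simp add: abs_mult mult_left_mono)
    then show ?thesis using r n by linarith
  qed
  also have "\<bar>Im (\<omega> * s x)\<bar> \<le> \<bar>M\<bar> * r x x"
  proof -
    have e: "Re (\<omega> * s x) - \<gamma> * ?n = r x x - ?n" using r by (simp add: algebra_simps)
    have "\<bar>Im (\<omega> * s x)\<bar> \<le> M * (r x x - ?n)" using sector(2)[OF x] e by simp
    also have "\<dots> \<le> \<bar>M\<bar> * (r x x - ?n)" using n by (intro mult_right_mono) auto
    also have "\<dots> \<le> \<bar>M\<bar> * r x x" using n by (intro mult_left_mono) auto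
    finally show ?thesis .
  qed
  finally have "cmod (s x) \<le> r x x + \<bar>1 - \<gamma>\<bar> * r x x + \<bar>M\<bar> * r x x" by linarith
  also have "\<dots> \<le> (2 + \<bar>1 - \<gamma>\<bar> + \<bar>M\<bar>) * r x x"
    using order_trans[OF n] by (simp add: algebra_simps)
  finally show ?thesis .
qed

lemma A_bound:
  assumes x: "x \<in> D" and y: "y \<in> D"
  shows "cmod (cinner (A x) y) \<le> C * sqrt (r x x) * sqrt (r y y)"
  unfolding C_def
proof (rule sesquilinear_bound[OF linear, where q="\<lambda>x. r x x"])
  fix x assume x: "x \<in> D"
  show "0 \<le> r x x" by (rule order_trans[OF zero_le_power2 r_ge[OF x]])
  show "x = 0" if "r x x = 0" using r_ge[OF x] that by simp
  show "r (c *\<^sub>R x) (c *\<^sub>R x) = c\<^sup>2 * r x x" for c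
    by (simp add: r_def clinear_on_scaleR[OF linear x] cinner.scaleR_left cinner.scaleR_right
        power2_eq_square algebra_simps)
  show "cmod (s x) \<le> (2 + \<bar>1 - \<gamma>\<bar> + \<bar>M\<bar>) * r x x" by (rule s_le[OF x])
next
  fix x y assume x: "x \<in> D" and y: "y \<in> D"
  \<comment> \<open>The mixed terms cancel when summed over the fourth roots of unity.\<close>
  have *: "r (x + c *\<^sub>C y) (x + c *\<^sub>C y) = r x x + Re (cnj c * (\<omega> * cinner (A x) y + of_real (1 - \<gamma>) * cinner x y))
      + Re (c * (\<omega> * cinner (A y) x + of_real (1 - \<gamma>) * cinner y x)) + r y y" if "c * cnj c = 1" for c
  proof -
    have z: "\<omega> * cinner (A (x + c *\<^sub>C y)) (x + c *\<^sub>C y) + of_real (1 - \<gamma>) * cinner (x + c *\<^sub>C y) (x + c *\<^sub>C y)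
      = (\<omega> * s x + of_real (1 - \<gamma>) * cinner x x)
      + cnj c * (\<omega> * cinner (A x) y + of_real (1 - \<gamma>) * cinner x y)
      + c * (\<omega> * cinner (A y) x + of_real (1 - \<gamma>) * cinner y x)
      + (c * cnj c) * (\<omega> * s y + of_real (1 - \<gamma>) * cinner y y)"
      unfolding clinear_on_add_scale[OF linear x y] cinner_add_scale by (simp only: distrib_left) algebra
    have r: "r u u = Re (\<omega> * s u + of_real (1 - \<gamma>) * cinner u u)" for u
      by (simp add: r_def inner_l2_def)
    show ?thesis unfolding r z that by simp
  qed
  show "r (x + y) (x + y) + r (x + \<i> *\<^sub>C y) (x + \<i> *\<^sub>C y) + r (x + (- 1) *\<^sub>C y) (x + (- 1) *\<^sub>C y)
    + r (x + (- \<i>) *\<^sub>C y) (x + (- \<i>) *\<^sub>C y) = 4 * (r x x + r y y)"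
    using *[of 1] *[of \<i>] *[of "-1"] *[of "-\<i>"] by simp
qed (rule x, rule y)

lemma C_nonneg: "0 \<le> C"
  by (simp add: C_def)

lemma norm_le_sqrt_r: "x \<in> D \<Longrightarrow> norm x \<le> sqrt (r x x)"
  using r_ge by (rule real_le_rsqrt)

lemma r_bound:
  assumes "x \<in> D" "y \<in> D"
  shows "\<bar>r x y\<bar> \<le> (C + \<bar>1 - \<gamma>\<bar>) * sqrt (r x x) * sqrt (r y y)"
proof -
  have "\<bar>Re (\<omega> * cinner (A x) y)\<bar> \<le> C * sqrt (r x x) * sqrt (r y y)"
    using abs_Re_le_cmod[of "\<omega> * cinner (A x) y"] A_bound[OF assms] by (simp add: norm_mult omega)
  moreover have "\<bar>(1 - \<gamma>) * inner x y\<bar> \<le> \<bar>1 - \<gamma>\<bar> * (sqrt (r x x) * sqrt (r y y))"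
  proof -
    have "\<bar>inner x y\<bar> \<le> norm x * norm y" by (rule Cauchy_Schwarz_ineq2)
    also have "\<dots> \<le> sqrt (r x x) * sqrt (r y y)"
      by (rule mult_mono[OF norm_le_sqrt_r norm_le_sqrt_r])
        (use assms order_trans[OF norm_ge_zero norm_le_sqrt_r] in auto)
    finally show ?thesis by (simp add: abs_mult mult_left_mono)
  qed
  ultimately show ?thesis by (simp add: r_def algebra_simps)
qed

text \<open>\<open>form_converges\<close> controls only \<open>s (X m - X n)\<close>; the additional
  term \<open>(1 - \<gamma>) * inner\<close> in \<open>r\<close> vanishes because \<open>X\<close>
  converges. The other direction is \<open>s_le\<close>.\<close>

lemma Cauchy_r_iff:
  assumes X: "\<And>n. X n \<in> D" "X \<longlonglongrightarrow> f"
  shows "(\<forall>e>0. \<exists>N. \<forall>m\<ge>N. \<forall>n\<ge>N. r (X m - X n) (X m - X n) < e) \<longleftrightarrow> form_converges D s X f"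
proof
  assume L: "\<forall>e>0. \<exists>N. \<forall>m\<ge>N. \<forall>n\<ge>N. r (X m - X n) (X m - X n) < e"
  have "((\<lambda>(m, n). s (X m - X n)) \<longlongrightarrow> 0) (sequentially \<times>\<^sub>F sequentially)"
  proof (rule tendstoI)
    fix e :: real assume e: "0 < e"
    let ?K = "2 + \<bar>1 - \<gamma>\<bar> + \<bar>M\<bar>"
    have K: "?K > 0" by (rule add_pos_nonneg[OF add_pos_nonneg]) auto
    then obtain N where N: "\<forall>m\<ge>N. \<forall>n\<ge>N. r (X m - X n) (X m - X n) < e / ?K"
      using L e by (meson divide_pos_pos)
    have "cmod (s (X m - X n)) < e" if "m \<ge> N" "n \<ge> N" for m n
    proof -
      have "cmod (s (X m - X n)) \<le> ?K * r (X m - X n) (X m - X n)"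
        by (rule s_le[OF subspace_diff[OF subspace X(1) X(1)]])
      also have "\<dots> < ?K * (e / ?K)" using N that K by (intro mult_strict_left_mono) auto
      also have "\<dots> = e" using K by simp
      finally show ?thesis .
    qed
    then show "\<forall>\<^sub>F p in sequentially \<times>\<^sub>F sequentially. dist (case p of (m, n) \<Rightarrow> s (X m - X n)) 0 < e"
      unfolding eventually_prod_sequentially by auto
  qed
  then show "form_converges D s X f" using X by (auto simp: form_converges_def)
next
  assume "form_converges D s X f"
  then have lim: "((\<lambda>(m, n). s (X m - X n)) \<longlongrightarrow> 0) (sequentially \<times>\<^sub>F sequentially)"
    by (simp add: form_converges_def)
  show "\<forall>e>0. \<exists>N. \<forall>m\<ge>N. \<forall>n\<ge>N. r (X m - X n) (X m - X n) < e"
  proof (intro allI impI)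
    fix e :: real assume e: "0 < e"
    have "\<forall>\<^sub>F p in sequentially \<times>\<^sub>F sequentially. dist (case p of (m, n) \<Rightarrow> s (X m - X n)) 0 < e / 2"
      using tendstoD[OF lim, of "e / 2"] e by simp
    then obtain N1 where N1: "\<forall>m\<ge>N1. \<forall>n\<ge>N1. cmod (s (X m - X n)) < e / 2"
      unfolding eventually_prod_sequentially by auto
    define k where "k = \<bar>1 - \<gamma>\<bar> + 1"
    have k: "0 < k" "\<bar>1 - \<gamma>\<bar> \<le> k" by (auto simp: k_def)
    have "Cauchy X" using X(2) by (rule LIMSEQ_imp_Cauchy)
    then obtain N2 where N2: "\<forall>m\<ge>N2. \<forall>n\<ge>N2. norm (X m - X n) < sqrt (e / (2 * k))"
      using CauchyD[of X "sqrt (e / (2 * k))"] e k by auto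
    have "r (X m - X n) (X m - X n) < e" if mn: "m \<ge> max N1 N2" "n \<ge> max N1 N2" for m n
    proof -
      let ?z = "X m - X n"
      have "(norm ?z)\<^sup>2 < (sqrt (e / (2 * k)))\<^sup>2"
        using N2 mn by (intro power_strict_mono) auto
      then have n: "(norm ?z)\<^sup>2 < e / (2 * k)" using e k by simp
      have "r ?z ?z = Re (\<omega> * s ?z) + (1 - \<gamma>) * (norm ?z)\<^sup>2" by (simp add: r_def power2_norm_eq_inner)
      also have "Re (\<omega> * s ?z) \<le> cmod (s ?z)"
        using complex_Re_le_cmod[of "\<omega> * s ?z"] by (simp add: norm_mult omega)
      also have "(1 - \<gamma>) * (norm ?z)\<^sup>2 \<le> k * (norm ?z)\<^sup>2" using k by (intro mult_right_mono) auto
      also have "\<dots> \<le> k * (e / (2 * k))" using n k by (intro mult_left_mono) auto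
      also have "\<dots> = e / 2" using k by simp
      finally show ?thesis using N1 mn by fastforce
    qed
    then show "\<exists>N. \<forall>m\<ge>N. \<forall>n\<ge>N. r (X m - X n) (X m - X n) < e" by blast
  qed
qed

sublocale F: closable_real_form D r "C + \<bar>1 - \<gamma>\<bar>"
proof
  fix X :: "nat \<Rightarrow> 'd l2"
  assume X: "\<And>n. X n \<in> D" "X \<longlonglongrightarrow> 0"
    and c: "\<And>e. 0 < e \<Longrightarrow> \<exists>N. \<forall>m\<ge>N. \<forall>n\<ge>N. r (X m - X n) (X m - X n) < e"
  then have "form_converges D s X 0" using Cauchy_r_iff[OF X] by blast
  then have s0: "(\<lambda>n. s (X n)) \<longlonglongrightarrow> 0" by (rule form_closable)
  have "(\<lambda>n. Re (\<omega> * s (X n)) + (1 - \<gamma>) * inner (X n) (X n)) \<longlonglongrightarrow> Re (\<omega> * 0) + (1 - \<gamma>) * inner 0 (0 :: 'd l2)"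
    by (intro tendsto_add tendsto_Re tendsto_mult tendsto_const s0 tendsto_inner[OF X(2) X(2)])
  then show "(\<lambda>n. r (X n) (X n)) \<longlonglongrightarrow> 0" by (simp add: r_def)
next
  show "r (x + y) z = r x z + r y z" if "x \<in> D" "y \<in> D" "z \<in> D" for x y z
    unfolding r_def clinear_onD(2)[OF linear that(1,2)] cinner.add_left inner_add_left by (simp add: algebra_simps)
  show "r z (x + y) = r z x + r z y" for x y z
    unfolding r_def cinner.add_right inner_add_right by (simp add: algebra_simps)
  show "r (c *\<^sub>R x) y = c * r x y" if "x \<in> D" "y \<in> D" for c x y
    unfolding r_def clinear_on_scaleR[OF linear that(1)] cinner.scaleR_left inner_scaleR_left by (simp add: algebra_simps)
  show "r x (c *\<^sub>R y) = c * r x y" for c x y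
    unfolding r_def cinner.scaleR_right inner_scaleR_right by (simp add: algebra_simps)
qed (auto intro: subspace r_ge r_bound)

lemma conv_iff: "F.conv X f \<longleftrightarrow> form_converges D s X f"
proof -
  have "F.conv X f \<longleftrightarrow> (\<forall>n. X n \<in> D) \<and> X \<longlonglongrightarrow> f \<and>
    (\<forall>e>0. \<exists>N. \<forall>m\<ge>N. \<forall>n\<ge>N. r (X m - X n) (X m - X n) < e)"
    unfolding F.conv_def F.nrm_def using Cauchy_sqrt_iff[of "\<lambda>m n. r (X m - X n) (X m - X n)"] by blast
  also have "\<dots> \<longleftrightarrow> form_converges D s X f"
    using Cauchy_r_iff[of X f] by (auto simp: form_converges_def)
  finally show ?thesis .
qed

lemma V_eq: "F.V = dom_form_closure D s"
  by (simp add: F.V_def dom_form_closure_def conv_iff)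

lemma A_nrm: "x \<in> D \<Longrightarrow> y \<in> D \<Longrightarrow> cmod (cinner (A x) y) \<le> C * F.nrm x * F.nrm y"
  using A_bound by (simp add: F.nrm_def)

lemma A_null:
  assumes "\<And>n. Z n \<in> D" "\<And>n. W n \<in> D" "(\<lambda>n. F.nrm (Z n)) \<longlonglongrightarrow> 0" "\<And>n. F.nrm (W n) \<le> B"
  shows "(\<lambda>n. cinner (A (Z n)) (W n)) \<longlonglongrightarrow> 0" "(\<lambda>n. cinner (A (W n)) (Z n)) \<longlonglongrightarrow> 0"
proof -
  have *: "C * F.nrm (Z n) * F.nrm (W n) \<le> C * B * F.nrm (Z n)" for n
    using mult_left_mono[OF assms(4)[of n], of "C * F.nrm (Z n)"] C_nonneg F.nrm_nonneg[OF assms(1)[of n]]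
    by (simp add: mult_ac)
  have 1: "cmod (cinner (A (Z n)) (W n)) \<le> C * B * F.nrm (Z n)" for n
    using A_nrm[OF assms(1,2), of n n] * by (rule order_trans)
  have 2: "cmod (cinner (A (W n)) (Z n)) \<le> C * B * F.nrm (Z n)" for n
    using A_nrm[OF assms(2,1), of n n] *[of n] by (simp add: mult_ac)
  have lim: "(\<lambda>n. C * B * F.nrm (Z n)) \<longlonglongrightarrow> 0"
    using tendsto_mult[OF tendsto_const[of "C * B"] assms(3)] by simp
  show "(\<lambda>n. cinner (A (Z n)) (W n)) \<longlonglongrightarrow> 0"
    by (rule Lim_null_comparison[OF _ lim]) (use 1 in auto)
  show "(\<lambda>n. cinner (A (W n)) (Z n)) \<longlonglongrightarrow> 0"
    by (rule Lim_null_comparison[OF _ lim]) (use 2 in auto)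
qed

lemma s_diff_null:
  assumes X: "F.conv X f" and Y: "F.conv Y f"
  shows "(\<lambda>n. s (X n) - s (Y n)) \<longlonglongrightarrow> 0"
proof -
  note XD = F.convD(1)[OF X] and YD = F.convD(1)[OF Y]
  obtain B B' where B: "\<And>n. F.nrm (X n) \<le> B" "\<And>n. F.nrm (Y n) \<le> B'"
    using F.conv_bounded[OF X] F.conv_bounded[OF Y] by blast
  have z: "(\<lambda>n. F.nrm (X n - Y n)) \<longlonglongrightarrow> 0"
    using F.conv_zero_nrm[of "\<lambda>n. X n - Y n"] F.conv_diff[OF X Y] by simp
  have zD: "X n - Y n \<in> D" for n using XD YD by (intro F.D_diff)
  have "s (X n) - s (Y n) = cinner (A (X n - Y n)) (X n) + cinner (A (Y n)) (X n - Y n)" for n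
    using clinear_on_diff[OF linear XD[of n] YD[of n]] by (simp add: cinner.diff_left cinner.diff_right)
  moreover have "(\<lambda>n. cinner (A (X n - Y n)) (X n) + cinner (A (Y n)) (X n - Y n)) \<longlonglongrightarrow> 0 + 0"
    by (intro tendsto_add A_null(1)[OF zD XD z B(1)] A_null(2)[OF zD YD z B(2)])
  ultimately show ?thesis by simp
qed

text \<open>This justifies the definite description in \<open>form_closure\<close>: the limit exists
  because \<open>s\<close> is continuous in the form norm, and \<open>s_diff_null\<close> makes it
  independent of the sequence.\<close>

lemma form_closure_lim:
  assumes X: "F.conv X f"
  shows "(\<lambda>n. s (X n)) \<longlonglongrightarrow> form_closure D s f"
proof -
  note XD = F.convD(1)[OF X]
  obtain B where B: "\<And>n. F.nrm (X n) \<le> B" using F.conv_bounded[OF X] by blast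
  have B0: "0 \<le> B" using B[of 0] F.nrm_nonneg[OF XD[of 0]] by linarith
  have "Cauchy (\<lambda>n. s (X n))"
  proof (rule CauchyI)
    fix e :: real assume e: "0 < e"
    define K where "K = 2 * C * B + 1"
    have K: "0 < K" using C_nonneg B0 by (auto simp: K_def intro: add_nonneg_pos)
    obtain N where N: "\<forall>m\<ge>N. \<forall>n\<ge>N. F.nrm (X m - X n) < e / K"
      using F.convD(3)[OF X, of "e / K"] e K by auto
    have "norm (s (X m) - s (X n)) < e" if "m \<ge> N" "n \<ge> N" for m n
    proof -
      have z: "X m - X n \<in> D" using XD by (intro F.D_diff)
      have "s (X m) - s (X n) = cinner (A (X m - X n)) (X m) + cinner (A (X n)) (X m - X n)"
        using clinear_on_diff[OF linear XD[of m] XD[of n]] by (simp add: cinner.diff_left cinner.diff_right)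
      then have "norm (s (X m) - s (X n)) \<le> cmod (cinner (A (X m - X n)) (X m)) + cmod (cinner (A (X n)) (X m - X n))"
        by (metis norm_triangle_ineq)
      also have "\<dots> \<le> C * F.nrm (X m - X n) * F.nrm (X m) + C * F.nrm (X n) * F.nrm (X m - X n)"
        by (intro add_mono A_nrm z XD)
      also have "\<dots> = (C * F.nrm (X m - X n)) * (F.nrm (X m) + F.nrm (X n))" by (simp add: algebra_simps)
      also have "\<dots> \<le> (C * F.nrm (X m - X n)) * (B + B)"
        using C_nonneg F.nrm_nonneg[OF z] B by (intro mult_left_mono add_mono) auto
      also have "\<dots> \<le> K * F.nrm (X m - X n)"
        using F.nrm_nonneg[OF z] by (simp add: K_def algebra_simps)
      also have "\<dots> < e" using N that K by (auto simp: field_simps)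
      finally show ?thesis .
    qed
    then show "\<exists>M. \<forall>m\<ge>M. \<forall>n\<ge>M. norm (s (X m) - s (X n)) < e" by blast
  qed
  then obtain z where z: "(\<lambda>n. s (X n)) \<longlonglongrightarrow> z" using Cauchy_convergent convergentD by blast
  have "form_closure D s f = z"
    unfolding form_closure_def
  proof (rule the_equality)
    show "\<exists>X. form_converges D s X f \<and> (\<lambda>n. s (X n)) \<longlonglongrightarrow> z" using X z conv_iff by blast
    fix z' assume "\<exists>X. form_converges D s X f \<and> (\<lambda>n. s (X n)) \<longlonglongrightarrow> z'"
    then obtain Y where Y: "F.conv Y f" "(\<lambda>n. s (Y n)) \<longlonglongrightarrow> z'" using conv_iff by blast
    have "(\<lambda>n. s (X n) - s (Y n)) \<longlonglongrightarrow> z - z'" by (intro tendsto_diff z Y(2))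
    then show "z' = z" using s_diff_null[OF X Y(1)] LIMSEQ_unique by fastforce
  qed
  then show ?thesis using z by simp
qed

lemma s_ge_nrm: "x \<in> D \<Longrightarrow> (F.nrm x)\<^sup>2 \<le> (1 + \<bar>1 - \<gamma>\<bar>) * (cmod (s x) + (norm x)\<^sup>2)"
proof -
  assume x: "x \<in> D"
  have "(F.nrm x)\<^sup>2 = Re (\<omega> * s x) + (1 - \<gamma>) * (norm x)\<^sup>2"
    using F.r_self[OF x] by (simp add: r_def power2_norm_eq_inner)
  also have "Re (\<omega> * s x) \<le> cmod (s x)"
    using complex_Re_le_cmod[of "\<omega> * s x"] by (simp add: norm_mult omega)
  also have "(1 - \<gamma>) * (norm x)\<^sup>2 \<le> \<bar>1 - \<gamma>\<bar> * (norm x)\<^sup>2" by (intro mult_right_mono) auto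
  also have "cmod (s x) + \<bar>1 - \<gamma>\<bar> * (norm x)\<^sup>2 \<le> (1 + \<bar>1 - \<gamma>\<bar>) * (cmod (s x) + (norm x)\<^sup>2)"
    by (simp add: algebra_simps)
  finally show ?thesis by simp
qed

lemma nrm_scaleC: "x \<in> D \<Longrightarrow> F.nrm (c *\<^sub>C x) = cmod c * F.nrm x"
proof -
  assume x: "x \<in> D"
  have "r (c *\<^sub>C x) (c *\<^sub>C x) = Re (c * cnj c * (\<omega> * s x + of_real (1 - \<gamma>) * cinner x x))"
    by (simp add: r_def inner_l2_def clinear_onD(3)[OF linear x] cinner_scaleC_left cinner_scaleC_right
        algebra_simps)
  also have "c * cnj c = of_real ((cmod c)\<^sup>2)" by (rule complex_norm_square[symmetric])
  also have "Re (of_real ((cmod c)\<^sup>2) * (\<omega> * s x + of_real (1 - \<gamma>) * cinner x x)) = (cmod c)\<^sup>2 * r x x"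
    by (simp add: r_def inner_l2_def)
  finally show ?thesis by (simp add: F.nrm_def real_sqrt_mult)
qed

text \<open>Representing elements of the form lie in the domain of an adjoint: the shift goes to the
  right-hand side, inserting \<open>\<i> *\<^sub>C y\<close> recovers the complex identity, and
  \<open>cnj \<omega>\<close> undoes the rotation.\<close>

lemma adjoint_dense:
  assumes x: "x \<in> D" and e: "0 < e"
  shows "\<exists>g k X. (\<forall>n. X n \<in> D \<and> F.nrm (x - X n) < e) \<and> X \<longlonglongrightarrow> g \<and>
    (\<forall>y\<in>D. cinner (A y) g = cinner y k)"
proof -
  obtain g h X where X: "\<And>n. X n \<in> D \<and> F.nrm (x - X n) < e" "X \<longlonglongrightarrow> g"
    "\<And>y. y \<in> D \<Longrightarrow> (\<lambda>n. r y (X n)) \<longlonglongrightarrow> inner y h"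
    using F.representing_dense[OF x e] by blast
  define h' where "h' = h - (1 - \<gamma>) *\<^sub>R g"
  have Re: "Re (\<omega> * cinner (A y) g) = Re (cinner y h')" if y: "y \<in> D" for y
  proof -
    have "(\<lambda>n. r y (X n)) \<longlonglongrightarrow> Re (\<omega> * cinner (A y) g) + (1 - \<gamma>) * inner y g"
      unfolding r_def by (intro tendsto_intros cinner.tendsto X(2))
    then have "Re (\<omega> * cinner (A y) g) + (1 - \<gamma>) * inner y g = inner y h"
      using X(3)[OF y] LIMSEQ_unique by blast
    then show ?thesis
      by (simp add: h'_def inner_l2_def cinner.diff_right cinner.scaleR_right)
  qed
  have eq: "\<omega> * cinner (A y) g = cinner y h'" if y: "y \<in> D" for y
  proof (rule complex_eqI)
    show "Re (\<omega> * cinner (A y) g) = Re (cinner y h')" by (rule Re[OF y])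
    have "Re (\<omega> * cinner (A (\<i> *\<^sub>C y)) g) = Re (cinner (\<i> *\<^sub>C y) h')"
      by (rule Re[OF csubspace_scale[OF D y]])
    moreover have "Re (\<omega> * cinner (A (\<i> *\<^sub>C y)) g) = - Im (\<omega> * cinner (A y) g)"
      by (simp add: clinear_onD(3)[OF linear y] cinner_scaleC_left)
    moreover have "Re (cinner (\<i> *\<^sub>C y) h') = - Im (cinner y h')" by (simp add: cinner_scaleC_left)
    ultimately show "Im (\<omega> * cinner (A y) g) = Im (cinner y h')" by simp
  qed
  have "cinner (A y) g = cinner y (\<omega> *\<^sub>C h')" if y: "y \<in> D" for y
  proof -
    have "cnj \<omega> * \<omega> = 1" using omega complex_norm_square[of \<omega>] by (simp add: mult.commute)
    then have "cinner (A y) g = cnj \<omega> * (\<omega> * cinner (A y) g)" by (simp flip: mult.assoc)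
    then show ?thesis using eq[OF y] by (simp add: cinner_scaleC_right)
  qed
  then show ?thesis using X by blast
qed

end

text \<open>The half-plane condition at \<open>X n\<close> plus a small multiple of \<open>h\<close>
  becomes, in the limit, an inequality whose linear term is a multiple of \<open>cinner g h\<close>.
  The multiples with phases \<open>1\<close> and \<open>\<i>\<close> annihilate both parts of this
  product.\<close>

lemma half_plane_closable:
  assumes A: "clinear_on D A" and omega: "cmod \<omega> = 1"
    and half: "\<And>x. x \<in> D \<Longrightarrow> \<gamma> * (norm x)\<^sup>2 \<le> Re (\<omega> * cinner (A x) x)"
    and X: "\<And>n. X n \<in> D" "X \<longlonglongrightarrow> 0" "(\<lambda>n. A (X n)) \<longlonglongrightarrow> g" and g: "g \<in> closure D"
  shows "g = 0"
proof (rule cinner_eq_zeroI[OF _ g])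
  note D = clinear_onD(1)[OF A]
  fix h assume h: "h \<in> D"
  have *: "Re (\<omega> * (cnj u * cinner g h)) = 0" if u: "cmod u = 1" for u
  proof -
    have "0 \<le> 2 * t * (Re (\<omega> * (cnj u * cinner g h)) / 2) + t\<^sup>2 * (Re (\<omega> * cinner (A h) h) - \<gamma> * (norm h)\<^sup>2)" for t
    proof -
      let ?c = "of_real t * u"
      have hc: "?c *\<^sub>C h \<in> D" by (rule csubspace_scale[OF D h])
      have Ah: "A (X n + ?c *\<^sub>C h) = A (X n) + ?c *\<^sub>C A h" for n
        using clinear_onD(2)[OF A X(1) hc] clinear_onD(3)[OF A h] by simp
      have L1: "(\<lambda>n. \<gamma> * (norm (X n + ?c *\<^sub>C h))\<^sup>2) \<longlonglongrightarrow> \<gamma> * (norm (0 + ?c *\<^sub>C h))\<^sup>2"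
        by (intro tendsto_intros X)
      have L2: "(\<lambda>n. Re (\<omega> * cinner (A (X n) + ?c *\<^sub>C A h) (X n + ?c *\<^sub>C h)))
        \<longlonglongrightarrow> Re (\<omega> * cinner (g + ?c *\<^sub>C A h) (0 + ?c *\<^sub>C h))"
        by (intro tendsto_intros cinner.tendsto X)
      have "\<gamma> * (norm (0 + ?c *\<^sub>C h))\<^sup>2 \<le> Re (\<omega> * cinner (g + ?c *\<^sub>C A h) (0 + ?c *\<^sub>C h))"
        using half[OF csubspace_add[OF D X(1) hc]] Ah by (intro LIMSEQ_le[OF L1 L2]) auto
      moreover have "(norm (0 + ?c *\<^sub>C h))\<^sup>2 = t\<^sup>2 * (norm h)\<^sup>2"
        using u by (simp add: norm_scaleC norm_mult power_mult_distrib)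
      moreover have "Re (\<omega> * cinner (g + ?c *\<^sub>C A h) (0 + ?c *\<^sub>C h))
        = t * Re (\<omega> * (cnj u * cinner g h)) + t\<^sup>2 * Re (\<omega> * cinner (A h) h)"
      proof -
        have "u * cnj u = 1" using u complex_norm_square[of u] by simp
        then have uu: "u * (cnj u * z) = z" for z by (simp flip: mult.assoc)
        have "\<omega> * cinner (g + ?c *\<^sub>C A h) (0 + ?c *\<^sub>C h)
          = of_real t * (\<omega> * (cnj u * cinner g h)) + of_real (t\<^sup>2) * (\<omega> * cinner (A h) h)"
          by (simp add: cinner.add_left cinner_scaleC_left cinner_scaleC_right power2_eq_square algebra_simps uu)
        moreover have "Re (of_real a * z + of_real b * w) = a * Re z + b * Re w" for a b z w by simp
        ultimately show ?thesis by metis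
      qed
      moreover have "0 \<le> 2 * t * (P / 2) + t\<^sup>2 * (Q - \<gamma> * n)" if "\<gamma> * (t\<^sup>2 * n) \<le> t * P + t\<^sup>2 * Q" for P Q n
        using that by (simp add: algebra_simps)
      ultimately show ?thesis by metis
    qed
    then have "Re (\<omega> * (cnj u * cinner g h)) / 2 = 0" by (rule real_quadratic_nonneg_imp_zero)
    then show ?thesis by simp
  qed
  have "\<omega> * cinner g h = 0"
    using *[of 1] *[of \<i>] by (intro complex_eqI) auto
  then show "cinner g h = 0" using omega by auto
qed

text \<open>The half-plane condition makes \<open>S\<close> closable, so that the closed graph theorem applies to \<open>S T\<^sup>-\<^sup>1\<close>.\<close>

lemma half_plane_relatively_bounded:
  fixes T S :: "'d::finite l2 \<Rightarrow> 'd l2"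
  assumes H: "closed H" and dense: "closure D = H"
    and T: "clinear_on D T" "bij_betw T D H" "\<And>x. x \<in> D \<Longrightarrow> norm x \<le> c * norm (T x)"
    and S: "clinear_on D S" "\<And>x. x \<in> D \<Longrightarrow> S x \<in> H" "cmod \<omega> = 1"
      "\<And>x. x \<in> D \<Longrightarrow> \<gamma> * (norm x)\<^sup>2 \<le> Re (\<omega> * cinner (S x) x)"
  shows "\<exists>C\<ge>0. \<forall>x\<in>D. norm (S x) \<le> C * norm (T x)"
proof -
  have D: "csubspace D" by (rule clinear_onD(1)[OF S(1)])
  have HS: "csubspace H" using csubspace_closure[OF D] dense by simp
  have sH: "subspace H" by (rule csubspace_imp_subspace[OF HS])
  define R where "R = inv_into D T"
  have R: "R y \<in> D" "T (R y) = y" if "y \<in> H" for y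
    using T(2) that unfolding R_def bij_betw_def by (auto intro: inv_into_into f_inv_into_f)
  have RT: "R (T x) = x" if "x \<in> D" for x
    using T(2) that unfolding R_def bij_betw_def by simp
  have R_add: "R (y + z) = R y + R z" if "y \<in> H" "z \<in> H" for y z
    using RT[OF csubspace_add[OF D R(1)[OF that(1)] R(1)[OF that(2)]]] that
    by (simp add: clinear_onD(2)[OF T(1)] R)
  have R_scale: "R (c *\<^sub>R y) = c *\<^sub>R R y" if "y \<in> H" for c y
    using RT[OF subspace_scale[OF csubspace_imp_subspace[OF D] R(1)[OF that]]] that
    by (simp add: clinear_on_scaleR[OF T(1)] R)
  have R_diff: "R (y - z) = R y - R z" if "y \<in> H" "z \<in> H" for y z
    using R_add[of y "(-1) *\<^sub>R z"] R_scale[of z "-1"] subspace_scale[OF sH, of z "-1"] that by simp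
  have "\<exists>C\<ge>0. \<forall>y\<in>H. norm (S (R y)) \<le> C * norm y"
  proof (rule closed_graph_seminorm[OF sH])
    fix X :: "nat \<Rightarrow> 'd l2"
    assume X: "\<And>n. X n \<in> H" and c: "\<And>e. 0 < e \<Longrightarrow> \<exists>N. \<forall>m\<ge>N. \<forall>n\<ge>N. norm (X m - X n) < e"
    have "Cauchy X" by (rule CauchyI) (rule c)
    then obtain x where x: "X \<longlonglongrightarrow> x" using Cauchy_convergent convergentD by blast
    then have "x \<in> H" using H X closed_sequentially by blast
    moreover have "(\<lambda>n. norm (X n - x)) \<longlonglongrightarrow> 0" using x by (simp add: tendsto_norm_zero LIM_zero)
    ultimately show "\<exists>x\<in>H. (\<lambda>n. norm (X n - x)) \<longlonglongrightarrow> 0" by blast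
  next
    fix y x B
    assume y: "\<And>n. y n \<in> H" and x: "x \<in> H" and B: "\<And>n. (\<Sum>i<n. norm (S (R (y i)))) \<le> B"
      and lim: "(\<lambda>n. norm ((\<Sum>i<n. y i) - x)) \<longlonglongrightarrow> 0"
    let ?s = "\<lambda>n. \<Sum>i<n. y i"
    have sn: "?s n \<in> H" for n using y by (intro subspace_sum[OF sH])
    have d: "?s n - x \<in> H" for n by (rule subspace_diff[OF sH sn x])
    have R0: "R 0 = 0" using R_scale[OF subspace_0[OF sH], of 0] by simp
    have SRsum: "S (R (?s n)) = (\<Sum>i<n. S (R (y i)))" for n
    proof (induction n)
      case 0
      then show ?case by (simp add: R0 clinear_on_zero[OF S(1)])
    next
      case (Suc n)
      then show ?case
        using R_add[OF sn[of n] y[of n]] clinear_onD(2)[OF S(1) R(1)[OF sn[of n]] R(1)[OF y[of n]]] by simp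
    qed
    have "summable (\<lambda>i. norm (S (R (y i))))"
      using B by (intro bounded_imp_summable[where B=B])
        (auto simp: lessThan_Suc_atMost[symmetric] simp del: sum.lessThan_Suc)
    then have "summable (\<lambda>i. S (R (y i)))"
    proof -
      have "Cauchy (\<lambda>n. \<Sum>i<n. S (R (y i)))"
      proof (rule CauchyI)
        fix e :: real assume e: "0 < e"
        obtain N where N: "\<forall>m\<ge>N. \<forall>n. norm (\<Sum>i\<in>{m..<n}. norm (S (R (y i)))) < e"
          using \<open>summable (\<lambda>i. norm (S (R (y i))))\<close> e unfolding summable_Cauchy by blast
        have *: "norm ((\<Sum>i<n. S (R (y i))) - (\<Sum>i<m. S (R (y i)))) < e" if "m \<ge> N" "m \<le> n" for m n
        proof -
          have "(\<Sum>i<n. S (R (y i))) - (\<Sum>i<m. S (R (y i))) = (\<Sum>i\<in>{m..<n}. S (R (y i)))"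
            using sum_diff_nat_ivl[of 0 m n "\<lambda>i. S (R (y i))"] that by (simp add: atLeast0LessThan)
          then have "norm ((\<Sum>i<n. S (R (y i))) - (\<Sum>i<m. S (R (y i)))) \<le> (\<Sum>i\<in>{m..<n}. norm (S (R (y i))))"
            by (simp add: norm_sum)
          also have "\<dots> \<le> norm (\<Sum>i\<in>{m..<n}. norm (S (R (y i))))" by simp
          also have "\<dots> < e" using N that by blast
          finally show ?thesis .
        qed
        have "norm ((\<Sum>i<m. S (R (y i))) - (\<Sum>i<n. S (R (y i)))) < e" if "m \<ge> N" "n \<ge> N" for m n
        proof (cases "m \<le> n")
          case True
          show ?thesis unfolding norm_minus_commute[of "\<Sum>i<m. S (R (y i))"] by (rule *[OF that(1) True])
        next
          case False
          show ?thesis by (rule *[OF that(2)]) (use False in simp)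
        qed
        then show "\<exists>M. \<forall>m\<ge>M. \<forall>n\<ge>M. norm ((\<Sum>i<m. S (R (y i))) - (\<Sum>i<n. S (R (y i)))) < e" by blast
      qed
      then show ?thesis unfolding summable_iff_convergent by (rule Cauchy_convergent)
    qed
    then obtain z where z: "(\<lambda>n. S (R (?s n))) \<longlonglongrightarrow> z"
      unfolding SRsum summable_iff_convergent convergent_def by blast
    have zH: "z \<in> H" using closed_sequentially[OF H, of "\<lambda>n. S (R (?s n))" z] z S(2) R(1) sn by blast
    \<comment> \<open>\<open>R (?s n - x)\<close> tends to \<open>0\<close> while its image under
      \<open>S\<close> tends to \<open>z - S (R x)\<close>, so closability identifies
      \<open>z\<close>.\<close>
    have "z - S (R x) = 0"
    proof (rule half_plane_closable[OF S(1,3,4)])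
      show "R (?s n - x) \<in> D" for n by (rule R(1)[OF d])
      have "(\<lambda>n. c * norm (?s n - x)) \<longlonglongrightarrow> c * 0" by (intro tendsto_intros lim)
      then have cl: "(\<lambda>n. c * norm (?s n - x)) \<longlonglongrightarrow> 0" by simp
      show "(\<lambda>n. R (?s n - x)) \<longlonglongrightarrow> 0"
      proof (rule Lim_null_comparison[OF always_eventually cl], rule allI)
        show "norm (R (?s n - x)) \<le> c * norm (?s n - x)" for n
          using T(3)[OF R(1)[OF d[of n]]] R(2)[OF d[of n]] by simp
      qed
      have "S (R (?s n - x)) = S (R (?s n)) - S (R x)" for n
        using R_diff[OF sn[of n] x] clinear_on_diff[OF S(1) R(1)[OF sn[of n]] R(1)[OF x]] by simp
      then show "(\<lambda>n. S (R (?s n - x))) \<longlonglongrightarrow> z - S (R x)"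
        using z by (simp add: tendsto_diff)
      show "z - S (R x) \<in> closure D"
        unfolding dense by (rule subspace_diff[OF sH zH S(2)[OF R(1)[OF x]]])
    qed
    then have "(\<lambda>n. norm (S (R (?s n)))) \<longlonglongrightarrow> norm (S (R x))" using tendsto_norm[OF z] by simp
    moreover have "norm (S (R (?s n))) \<le> B" for n
      unfolding SRsum using norm_sum[of "\<lambda>i. S (R (y i))" "{..<n}"] B[of n] by linarith
    ultimately show "norm (S (R x)) \<le> B" by (intro LIMSEQ_le_const2) auto
  next
    show "norm (S (R (y + z))) \<le> norm (S (R y)) + norm (S (R z))" if "y \<in> H" "z \<in> H" for y z
      using norm_triangle_ineq clinear_onD(2)[OF S(1)] R that R_add by simp
    show "norm (S (R (c *\<^sub>R y))) = \<bar>c\<bar> * norm (S (R y))" if "y \<in> H" for c y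
      using clinear_on_scaleR[OF S(1)] R that R_scale by simp
  qed (auto simp: norm_triangle_ineq)
  then obtain C where C: "C \<ge> 0" "\<And>y. y \<in> H \<Longrightarrow> norm (S (R y)) \<le> C * norm y" by blast
  have "norm (S x) \<le> C * norm (T x)" if "x \<in> D" for x
    using C(2)[of "T x"] RT[OF that] T(2) that by (auto simp: bij_betw_def)
  then show ?thesis using C(1) by blast
qed

section \<open>Weak limits of approximate eigenfunctions\<close>

definition corthonormal :: "'d::finite l2 set \<Rightarrow> bool" where
  "corthonormal F \<longleftrightarrow> (\<forall>e\<in>F. \<forall>e'\<in>F. cinner e e' = (if e = e' then 1 else 0))"

definition cproj :: "'d::finite l2 set \<Rightarrow> 'd l2 \<Rightarrow> 'd l2" where
  "cproj F x = (\<Sum>e\<in>F. cinner x e *\<^sub>C e)"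

lemma cinner_cproj:
  assumes "finite F" "corthonormal F" "e \<in> F"
  shows "cinner (cproj F x) e = cinner x e"
proof -
  have "cinner (cproj F x) e = (\<Sum>e'\<in>F. cinner x e' * cinner e' e)"
    by (simp add: cproj_def cinner.sum_left cinner_scaleC_left)
  also have "\<dots> = (\<Sum>e'\<in>F. if e' = e then cinner x e' else 0)"
    by (rule sum.cong) (use assms in \<open>auto simp: corthonormal_def\<close>)
  finally show ?thesis using assms by simp
qed

lemma cinner_cproj_commute: "cinner (cproj F x) y = cinner x (cproj F y)"
proof -
  have "cinner (cproj F x) y = (\<Sum>e\<in>F. cinner x e * cinner e y)"
    by (simp add: cproj_def cinner.sum_left cinner_scaleC_left)
  also have "\<dots> = (\<Sum>e\<in>F. cnj (cinner y e) * cinner x e)"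
    by (rule sum.cong) (use cinner_commute in \<open>auto simp: mult.commute\<close>)
  also have "\<dots> = cinner x (cproj F y)"
    by (simp add: cproj_def cinner.sum_right cinner_scaleC_right)
  finally show ?thesis .
qed

lemma cproj_in: "csubspace D \<Longrightarrow> F \<subseteq> D \<Longrightarrow> cproj F x \<in> D"
  unfolding cproj_def by (intro csubspace_sum csubspace_scale) auto

lemma cproj_add: "cproj F (x + y) = cproj F x + cproj F y"
  by (simp add: cproj_def cinner.add_left scaleC.add_left sum.distrib)

lemma cproj_scaleR: "cproj F (c *\<^sub>R x) = c *\<^sub>R cproj F x"
  by (simp add: cproj_def cinner.scaleR_left scaleC.scaleR_left scaleR_right.sum)

text \<open>A vector outside the image, joined to the image of a basis, would be an independent set
  with one element more than the basis.\<close>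

lemma linear_on_span_injective_imp_surjective:
  fixes f :: "'a::real_vector \<Rightarrow> 'a"
  assumes lin: "linear f" and fin: "finite B" and into: "f ` span B \<subseteq> span B"
    and inj: "inj_on f (span B)"
  shows "f ` span B = span B"
proof (rule ccontr)
  assume neq: "f ` span B \<noteq> span B"
  obtain B' where B': "B' \<subseteq> B" "independent B'" "B \<subseteq> span B'"
    using real_vector.maximal_independent_subset[of B] by blast
  have finB': "finite B'" using B'(1) fin finite_subset by blast
  have sp: "span B' = span B" using B' span_mono span_minimal subspace_span by blast
  have ind: "independent (f ` B')"
    using linear_independent_injective_image[OF lin B'(2)] inj unfolding sp by blast
  have inj': "inj_on f B'"
    by (rule inj_on_subset[OF inj]) (use B'(1) span_superset[of B] in blast)
  obtain v where v: "v \<in> span B" "v \<notin> f ` span B" using neq into by blast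
  have "v \<notin> span (f ` B')"
    using v(2) linear_span_image[OF lin, of B'] sp by blast
  then have ind': "independent (insert v (f ` B'))"
    using ind by (simp add: independent_insertI)
  have "insert v (f ` B') \<subseteq> span B'" using v(1) into B'(1) span_superset sp by blast
  then have "card (insert v (f ` B')) \<le> card B'"
    using real_vector.independent_span_bound[OF finB' ind'] by blast
  moreover have "v \<notin> f ` B'" using \<open>v \<notin> span (f ` B')\<close> span_base by metis
  ultimately show False using finB' inj' by (simp add: card_image)
qed

text \<open>\<open>T\<close> stands for \<open>A - \<mu>B\<close> and \<open>nrm\<close> for the
  form norm of \<open>A\<close>. \<open>separated\<close> says \<open>\<mu> \<notin> W\<close>, and
  \<open>nrm_le\<close> reflects that the form of \<open>A\<close> is recovered from those of
  \<open>T\<close> and \<open>B\<close>.\<close>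

locale pencil_form =
  fixes D H :: "'d::finite l2 set" and T B :: "'d l2 \<Rightarrow> 'd l2" and nrm :: "'d l2 \<Rightarrow> real" and C C1 :: real
  assumes T: "clinear_on D T" and T_bij: "bij_betw T D H" and dense: "closure D = H"
    and norm_le: "x \<in> D \<Longrightarrow> norm x \<le> nrm x"
    and nrm_triangle: "x \<in> D \<Longrightarrow> y \<in> D \<Longrightarrow> nrm (x + y) \<le> nrm x + nrm y"
    and nrm_scale: "x \<in> D \<Longrightarrow> nrm (c *\<^sub>C x) = cmod c * nrm x"
    and T_bound: "x \<in> D \<Longrightarrow> y \<in> D \<Longrightarrow> cmod (cinner (T x) y) \<le> C * nrm x * nrm y"
    and B_bound: "x \<in> D \<Longrightarrow> cmod (cinner (B x) x) \<le> C * (nrm x)\<^sup>2"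
    and C: "0 \<le> C" "0 \<le> C1"
    and nrm_le: "x \<in> D \<Longrightarrow> (nrm x)\<^sup>2 \<le> C1 * (cmod (cinner (T x) x) + cmod (cinner (B x) x) + (norm x)\<^sup>2)"
    and B_scale: "x \<in> D \<Longrightarrow> B (c *\<^sub>C x) = c *\<^sub>C B x"
    and separated: "\<And>x. (\<And>n. x n \<in> D) \<Longrightarrow> (\<And>n. norm (x n) = 1) \<Longrightarrow> weakly_null x \<Longrightarrow>
      \<not> (\<lambda>n. cmod (cinner (T (x n)) (x n)) / (1 + cmod (cinner (B (x n)) (x n)))) \<longlonglongrightarrow> 0"
begin

abbreviation t :: "'d l2 \<Rightarrow> complex" where "t x \<equiv> cinner (T x) x"
abbreviation b :: "'d l2 \<Rightarrow> complex" where "b x \<equiv> cinner (B x) x"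

lemmas D = clinear_onD(1)[OF T]
lemmas D_add = csubspace_add[OF D]
lemmas D_diff = csubspace_diff[OF D]
lemmas D_scale = csubspace_scale[OF D]

lemma nrm_nonneg: "x \<in> D \<Longrightarrow> 0 \<le> nrm x"
  using norm_le[of x] norm_ge_zero[of x] by linarith

lemma nrm_triangle_diff: "x \<in> D \<Longrightarrow> y \<in> D \<Longrightarrow> nrm (x - y) \<le> nrm x + nrm y"
  using nrm_triangle[of x "(-1) *\<^sub>C y"] nrm_scale[of y "-1"] D_scale[of y "-1"] by simp

lemma nrm_sum: "(\<And>i. i \<in> I \<Longrightarrow> x i \<in> D) \<Longrightarrow> nrm (\<Sum>i\<in>I. x i) \<le> (\<Sum>i\<in>I. nrm (x i))"
proof (induction I rule: infinite_finite_induct)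
  case (insert i I)
  have "nrm (x i + (\<Sum>i\<in>I. x i)) \<le> nrm (x i) + nrm (\<Sum>i\<in>I. x i)"
    using insert by (intro nrm_triangle csubspace_sum[OF D]) auto
  then show ?case using insert by simp
qed (use nrm_scale[of 0 0] csubspace_0[OF D] in \<open>auto simp: scaleC.zero_left\<close>)

lemma t_diff:
  assumes "x \<in> D" "y \<in> D"
  shows "t (x - y) = t x - cinner (T x) y - cinner (T y) x + t y"
  using clinear_on_diff[OF T assms] by (simp add: cinner.diff_left cinner.diff_right)

lemma t_scaleR: "x \<in> D \<Longrightarrow> t (c *\<^sub>R x) = of_real (c\<^sup>2) * t x"
  by (simp add: clinear_on_scaleR[OF T] cinner.scaleR_left cinner.scaleR_right scaleR_conv_of_real power2_eq_square)

lemma b_scaleR: "x \<in> D \<Longrightarrow> b (c *\<^sub>R x) = of_real (c\<^sup>2) * b x"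
  using B_scale[of x "of_real c"]
  by (simp add: scaleC_of_real cinner.scaleR_left cinner.scaleR_right scaleR_conv_of_real power2_eq_square)

text \<open>Otherwise one could build an orthonormal, hence weakly null, sequence contradicting
  \<open>separated\<close>.\<close>

lemma coercive_finite_codimension:
  shows "\<exists>F \<epsilon>. finite F \<and> F \<subseteq> D \<and> corthonormal F \<and> 0 < \<epsilon> \<and>
    (\<forall>x\<in>D. (\<forall>e\<in>F. cinner x e = 0) \<longrightarrow> \<epsilon> * ((norm x)\<^sup>2 + cmod (b x)) \<le> cmod (t x))"
proof (rule ccontr)
  assume contra: "\<not> ?thesis"
  have step: "\<exists>x\<in>D. (\<forall>e\<in>F. cinner x e = 0) \<and> norm x = 1 \<and> cmod (t x) < \<epsilon> * (1 + cmod (b x))"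
    if F: "finite F" "F \<subseteq> D" "corthonormal F" and \<epsilon>: "0 < \<epsilon>" for F \<epsilon>
  proof -
    have "\<not> (\<forall>x\<in>D. (\<forall>e\<in>F. cinner x e = 0) \<longrightarrow> \<epsilon> * ((norm x)\<^sup>2 + cmod (b x)) \<le> cmod (t x))"
      using contra F \<epsilon> by blast
    then obtain x where x: "x \<in> D" "\<forall>e\<in>F. cinner x e = 0" "cmod (t x) < \<epsilon> * ((norm x)\<^sup>2 + cmod (b x))"
      by (auto simp: not_le)
    have x0: "x \<noteq> 0"
    proof
      assume "x = 0"
      then show False using x(3) by (simp add: cinner.zero_right)
    qed
    define c where "c = inverse (norm x)"
    have c: "0 < c" "c * norm x = 1" using x0 by (auto simp: c_def)
    let ?y = "c *\<^sub>R x"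
    have "?y \<in> D" using x(1) D_scale[of x "of_real c"] by (simp add: scaleC_of_real)
    moreover have "\<forall>e\<in>F. cinner ?y e = 0" using x(2) by (simp add: cinner.scaleR_left)
    moreover have "norm ?y = 1" using c by simp
    moreover have "cmod (t ?y) < \<epsilon> * (1 + cmod (b ?y))"
    proof -
      have "c\<^sup>2 * cmod (t x) < c\<^sup>2 * (\<epsilon> * ((norm x)\<^sup>2 + cmod (b x)))" using x(3) c by simp
      also have "\<dots> = \<epsilon> * ((c * norm x)\<^sup>2 + c\<^sup>2 * cmod (b x))" by (simp add: power_mult_distrib algebra_simps)
      finally show ?thesis using c by (simp add: t_scaleR[OF x(1)] b_scaleR[OF x(1)] norm_mult del: of_real_power)
    qed
    ultimately show ?thesis by blast
  qed
  \<comment> \<open>State of the construction: the orthonormal set found so far and a unit vector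
    orthogonal to it that violates coercivity with constant \<open>1 / Suc n\<close>.\<close>
  let ?P = "\<lambda>n (F, x). finite F \<and> F \<subseteq> D \<and> corthonormal F \<and> x \<in> D \<and> (\<forall>e\<in>F. cinner x e = 0) \<and> norm x = 1 \<and>
    cmod (t x) < inverse (real (Suc n)) * (1 + cmod (b x))"
  let ?Q = "\<lambda>n (F, x) (F', x'). F' = insert x F"
  have "\<exists>z. \<forall>n. ?P n (z n) \<and> ?Q n (z n) (z (Suc n))"
  proof (rule dependent_nat_choice)
    show "\<exists>z. ?P 0 z" using step[of "{}" 1] by (auto simp: corthonormal_def)
    fix z n assume P: "?P n z"
    obtain F x where z: "z = (F, x)" by force
    have x: "cinner x x = 1" using P z by (simp add: cinner_self_norm)
    have "corthonormal (insert x F)"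
      unfolding corthonormal_def
    proof (intro ballI)
      fix e e' assume "e \<in> insert x F" "e' \<in> insert x F"
      moreover have "cinner e x = 0" "e \<noteq> x" if "e \<in> F" for e
        using that P z x cinner_commute[of e x] by auto
      ultimately show "cinner e e' = (if e = e' then 1 else 0)"
        using P z x by (auto simp: corthonormal_def)
    qed
    then obtain x' where "x' \<in> D" "\<forall>e\<in>insert x F. cinner x' e = 0" "norm x' = 1"
      "cmod (t x') < inverse (real (Suc (Suc n))) * (1 + cmod (b x'))"
      using step[of "insert x F" "inverse (real (Suc (Suc n)))"] P z by auto
    then show "\<exists>z'. ?P (Suc n) z' \<and> ?Q n z z'"
      using P z \<open>corthonormal (insert x F)\<close> by (intro exI[of _ "(insert x F, x')"]) auto
  qed
  then obtain z where z: "\<forall>n. ?P n (z n) \<and> ?Q n (z n) (z (Suc n))" by (elim exE)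
  define F x where "F n = fst (z n)" and "x n = snd (z n)" for n
  have P: "x n \<in> D" "\<forall>e\<in>F n. cinner (x n) e = 0" "norm (x n) = 1"
    "cmod (t (x n)) < inverse (real (Suc n)) * (1 + cmod (b (x n)))" "F (Suc n) = insert (x n) (F n)" for n
    using spec[OF z, of n] by (auto simp: F_def x_def split: prod.splits)
  have mem: "x j \<in> F (Suc j + k)" for j k by (induction k) (auto simp: P(5))
  have "weakly_null x"
  proof (rule weakly_nullI_self)
    show "norm (x n) \<le> 1" for n using P(3)[of n] by simp
    show "(\<lambda>n. cinner (x n) (x j)) \<longlonglongrightarrow> 0" for j
    proof (rule tendsto_eventually, rule eventually_sequentiallyI[of "Suc j"])
      show "cinner (x n) (x j) = 0" if "Suc j \<le> n" for n
        using mem[of j "n - Suc j"] that P(2)[of n] by simp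
    qed
  qed
  moreover have "(\<lambda>n. cmod (t (x n)) / (1 + cmod (b (x n)))) \<longlonglongrightarrow> 0"
  proof (rule Lim_null_comparison[OF always_eventually LIMSEQ_inverse_real_of_nat], rule allI)
    fix n
    have "0 < 1 + cmod (b (x n))" by (rule add_pos_nonneg) auto
    then show "norm (cmod (t (x n)) / (1 + cmod (b (x n)))) \<le> inverse (real (Suc n))"
      using P(4)[of n] by (simp add: divide_le_eq del: of_nat_Suc)
  qed
  ultimately show False using separated[of x] P(1,3) by blast
qed

text \<open>All that is known of \<open>f\<close> enters through \<open>adj\<close>: close to any
  \<open>x\<close> in the form norm there is a \<open>g\<close>, a limit of vectors of
  \<open>D\<close>, at which \<open>T\<close> has an adjoint value orthogonal to
  \<open>f\<close>.\<close>

lemma weak_limit_zero: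
  assumes y: "\<And>k. y k \<in> D" and bounded: "\<And>k. norm (y k) \<le> Cy" and weak: "weakly_null (\<lambda>k. y k - f)"
    and small: "(\<lambda>k. cmod (t (y k)) / (1 + cmod (b (y k)))) \<longlonglongrightarrow> 0"
    and adj: "\<And>x e. x \<in> D \<Longrightarrow> 0 < e \<Longrightarrow> \<exists>g k X. (\<forall>n. X n \<in> D \<and> nrm (x - X n) < e) \<and> X \<longlonglongrightarrow> g \<and>
      (\<forall>z\<in>D. cinner (T z) g = cinner z k) \<and> cinner f k = 0"
  shows "f = 0"
proof -
  obtain F \<epsilon> where F: "finite F" "F \<subseteq> D" "corthonormal F" and \<epsilon>: "0 < \<epsilon>"
    and coer: "\<And>x. x \<in> D \<Longrightarrow> (\<And>e. e \<in> F \<Longrightarrow> cinner x e = 0) \<Longrightarrow> \<epsilon> * ((norm x)\<^sup>2 + cmod (b x)) \<le> cmod (t x)"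
    using coercive_finite_codimension by metis
  let ?P = "cproj F"
  note P_D = cproj_in[OF D F(2)]
  have orth: "cinner (x - ?P x) e = 0" if "e \<in> F" for x e
    using cinner_cproj[OF F(1,3) that] by (simp add: cinner.diff_left)
  \<comment> \<open>The complex span of \<open>F\<close>, written as a real span so that the
    dimension count applies.\<close>
  define N where "N = span (F \<union> (\<lambda>e. \<i> *\<^sub>C e) ` F)"
  have P_N: "?P x \<in> N" for x
    unfolding cproj_def N_def
  proof (rule span_sum)
    fix e assume e: "e \<in> F"
    have eq: "cinner x e *\<^sub>C e = Re (cinner x e) *\<^sub>R e + Im (cinner x e) *\<^sub>R (\<i> *\<^sub>C e)"
    proof -
      have "cinner x e *\<^sub>C e = (of_real (Re (cinner x e)) + of_real (Im (cinner x e)) * \<i>) *\<^sub>C e"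
        by (metis complex_eq mult.commute)
      then show ?thesis by (simp add: scaleC.add_left flip: scaleC_of_real)
    qed
    show "cinner x e *\<^sub>C e \<in> span (F \<union> (\<lambda>e. \<i> *\<^sub>C e) ` F)"
      unfolding eq by (intro span_add span_scale span_base) (use e in auto)
  qed
  have N_P: "?P \<nu> = \<nu>" if "\<nu> \<in> N" for \<nu>
    using that unfolding N_def
  proof (induction rule: span_induct)
    case base
    show ?case
      by (auto simp: subspace_def cproj_add cproj_scaleR) (simp add: cproj_def cinner.zero_left scaleC.zero_left)
  next
    case (step v)
    have Pe: "?P e = e" if "e \<in> F" for e
    proof -
      have "?P e = (\<Sum>e'\<in>F. if e' = e then e else 0)"
        unfolding cproj_def by (rule sum.cong) (use that F(3) in \<open>auto simp: corthonormal_def scaleC.zero_left\<close>)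
      then show ?thesis using that F(1) by simp
    qed
    have Pi: "?P (\<i> *\<^sub>C x) = \<i> *\<^sub>C ?P x" for x
      by (simp add: cproj_def cinner_scaleC_left scaleC.sum_right)
    show ?case using step Pe Pi by auto
  qed
  have N_D: "\<nu> \<in> D" if "\<nu> \<in> N" for \<nu> using N_P[OF that] P_D by metis
  have DH: "D \<subseteq> H" using dense closure_subset by blast
  define R where "R = inv_into D T"
  have R: "R z \<in> D" "T (R z) = z" if "z \<in> H" for z
    using T_bij that unfolding R_def bij_betw_def by (auto intro: inv_into_into f_inv_into_f)
  have T_inj: "x = x'" if "x \<in> D" "x' \<in> D" "T x = T x'" for x x'
    using T_bij that by (auto simp: bij_betw_def inj_on_def)
  have PH: "?P x \<in> H" for x using P_D DH by auto
  \<comment> \<open>The compression of \<open>T\<^sup>-\<^sup>1\<close> to the exceptional subspace.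
    Surjectivity on \<open>N\<close> yields \<open>x\<close> with \<open>T x \<in> N\<close> and
    \<open>?P x = ?P f\<close>.\<close>
  define L where "L x = ?P (R (?P x))" for x
  have lin: "linear L"
  proof (rule linearI)
    fix x x' c
    have P2: "?P x + ?P x' \<in> H" using PH[of "x + x'"] by (simp only: cproj_add)
    have "R (?P x + ?P x') = R (?P x) + R (?P x')"
      by (rule T_inj[OF R(1)[OF P2] D_add[OF R(1)[OF PH] R(1)[OF PH]]])
        (simp only: R(2)[OF P2] R(2)[OF PH] clinear_onD(2)[OF T R(1)[OF PH] R(1)[OF PH]])
    then show "L (x + x') = L x + L x'" by (simp add: L_def cproj_add)
    have cR: "c *\<^sub>R R (?P x) \<in> D" using D_scale[OF R(1)[OF PH], of "of_real c"] by (simp add: scaleC_of_real)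
    have cP: "c *\<^sub>R ?P x \<in> H" using PH[of "c *\<^sub>R x"] by (simp only: cproj_scaleR)
    have "R (c *\<^sub>R ?P x) = c *\<^sub>R R (?P x)"
      by (rule T_inj[OF R(1)[OF cP] cR])
        (simp only: R(2)[OF cP] R(2)[OF PH] clinear_on_scaleR[OF T R(1)[OF PH]])
    then show "L (c *\<^sub>R x) = c *\<^sub>R L x" by (simp add: L_def cproj_scaleR)
  qed
  have "L ` N = N"
    unfolding N_def
  proof (rule linear_on_span_injective_imp_surjective[OF lin])
    show "finite (F \<union> (\<lambda>e. \<i> *\<^sub>C e) ` F)" using F(1) by simp
    show "L ` span (F \<union> (\<lambda>e. \<i> *\<^sub>C e) ` F) \<subseteq> span (F \<union> (\<lambda>e. \<i> *\<^sub>C e) ` F)"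
      using P_N unfolding L_def N_def by blast
    \<comment> \<open>If \<open>m = T\<^sup>-\<^sup>1 \<nu>\<close> is orthogonal to
      \<open>F\<close>, then \<open>t m\<close> is the product of \<open>\<nu> \<in> N\<close> with
      \<open>m\<close>, hence zero, and coercivity leaves only \<open>m = 0\<close>.\<close>
    have "\<nu> = 0" if \<nu>: "\<nu> \<in> N" and L0: "L \<nu> = 0" for \<nu>
    proof -
      have \<nu>H: "\<nu> \<in> H" using N_D[OF \<nu>] DH by auto
      define m where "m = R \<nu>"
      have m: "m \<in> D" "T m = \<nu>" using R[OF \<nu>H] by (auto simp: m_def)
      have Pm: "?P m = 0" using L0 N_P[OF \<nu>] by (simp add: L_def m_def)
      have "cinner m e = 0" if "e \<in> F" for e
        using cinner_cproj[OF F(1,3) that, of m] Pm by (simp add: cinner.zero_left)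
      then have "\<epsilon> * ((norm m)\<^sup>2 + cmod (b m)) \<le> cmod (t m)" by (rule coer[OF m(1)])
      moreover have "t m = 0"
        using cinner_cproj_commute[of F \<nu> m] N_P[OF \<nu>] Pm m(2) by (simp add: cinner.zero_right)
      ultimately have "\<epsilon> * ((norm m)\<^sup>2 + cmod (b m)) \<le> 0" by simp
      then have "(norm m)\<^sup>2 + cmod (b m) \<le> 0" using \<epsilon> by (simp add: mult_le_0_iff)
      then have "(norm m)\<^sup>2 \<le> 0" using norm_ge_zero[of "b m"] by linarith
      then have "m = 0" by simp
      then show ?thesis using m(2) clinear_on_zero[OF T] by simp
    qed
    then show "inj_on L (span (F \<union> (\<lambda>e. \<i> *\<^sub>C e) ` F))"
      unfolding linear_inj_on_iff_eq_0[OF lin subspace_span] N_def[symmetric]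
      using linear_inj_on_iff_eq_0[OF lin, of N] by (auto simp: N_def)
  qed
  then obtain \<nu> where \<nu>: "\<nu> \<in> N" "L \<nu> = ?P f" using P_N[of f] by (metis image_iff)
  have \<nu>H: "\<nu> \<in> H" using N_D[OF \<nu>(1)] DH by auto
  define x where "x = R \<nu>"
  have x: "x \<in> D" "T x = \<nu>" "?P x = ?P f"
    using R[OF \<nu>H] \<nu>(2) N_P[OF \<nu>(1)] by (auto simp: x_def L_def)
  have weak': "(\<lambda>k. cinner (y k) g) \<longlonglongrightarrow> cinner f g" for g
    using weak by (simp add: weakly_null_def cinner.diff_left LIM_zero_iff)
  define C3 where "C3 = (\<Sum>e\<in>F. Cy * norm e * nrm e)"
  have Cy: "0 \<le> Cy" using bounded[of 0] norm_ge_zero order_trans by blast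
  have nF: "0 \<le> nrm e" if "e \<in> F" for e using nrm_nonneg F(2) that by auto
  have C3: "0 \<le> C3" unfolding C3_def using Cy nF by (intro sum_nonneg mult_nonneg_nonneg) auto
  have nP: "nrm (?P z) \<le> (\<Sum>e\<in>F. cmod (cinner z e) * nrm e)" for z
  proof -
    have "nrm (?P z) \<le> (\<Sum>e\<in>F. nrm (cinner z e *\<^sub>C e))"
      unfolding cproj_def using F(2) by (intro nrm_sum D_scale) auto
    also have "\<dots> = (\<Sum>e\<in>F. cmod (cinner z e) * nrm e)"
      using F(2) by (intro sum.cong) (auto simp: nrm_scale)
    finally show ?thesis .
  qed
  have nPy: "nrm (?P (y k)) \<le> C3" for k
  proof (rule order_trans[OF nP], unfold C3_def, rule sum_mono)
    fix e assume e: "e \<in> F"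
    have "cmod (cinner (y k) e) \<le> Cy * norm e"
      using norm_cinner_le[of "y k" e] mult_right_mono[OF bounded[of k], of "norm e"] by simp
    then show "cmod (cinner (y k) e) * nrm e \<le> Cy * norm e * nrm e"
      using nF[OF e] by (rule mult_right_mono)
  qed
  \<comment> \<open>On vectors orthogonal to \<open>F\<close>, coercivity and \<open>nrm_le\<close>
    let \<open>t\<close> control the full form norm.\<close>
  define C4 where "C4 = C1 * (1 + 1 / \<epsilon>)"
  have C4: "0 \<le> C4" using C(2) \<epsilon> by (simp add: C4_def)
  have coer': "(nrm m)\<^sup>2 \<le> C4 * cmod (t m)" if m: "m \<in> D" "\<And>e. e \<in> F \<Longrightarrow> cinner m e = 0" for m
  proof -
    have "(norm m)\<^sup>2 + cmod (b m) \<le> cmod (t m) / \<epsilon>" using coer[OF m] \<epsilon> by (simp add: field_simps)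
    then have "cmod (t m) + cmod (b m) + (norm m)\<^sup>2 \<le> (1 + 1 / \<epsilon>) * cmod (t m)" by (simp add: algebra_simps)
    then have "C1 * (cmod (t m) + cmod (b m) + (norm m)\<^sup>2) \<le> C1 * ((1 + 1 / \<epsilon>) * cmod (t m))"
      using C(2) by (rule mult_left_mono)
    then show ?thesis using nrm_le[OF m(1)] by (simp add: C4_def mult.assoc)
  qed
  define \<delta> where "\<delta> k = cmod (t (y k)) / (1 + cmod (b (y k)))" for k
  have \<delta>: "\<delta> \<longlonglongrightarrow> 0" "0 \<le> \<delta> k" for k
    using small by (auto simp: \<delta>_def[abs_def] \<delta>_def intro!: divide_nonneg_nonneg)
  have ty: "cmod (t (y k)) \<le> \<delta> k * (1 + C * (nrm (y k))\<^sup>2)" for k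
  proof -
    have "0 < 1 + cmod (b (y k))" by (rule add_pos_nonneg) auto
    then have "cmod (t (y k)) = \<delta> k * (1 + cmod (b (y k)))" by (simp add: \<delta>_def)
    also have "\<dots> \<le> \<delta> k * (1 + C * (nrm (y k))\<^sup>2)"
      using B_bound[OF y[of k]] \<delta>(2)[of k] by (intro mult_left_mono) auto
    finally show ?thesis .
  qed
  \<comment> \<open>Coercivity at \<open>y k - ?P (y k)\<close> gives
    \<open>Y\<^sup>2 \<le> \<alpha> + \<beta> * Y\<close> for \<open>Y = nrm (y k)\<close>, once
    \<open>\<delta> k\<close> is so small that half of \<open>Y\<^sup>2\<close> absorbs the term
    with \<open>\<delta> k * Y\<^sup>2\<close>.\<close>
  have bound_y: "\<exists>K. \<forall>\<^sub>F k in sequentially. nrm (y k) \<le> K"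
  proof -
    define \<alpha> where "\<alpha> = 4 * C4 + 4 * C4 * C * C3\<^sup>2 + 4 * C3\<^sup>2"
    define \<beta> where "\<beta> = 8 * C4 * C * C3"
    have "\<forall>\<^sub>F k in sequentially. \<delta> k < 1 / (4 * C4 * C + 1)"
      using C4 C by (intro order_tendstoD(2)[OF \<delta>(1)]) (auto intro!: divide_pos_pos add_nonneg_pos)
    then have "\<forall>\<^sub>F k in sequentially. nrm (y k) \<le> 1 + \<alpha> + \<beta>"
    proof eventually_elim
      case (elim k)
      define Y where "Y = nrm (y k)"
      have Y: "0 \<le> Y" using nrm_nonneg[OF y] by (simp add: Y_def)
      have pos: "0 < 4 * C4 * C + 1" using C4 C by (intro add_nonneg_pos) auto
      have d: "\<delta> k * (4 * C4 * C + 1) \<le> 1" using elim pos by (simp add: field_simps)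
      have d4: "4 * C4 * C * \<delta> k \<le> 1" "\<delta> k \<le> 1"
      proof -
        have "0 \<le> 4 * C4 * C * \<delta> k" using C4 C \<delta>(2)[of k] by simp
        then show "4 * C4 * C * \<delta> k \<le> 1" "\<delta> k \<le> 1" using d \<delta>(2)[of k] by (auto simp: algebra_simps)
      qed
      let ?p = "?P (y k)"
      let ?m = "y k - ?p"
      have m: "?m \<in> D" by (rule D_diff[OF y P_D])
      have np: "0 \<le> nrm ?p" "nrm ?p \<le> C3" using nrm_nonneg[OF P_D] nPy by auto
      have "cmod (t ?m) \<le> cmod (t (y k)) + cmod (cinner (T (y k)) ?p) + cmod (cinner (T ?p) (y k)) + cmod (t ?p)"
        unfolding t_diff[OF y P_D]
        by (rule order_trans[OF norm_triangle_ineq]) (intro add_right_mono order_trans[OF norm_triangle_ineq4], simp add: norm_triangle_ineq4)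
      also have "\<dots> \<le> \<delta> k * (1 + C * Y\<^sup>2) + C * Y * nrm ?p + C * nrm ?p * Y + C * nrm ?p * nrm ?p"
        unfolding Y_def by (intro add_mono ty T_bound y P_D)
      also have "\<dots> \<le> \<delta> k * (1 + C * Y\<^sup>2) + C * Y * C3 + C * C3 * Y + C * C3 * C3"
        using np C(1) Y C3 by (intro add_mono mult_mono mult_left_mono mult_right_mono order_refl mult_nonneg_nonneg) auto
      finally have tm: "cmod (t ?m) \<le> \<delta> k * (1 + C * Y\<^sup>2) + 2 * C * C3 * Y + C * C3\<^sup>2"
        by (simp add: power2_eq_square algebra_simps)
      have "Y \<le> nrm ?m + C3"
        using nrm_triangle[OF m P_D[of "y k"]] np by (simp add: Y_def)
      then have "Y\<^sup>2 \<le> (nrm ?m + C3)\<^sup>2" using Y by (rule power_mono)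
      also have "\<dots> \<le> 2 * (nrm ?m)\<^sup>2 + 2 * C3\<^sup>2"
        using zero_le_power2[of "nrm ?m - C3"] by (simp add: power2_eq_square algebra_simps)
      also have "\<dots> \<le> 2 * (C4 * (\<delta> k * (1 + C * Y\<^sup>2) + 2 * C * C3 * Y + C * C3\<^sup>2)) + 2 * C3\<^sup>2"
        using order_trans[OF coer'[OF m orth] mult_left_mono[OF tm C4]] by simp
      also have "\<dots> = 2 * C4 * \<delta> k + (4 * C4 * C * \<delta> k) * Y\<^sup>2 / 2 + 4 * C4 * C * C3 * Y + 2 * C4 * C * C3\<^sup>2 + 2 * C3\<^sup>2"
        by (simp add: algebra_simps)
      also have "\<dots> \<le> 2 * C4 * 1 + 1 * Y\<^sup>2 / 2 + 4 * C4 * C * C3 * Y + 2 * C4 * C * C3\<^sup>2 + 2 * C3\<^sup>2"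
      proof -
        have "2 * C4 * \<delta> k \<le> 2 * C4 * 1" using d4 C4 by (intro mult_left_mono) auto
        moreover have "(4 * C4 * C * \<delta> k) * Y\<^sup>2 / 2 \<le> 1 * Y\<^sup>2 / 2"
          using d4 by (intro divide_right_mono mult_right_mono) auto
        ultimately show ?thesis by linarith
      qed
      finally have "Y\<^sup>2 \<le> \<alpha> + \<beta> * Y" by (simp add: \<alpha>_def \<beta>_def algebra_simps)
      then have YY: "Y * Y \<le> \<alpha> + \<beta> * Y" by (simp add: power2_eq_square)
      have ab: "0 \<le> \<alpha>" "0 \<le> \<beta>" using C4 C C3 by (auto simp: \<alpha>_def \<beta>_def)
      show "nrm (y k) \<le> 1 + \<alpha> + \<beta>"
      proof (cases "Y \<le> 1")
        case True
        then show ?thesis using ab by (simp add: Y_def)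
      next
        case False
        then have "\<alpha> * 1 \<le> \<alpha> * Y" using ab by (intro mult_left_mono) auto
        then have "Y * Y \<le> (\<alpha> + \<beta>) * Y" using YY by (simp add: algebra_simps)
        then have "Y \<le> \<alpha> + \<beta>" using False by (simp add: mult_le_cancel_right)
        then show ?thesis by (simp add: Y_def)
      qed
    qed
    then show ?thesis by blast
  qed
  then obtain K0 where K0: "\<forall>\<^sub>F k in sequentially. nrm (y k) \<le> K0" by blast
  define K where "K = \<bar>K0\<bar> + nrm x"
  have K: "0 \<le> K" using nrm_nonneg[OF x(1)] by (simp add: K_def)
  have Kyx: "\<forall>\<^sub>F k in sequentially. nrm (y k) \<le> K \<and> nrm (y k - x) \<le> K"
    using K0
  proof eventually_elim
    case (elim k)
    then show ?case using nrm_triangle_diff[OF y[of k] x(1)] nrm_nonneg[OF x(1)] by (auto simp: K_def)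
  qed
  have null_prod: "(\<lambda>k. cinner (T (u k)) (v k)) \<longlonglongrightarrow> 0"
    if "\<And>k. u k \<in> D" "\<And>k. v k \<in> D" "\<forall>\<^sub>F k in sequentially. nrm (u k) * nrm (v k) \<le> w k" "w \<longlonglongrightarrow> 0" for u v w
  proof (rule Lim_null_comparison)
    show "\<forall>\<^sub>F k in sequentially. norm (cinner (T (u k)) (v k)) \<le> C * w k"
      using that(3)
    proof eventually_elim
      case (elim k)
      have "norm (cinner (T (u k)) (v k)) \<le> C * (nrm (u k) * nrm (v k))"
        using T_bound[OF that(1,2)] by (simp add: mult.assoc)
      also have "\<dots> \<le> C * w k" using elim C(1) by (rule mult_left_mono)
      finally show ?case .
    qed
    show "(\<lambda>k. C * w k) \<longlonglongrightarrow> 0" using tendsto_mult[OF tendsto_const that(4)] by simp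
  qed
  have ty0: "(\<lambda>k. t (y k)) \<longlonglongrightarrow> 0"
  proof (rule Lim_null_comparison)
    show "\<forall>\<^sub>F k in sequentially. norm (t (y k)) \<le> \<delta> k * (1 + C * K\<^sup>2)"
      using Kyx
    proof eventually_elim
      case (elim k)
      have "(nrm (y k))\<^sup>2 \<le> K\<^sup>2" using elim nrm_nonneg[OF y] by (intro power_mono) auto
      then have "\<delta> k * (1 + C * (nrm (y k))\<^sup>2) \<le> \<delta> k * (1 + C * K\<^sup>2)"
        using C(1) \<delta>(2)[of k] by (intro mult_left_mono add_left_mono) auto
      then show ?case using ty[of k] by linarith
    qed
    show "(\<lambda>k. \<delta> k * (1 + C * K\<^sup>2)) \<longlonglongrightarrow> 0" using tendsto_mult[OF \<delta>(1) tendsto_const] by simp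
  qed
  \<comment> \<open>Weak convergence of \<open>y k\<close> does not control \<open>T (y k)\<close>.
    So \<open>x\<close> is replaced by \<open>g\<close>, whose product with \<open>T (y k)\<close>
    equals that of \<open>y k\<close> with \<open>h\<close> and tends to
    \<open>cinner f h = 0\<close>; the error is uniform in \<open>k\<close> because
    \<open>nrm (y k)\<close> is bounded.\<close>
  have tyx: "(\<lambda>k. cinner (T (y k)) x) \<longlonglongrightarrow> 0"
  proof (rule LIMSEQ_I)
    fix e :: real assume e: "0 < e"
    define e' where "e' = e / (2 * (C * K + 1))"
    have CK: "0 < C * K + 1" using C(1) K by (intro add_nonneg_pos) auto
    have e': "0 < e'" using e CK by (simp add: e'_def)
    obtain g h X where g: "\<And>n. X n \<in> D \<and> nrm (x - X n) < e'" "X \<longlonglongrightarrow> g"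
      "\<And>z. z \<in> D \<Longrightarrow> cinner (T z) g = cinner z h" "cinner f h = 0"
      using adj[OF x(1) e'] by blast
    have "(\<lambda>k. cinner (y k) h) \<longlonglongrightarrow> 0" using weak'[of h] g(4) by simp
    then have "\<forall>\<^sub>F k in sequentially. norm (cinner (y k) h) < e / 2"
      using e order_tendstoD(2)[OF tendsto_norm_zero, of _ sequentially "e / 2"] by fastforce
    then have "\<forall>\<^sub>F k in sequentially. norm (cinner (T (y k)) x) < e"
      using Kyx
    proof eventually_elim
      case (elim k)
      have "(\<lambda>n. cmod (cinner (T (y k)) (x - X n))) \<longlonglongrightarrow> cmod (cinner (T (y k)) (x - g))"
        by (intro tendsto_intros cinner.tendsto g(2))
      moreover have "cmod (cinner (T (y k)) (x - X n)) \<le> C * K * e'" for n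
      proof -
        have xX: "x - X n \<in> D" using x(1) g(1) D_diff by blast
        have "cmod (cinner (T (y k)) (x - X n)) \<le> C * nrm (y k) * nrm (x - X n)"
          by (rule T_bound[OF y xX])
        also have "\<dots> \<le> C * K * e'"
          using elim g(1)[of n] C(1) K nrm_nonneg[OF xX] by (intro mult_mono mult_left_mono mult_nonneg_nonneg) auto
        finally show ?thesis .
      qed
      ultimately have "cmod (cinner (T (y k)) (x - g)) \<le> C * K * e'" by (intro LIMSEQ_le_const2) auto
      also have "\<dots> \<le> (C * K + 1) * e'" using e' by (simp add: algebra_simps)
      also have "\<dots> = e / 2"
      proof -
        have "a * (e / (2 * a)) = e / 2" if "0 < a" for a using that by simp
        from this[OF CK] show ?thesis unfolding e'_def .
      qed
      finally have "cmod (cinner (T (y k)) (x - g)) \<le> e / 2" .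
      moreover have "cinner (T (y k)) x = cinner (T (y k)) (x - g) + cinner (y k) h"
        using g(3)[OF y[of k]] by (simp add: cinner.diff_right)
      ultimately show ?case using elim norm_triangle_ineq[of "cinner (T (y k)) (x - g)" "cinner (y k) h"] by simp
    qed
    then show "\<exists>no. \<forall>k\<ge>no. norm (cinner (T (y k)) x - 0) < e" by (simp add: eventually_sequentially)
  qed
  \<comment> \<open>\<open>T x = \<nu>\<close> is a fixed vector of \<open>N\<close>, and
    \<open>f\<close> and \<open>x\<close> have the same projection to \<open>N\<close>.\<close>
  have txy: "(\<lambda>k. cinner (T x) (y k)) \<longlonglongrightarrow> t x"
  proof -
    have "(\<lambda>k. cnj (cinner (y k) \<nu>)) \<longlonglongrightarrow> cnj (cinner f \<nu>)" by (intro tendsto_cnj weak')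
    then have "(\<lambda>k. cinner \<nu> (y k)) \<longlonglongrightarrow> cinner \<nu> f" by (simp flip: cinner_commute)
    moreover have "cinner \<nu> f = cinner \<nu> x"
      using cinner_cproj_commute[of F \<nu> f] cinner_cproj_commute[of F \<nu> x] N_P[OF \<nu>(1)] x(3) by simp
    ultimately show ?thesis using x(2) by simp
  qed
  define w where "w k = y k - x" for k
  define p where "p k = ?P (w k)" for k
  define m where "m k = w k - p k" for k
  have wD: "w k \<in> D" for k unfolding w_def by (rule D_diff[OF y x(1)])
  have pD: "p k \<in> D" for k unfolding p_def by (rule P_D)
  have mD: "m k \<in> D" for k unfolding m_def by (rule D_diff[OF wD pD])
  have tw: "(\<lambda>k. t (w k)) \<longlonglongrightarrow> 0"
  proof -
    have "(\<lambda>k. t (y k) - cinner (T (y k)) x - cinner (T x) (y k) + t x) \<longlonglongrightarrow> 0 - 0 - t x + t x"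
      by (intro tendsto_intros ty0 tyx txy)
    then show ?thesis unfolding w_def t_diff[OF y x(1)] by simp
  qed
  have np: "(\<lambda>k. nrm (p k)) \<longlonglongrightarrow> 0"
  proof (rule Lim_null_comparison)
    show "\<forall>\<^sub>F k in sequentially. norm (nrm (p k)) \<le> (\<Sum>e\<in>F. cmod (cinner (w k) e) * nrm e)"
      using nP nrm_nonneg[OF P_D] by (auto simp: p_def)
    have "(\<lambda>k. \<Sum>e\<in>F. cmod (cinner (w k) e) * nrm e) \<longlonglongrightarrow> (\<Sum>e\<in>F. cmod 0 * nrm e)"
    proof (intro tendsto_sum tendsto_mult tendsto_const tendsto_norm)
      fix e assume e: "e \<in> F"
      have "cinner f e = cinner x e"
        using cinner_cproj[OF F(1,3) e, of f] cinner_cproj[OF F(1,3) e, of x] x(3) by simp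
      then have "(\<lambda>k. cinner (y k) e - cinner x e) \<longlonglongrightarrow> cinner x e - cinner x e"
        using weak'[of e] by (intro tendsto_intros) simp
      then show "(\<lambda>k. cinner (w k) e) \<longlonglongrightarrow> 0" by (simp add: w_def cinner.diff_left)
    qed
    then show "(\<lambda>k. \<Sum>e\<in>F. cmod (cinner (w k) e) * nrm e) \<longlonglongrightarrow> 0" by simp
  qed
  have Kp: "(\<lambda>k. K * nrm (p k)) \<longlonglongrightarrow> 0" using tendsto_mult[OF tendsto_const np] by simp
  have wp: "\<forall>\<^sub>F k in sequentially. nrm (w k) * nrm (p k) \<le> K * nrm (p k)"
    using Kyx by eventually_elim (auto simp: w_def[symmetric] intro!: mult_right_mono nrm_nonneg[OF pD])
  have "(\<lambda>k. t (w k) - cinner (T (w k)) (p k) - cinner (T (p k)) (w k) + t (p k)) \<longlonglongrightarrow> 0 - 0 - 0 + 0"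
  proof (intro tendsto_add tendsto_diff tw)
    show "(\<lambda>k. cinner (T (w k)) (p k)) \<longlonglongrightarrow> 0" by (rule null_prod[OF wD pD wp Kp])
    show "(\<lambda>k. cinner (T (p k)) (w k)) \<longlonglongrightarrow> 0"
      by (rule null_prod[OF pD wD _ Kp]) (use wp in \<open>simp add: mult.commute\<close>)
    have "(\<lambda>k. nrm (p k) * nrm (p k)) \<longlonglongrightarrow> 0 * 0" by (intro tendsto_mult np)
    then show "(\<lambda>k. t (p k)) \<longlonglongrightarrow> 0" by (intro null_prod[OF pD pD, where w="\<lambda>k. nrm (p k) * nrm (p k)"]) auto
  qed
  then have tm: "(\<lambda>k. t (m k)) \<longlonglongrightarrow> 0" unfolding m_def t_diff[OF wD pD] by simp
  have "(\<lambda>k. m k) \<longlonglongrightarrow> 0"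
  proof (rule tendsto_norm_zero_cancel)
    have "(\<lambda>k. (norm (m k))\<^sup>2) \<longlonglongrightarrow> 0"
    proof (rule Lim_null_comparison)
      show "\<forall>\<^sub>F k in sequentially. norm ((norm (m k))\<^sup>2) \<le> cmod (t (m k)) / \<epsilon>"
      proof (rule always_eventually, rule allI)
        fix k
        have "\<epsilon> * ((norm (m k))\<^sup>2 + cmod (b (m k))) \<le> cmod (t (m k))"
          using orth by (intro coer[OF mD]) (auto simp: m_def p_def)
        then have "(norm (m k))\<^sup>2 + cmod (b (m k)) \<le> cmod (t (m k)) / \<epsilon>" using \<epsilon> by (simp add: field_simps)
        moreover have "(norm (m k))\<^sup>2 \<le> (norm (m k))\<^sup>2 + cmod (b (m k))" by simp
        ultimately have "(norm (m k))\<^sup>2 \<le> cmod (t (m k)) / \<epsilon>" by (rule order_trans[rotated])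
        then show "norm ((norm (m k))\<^sup>2) \<le> cmod (t (m k)) / \<epsilon>" by simp
      qed
      show "(\<lambda>k. cmod (t (m k)) / \<epsilon>) \<longlonglongrightarrow> 0" using tendsto_divide[OF tendsto_norm[OF tm] tendsto_const, of \<epsilon>] \<epsilon> by simp
    qed
    then have "(\<lambda>k. sqrt ((norm (m k))\<^sup>2)) \<longlonglongrightarrow> sqrt 0" by (rule tendsto_real_sqrt)
    then show "(\<lambda>k. norm (m k)) \<longlonglongrightarrow> 0" by simp
  qed
  moreover have "p \<longlonglongrightarrow> 0"
    by (rule Lim_null_comparison[OF _ np]) (use norm_le[OF pD] in auto)
  ultimately have "(\<lambda>k. m k + p k + x) \<longlonglongrightarrow> 0 + 0 + x" by (intro tendsto_intros)
  then have "y \<longlonglongrightarrow> x" by (simp add: m_def w_def)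
  then have fx: "f = x" by (rule weak_limit_strong_limit[OF weak])
  \<comment> \<open>The vectors \<open>g\<close> are used once more, now with \<open>f = x\<close>:
    the product of \<open>T x\<close> with \<open>g\<close> is
    \<open>cinner f h = 0\<close>.\<close>
  have "T x = 0"
  proof (rule cinner_eq_zeroI[of D])
    show "T x \<in> closure D" using T_bij x(1) dense by (auto simp: bij_betw_def)
    fix z assume z: "z \<in> D"
    have le: "cmod (cinner (T x) z) \<le> norm (T x) * e" if e: "0 < e" for e
    proof -
      obtain g h X where g: "\<And>n. X n \<in> D \<and> nrm (z - X n) < e" "X \<longlonglongrightarrow> g"
        "\<And>z. z \<in> D \<Longrightarrow> cinner (T z) g = cinner z h" "cinner f h = 0"
        using adj[OF z e] by blast
      have "norm (z - X n) \<le> e" for n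
        using norm_le[of "z - X n"] g(1)[of n] D_diff[OF z] by fastforce
      moreover have "(\<lambda>n. norm (z - X n)) \<longlonglongrightarrow> norm (z - g)" by (intro tendsto_intros g(2))
      ultimately have "norm (z - g) \<le> e" by (intro LIMSEQ_le_const2) auto
      moreover have "cinner (T x) z = cinner (T x) (z - g)"
        using g(3)[OF x(1)] g(4) fx by (simp add: cinner.diff_right)
      ultimately show ?thesis
        using norm_cinner_le[of "T x" "z - g"] mult_left_mono[of "norm (z - g)" e "norm (T x)"] by simp
    qed
    have "cmod (cinner (T x) z) \<le> 0"
    proof (rule field_le_epsilon)
      fix d :: real assume d: "0 < d"
      have p: "0 < norm (T x) + 1" by (rule add_nonneg_pos) auto
      have "cmod (cinner (T x) z) \<le> norm (T x) * (d / (norm (T x) + 1))" using d p by (intro le) simp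
      also have "\<dots> \<le> d" using d p by (simp add: field_simps)
      finally show "cmod (cinner (T x) z) \<le> 0 + d" by simp
    qed
    then show "cinner (T x) z = 0" by simp
  qed
  then have "x = 0" using T_inj[OF x(1) csubspace_0[OF D]] clinear_on_zero[OF T] by simp
  then show ?thesis using fx by simp
qed

text \<open>With \<open>f = 0\<close> the normalised tail of \<open>y\<close> is weakly null and
  contradicts \<open>separated\<close>. From \<open>k0\<close> on the norms exceed
  \<open>1/2\<close>, so normalisation multiplies the quotient by at most \<open>4\<close>.\<close>

lemma no_approximate_eigenvectors:
  assumes y: "\<And>k. y k \<in> D" and norm1: "(\<lambda>k. norm (y k)) \<longlonglongrightarrow> 1" and weak: "weakly_null (\<lambda>k. y k - f)"
    and small: "(\<lambda>k. cmod (t (y k)) / (1 + cmod (b (y k)))) \<longlonglongrightarrow> 0"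
    and adj: "\<And>x e. x \<in> D \<Longrightarrow> 0 < e \<Longrightarrow> \<exists>g k X. (\<forall>n. X n \<in> D \<and> nrm (x - X n) < e) \<and> X \<longlonglongrightarrow> g \<and>
      (\<forall>z\<in>D. cinner (T z) g = cinner z k) \<and> cinner f k = 0"
  shows False
proof -
  have "Bseq (\<lambda>k. norm (y k))" using norm1 by (intro convergent_imp_Bseq convergentI)
  then obtain Cy where "\<And>k. norm (y k) \<le> Cy" by (auto simp: Bseq_def)
  then have f: "f = 0" using weak_limit_zero[OF y _ weak small adj] by blast
  have "\<forall>\<^sub>F k in sequentially. 1/2 < norm (y k)" using order_tendstoD(1)[OF norm1, of "1/2"] by simp
  then obtain k0 where k0: "\<And>k. k \<ge> k0 \<Longrightarrow> 1/2 < norm (y k)" by (auto simp: eventually_sequentially)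
  define z where "z k = inverse (norm (y (k + k0))) *\<^sub>R y (k + k0)" for k
  have ny: "1/2 < norm (y (k + k0))" for k using k0 by simp
  have "z k \<in> D" for k
    using D_scale[OF y, of "of_real (inverse (norm (y (k + k0))))" "k + k0"] by (simp only: z_def scaleC_of_real)
  moreover have "norm (z k) = 1" for k
  proof -
    have "norm (y (k + k0)) \<noteq> 0" using ny[of k] by linarith
    then show ?thesis by (simp add: z_def)
  qed
  moreover have "weakly_null z"
    unfolding weakly_null_def
  proof
    fix g
    have "(\<lambda>k. cinner (y k) g) \<longlonglongrightarrow> 0" using weak f by (simp add: weakly_null_def)
    then have lim: "(\<lambda>k. 2 * cmod (cinner (y (k + k0)) g)) \<longlonglongrightarrow> 0"
      using tendsto_mult_right_zero[OF tendsto_norm_zero[OF LIMSEQ_ignore_initial_segment], of _ 2 k0] by blast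
    show "(\<lambda>k. cinner (z k) g) \<longlonglongrightarrow> 0"
    proof (rule Lim_null_comparison[OF always_eventually lim], rule allI)
      fix k
      have "inverse (norm (y (k + k0))) \<le> 2" using ny[of k] by (simp add: inverse_eq_divide divide_le_eq)
      then show "norm (cinner (z k) g) \<le> 2 * cmod (cinner (y (k + k0)) g)"
        by (simp add: z_def cinner.scaleR_left mult_right_mono)
    qed
  qed
  moreover have "(\<lambda>k. cmod (t (z k)) / (1 + cmod (b (z k)))) \<longlonglongrightarrow> 0"
  proof -
    have lim: "(\<lambda>k. 4 * (cmod (t (y (k + k0))) / (1 + cmod (b (y (k + k0)))))) \<longlonglongrightarrow> 0"
      using tendsto_mult_right_zero[OF LIMSEQ_ignore_initial_segment[OF small, of k0], of 4] by simp
    show ?thesis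
    proof (rule Lim_null_comparison[OF always_eventually lim], rule allI)
      fix k
      define c where "c = inverse (norm (y (k + k0)))"
      define tt bb where "tt = cmod (t (y (k + k0)))" and "bb = cmod (b (y (k + k0)))"
      have nn: "0 \<le> tt" "0 \<le> bb" by (auto simp: tt_def bb_def)
      have c: "0 < c" "c \<le> 2"
        using ny[of k] by (auto simp: c_def inverse_eq_divide divide_le_eq intro!: divide_pos_pos)
      have z: "cmod (t (z k)) = c\<^sup>2 * tt" "cmod (b (z k)) = c\<^sup>2 * bb"
        using t_scaleR[OF y, of c "k + k0"] b_scaleR[OF y, of c "k + k0"]
        by (simp_all add: z_def c_def tt_def bb_def norm_mult del: of_real_power)
      have c2: "c\<^sup>2 \<le> 4" using power_mono[OF c(2), of 2] c(1) by simp
      have p: "0 < 1 + c\<^sup>2 * bb" "0 < 1 + bb" using nn c(1) by (auto intro!: add_pos_nonneg)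
      have "c\<^sup>2 * tt * (1 + bb) \<le> 4 * tt * (1 + c\<^sup>2 * bb)"
      proof -
        have "c\<^sup>2 * tt \<le> 4 * tt" using c2 nn by (intro mult_right_mono) auto
        moreover have "c\<^sup>2 * tt * bb \<le> 4 * tt * (c\<^sup>2 * bb)"
        proof -
          have "0 \<le> c\<^sup>2 * tt * bb" using nn by simp
          then show ?thesis by (simp add: algebra_simps)
        qed
        ultimately show ?thesis by (simp add: algebra_simps)
      qed
      then have "c\<^sup>2 * tt / (1 + c\<^sup>2 * bb) \<le> 4 * tt / (1 + bb)"
        using p by (simp add: frac_le_eq divide_le_eq le_divide_eq pos_divide_le_eq pos_le_divide_eq)
      then show "norm (cmod (t (z k)) / (1 + cmod (b (z k)))) \<le> 4 * (cmod (t (y (k + k0))) / (1 + cmod (b (y (k + k0)))))"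
        unfolding z tt_def[symmetric] bb_def[symmetric] using p nn by simp
    qed
  qed
  ultimately show False using separated by blast
qed

end

section \<open>Linear operators as graphs\<close>

lemma app_eq: "single_valued S \<Longrightarrow> (f, g) \<in> S \<Longrightarrow> app S f = g"
  unfolding app_def by (rule the_equality) (auto dest: single_valuedD)

lemma linear_operatorD:
  assumes "linear_operator H S"
  shows "single_valued S" "S \<subseteq> H \<times> H" "f \<in> dom S \<Longrightarrow> (f, app S f) \<in> S"
    "dom S \<subseteq> H" "f \<in> dom S \<Longrightarrow> app S f \<in> H"
proof -
  show sv: "single_valued S" and sub: "S \<subseteq> H \<times> H" using assms by (auto simp: linear_operator_def)
  have *: "(f, app S f) \<in> S" if "f \<in> dom S" for f using app_eq[OF sv] that by auto
  then show "f \<in> dom S \<Longrightarrow> (f, app S f) \<in> S" .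
  show "dom S \<subseteq> H" using sub by auto
  show "f \<in> dom S \<Longrightarrow> app S f \<in> H" using * sub by auto
qed

lemma mem_graph_iff: "linear_operator H S \<Longrightarrow> (f, g) \<in> S \<longleftrightarrow> f \<in> dom S \<and> g = app S f"
  using linear_operatorD(1,3) app_eq by (metis DomainI)

lemma linear_operator_clinear_on:
  assumes "linear_operator H S"
  shows "clinear_on (dom S) (app S)"
proof -
  note S = linear_operatorD[OF assms]
  have add: "(f + f', g + g') \<in> S" if "(f, g) \<in> S" "(f', g') \<in> S" for f g f' g'
    using assms that unfolding linear_operator_def by fast
  have scale: "(c *\<^sub>C f, c *\<^sub>C g) \<in> S" if "(f, g) \<in> S" for c f g
    using assms that unfolding linear_operator_def by fast
  have zero: "(0, 0) \<in> S" using assms by (simp add: linear_operator_def)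
  show ?thesis
    unfolding clinear_on_def csubspace_def
  proof (intro conjI ballI allI)
    show "0 \<in> dom S" using zero by blast
    fix x y assume "x \<in> dom S" "y \<in> dom S"
    then have "(x + y, app S x + app S y) \<in> S" using add S(3) by blast
    then show "x + y \<in> dom S" "app S (x + y) = app S x + app S y" using app_eq[OF S(1)] by blast+
  next
    fix c x assume "x \<in> dom S"
    then have "(c *\<^sub>C x, c *\<^sub>C app S x) \<in> S" using scale S(3) by blast
    then show "c *\<^sub>C x \<in> dom S" "app S (c *\<^sub>C x) = c *\<^sub>C app S x" using app_eq[OF S(1)] by blast+
  qed
qed

lemma mem_adjoint_iff:
  assumes "linear_operator H S"
  shows "(g, h) \<in> adjoint H S \<longleftrightarrow> g \<in> H \<and> h \<in> H \<and> (\<forall>f\<in>dom S. cinner (app S f) g = cinner f h)"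
  unfolding adjoint_def using mem_graph_iff[OF assms] by auto

lemma linear_operator_adjoint:
  assumes S: "linear_operator H S" "densely_defined H S" and H: "csubspace H"
  shows "linear_operator H (adjoint H S)"
  unfolding linear_operator_def
proof (intro conjI)
  note m = mem_adjoint_iff[OF S(1)]
  show "adjoint H S \<subseteq> H \<times> H" by (auto simp: adjoint_def)
  show "single_valued (adjoint H S)"
  proof (rule single_valuedI)
    fix g h h' assume "(g, h) \<in> adjoint H S" "(g, h') \<in> adjoint H S"
    then have *: "h \<in> H" "h' \<in> H" "\<forall>f\<in>dom S. cinner f h = cinner f h'" by (auto simp: m)
    have "h - h' = 0"
    proof (rule cinner_eq_zeroI[of "dom S"])
      show "h - h' \<in> closure (dom S)"
        using csubspace_diff[OF H *(1,2)] S(2) by (simp add: densely_defined_def)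
      show "cinner (h - h') f = 0" if "f \<in> dom S" for f
        using *(3) that cinner_commute[of "h - h'" f] by (simp add: cinner.diff_right)
    qed
    then show "h = h'" by simp
  qed
  show "(0, 0) \<in> adjoint H S" using csubspace_0[OF H] by (auto simp: m cinner.zero_right)
  show "\<forall>(f, g)\<in>adjoint H S. \<forall>(f', g')\<in>adjoint H S. (f + f', g + g') \<in> adjoint H S"
  proof -
    have "(f + f', g + g') \<in> adjoint H S" if "(f, g) \<in> adjoint H S" "(f', g') \<in> adjoint H S" for f g f' g'
      using that csubspace_add[OF H] unfolding m by (simp add: cinner.add_right)
    then show ?thesis by blast
  qed
  show "\<forall>c. \<forall>(f, g)\<in>adjoint H S. (c *\<^sub>C f, c *\<^sub>C g) \<in> adjoint H S"
  proof -
    have "(c *\<^sub>C f, c *\<^sub>C g) \<in> adjoint H S" if "(f, g) \<in> adjoint H S" for c f g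
      using that csubspace_scale[OF H] unfolding m by (simp add: cinner_scaleC_right)
    then show ?thesis by blast
  qed
qed

text \<open>A core approximates in the graph norm of \<open>S\<close>, and relative boundedness
  carries this convergence over to \<open>R\<close>.\<close>

lemma core_approximation:
  assumes S: "linear_operator H S" and R: "linear_operator H' R" "relatively_bounded R S"
    and core: "core S \<Phi>" and g: "g \<in> dom S"
  shows "\<exists>\<phi>. (\<forall>j. \<phi> j \<in> \<Phi> \<and> \<phi> j \<in> dom S) \<and> \<phi> \<longlonglongrightarrow> g \<and> (\<lambda>j. app S (\<phi> j)) \<longlonglongrightarrow> app S g \<and>
    (\<lambda>j. app R (\<phi> j)) \<longlonglongrightarrow> app R g"
proof -
  have "(g, app S g) \<in> closure (S \<inter> \<Phi> \<times> UNIV)"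
    using core linear_operatorD(3)[OF S g] closure_subset[of S] unfolding core_def by auto
  then obtain p where p: "\<And>j. p j \<in> S \<inter> \<Phi> \<times> UNIV" "p \<longlonglongrightarrow> (g, app S g)"
    unfolding closure_sequential by blast
  define \<phi> where "\<phi> j = fst (p j)" for j
  have \<phi>: "\<phi> j \<in> \<Phi>" "\<phi> j \<in> dom S" "snd (p j) = app S (\<phi> j)" for j
    using p(1)[of j] mem_graph_iff[OF S, of "fst (p j)" "snd (p j)"] by (auto simp: \<phi>_def)
  have lim: "\<phi> \<longlonglongrightarrow> g" "(\<lambda>j. app S (\<phi> j)) \<longlonglongrightarrow> app S g"
    using tendsto_fst[OF p(2)] tendsto_snd[OF p(2)] unfolding \<phi>(3) by (simp_all add: \<phi>_def[abs_def])
  obtain C E where CE: "\<And>f. f \<in> dom S \<Longrightarrow> norm (app R f) \<le> C * norm f + E * norm (app S f)" and dom: "dom S \<subseteq> dom R"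
    using R(2) unfolding relatively_bounded_def by blast
  have "(\<lambda>j. app R (\<phi> j) - app R g) \<longlonglongrightarrow> 0"
  proof (rule Lim_null_comparison)
    have "(\<lambda>j. C * norm (\<phi> j - g) + E * norm (app S (\<phi> j) - app S g)) \<longlonglongrightarrow> C * norm (g - g) + E * norm (app S g - app S g)"
      by (intro tendsto_intros lim)
    then show "(\<lambda>j. C * norm (\<phi> j - g) + E * norm (app S (\<phi> j) - app S g)) \<longlonglongrightarrow> 0" by simp
    show "\<forall>\<^sub>F j in sequentially. norm (app R (\<phi> j) - app R g) \<le> C * norm (\<phi> j - g) + E * norm (app S (\<phi> j) - app S g)"
    proof (rule always_eventually, rule allI)
      fix j
      have "\<phi> j - g \<in> dom S"
        using csubspace_diff[OF clinear_onD(1)[OF linear_operator_clinear_on[OF S]] \<phi>(2) g] .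
      moreover have "app S (\<phi> j - g) = app S (\<phi> j) - app S g"
        by (rule clinear_on_diff[OF linear_operator_clinear_on[OF S] \<phi>(2) g])
      moreover have "app R (\<phi> j - g) = app R (\<phi> j) - app R g"
        by (rule clinear_on_diff[OF linear_operator_clinear_on[OF R(1)]]) (use \<phi>(2) g dom in auto)
      ultimately show "norm (app R (\<phi> j) - app R g) \<le> C * norm (\<phi> j - g) + E * norm (app S (\<phi> j) - app S g)"
        using CE[of "\<phi> j - g"] by simp
    qed
  qed
  then have "(\<lambda>j. app R (\<phi> j)) \<longlonglongrightarrow> app R g" by (simp add: LIM_zero_iff)
  then show ?thesis using \<phi> lim by blast
qed

section \<open>Operator pencils\<close>

text \<open>Bounded invertibility of a function with explicit domain;
  \<open>pencil_spectrum_iff\<close> reduces the spectrum of a pencil to it.\<close>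

definition binv :: "'d::finite l2 set \<Rightarrow> 'd l2 set \<Rightarrow> ('d l2 \<Rightarrow> 'd l2) \<Rightarrow> bool" where
  "binv D H T \<longleftrightarrow> bij_betw T D H \<and> (\<exists>C. \<forall>x\<in>D. norm x \<le> C * norm (T x))"

locale operator_pair =
  fixes H :: "'d::finite l2 set" and A B :: "'d operator"
  assumes A: "linear_operator H A" and B: "linear_operator H B" and dom: "dom A \<subseteq> dom B"
begin

lemma clin_A: "clinear_on (dom A) (app A)"
  by (rule linear_operator_clinear_on[OF A])

lemma clin_B: "clinear_on (dom A) (app B)"
  by (rule clinear_on_subset[OF linear_operator_clinear_on[OF B] clinear_onD(1)[OF clin_A] dom])

definition T :: "complex \<Rightarrow> 'd l2 \<Rightarrow> 'd l2" where
  "T \<mu> x = app A x - \<mu> *\<^sub>C app B x"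

lemma clin_T: "clinear_on (dom A) (T \<mu>)"
  unfolding T_def by (rule clinear_on_lincomb[OF clin_A clin_B])

lemma mem_pencil_iff: "(f, k) \<in> pencil A B \<mu> \<longleftrightarrow> f \<in> dom A \<and> k = T \<mu> f"
  unfolding pencil_def T_def
  using mem_graph_iff[OF A] mem_graph_iff[OF B] dom by auto

lemma dom_pencil: "dom (pencil A B \<mu>) = dom A"
  unfolding set_eq_iff Domain_iff[of _ "pencil A B \<mu>"] mem_pencil_iff by blast

lemma app_pencil: "f \<in> dom A \<Longrightarrow> app (pencil A B \<mu>) f = T \<mu> f"
  unfolding app_def by (rule the_equality) (auto simp: mem_pencil_iff)

lemma pencil_Id_on: "pencil (pencil A B \<mu>) (Id_on H) 0 = pencil A B \<mu>"
proof -
  have "(f, k) \<in> pencil (pencil A B \<mu>) (Id_on H) 0 \<longleftrightarrow> (f, k) \<in> pencil A B \<mu>" for f k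
  proof -
    have "(f, k) \<in> pencil (pencil A B \<mu>) (Id_on H) 0 \<longleftrightarrow> (f, k) \<in> pencil A B \<mu> \<and> f \<in> H"
      unfolding pencil_def[of "pencil A B \<mu>"] by (auto simp: scaleC.zero_left)
    then show ?thesis using linear_operatorD(4)[OF A] mem_pencil_iff by auto
  qed
  then show ?thesis by auto
qed

lemma pencil_spectrum_iff: "\<mu> \<in> pencil_spectrum H A B \<longleftrightarrow> \<not> binv (dom A) H (T \<mu>)"
proof -
  have "bij_betw (app (pencil A B \<mu>)) (dom A) H \<longleftrightarrow> bij_betw (T \<mu>) (dom A) H"
    by (rule bij_betw_cong) (rule app_pencil)
  then show ?thesis
    unfolding pencil_spectrum_def spectrum_def mem_Collect_eq pencil_Id_on boundedly_invertible_def
      dom_pencil binv_def using app_pencil by auto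
qed

lemma pencil_eigenvalue_iff: "pencil_eigenvalue A B \<mu> \<longleftrightarrow> (\<exists>f\<in>dom A. f \<noteq> 0 \<and> T \<mu> f = 0)"
  unfolding pencil_eigenvalue_def eigenvalue_def dom_pencil
  using app_pencil by (auto simp: scaleC.zero_left)

lemma pencil_approx_spectrum_iff: "\<mu> \<in> pencil_approx_spectrum A B \<longleftrightarrow>
    (\<exists>x. (\<forall>n. x n \<in> dom A \<and> norm (x n) = 1) \<and> (\<lambda>n. T \<mu> (x n)) \<longlonglongrightarrow> 0)"
proof -
  have "(\<lambda>n. app (pencil A B \<mu>) (x n) - 0 *\<^sub>C x n) = (\<lambda>n. T \<mu> (x n))" if "\<forall>n. x n \<in> dom A" for x :: "nat \<Rightarrow> 'd l2"
    using app_pencil that by (auto simp: fun_eq_iff scaleC.zero_left)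
  then show ?thesis
    unfolding pencil_approx_spectrum_def approx_spectrum_def mem_Collect_eq dom_pencil
    by (intro ex_cong1 conj_cong refl arg_cong[where f="\<lambda>u. u \<longlonglongrightarrow> 0"]) auto
qed

lemma pencil_ess_num_range_iff: "\<mu> \<in> pencil_ess_num_range A B \<longleftrightarrow>
    (\<exists>x. (\<forall>n. x n \<in> dom A \<and> norm (x n) = 1) \<and> weakly_null x \<and> (\<lambda>n. cinner (T \<mu> (x n)) (x n)) \<longlonglongrightarrow> 0)"
proof -
  have "(\<lambda>n. cinner (app (pencil A B \<mu>) (x n)) (x n)) = (\<lambda>n. cinner (T \<mu> (x n)) (x n))"
    if "\<forall>n. x n \<in> dom A" for x :: "nat \<Rightarrow> 'd l2"
    using app_pencil that by (auto simp: fun_eq_iff)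
  then show ?thesis
    unfolding pencil_ess_num_range_def ess_num_range_def mem_Collect_eq dom_pencil
    by (intro ex_cong1 conj_cong refl arg_cong[where f="\<lambda>u. u \<longlonglongrightarrow> 0"]) auto
qed

abbreviation a :: "'d l2 \<Rightarrow> complex" where "a x \<equiv> cinner (app A x) x"
abbreviation b :: "'d l2 \<Rightarrow> complex" where "b x \<equiv> cinner (app B x) x"

lemma t_eq: "cinner (T \<mu> x) y = cinner (app A x) y - \<mu> * cinner (app B x) y"
  by (simp add: T_def cinner.diff_left cinner_scaleC_left)

text \<open>Unlike its two parts, the union is always closed. It is \<open>w\<^sub>e(A,B)\<close> under the hypothesis of
  part (i) of the theorem and \<open>W\<^sub>e(A,B)\<close> under that of part (ii).\<close>

definition W :: "complex set" where
  "W = pencil_ess_num_range A B \<union> pencil_ess_quotient_range A B"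

lemma one_plus_cmod_pos: "0 < 1 + cmod z"
  by (rule add_pos_nonneg) auto

lemma dichotomy:
  fixes u :: "nat \<Rightarrow> complex"
  shows "(\<exists>r. strict_mono r \<and> (\<lambda>n. u (r n)) \<longlonglongrightarrow> 0) \<or> (\<exists>e>0. \<forall>\<^sub>F n in sequentially. e \<le> cmod (u n))"
proof (rule disjCI)
  assume "\<not> (\<exists>e>0. \<forall>\<^sub>F n in sequentially. e \<le> cmod (u n))"
  then have *: "\<exists>n>m. cmod (u n) < e" if "0 < e" for e m
    using that by (auto simp: eventually_sequentially not_le) (meson Suc_le_eq)
  have "\<exists>r. \<forall>n. cmod (u (r n)) < inverse (real (Suc n)) \<and> r n < r (Suc n)"
  proof (rule dependent_nat_choice)
    show "\<exists>m. cmod (u m) < inverse (real (Suc 0))" using *[of 1 0] by auto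
    show "\<exists>m'. cmod (u m') < inverse (real (Suc (Suc n))) \<and> m < m'" for m n
      using *[of "inverse (real (Suc (Suc n)))" m] by auto
  qed
  then obtain r where r: "\<And>n. cmod (u (r n)) < inverse (real (Suc n))" "strict_mono r"
    by (auto simp: strict_mono_Suc_iff)
  have "(\<lambda>n. u (r n)) \<longlonglongrightarrow> 0"
    by (rule Lim_null_comparison[OF always_eventually LIMSEQ_inverse_real_of_nat])
      (use r(1) in \<open>auto intro: less_imp_le simp del: of_nat_Suc\<close>)
  then show "\<exists>r. strict_mono r \<and> (\<lambda>n. u (r n)) \<longlonglongrightarrow> 0" using r(2) by blast
qed

text \<open>The quotient can be small for two reasons. If \<open>b\<close> tends to \<open>0\<close>
  along a subsequence, the numerators and hence \<open>a\<close> vanish too. If \<open>b\<close>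
  stays away from \<open>0\<close>, then \<open>1 + \<bar>b\<bar>\<close> is comparable with
  \<open>\<bar>b\<bar>\<close>, and \<open>a / b\<close> tends to \<open>\<mu>\<close>.\<close>

lemma W_I:
  assumes x: "\<And>n. x n \<in> dom A" "\<And>n. norm (x n) = 1" "weakly_null x"
    and lim: "(\<lambda>n. cmod (cinner (T \<mu> (x n)) (x n)) / (1 + cmod (b (x n)))) \<longlonglongrightarrow> 0"
  shows "\<mu> \<in> pencil_ess_quotient_range A B \<or>
    (\<exists>r. strict_mono r \<and> (\<lambda>n. b (x (r n))) \<longlonglongrightarrow> 0 \<and> (\<lambda>n. a (x (r n))) \<longlonglongrightarrow> 0)"
proof -
  consider (null) r where "strict_mono r" "(\<lambda>n. b (x (r n))) \<longlonglongrightarrow> 0"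
    | (sep) e where "e > 0" "\<forall>\<^sub>F n in sequentially. e \<le> cmod (b (x n))"
    using dichotomy[of "\<lambda>n. b (x n)"] by blast
  then show ?thesis
  proof cases
    case null
    let ?q = "\<lambda>n. cmod (cinner (T \<mu> (x n)) (x n)) / (1 + cmod (b (x n)))"
    have q: "(\<lambda>n. ?q (r n)) \<longlonglongrightarrow> 0"
      using LIMSEQ_subseq_LIMSEQ[OF lim null(1)] by (simp add: o_def)
    have "(\<lambda>n. ?q (r n) * (1 + cmod (b (x (r n))))) \<longlonglongrightarrow> 0 * (1 + cmod 0)"
      by (intro tendsto_intros q null(2))
    moreover have "?q n * (1 + cmod (b (x n))) = cmod (cinner (T \<mu> (x n)) (x n))" for n
      using one_plus_cmod_pos[of "b (x n)"] by simp
    ultimately have "(\<lambda>n. cmod (cinner (T \<mu> (x (r n))) (x (r n)))) \<longlonglongrightarrow> 0" by simp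
    then have "(\<lambda>n. cinner (T \<mu> (x (r n))) (x (r n))) \<longlonglongrightarrow> 0" by (rule tendsto_norm_zero_cancel)
    then have "(\<lambda>n. cinner (T \<mu> (x (r n))) (x (r n)) + \<mu> * b (x (r n))) \<longlonglongrightarrow> 0 + \<mu> * 0"
      by (intro tendsto_intros null(2))
    then have "(\<lambda>n. a (x (r n))) \<longlonglongrightarrow> 0" by (simp add: t_eq)
    then show ?thesis using null by blast
  next
    case sep
    then obtain N where N: "\<And>n. n \<ge> N \<Longrightarrow> e \<le> cmod (b (x n))" by (auto simp: eventually_sequentially)
    let ?y = "\<lambda>n. x (n + N)"
    have b0: "b (?y n) \<noteq> 0" for n using N[of "n + N"] sep(1) by auto
    have lim': "(\<lambda>n. (1 + inverse e) * (cmod (cinner (T \<mu> (?y n)) (?y n)) / (1 + cmod (b (?y n))))) \<longlonglongrightarrow> 0"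
      using tendsto_mult_right_zero[OF LIMSEQ_ignore_initial_segment[OF lim, of N], of "1 + inverse e"] by simp
    have "(\<lambda>n. a (?y n) / b (?y n) - \<mu>) \<longlonglongrightarrow> 0"
    proof (rule Lim_null_comparison[OF always_eventually lim'], rule allI)
      fix n
      let ?b = "cmod (b (?y n))" and ?t = "cmod (cinner (T \<mu> (?y n)) (?y n))"
      have p: "0 < ?b" "0 < 1 + ?b" "e \<le> ?b" using b0[of n] one_plus_cmod_pos N by auto
      have "a (?y n) / b (?y n) - \<mu> = cinner (T \<mu> (?y n)) (?y n) / b (?y n)"
        using b0[of n] by (simp add: t_eq field_simps)
      then have "norm (a (?y n) / b (?y n) - \<mu>) = ?t / ?b" by (simp add: norm_divide)
      also have "\<dots> \<le> (1 + inverse e) * (?t / (1 + ?b))"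
      proof -
        have "1 + ?b \<le> (1 + inverse e) * ?b"
          using p sep(1) by (simp add: algebra_simps inverse_eq_divide pos_le_divide_eq)
        then have "?t * (1 + ?b) \<le> ?t * ((1 + inverse e) * ?b)" by (intro mult_left_mono) auto
        then show ?thesis using p(1,2) by (simp add: divide_le_eq le_divide_eq mult_ac)
      qed
      finally show "norm (a (?y n) / b (?y n) - \<mu>) \<le> (1 + inverse e) * (?t / (1 + ?b))" .
    qed
    then have "(\<lambda>n. a (?y n) / b (?y n)) \<longlonglongrightarrow> \<mu>" by (simp add: LIM_zero_iff)
    moreover have "weakly_null ?y"
      by (rule weakly_null_subseq[OF x(3)]) (simp add: strict_mono_def)
    ultimately have "\<mu> \<in> pencil_ess_quotient_range A B"
      unfolding pencil_ess_quotient_range_def using x(1,2) b0 by (intro CollectI exI[of _ ?y]) auto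
    then show ?thesis by simp
  qed
qed

text \<open>Such a sequence works for every \<open>\<mu>\<close> at once. By \<open>W_I\<close> it
  is the only way in which \<open>W\<close> can exceed the quotient range, and the hypothesis of
  part (i) rules it out.\<close>

lemma null_forms_imp_ess_num_range:
  assumes x: "\<And>n. x n \<in> dom A" "\<And>n. norm (x n) = 1" "weakly_null x"
    and lim: "(\<lambda>n. a (x n)) \<longlonglongrightarrow> 0" "(\<lambda>n. b (x n)) \<longlonglongrightarrow> 0"
  shows "\<mu> \<in> pencil_ess_num_range A B" "0 \<in> ess_num_range A" "0 \<in> ess_num_range B"
proof -
  have "(\<lambda>n. a (x n) - \<mu> * b (x n)) \<longlonglongrightarrow> 0 - \<mu> * 0" by (intro tendsto_intros lim)
  then show "\<mu> \<in> pencil_ess_num_range A B"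
    unfolding pencil_ess_num_range_iff using x by (intro exI[of _ x]) (simp add: t_eq)
  show "0 \<in> ess_num_range A" "0 \<in> ess_num_range B"
    unfolding ess_num_range_def using x lim dom by blast+
qed

lemma W_iff: "\<mu> \<in> W \<longleftrightarrow> (\<exists>x. (\<forall>n. x n \<in> dom A \<and> norm (x n) = 1) \<and> weakly_null x \<and>
    (\<lambda>n. cmod (cinner (T \<mu> (x n)) (x n)) / (1 + cmod (b (x n)))) \<longlonglongrightarrow> 0)"
    (is "_ \<longleftrightarrow> ?R")
proof
  assume "\<mu> \<in> W"
  then consider (1) "\<mu> \<in> pencil_ess_num_range A B" | (2) "\<mu> \<in> pencil_ess_quotient_range A B"
    by (auto simp: W_def)
  then show ?R
  proof cases
    case 1
    then obtain x where x: "\<forall>n. x n \<in> dom A \<and> norm (x n) = 1" "weakly_null x"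
      "(\<lambda>n. cinner (T \<mu> (x n)) (x n)) \<longlonglongrightarrow> 0" unfolding pencil_ess_num_range_iff by blast
    have "(\<lambda>n. cmod (cinner (T \<mu> (x n)) (x n)) / (1 + cmod (b (x n)))) \<longlonglongrightarrow> 0"
    proof (rule Lim_null_comparison[OF always_eventually tendsto_norm_zero[OF x(3)]], rule allI)
      fix n
      show "norm (cmod (cinner (T \<mu> (x n)) (x n)) / (1 + cmod (b (x n)))) \<le> norm (cinner (T \<mu> (x n)) (x n))"
        using one_plus_cmod_pos[of "b (x n)"] by (simp add: divide_le_eq mult_left_le algebra_simps)
    qed
    then show ?thesis using x by blast
  next
    case 2
    then obtain x where x: "\<forall>n. x n \<in> dom A \<and> b (x n) \<noteq> 0 \<and> norm (x n) = 1" "weakly_null x"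
      "(\<lambda>n. a (x n) / b (x n)) \<longlonglongrightarrow> \<mu>" unfolding pencil_ess_quotient_range_def by blast
    have lim: "(\<lambda>n. a (x n) / b (x n) - \<mu>) \<longlonglongrightarrow> 0" using x(3) by (rule LIM_zero)
    have "(\<lambda>n. cmod (cinner (T \<mu> (x n)) (x n)) / (1 + cmod (b (x n)))) \<longlonglongrightarrow> 0"
    proof (rule Lim_null_comparison[OF always_eventually tendsto_norm_zero[OF lim]], rule allI)
      fix n
      let ?b = "cmod (b (x n))"
      have "cinner (T \<mu> (x n)) (x n) = (a (x n) / b (x n) - \<mu>) * b (x n)"
        using x(1) by (simp add: t_eq field_simps)
      then have "cmod (cinner (T \<mu> (x n)) (x n)) = cmod (a (x n) / b (x n) - \<mu>) * ?b"
        by (simp add: norm_mult)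
      also have "\<dots> \<le> cmod (a (x n) / b (x n) - \<mu>) * (1 + ?b)" by (intro mult_left_mono) auto
      finally show "norm (cmod (cinner (T \<mu> (x n)) (x n)) / (1 + ?b)) \<le> norm (a (x n) / b (x n) - \<mu>)"
        using one_plus_cmod_pos[of "b (x n)"] by (simp add: divide_le_eq)
    qed
    then show ?thesis using x by blast
  qed
next
  assume ?R
  then obtain x where x: "\<And>n. x n \<in> dom A" "\<And>n. norm (x n) = 1" "weakly_null x"
    "(\<lambda>n. cmod (cinner (T \<mu> (x n)) (x n)) / (1 + cmod (b (x n)))) \<longlonglongrightarrow> 0" by blast
  show "\<mu> \<in> W"
    using W_I[OF x]
  proof
    assume "\<exists>r. strict_mono r \<and> (\<lambda>n. b (x (r n))) \<longlonglongrightarrow> 0 \<and> (\<lambda>n. a (x (r n))) \<longlonglongrightarrow> 0"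
    then obtain r where "strict_mono r" "(\<lambda>n. b (x (r n))) \<longlonglongrightarrow> 0" "(\<lambda>n. a (x (r n))) \<longlonglongrightarrow> 0" by blast
    then show ?thesis
      using null_forms_imp_ess_num_range(1)[of "\<lambda>n. x (r n)" \<mu>] x weakly_null_subseq[OF x(3)]
      by (simp add: W_def)
  qed (simp add: W_def)
qed

text \<open>Diagonal choice: \<open>y n\<close> is taken from the sequence belonging to
  \<open>\<mu> n\<close>, far enough out to be almost orthogonal to all earlier choices. Then
  \<open>weakly_nullI_self\<close> applies.\<close>

lemma closed_W: "closed W"
  unfolding closed_sequential_limits
proof (intro allI impI, elim conjE)
  fix \<mu> l assume \<mu>: "\<forall>k. \<mu> k \<in> W" and l: "\<mu> \<longlonglongrightarrow> l"
  let ?q = "\<lambda>\<mu> x. cmod (cinner (T \<mu> x) x) / (1 + cmod (b x))"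
  have step: "\<exists>y\<in>dom A. norm y = 1 \<and> ?q (\<mu> k) y < e \<and> (\<forall>s\<in>S. cmod (cinner y s) < e)"
    if S: "finite S" and e: "0 < e" for S e k
  proof -
    obtain x where x: "\<forall>n. x n \<in> dom A \<and> norm (x n) = 1" "weakly_null x" "(\<lambda>n. ?q (\<mu> k) (x n)) \<longlonglongrightarrow> 0"
      using \<mu> W_iff by blast
    have "\<forall>\<^sub>F n in sequentially. \<forall>s\<in>S. cmod (cinner (x n) s) < e"
    proof (rule eventually_ball_finite[OF S], rule ballI)
      fix s
      have "(\<lambda>n. cinner (x n) s) \<longlonglongrightarrow> 0" using x(2) by (simp add: weakly_null_def)
      then show "\<forall>\<^sub>F n in sequentially. cmod (cinner (x n) s) < e"
        using order_tendstoD(2)[OF tendsto_norm_zero e] by blast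
    qed
    moreover have "\<forall>\<^sub>F n in sequentially. ?q (\<mu> k) (x n) < e" using order_tendstoD(2)[OF x(3) e] .
    ultimately have "\<forall>\<^sub>F n in sequentially. (\<forall>s\<in>S. cmod (cinner (x n) s) < e) \<and> ?q (\<mu> k) (x n) < e"
      by (rule eventually_conj)
    then obtain n where "(\<forall>s\<in>S. cmod (cinner (x n) s) < e) \<and> ?q (\<mu> k) (x n) < e"
      using eventually_happens'[OF sequentially_bot] by blast
    then show ?thesis using x(1) by blast
  qed
  let ?P = "\<lambda>n (S, y). finite S \<and> y \<in> dom A \<and> norm y = 1 \<and> ?q (\<mu> n) y < inverse (real (Suc n)) \<and>
    (\<forall>s\<in>S. cmod (cinner y s) < inverse (real (Suc n)))"
  let ?Q = "\<lambda>n (S, y) (S', y'). S' = insert y S"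
  have "\<exists>z. \<forall>n. ?P n (z n) \<and> ?Q n (z n) (z (Suc n))"
  proof (rule dependent_nat_choice)
    show "\<exists>z. ?P 0 z" using step[of "{}" 1 0] by auto
    fix z n assume P: "?P n z"
    obtain S y where z: "z = (S, y)" by force
    obtain y' where "y' \<in> dom A" "norm y' = 1" "?q (\<mu> (Suc n)) y' < inverse (real (Suc (Suc n)))"
      "\<forall>s\<in>insert y S. cmod (cinner y' s) < inverse (real (Suc (Suc n)))"
      using step[of "insert y S" "inverse (real (Suc (Suc n)))" "Suc n"] P z by auto
    then show "\<exists>z'. ?P (Suc n) z' \<and> ?Q n z z'"
      using P z by (intro exI[of _ "(insert y S, y')"]) auto
  qed
  then obtain z where z: "\<forall>n. ?P n (z n) \<and> ?Q n (z n) (z (Suc n))" by (elim exE)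
  define S y where "S n = fst (z n)" and "y n = snd (z n)" for n
  have P: "y n \<in> dom A" "norm (y n) = 1" "?q (\<mu> n) (y n) < inverse (real (Suc n))"
    "\<forall>s\<in>S n. cmod (cinner (y n) s) < inverse (real (Suc n))" "S (Suc n) = insert (y n) (S n)" for n
    using spec[OF z, of n] by (auto simp: S_def y_def split: prod.splits)
  have mem: "y j \<in> S (Suc j + k)" for j k by (induction k) (auto simp: P(5))
  have weak: "weakly_null y"
  proof (rule weakly_nullI_self)
    show "norm (y n) \<le> 1" for n using P(2)[of n] by simp
    show "(\<lambda>n. cinner (y n) (y j)) \<longlonglongrightarrow> 0" for j
    proof (rule Lim_null_comparison[OF eventually_sequentiallyI[of "Suc j"] LIMSEQ_inverse_real_of_nat])
      show "norm (cinner (y n) (y j)) \<le> inverse (real (Suc n))" if "Suc j \<le> n" for n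
        using mem[of j "n - Suc j"] that P(4)[of n] by (auto intro: less_imp_le)
    qed
  qed
  have lim: "(\<lambda>n. inverse (real (Suc n)) + cmod (\<mu> n - l)) \<longlonglongrightarrow> 0"
    using tendsto_add[OF LIMSEQ_inverse_real_of_nat tendsto_norm_zero[OF LIM_zero[OF l]]] by simp
  have "(\<lambda>n. ?q l (y n)) \<longlonglongrightarrow> 0"
  proof (rule Lim_null_comparison[OF always_eventually lim], rule allI)
    fix n
    \<comment> \<open>Replacing \<open>\<mu> n\<close> by \<open>l\<close> costs
      \<open>\<mu> n - l\<close> times \<open>b (y n)\<close>, which the denominator
      absorbs.\<close>
    have "cinner (T l (y n)) (y n) = cinner (T (\<mu> n) (y n)) (y n) + (\<mu> n - l) * b (y n)"
      by (simp add: t_eq algebra_simps)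
    then have "cmod (cinner (T l (y n)) (y n)) \<le> cmod (cinner (T (\<mu> n) (y n)) (y n)) + cmod (\<mu> n - l) * cmod (b (y n))"
      by (metis norm_mult norm_triangle_ineq)
    also have "\<dots> \<le> cmod (cinner (T (\<mu> n) (y n)) (y n)) + cmod (\<mu> n - l) * (1 + cmod (b (y n)))"
      by (intro add_left_mono mult_left_mono) auto
    finally have "?q l (y n) \<le> (cmod (cinner (T (\<mu> n) (y n)) (y n)) + cmod (\<mu> n - l) * (1 + cmod (b (y n)))) / (1 + cmod (b (y n)))"
      by (rule divide_right_mono) (rule less_imp_le[OF one_plus_cmod_pos])
    also have "\<dots> = ?q (\<mu> n) (y n) + cmod (\<mu> n - l)"
      using one_plus_cmod_pos[of "b (y n)"] by (simp add: add_divide_distrib)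
    finally have "?q l (y n) \<le> ?q (\<mu> n) (y n) + cmod (\<mu> n - l)" .
    moreover have "0 \<le> ?q l (y n)" by (intro divide_nonneg_nonneg) auto
    ultimately show "norm (?q l (y n)) \<le> inverse (real (Suc n)) + cmod (\<mu> n - l)"
      using P(3)[of n] by simp
  qed
  then show "l \<in> W" using W_iff P weak by blast
qed

end

section \<open>Resolvents of operator pencils\<close>

text \<open>Neumann series in the form of a fixed point:
  \<open>u = y - E (T\<^sup>-\<^sup>1 u)\<close> is a contraction with constant \<open>1/2\<close>
  on \<open>H\<close>, and \<open>T\<^sup>-\<^sup>1 u\<close> solves the perturbed equation.\<close>

lemma binv_perturb:
  fixes T E :: "'d::finite l2 \<Rightarrow> 'd l2"
  assumes H: "csubspace H" "closed H" and T: "clinear_on D T" "binv D H T"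
    and E: "clinear_on D E" "\<And>x. x \<in> D \<Longrightarrow> E x \<in> H" "\<And>x. x \<in> D \<Longrightarrow> norm (E x) \<le> norm (T x) / 2"
  shows "binv D H (\<lambda>x. T x + E x)"
proof -
  obtain C where bij: "bij_betw T D H" and C: "\<And>x. x \<in> D \<Longrightarrow> norm x \<le> C * norm (T x)"
    using T(2) by (auto simp: binv_def)
  note D = clinear_onD(1)[OF T(1)]
  have TH: "T x \<in> H" if "x \<in> D" for x using bij that by (auto simp: bij_betw_def)
  have half: "norm (T x) \<le> 2 * norm (T x + E x)" if "x \<in> D" for x
  proof -
    have "norm (T x) \<le> norm (T x + E x) + norm (E x)"
      using norm_triangle_ineq4[of "T x + E x" "E x"] by simp
    then show ?thesis using E(3)[OF that] by linarith
  qed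
  have bound: "norm x \<le> 2 * \<bar>C\<bar> * norm (T x + E x)" if "x \<in> D" for x
  proof -
    have "norm x \<le> \<bar>C\<bar> * norm (T x)"
      using C[OF that] mult_right_mono[OF abs_ge_self[of C], of "norm (T x)"] by simp
    also have "\<dots> \<le> \<bar>C\<bar> * (2 * norm (T x + E x))" using half[OF that] by (rule mult_left_mono) simp
    finally show ?thesis by simp
  qed
  have "inj_on (\<lambda>x. T x + E x) D"
  proof (rule inj_onI)
    fix x y assume xy: "x \<in> D" "y \<in> D" "T x + E x = T y + E y"
    have "T (x - y) + E (x - y) = (T x + E x) - (T y + E y)"
      using clinear_on_diff[OF T(1) xy(1,2)] clinear_on_diff[OF E(1) xy(1,2)] by simp
    then have "T (x - y) + E (x - y) = 0" unfolding xy(3) by simp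
    then show "x = y" using bound[OF csubspace_diff[OF D xy(1,2)]] by simp
  qed
  moreover have "y \<in> (\<lambda>x. T x + E x) ` D" if y: "y \<in> H" for y
  proof -
    define R where "R = inv_into D T"
    have R: "R u \<in> D" "T (R u) = u" if "u \<in> H" for u
      using bij that unfolding R_def bij_betw_def by (auto intro: inv_into_into f_inv_into_f)
    have "\<exists>!u\<in>H. y - E (R u) = u"
    proof (rule Banach_fix[of H "1/2" "\<lambda>u. y - E (R u)"])
      show "complete H" using H(2) by (simp add: complete_eq_closed)
      show "H \<noteq> {}" using csubspace_0[OF H(1)] by auto
      show "(\<lambda>u. y - E (R u)) ` H \<subseteq> H" using y E(2) R(1) csubspace_diff[OF H(1)] by auto
      show "dist (y - E (R u)) (y - E (R v)) \<le> 1/2 * dist u v" if "u \<in> H" "v \<in> H" for u v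
      proof -
        have "norm (E (R u - R v)) \<le> norm (T (R u - R v)) / 2"
          by (rule E(3)[OF csubspace_diff[OF D R(1)[OF that(1)] R(1)[OF that(2)]]])
        then show ?thesis
          using R[OF that(1)] R[OF that(2)] clinear_on_diff[OF T(1)] clinear_on_diff[OF E(1)]
          by (simp add: dist_norm norm_minus_commute)
      qed
    qed auto
    then obtain u where u: "u \<in> H" "y - E (R u) = u" by blast
    then have "y = T (R u) + E (R u)" using R(2)[OF u(1)] by (metis diff_add_cancel)
    then show ?thesis using R(1)[OF u(1)] by blast
  qed
  moreover have "(\<lambda>x. T x + E x) ` D \<subseteq> H" using TH E(2) csubspace_add[OF H(1)] by auto
  ultimately show ?thesis
    unfolding binv_def bij_betw_def using bound by blast
qed

text \<open>The half-plane condition on the form of \<open>B\<close> makes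
  \<open>B (A - \<mu>B)\<^sup>-\<^sup>1\<close> bounded, see \<open>B_bounded\<close>. The inclusion
  of domains alone would not suffice for that.\<close>

locale closable_pencil = operator_pair H A B for H :: "'d::finite l2 set" and A B +
  fixes \<omega> :: complex and \<gamma> :: real
  assumes H: "csubspace H" "closed H" and dense: "closure (dom A) = H"
    and half_plane: "cmod \<omega> = 1" "x \<in> dom A \<Longrightarrow> \<gamma> * (norm x)\<^sup>2 \<le> Re (\<omega> * cinner (app B x) x)"
begin

abbreviation D :: "'d l2 set" where "D \<equiv> dom A"

definition R :: "complex \<Rightarrow> 'd l2 \<Rightarrow> 'd l2" where
  "R \<mu> = inv_into D (T \<mu>)"

lemmas subD = clinear_onD(1)[OF clin_A]

lemma BH: "x \<in> D \<Longrightarrow> app B x \<in> H"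
  by (rule linear_operatorD(5)[OF B subsetD[OF dom]])

lemma T_change: "T \<nu> x = T \<mu> x - (\<nu> - \<mu>) *\<^sub>C app B x"
  by (simp add: T_def scaleC.diff_left)

lemma R_in:
  assumes "binv D H (T \<mu>)" "y \<in> H"
  shows "R \<mu> y \<in> D" "T \<mu> (R \<mu> y) = y"
  using assms unfolding R_def binv_def bij_betw_def by (auto intro: inv_into_into f_inv_into_f)

lemma R_T: "binv D H (T \<mu>) \<Longrightarrow> x \<in> D \<Longrightarrow> R \<mu> (T \<mu> x) = x"
  unfolding R_def binv_def bij_betw_def by simp

lemma T_H: "binv D H (T \<mu>) \<Longrightarrow> x \<in> D \<Longrightarrow> T \<mu> x \<in> H"
  unfolding binv_def bij_betw_def by auto

lemma B_bounded:
  assumes "binv D H (T \<mu>)"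
  shows "\<exists>C\<ge>0. \<forall>x\<in>D. norm (app B x) \<le> C * norm (T \<mu> x)"
proof -
  obtain c where c: "bij_betw (T \<mu>) D H" "\<And>x. x \<in> D \<Longrightarrow> norm x \<le> c * norm (T \<mu> x)"
    using assms by (auto simp: binv_def)
  show ?thesis
    by (rule half_plane_relatively_bounded[OF H(2) dense clin_T c clin_B BH half_plane])
qed

text \<open>Near \<open>\<mu>\<close> the perturbation by a multiple of \<open>B\<close> is at most
  half of \<open>T \<mu>\<close>. The bounds hold at every nearby \<open>\<nu>\<close>, before
  invertibility there is known.\<close>

lemma local_bound:
  assumes "binv D H (T \<mu>)"
  shows "\<exists>K\<ge>0. \<exists>\<rho>>0. \<forall>\<nu>. cmod (\<nu> - \<mu>) < \<rho> \<longrightarrow>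
    (\<forall>x\<in>D. norm x \<le> K * norm (T \<nu> x) \<and> norm (app B x) \<le> K * norm (T \<nu> x))"
proof -
  obtain C where C: "C \<ge> 0" "\<And>x. x \<in> D \<Longrightarrow> norm (app B x) \<le> C * norm (T \<mu> x)"
    using B_bounded[OF assms] by blast
  obtain c where c: "\<And>x. x \<in> D \<Longrightarrow> norm x \<le> c * norm (T \<mu> x)" using assms by (auto simp: binv_def)
  define \<rho> where "\<rho> = 1 / (2 * (C + 1))"
  have \<rho>: "\<rho> > 0" using C by (simp add: \<rho>_def)
  have half: "norm (T \<mu> x) \<le> 2 * norm (T \<nu> x)" if "cmod (\<nu> - \<mu>) < \<rho>" "x \<in> D" for \<nu> x
  proof -
    have "cmod (\<nu> - \<mu>) * C \<le> \<rho> * C" using that(1) C(1) by (intro mult_right_mono) auto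
    also have "\<dots> \<le> 1/2" using C(1) by (simp add: \<rho>_def field_simps)
    finally have half: "cmod (\<nu> - \<mu>) * C \<le> 1/2" .
    have "norm (T \<mu> x) \<le> norm (T \<nu> x) + cmod (\<nu> - \<mu>) * norm (app B x)"
      using norm_triangle_ineq[of "T \<nu> x" "(\<nu> - \<mu>) *\<^sub>C app B x"] T_change[of \<nu> x \<mu>] by (simp add: norm_scaleC)
    also have "cmod (\<nu> - \<mu>) * norm (app B x) \<le> cmod (\<nu> - \<mu>) * (C * norm (T \<mu> x))"
      by (intro mult_left_mono C(2) that) simp
    also have "\<dots> \<le> 1/2 * norm (T \<mu> x)"
      using mult_right_mono[OF half, of "norm (T \<mu> x)"] by (simp add: mult.assoc)
    finally show ?thesis by simp
  qed
  define K where "K = 2 * max \<bar>c\<bar> C"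
  have K: "K \<ge> 0" by (simp add: K_def)
  have "norm x \<le> K * norm (T \<nu> x) \<and> norm (app B x) \<le> K * norm (T \<nu> x)" if "cmod (\<nu> - \<mu>) < \<rho>" "x \<in> D" for \<nu> x
  proof -
    have le: "m * norm (T \<mu> x) \<le> K * norm (T \<nu> x)" if m: "m \<le> max \<bar>c\<bar> C" for m
    proof -
      have "m * norm (T \<mu> x) \<le> max \<bar>c\<bar> C * norm (T \<mu> x)" using m by (intro mult_right_mono) auto
      also have "\<dots> \<le> max \<bar>c\<bar> C * (2 * norm (T \<nu> x))"
        by (rule mult_left_mono[OF half]) (use \<open>cmod (\<nu> - \<mu>) < \<rho>\<close> \<open>x \<in> D\<close> in auto)
      finally show ?thesis by (simp add: K_def)
    qed
    show ?thesis
      using order_trans[OF c[OF that(2)] le[of c]] order_trans[OF C(2)[OF that(2)] le[of C]] by auto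
  qed
  then show ?thesis using K \<rho> by blast
qed

lemma neumann:
  assumes inv: "binv D H (T \<mu>)" and C: "\<And>x. x \<in> D \<Longrightarrow> norm (app B x) \<le> C * norm (T \<mu> x)"
    and near: "cmod (\<nu> - \<mu>) * C \<le> 1/2"
  shows "binv D H (T \<nu>)"
proof -
  have "binv D H (\<lambda>x. T \<mu> x + (\<mu> - \<nu>) *\<^sub>C app B x)"
  proof (rule binv_perturb[OF H clin_T inv])
    show "clinear_on D (\<lambda>x. (\<mu> - \<nu>) *\<^sub>C app B x)"
      using clin_B unfolding clinear_on_def by (auto simp: scaleC.add_right mult.commute)
    show "(\<mu> - \<nu>) *\<^sub>C app B x \<in> H" if "x \<in> D" for x by (rule csubspace_scale[OF H(1) BH[OF that]])
    show "norm ((\<mu> - \<nu>) *\<^sub>C app B x) \<le> norm (T \<mu> x) / 2" if "x \<in> D" for x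
    proof -
      have "cmod (\<mu> - \<nu>) * norm (app B x) \<le> cmod (\<nu> - \<mu>) * (C * norm (T \<mu> x))"
        using mult_left_mono[OF C[OF that], of "cmod (\<nu> - \<mu>)"] by (simp add: norm_minus_commute)
      also have "\<dots> \<le> 1/2 * norm (T \<mu> x)" using mult_right_mono[OF near, of "norm (T \<mu> x)"] by (simp add: mult.assoc)
      finally show ?thesis by (simp add: norm_scaleC)
    qed
  qed
  moreover have "(\<lambda>x. T \<mu> x + (\<mu> - \<nu>) *\<^sub>C app B x) = T \<nu>"
    by (auto simp: fun_eq_iff T_def scaleC.diff_left)
  ultimately show ?thesis by simp
qed

lemma resolvent_identity:
  assumes "binv D H (T \<mu>)" "binv D H (T \<nu>)" "y \<in> H"
  shows "R \<nu> y - R \<mu> y = (\<nu> - \<mu>) *\<^sub>C R \<nu> (app B (R \<mu> y))"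
proof -
  note r = R_in[OF assms(1,3)] R_in[OF assms(2,3)]
  note q = R_in[OF assms(2) BH[OF r(1)]]
  have "T \<nu> (R \<nu> y - R \<mu> y) = T \<nu> ((\<nu> - \<mu>) *\<^sub>C R \<nu> (app B (R \<mu> y)))"
    using clinear_on_diff[OF clin_T r(3,1), of \<nu>] clinear_onD(3)[OF clin_T q(1), of \<nu>] r q T_change[of \<nu> "R \<mu> y" \<mu>]
    by simp
  moreover have "R \<nu> y - R \<mu> y \<in> D" "(\<nu> - \<mu>) *\<^sub>C R \<nu> (app B (R \<mu> y)) \<in> D"
    using r q csubspace_diff[OF subD] csubspace_scale[OF subD] by auto
  ultimately show ?thesis using R_T[OF assms(2)] by metis
qed

lemma resolvent_tendsto:
  assumes inv: "binv D H (T \<mu>)" and ev: "\<forall>\<^sub>F \<nu> in at \<mu>. binv D H (T \<nu>)" and z: "z \<in> H"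
  shows "((\<lambda>\<nu>. R \<nu> z) \<longlongrightarrow> R \<mu> z) (at \<mu>)"
proof -
  obtain K \<rho> where K: "K \<ge> 0" "\<rho> > 0"
    "\<And>\<nu> x. cmod (\<nu> - \<mu>) < \<rho> \<Longrightarrow> x \<in> D \<Longrightarrow> norm x \<le> K * norm (T \<nu> x)"
    using local_bound[OF inv] by blast
  have near: "\<forall>\<^sub>F \<nu> in at \<mu>. cmod (\<nu> - \<mu>) < \<rho>"
    unfolding eventually_at using K(2) by (auto simp: dist_norm)
  let ?w = "norm (app B (R \<mu> z))"
  have lim: "((\<lambda>\<nu>. cmod (\<nu> - \<mu>) * (K * ?w)) \<longlongrightarrow> 0) (at \<mu>)"
  proof -
    have "((\<lambda>\<nu>. cmod (\<nu> - \<mu>) * (K * ?w)) \<longlongrightarrow> cmod (\<mu> - \<mu>) * (K * ?w)) (at \<mu>)"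
      by (intro tendsto_intros)
    then show ?thesis by simp
  qed
  have "((\<lambda>\<nu>. R \<nu> z - R \<mu> z) \<longlongrightarrow> 0) (at \<mu>)"
  proof (rule Lim_null_comparison[OF _ lim])
    show "\<forall>\<^sub>F \<nu> in at \<mu>. norm (R \<nu> z - R \<mu> z) \<le> cmod (\<nu> - \<mu>) * (K * ?w)"
      using ev near
    proof eventually_elim
      case (elim \<nu>)
      have w: "app B (R \<mu> z) \<in> H" by (rule BH[OF R_in(1)[OF inv z]])
      have "norm (R \<nu> (app B (R \<mu> z))) \<le> K * ?w"
        using K(3)[OF elim(2) R_in(1)[OF elim(1) w]] R_in(2)[OF elim(1) w] by simp
      then show ?case
        unfolding resolvent_identity[OF inv elim(1) z] norm_scaleC by (rule mult_left_mono) simp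
    qed
  qed
  then show ?thesis by (rule LIM_zero_cancel)
qed

text \<open>By the resolvent identity the difference quotient is a matrix element of
  \<open>R \<nu>\<close> at the fixed vector \<open>app B (R \<mu> y)\<close>, and
  \<open>resolvent_tendsto\<close> gives its limit.\<close>

lemma resolvent_holomorphic:
  assumes U: "open U" "\<And>\<mu>. \<mu> \<in> U \<Longrightarrow> binv D H (T \<mu>)" and y: "y \<in> H"
  shows "(\<lambda>\<mu>. cinner (R \<mu> y) g) holomorphic_on U"
proof (rule holomorphic_onI)
  fix \<mu> assume \<mu>: "\<mu> \<in> U"
  have inv: "binv D H (T \<mu>)" by (rule U(2)[OF \<mu>])
  have ev: "\<forall>\<^sub>F \<nu> in at \<mu>. \<nu> \<in> U" using U(1) \<mu> by (rule eventually_at_in_open')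
  let ?z = "app B (R \<mu> y)"
  have z: "?z \<in> H" by (rule BH[OF R_in(1)[OF inv y]])
  have "((\<lambda>\<nu>. R \<nu> ?z) \<longlongrightarrow> R \<mu> ?z) (at \<mu>)"
    by (rule resolvent_tendsto[OF inv _ z]) (use ev U(2) in \<open>auto elim: eventually_mono\<close>)
  then have "((\<lambda>\<nu>. cinner (R \<nu> ?z) g) \<longlongrightarrow> cinner (R \<mu> ?z) g) (at \<mu>)"
    by (intro cinner.tendsto tendsto_const)
  then have "((\<lambda>\<nu>. (cinner (R \<nu> y) g - cinner (R \<mu> y) g) / (\<nu> - \<mu>)) \<longlongrightarrow> cinner (R \<mu> ?z) g) (at \<mu>)"
  proof (rule Lim_transform_eventually)
    show "\<forall>\<^sub>F \<nu> in at \<mu>. cinner (R \<nu> ?z) g = (cinner (R \<nu> y) g - cinner (R \<mu> y) g) / (\<nu> - \<mu>)"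
      using ev eventually_neq_at_within[of \<mu> \<mu> UNIV]
    proof eventually_elim
      case (elim \<nu>)
      have "cinner (R \<nu> y) g - cinner (R \<mu> y) g = (\<nu> - \<mu>) * cinner (R \<nu> ?z) g"
        using resolvent_identity[OF inv U(2)[OF elim(1)] y]
        by (metis cinner.diff_left cinner_scaleC_left)
      then show ?case using elim(2) by simp
    qed
  qed
  then have "((\<lambda>\<mu>. cinner (R \<mu> y) g) has_field_derivative cinner (R \<mu> ?z) g) (at \<mu>)"
    by (simp add: has_field_derivative_iff)
  then show "(\<lambda>\<mu>. cinner (R \<mu> y) g) field_differentiable at \<mu> within U"
    using field_differentiable_at_within field_differentiable_def by blast
qed

text \<open>\<open>local_bound\<close> has constants that are uniform near each point, so a
  violating sequence in the compact set contradicts the bound at its limit point.\<close>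

lemma sphere_bound:
  assumes S: "compact S" "\<And>\<mu>. \<mu> \<in> S \<Longrightarrow> binv D H (T \<mu>)"
  shows "\<exists>K\<ge>0. \<forall>\<mu>\<in>S. \<forall>x\<in>D. norm (app B x) \<le> K * norm (T \<mu> x)"
proof (rule ccontr)
  assume "\<not> ?thesis"
  then have "\<exists>\<mu>\<in>S. \<exists>x\<in>D. real n * norm (T \<mu> x) < norm (app B x)" for n :: nat
    using of_nat_0_le_iff not_le by metis
  then obtain \<mu> x where \<mu>: "\<And>n. \<mu> n \<in> S" "\<And>n. x n \<in> D" "\<And>n. real n * norm (T (\<mu> n) (x n)) < norm (app B (x n))"
    by metis
  obtain l r where l: "l \<in> S" "strict_mono r" "(\<mu> \<circ> r) \<longlonglongrightarrow> l"
    using S(1) \<mu>(1) unfolding compact_def by metis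
  obtain K \<rho> where K: "K \<ge> 0" "\<rho> > 0"
    "\<And>\<nu> x. cmod (\<nu> - l) < \<rho> \<Longrightarrow> x \<in> D \<Longrightarrow> norm (app B x) \<le> K * norm (T \<nu> x)"
    using local_bound[OF S(2)[OF l(1)]] by blast
  obtain N where N: "\<And>n. n \<ge> N \<Longrightarrow> cmod (\<mu> (r n) - l) < \<rho>"
    using LIMSEQ_D[OF l(3) K(2)] by auto
  obtain M :: nat where M: "K \<le> real M" using real_arch_simple by blast
  define n where "n = max N M"
  have "real (r n) * norm (T (\<mu> (r n)) (x (r n))) < K * norm (T (\<mu> (r n)) (x (r n)))"
    using \<mu>(3)[of "r n"] K(3)[OF N \<mu>(2), of n "r n"] by (simp add: n_def)
  moreover have "K \<le> real (r n)"
  proof -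
    have "M \<le> r n" using seq_suble[OF l(2), of n] by (simp add: n_def)
    then show ?thesis using M by linarith
  qed
  then have "K * norm (T (\<mu> (r n)) (x (r n))) \<le> real (r n) * norm (T (\<mu> (r n)) (x (r n)))"
    by (intro mult_right_mono) auto
  ultimately show False by linarith
qed

text \<open>Maximum principle for \<open>cinner (R \<nu> y) x\<close> with
  \<open>y = T \<mu> x\<close>: at \<open>\<nu> = \<mu>\<close> this function equals the squared
  norm of \<open>x\<close>, so one test vector suffices.\<close>

lemma disc_bound:
  assumes r: "0 < r" "r < \<delta>" and inv: "\<And>\<mu>. \<mu> \<in> ball p \<delta> \<Longrightarrow> binv D H (T \<mu>)"
    and C: "\<And>\<mu> x. \<mu> \<in> sphere p r \<Longrightarrow> x \<in> D \<Longrightarrow> norm x \<le> C * norm (T \<mu> x)"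
    and \<mu>: "\<mu> \<in> cball p r" and x: "x \<in> D"
  shows "norm x \<le> C * norm (T \<mu> x)"
proof -
  have sub: "cball p r \<subseteq> ball p \<delta>" using r by auto
  have inv\<mu>: "binv D H (T \<mu>)" using inv sub \<mu> by blast
  define y where "y = T \<mu> x"
  have y: "y \<in> H" unfolding y_def by (rule T_H[OF inv\<mu> x])
  have hol: "(\<lambda>\<nu>. cinner (R \<nu> y) x) holomorphic_on ball p \<delta>"
    by (rule resolvent_holomorphic[OF open_ball inv y])
  have "cmod (cinner (R \<mu> y) x) \<le> C * norm y * norm x"
  proof (rule maximum_modulus_frontier[of "\<lambda>\<nu>. cinner (R \<nu> y) x" "cball p r"])
    show "(\<lambda>\<nu>. cinner (R \<nu> y) x) holomorphic_on interior (cball p r)"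
      by (rule holomorphic_on_subset[OF hol]) (use sub interior_subset in blast)
    show "continuous_on (closure (cball p r)) (\<lambda>\<nu>. cinner (R \<nu> y) x)"
      using holomorphic_on_imp_continuous_on[OF hol] sub by (auto intro: continuous_on_subset)
    show "cmod (cinner (R \<nu> y) x) \<le> C * norm y * norm x" if "\<nu> \<in> frontier (cball p r)" for \<nu>
    proof -
      have \<nu>: "\<nu> \<in> sphere p r" using that r(1) by (simp add: frontier_cball)
      then have i: "binv D H (T \<nu>)" using inv sub by auto
      have "norm (R \<nu> y) \<le> C * norm y" using C[OF \<nu> R_in(1)[OF i y]] R_in(2)[OF i y] by simp
      then show ?thesis
        using norm_cinner_le[of "R \<nu> y" x] mult_right_mono[of _ _ "norm x"] order_trans by fastforce
    qed
  qed (use \<mu> in auto)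
  moreover have "cinner (R \<mu> y) x = of_real ((norm x)\<^sup>2)"
    unfolding y_def R_T[OF inv\<mu> x] by (rule cinner_self_norm)
  ultimately have "norm x * norm x \<le> (C * norm y) * norm x" by (simp add: power2_eq_square norm_mult)
  then show ?thesis
    by (cases "norm x = 0") (auto simp: y_def mult_le_cancel_right clinear_on_zero[OF clin_T])
qed

text \<open>On the punctured disc \<open>\<mu> \<mapsto> \<langle>B (A - \<mu>B)\<^sup>-\<^sup>1 y, g\<rangle>\<close> has a removable singularity at \<open>p\<close>, hence is
  bounded by its values on the circle. This bounds \<open>B (A - \<mu>B)\<^sup>-\<^sup>1\<close> near \<open>p\<close>, and a Neumann series gives
  invertibility at \<open>p\<close>.\<close>

lemma removable_point:
  assumes r: "0 < r" "r < \<delta>" and inv: "\<And>\<mu>. \<mu> \<in> ball p \<delta> - {p} \<Longrightarrow> binv D H (T \<mu>)"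
    and C: "\<And>\<mu> x. \<mu> \<in> cball p r \<Longrightarrow> x \<in> D \<Longrightarrow> norm x \<le> C * norm (T \<mu> x)"
    and adj: "\<And>g. g \<in> G \<Longrightarrow> \<exists>k. \<forall>x\<in>D. cinner (app B x) g = cinner x k" and G: "H \<subseteq> closure G"
  shows "binv D H (T p)"
proof -
  have sub: "cball p r \<subseteq> ball p \<delta>" using r by auto
  have "p \<notin> sphere p r" using r by simp
  then have sph: "binv D H (T \<mu>)" if "\<mu> \<in> sphere p r" for \<mu> using inv sub that by auto
  obtain K where K: "K \<ge> 0" "\<And>\<mu> x. \<mu> \<in> sphere p r \<Longrightarrow> x \<in> D \<Longrightarrow> norm (app B x) \<le> K * norm (T \<mu> x)"
    using sphere_bound[OF compact_sphere sph] by blast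
  have bound: "norm (app B x) \<le> K * norm (T \<mu> x)" if \<mu>: "\<mu> \<in> cball p r - {p}" and x: "x \<in> D" for \<mu> x
  proof -
    have inv\<mu>: "binv D H (T \<mu>)" using inv sub \<mu> by blast
    define y where "y = T \<mu> x"
    have y: "y \<in> H" unfolding y_def by (rule T_H[OF inv\<mu> x])
    \<comment> \<open>For \<open>g \<in> G\<close> the operator \<open>B\<close> moves to the
      right-hand argument, which leaves a matrix element of the resolvent. \<open>C\<close> bounds
      it near \<open>p\<close>, which makes the singularity removable.\<close>
    have le: "cmod (cinner (app B x) g) \<le> K * norm y * norm g" if g: "g \<in> G" for g
    proof -
      obtain k where k: "\<And>x. x \<in> D \<Longrightarrow> cinner (app B x) g = cinner x k" using adj[OF g] by blast
      define F where "F \<nu> = cinner (R \<nu> y) k" for \<nu>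
      have "F holomorphic_on (ball p \<delta> - {p})"
        unfolding F_def by (rule resolvent_holomorphic[OF _ inv y]) auto
      moreover have "p \<in> interior (ball p \<delta>)" using r by (simp add: interior_open)
      moreover have "\<forall>\<^sub>F \<nu> in at p. norm (F \<nu>) \<le> C * norm y * norm k"
        unfolding eventually_at
      proof (intro exI[of _ r] conjI ballI impI r(1))
        fix \<nu> assume "\<nu> \<noteq> p \<and> dist \<nu> p < r"
        then have \<nu>: "\<nu> \<in> cball p r" "\<nu> \<in> ball p \<delta> - {p}" using r by (auto simp: dist_commute)
        have i: "binv D H (T \<nu>)" by (rule inv[OF \<nu>(2)])
        have "norm (R \<nu> y) \<le> C * norm y" using C[OF \<nu>(1) R_in(1)[OF i y]] R_in(2)[OF i y] by simp
        then show "norm (F \<nu>) \<le> C * norm y * norm k"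
          unfolding F_def using norm_cinner_le[of "R \<nu> y" k] mult_right_mono[of _ _ "norm k"] order_trans by fastforce
      qed
      ultimately obtain h where h: "h holomorphic_on ball p \<delta>" "\<And>z. z \<in> ball p \<delta> - {p} \<Longrightarrow> h z = F z"
        using holomorphic_on_extend_bounded[of F "ball p \<delta>" p] by blast
      have "cmod (h \<mu>) \<le> K * norm y * norm g"
      proof (rule maximum_modulus_frontier[of h "cball p r"])
        show "h holomorphic_on interior (cball p r)"
          by (rule holomorphic_on_subset[OF h(1)]) (use sub interior_subset in blast)
        show "continuous_on (closure (cball p r)) h"
          using holomorphic_on_imp_continuous_on[OF h(1)] sub by (auto intro: continuous_on_subset)
        show "cmod (h \<nu>) \<le> K * norm y * norm g" if "\<nu> \<in> frontier (cball p r)" for \<nu>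
        proof -
          have \<nu>: "\<nu> \<in> sphere p r" using that r(1) by (simp add: frontier_cball)
          then have i: "binv D H (T \<nu>)" by (rule sph)
          have "\<nu> \<in> ball p \<delta> - {p}" using \<nu> r by auto
          then have "h \<nu> = cinner (app B (R \<nu> y)) g" using h(2) k[OF R_in(1)[OF i y]] by (simp add: F_def)
          moreover have "norm (app B (R \<nu> y)) \<le> K * norm y" using K(2)[OF \<nu> R_in(1)[OF i y]] R_in(2)[OF i y] by simp
          ultimately show ?thesis
            using norm_cinner_le[of "app B (R \<nu> y)" g] mult_right_mono[of _ _ "norm g"] order_trans by fastforce
        qed
      qed (use \<mu> in auto)
      moreover have "h \<mu> = cinner (app B x) g"
      proof -
        have "\<mu> \<in> ball p \<delta> - {p}" using \<mu> sub by auto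
        then show ?thesis using h(2) k[OF x] R_T[OF inv\<mu> x] by (simp add: F_def y_def)
      qed
      ultimately show ?thesis by simp
    qed
    \<comment> \<open>By density \<open>g\<close> may run to \<open>app B x\<close> itself, which
      turns the weak estimate into one of the norm.\<close>
    obtain g where g: "\<And>n. g n \<in> G" "g \<longlonglongrightarrow> app B x"
      using BH[OF x] G unfolding closure_sequential[symmetric] by (meson closure_sequential subsetD)
    have "(\<lambda>n. cmod (cinner (app B x) (g n))) \<longlonglongrightarrow> cmod (cinner (app B x) (app B x))"
      by (intro tendsto_intros cinner.tendsto g)
    moreover have "(\<lambda>n. K * norm y * norm (g n)) \<longlonglongrightarrow> K * norm y * norm (app B x)"
      by (intro tendsto_intros g)
    ultimately have "cmod (cinner (app B x) (app B x)) \<le> K * norm y * norm (app B x)"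
      by (rule LIMSEQ_le) (use le g in auto)
    then have "norm (app B x) * norm (app B x) \<le> (K * norm y) * norm (app B x)"
      unfolding cinner_self_norm by (simp add: power2_eq_square norm_mult)
    then show ?thesis
      by (cases "norm (app B x) = 0") (use K(1) in \<open>auto simp: y_def mult_le_cancel_right\<close>)
  qed
  \<comment> \<open>The offset keeps the point inside the disc and so close to \<open>p\<close> that
    \<open>s * K \<le> 1/2\<close>, as \<open>neumann\<close> requires.\<close>
  define s where "s = min r (1 / (2 * (K + 1)))"
  have s: "0 < s" "s \<le> r" "s * K \<le> 1/2"
  proof -
    show "0 < s" "s \<le> r" using r(1) K(1) by (auto simp: s_def)
    have "s * K \<le> 1 / (2 * (K + 1)) * K" using K(1) by (intro mult_right_mono) (auto simp: s_def)
    also have "\<dots> \<le> 1/2" using K(1) by (simp add: field_simps)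
    finally show "s * K \<le> 1/2" .
  qed
  let ?\<mu> = "p + of_real s"
  have \<mu>: "?\<mu> \<in> cball p r - {p}" using s by (auto simp: dist_norm)
  show ?thesis
  proof (rule neumann[of ?\<mu> K])
    show "binv D H (T ?\<mu>)" using \<mu> sub inv by blast
    show "norm (app B x) \<le> K * norm (T ?\<mu> x)" if "x \<in> D" for x by (rule bound[OF \<mu> that])
    show "cmod (p - ?\<mu>) * K \<le> 1/2" using s by simp
  qed
qed

text \<open>Riccati inequality: along the real line \<open>\<phi>(s) = \<langle>(A - (p+s)B)\<^sup>-\<^sup>1 x, x\<rangle>\<close> satisfies
  \<open>\<phi>' \<ge> c \<phi>\<^sup>2 / \<parallel>x\<parallel>\<^sup>2\<close>, so a large value at \<open>0\<close> would force a blow-up.\<close>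

lemma symmetric_gap:
  assumes sym: "\<And>x y. x \<in> D \<Longrightarrow> y \<in> D \<Longrightarrow> cinner (app A x) y = cinner x (app A y)"
      "\<And>x y. x \<in> D \<Longrightarrow> y \<in> D \<Longrightarrow> cinner (app B x) y = cinner x (app B y)"
    and c: "0 < c" "\<And>x. x \<in> D \<Longrightarrow> c * (norm x)\<^sup>2 \<le> Re (cinner (app B x) x)"
    and \<delta>: "0 < \<delta>" and inv: "\<And>s. \<bar>s\<bar> < \<delta> \<Longrightarrow> binv D H (T (of_real (l + s)))"
    and x: "x \<in> D"
  shows "c * \<delta> * norm x \<le> norm (T (of_real l) x)"
proof -
  have symT: "cinner (T (of_real s) x) y = cinner x (T (of_real s) y)" if "x \<in> D" "y \<in> D" for s x y
    using sym[OF that] by (simp add: T_def cinner.diff_left cinner.diff_right cinner_scaleC_left cinner_scaleC_right)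
  define Q where "Q s = R (of_real (l + s))" for s :: real
  note QD = R_in[OF inv, folded Q_def]
  have bounded: "\<bar>Re (cinner (Q 0 y) y)\<bar> \<le> 1 / (c * \<delta>) * (norm y)\<^sup>2" if y: "y \<in> H" for y
  proof (cases "y = 0")
    case True
    then show ?thesis by (simp add: cinner.zero_right)
  next
    case False
    define \<phi> where "\<phi> s = Re (cinner (Q s y) y)" for s
    \<comment> \<open>With this rate Cauchy--Schwarz bounds \<open>k * (\<phi> s)\<^sup>2\<close> by
      \<open>c\<close> times the squared norm of \<open>Q s y\<close>.\<close>
    define k where "k = c / (norm y)\<^sup>2"
    have k: "0 < k" using False c(1) by (simp add: k_def)
    have deriv: "\<exists>d. (\<phi> has_real_derivative d) (at s) \<and> k * (\<phi> s)\<^sup>2 \<le> d" if s: "\<bar>s\<bar> < \<delta>" for s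
    proof (intro exI conjI)
      let ?z = "app B (Q s y)"
      note q = QD[OF s y]
      have z: "?z \<in> H" by (rule BH[OF q(1)])
      define \<mu> where "\<mu> = complex_of_real (l + s)"
      have inv\<mu>: "binv D H (T \<mu>)" unfolding \<mu>_def by (rule inv[OF s])
      have ev: "\<forall>\<^sub>F u in at s. \<bar>u\<bar> < \<delta>"
        by (rule eventually_at_in_open'[of "{-\<delta><..<\<delta>}", simplified, THEN eventually_mono]) (use s in auto)
      have lim: "((\<lambda>u. Q u ?z) \<longlongrightarrow> Q s ?z) (at s)"
      proof -
        obtain K \<rho> where K: "K \<ge> 0" "\<rho> > 0"
          "\<And>\<nu> x. cmod (\<nu> - \<mu>) < \<rho> \<Longrightarrow> x \<in> D \<Longrightarrow> norm x \<le> K * norm (T \<nu> x)"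
          using local_bound[OF inv\<mu>] by blast
        let ?w = "norm (app B (Q s ?z))"
        have w: "app B (Q s ?z) \<in> H" by (rule BH[OF QD(1)[OF s z]])
        have near: "\<forall>\<^sub>F u in at s. \<bar>u - s\<bar> < \<rho>"
          unfolding eventually_at using K(2) by (auto simp: dist_real_def)
        have "((\<lambda>u. \<bar>u - s\<bar> * (K * ?w)) \<longlongrightarrow> \<bar>s - s\<bar> * (K * ?w)) (at s)" by (intro tendsto_intros)
        then have lim0: "((\<lambda>u. \<bar>u - s\<bar> * (K * ?w)) \<longlongrightarrow> 0) (at s)" by simp
        have "((\<lambda>u. Q u ?z - Q s ?z) \<longlongrightarrow> 0) (at s)"
        proof (rule Lim_null_comparison[OF _ lim0])
          show "\<forall>\<^sub>F u in at s. norm (Q u ?z - Q s ?z) \<le> \<bar>u - s\<bar> * (K * ?w)"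
            using ev near
          proof eventually_elim
            case (elim u)
            have d: "complex_of_real (l + u) - complex_of_real (l + s) = of_real (u - s)" by simp
            have "cmod (complex_of_real (l + u) - \<mu>) < \<rho>" using elim(2) unfolding \<mu>_def d norm_of_real .
            then have "norm (Q u (app B (Q s ?z))) \<le> K * ?w"
              using K(3)[OF _ QD(1)[OF elim(1) w]] QD(2)[OF elim(1) w] by fastforce
            then show ?case
              using resolvent_identity[OF inv[OF s] inv[OF elim(1)] z]
              unfolding Q_def[symmetric] d by (simp add: norm_scaleC mult_left_mono del: of_real_diff)
          qed
        qed
        then show ?thesis by (rule LIM_zero_cancel)
      qed
      have "((\<lambda>u. Re (cinner (Q u ?z) y)) \<longlongrightarrow> Re (cinner (Q s ?z) y)) (at s)"
        by (intro tendsto_Re cinner.tendsto lim tendsto_const)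
      then have "((\<lambda>u. (\<phi> u - \<phi> s) / (u - s)) \<longlongrightarrow> Re (cinner (Q s ?z) y)) (at s)"
      proof (rule Lim_transform_eventually)
        show "\<forall>\<^sub>F u in at s. Re (cinner (Q u ?z) y) = (\<phi> u - \<phi> s) / (u - s)"
          using ev eventually_neq_at_within[of s s UNIV]
        proof eventually_elim
          case (elim u)
          have d: "complex_of_real (l + u) - complex_of_real (l + s) = of_real (u - s)" by simp
          have "Q u y - Q s y = of_real (u - s) *\<^sub>C Q u ?z"
            using resolvent_identity[OF inv[OF s] inv[OF elim(1)] y] unfolding Q_def[symmetric] d .
          then have "cinner (Q u y) y - cinner (Q s y) y = of_real (u - s) * cinner (Q u ?z) y"
            by (metis cinner.diff_left cinner_scaleC_left)
          from arg_cong[OF this, of Re] have "\<phi> u - \<phi> s = (u - s) * Re (cinner (Q u ?z) y)"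
            unfolding \<phi>_def by simp
          then show ?case using elim(2) by simp
        qed
      qed
      then show "(\<phi> has_real_derivative Re (cinner (Q s ?z) y)) (at s)" by (simp add: has_field_derivative_iff)
      \<comment> \<open>Symmetry moves one resolvent to the right, so the derivative is the form of
        \<open>B\<close> at \<open>Q s y\<close>, which positivity bounds from below.\<close>
      have "cinner (Q s ?z) y = cinner ?z (Q s y)"
        using symT[OF QD(1)[OF s z] q(1), of "l + s"] QD(2)[OF s z] q(2) by simp
      then have "Re (cinner (Q s ?z) y) \<ge> c * (norm (Q s y))\<^sup>2" using c(2)[OF q(1)] by simp
      moreover have "k * (\<phi> s)\<^sup>2 \<le> c * (norm (Q s y))\<^sup>2"
      proof -
        have "\<bar>\<phi> s\<bar> \<le> norm (Q s y) * norm y"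
          unfolding \<phi>_def by (rule order_trans[OF abs_Re_le_cmod norm_cinner_le])
        then have "(\<phi> s)\<^sup>2 \<le> (norm (Q s y) * norm y)\<^sup>2"
          using power_mono[of "\<bar>\<phi> s\<bar>" _ 2] by simp
        then have "k * (\<phi> s)\<^sup>2 \<le> k * (norm (Q s y) * norm y)\<^sup>2" using k by (intro mult_left_mono) auto
        also have "\<dots> = c * (norm (Q s y))\<^sup>2" using False by (simp add: k_def power_mult_distrib)
        finally show ?thesis .
      qed
      ultimately show "k * (\<phi> s)\<^sup>2 \<le> Re (cinner (Q s ?z) y)" by linarith
    qed
    have mono: "\<phi> u \<le> \<phi> v" if uv: "-\<delta> < u" "u \<le> v" "v < \<delta>" for u v
    proof (rule DERIV_nonneg_imp_nondecreasing[OF uv(2)])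
      fix s assume "u \<le> s" "s \<le> v"
      then have "\<bar>s\<bar> < \<delta>" using uv by auto
      then obtain d where "(\<phi> has_real_derivative d) (at s)" "k * (\<phi> s)\<^sup>2 \<le> d" using deriv by blast
      then show "\<exists>d. (\<phi> has_real_derivative d) (at s) \<and> 0 \<le> d"
        using k by (meson less_imp_le mult_nonneg_nonneg order_trans zero_le_power2)
    qed
    \<comment> \<open>Where \<open>\<phi>\<close> has no zero, the Riccati inequality says that
      \<open>- 1 / \<phi>\<close> grows at rate at least \<open>k\<close>.\<close>
    have grow: "- inverse (\<phi> u) + k * (v - u) \<le> - inverse (\<phi> v)"
      if uv: "-\<delta> < u" "u \<le> v" "v < \<delta>" and nz: "\<And>s. u \<le> s \<Longrightarrow> s \<le> v \<Longrightarrow> \<phi> s \<noteq> 0" for u v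
    proof -
      have "- inverse (\<phi> u) - k * u \<le> - inverse (\<phi> v) - k * v"
      proof (rule DERIV_nonneg_imp_nondecreasing[OF uv(2), of "\<lambda>s. - inverse (\<phi> s) - k * s"])
        fix s assume s: "u \<le> s" "s \<le> v"
        then have "\<bar>s\<bar> < \<delta>" using uv by auto
        then obtain d where d: "(\<phi> has_real_derivative d) (at s)" "k * (\<phi> s)\<^sup>2 \<le> d" using deriv by blast
        have "((\<lambda>s. - inverse (\<phi> s) - k * s) has_real_derivative d / (\<phi> s)\<^sup>2 - k) (at s)"
          using nz[OF s] by (auto intro!: derivative_eq_intros d(1) simp: power2_eq_square field_simps)
        moreover have "0 \<le> d / (\<phi> s)\<^sup>2 - k" using d(2) nz[OF s] by (simp add: pos_le_divide_eq)
        ultimately show "\<exists>d. ((\<lambda>s. - inverse (\<phi> s) - k * s) has_real_derivative d) (at s) \<and> 0 \<le> d" by blast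
      qed
      then show ?thesis by (simp add: algebra_simps)
    qed
    \<comment> \<open>Monotonicity preserves the sign of \<open>\<phi> 0\<close> on one side only:
      to the right if it is positive, to the left if it is negative. That half of the interval is
      used.\<close>
    have main: "k * u \<le> inverse \<bar>\<phi> 0\<bar>" if u: "0 < u" "u < \<delta>" and nz0: "\<phi> 0 \<noteq> 0" for u
    proof (cases "0 < \<phi> 0")
      case True
      have pos: "0 < \<phi> s" if "0 \<le> s" "s \<le> u" for s using mono[of 0 s] that u True by linarith
      have "- inverse (\<phi> 0) + k * (u - 0) \<le> - inverse (\<phi> u)"
        using pos u by (intro grow) (auto simp: less_imp_neq[symmetric] dest: less_imp_neq)
      moreover have "0 < inverse (\<phi> u)" using pos[of u] u by (simp only: inverse_positive_iff_positive)
      moreover have "inverse \<bar>\<phi> 0\<bar> = inverse (\<phi> 0)" using True by simp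
      ultimately show ?thesis unfolding diff_zero by linarith
    next
      case False
      then have neg0: "\<phi> 0 < 0" using nz0 by simp
      have neg: "\<phi> s < 0" if "-u \<le> s" "s \<le> 0" for s using mono[of s 0] that u neg0 by linarith
      have "- inverse (\<phi> (-u)) + k * (0 - (-u)) \<le> - inverse (\<phi> 0)"
        using neg u by (intro grow) (auto dest: less_imp_neq)
      moreover have "inverse (\<phi> (-u)) < 0" using neg[of "-u"] u by (simp only: inverse_negative_iff_negative)
      moreover have "inverse \<bar>\<phi> 0\<bar> = - inverse (\<phi> 0)" using neg0 by (simp add: abs_if)
      moreover have "k * (0 - (-u)) = k * u" by simp
      ultimately show ?thesis by linarith
    qed
    have "\<bar>\<phi> 0\<bar> \<le> 1 / (k * \<delta>)"
    proof (cases "\<phi> 0 = 0")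
      case False
      have "k * \<delta> \<le> inverse \<bar>\<phi> 0\<bar>"
      proof (rule ccontr)
        assume "\<not> k * \<delta> \<le> inverse \<bar>\<phi> 0\<bar>"
        then have lt: "inverse \<bar>\<phi> 0\<bar> / k < \<delta>"
          by (simp only: not_le pos_divide_less_eq[OF k] mult.commute)
        obtain u where lo: "inverse \<bar>\<phi> 0\<bar> / k < u" and hi: "u < \<delta>" using Orderings.dense[OF lt] by blast
        have "0 \<le> inverse \<bar>\<phi> 0\<bar> / k" using k by simp
        then have u: "0 < u" "u < \<delta>" "inverse \<bar>\<phi> 0\<bar> / k < u" using lo hi by (blast intro: le_less_trans)+
        have "k * u \<le> inverse \<bar>\<phi> 0\<bar>" by (rule main[OF u(1,2) False])
        moreover have "inverse \<bar>\<phi> 0\<bar> < k * u"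
          using u(3) by (simp only: pos_divide_less_eq[OF k] mult.commute)
        ultimately show False by linarith
      qed
      from le_imp_inverse_le[OF this] show ?thesis using k \<delta> by (simp add: divide_inverse)
    qed (use k \<delta> in simp)
    also have "1 / (k * \<delta>) = 1 / (c * \<delta>) * (norm y)\<^sup>2" using False by (simp add: k_def)
    finally show ?thesis unfolding \<phi>_def .
  qed
  have inv0: "binv D H (T (of_real l))" using inv[of 0] \<delta> by simp
  have Q0: "Q 0 = R (of_real l)" by (simp add: Q_def)
  define K where "K = 1 / (c * \<delta>)"
  have K: "0 < K" using c(1) \<delta> by (simp add: K_def)
  have Q_lin: "Q 0 (u + v) = Q 0 u + Q 0 v" if "u \<in> H" "v \<in> H" for u v
    using R_T[OF inv0 csubspace_add[OF subD R_in(1)[OF inv0 that(1)] R_in(1)[OF inv0 that(2)]]]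
      R_in(2)[OF inv0 that(1)] R_in(2)[OF inv0 that(2)]
      clinear_onD(2)[OF clin_T R_in(1)[OF inv0 that(1)] R_in(1)[OF inv0 that(2)]]
    by (simp add: Q0)
  have Q_diff: "Q 0 (u - v) = Q 0 u - Q 0 v" if "u \<in> H" "v \<in> H" for u v
    using Q_lin[of "u - v" v] that csubspace_diff[OF H(1)] by simp
  have Q_sym: "cinner (Q 0 u) v = cinner u (Q 0 v)" if "u \<in> H" "v \<in> H" for u v
    using symT[OF R_in(1)[OF inv0 that(1)] R_in(1)[OF inv0 that(2)], of l] R_in(2)[OF inv0 that(1)] R_in(2)[OF inv0 that(2)]
    by (simp add: Q0)
  text \<open>Polarisation turns the bound on the quadratic form of the symmetric operator \<open>Q 0\<close> into a norm bound.\<close>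
  have polar: "4 * Re (cinner (Q 0 u) v) \<le> 2 * K * ((norm u)\<^sup>2 + (norm v)\<^sup>2)" if u: "u \<in> H" and v: "v \<in> H" for u v
  proof -
    have uv: "u + v \<in> H" "u - v \<in> H" using csubspace_add[OF H(1) u v] csubspace_diff[OF H(1) u v] by auto
    have "Re (cinner (Q 0 v) u) = Re (cinner (Q 0 u) v)"
      using Q_sym[OF v u] cinner_commute[of v "Q 0 u"] by simp
    then have "4 * Re (cinner (Q 0 u) v) = Re (cinner (Q 0 (u + v)) (u + v)) - Re (cinner (Q 0 (u - v)) (u - v))"
      unfolding Q_lin[OF u v] Q_diff[OF u v]
      by (simp add: cinner.add_left cinner.add_right cinner.diff_left cinner.diff_right)
    also have "\<dots> \<le> K * (norm (u + v))\<^sup>2 + K * (norm (u - v))\<^sup>2"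
      using bounded[OF uv(1)] bounded[OF uv(2)] unfolding K_def[symmetric] by linarith
    also have "\<dots> = 2 * K * ((norm u)\<^sup>2 + (norm v)\<^sup>2)"
      by (simp add: power2_norm_eq_inner inner_add_left inner_add_right inner_diff_left inner_diff_right algebra_simps)
    finally show ?thesis .
  qed
  define y where "y = T (of_real l) x"
  have y: "y \<in> H" unfolding y_def by (rule T_H[OF inv0 x])
  have Qy: "Q 0 y = x" unfolding y_def Q0 by (rule R_T[OF inv0 x])
  have xH: "x \<in> H" using linear_operatorD(4)[OF A] x by auto
  have "norm x \<le> K * norm y"
  proof (cases "x = 0")
    case False
    \<comment> \<open>\<open>x\<close> is scaled to the norm of \<open>y\<close>, which balances the
      two squares in \<open>polar\<close>.\<close>
    define v where "v = (norm y / norm x) *\<^sub>R x"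
    have v: "v \<in> H" unfolding v_def by (rule subspace_scale[OF csubspace_imp_subspace[OF H(1)] xH])
    have nv: "norm v = norm y" using False by (simp add: v_def)
    have "Re (cinner (Q 0 y) v) = norm y * norm x"
      unfolding Qy v_def cinner.scaleR_right cinner_self_norm using False by (simp add: power2_eq_square)
    then have "4 * (norm y * norm x) \<le> 2 * K * ((norm y)\<^sup>2 + (norm y)\<^sup>2)"
      using polar[OF y v] nv by simp
    then have "norm x * norm y \<le> (K * norm y) * norm y" by (simp add: power2_eq_square algebra_simps)
    moreover have "norm y \<noteq> 0"
    proof
      assume "norm y = 0"
      then have "y = 0" by simp
      then have "x = Q 0 (0 - 0)" using Qy by simp
      then have "x = 0" unfolding Q_diff[OF csubspace_0[OF H(1)] csubspace_0[OF H(1)]] by simp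
      then show False using False by simp
    qed
    ultimately show ?thesis by (simp add: mult_le_cancel_right)
  qed (use K in simp)
  then have "c * \<delta> * norm x \<le> c * \<delta> * (K * norm y)" using c(1) \<delta> by (intro mult_left_mono) auto
  also have "\<dots> = norm y" using c(1) \<delta> by (simp add: K_def)
  finally show ?thesis by (simp add: y_def)
qed

end

section \<open>Domain truncation\<close>

lemma app_restrict:
  assumes S: "linear_operator (L2_on \<Omega>) S" "given_by \<tau> \<Omega> S"
    and S': "linear_operator (L2_on U) S'" "given_by \<tau> U S'"
    and U: "open U" "U \<subseteq> \<Omega>" and f: "f \<in> dom S" "restrict_l2 U f \<in> dom S'"
  shows "app S' (restrict_l2 U f) = restrict_l2 U (app S f)"
  by (rule given_by_restrict[OF S(2) S'(2) U linear_operatorD(3)[OF S(1) f(1)]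
        linear_operatorD(3)[OF S'(1) f(2)] linear_operatorD(5)[OF S'(1) f(2)]])

lemma closable_form_sectorial:
  assumes S: "linear_operator H S" and form: "closable_form (dom S) (qform S)"
  obtains \<omega> \<gamma> M where "sectorial_operator (dom S) (app S) \<omega> \<gamma> M"
proof -
  have q: "qform S = (\<lambda>f. cinner (app S f) f)" by (simp add: fun_eq_iff qform_def)
  obtain \<omega> \<gamma> M where *: "cmod \<omega> = 1" "\<And>f. f \<in> dom S \<Longrightarrow> \<gamma> * (norm f)\<^sup>2 \<le> Re (\<omega> * cinner (app S f) f)"
    "\<And>f. f \<in> dom S \<Longrightarrow> \<bar>Im (\<omega> * cinner (app S f) f)\<bar> \<le> M * (Re (\<omega> * cinner (app S f) f) - \<gamma> * (norm f)\<^sup>2)"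
    using form unfolding closable_form_def sectorial_form_def q by blast
  have "sectorial_operator (dom S) (app S) \<omega> \<gamma> M"
  proof
    show "(\<lambda>n. cinner (app S (X n)) (X n)) \<longlonglongrightarrow> 0" if "form_converges (dom S) (\<lambda>x. cinner (app S x) x) X 0" for X
      using form that unfolding closable_form_def q by blast
  qed (fact * linear_operator_clinear_on[OF S])+
  then show ?thesis by (rule that)
qed

text \<open>The sectors of the two forms may point in different directions, hence separate
  rotations, vertices and slopes.\<close>

locale truncation =
  SA: sectorial_operator "dom A" "app A" \<omega>A \<gamma>A MA + SB: sectorial_operator "dom B" "app B" \<omega>B \<gamma>B MB
  for A B :: "'d::finite operator" and \<omega>A \<omega>B :: complex and \<gamma>A MA \<gamma>B MB :: real +
  fixes \<Omega> :: "(real^'d) set" and \<Omega>n :: "nat \<Rightarrow> (real^'d) set" and \<tau>\<^sub>1 \<tau>\<^sub>2 :: "'d diff_expr" and An Bn :: "nat \<Rightarrow> 'd operator"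
  assumes open_\<Omega>: "open \<Omega>" "open (\<Omega>n n)" and nested: "\<Omega>n n \<subseteq> \<Omega>" "\<Omega>n n \<subseteq> \<Omega>n (Suc n)" and exhaust: "(\<Union>n. \<Omega>n n) = \<Omega>"
    and A: "realisation \<tau>\<^sub>1 \<Omega> A" and B: "realisation \<tau>\<^sub>2 \<Omega> B"
    and B_rel: "relatively_bounded B A"
    and B_rel': "relatively_bounded (adjoint (L2_on \<Omega>) B) (adjoint (L2_on \<Omega>) A)"
    and An: "realisation \<tau>\<^sub>1 (\<Omega>n n) (An n)" and Bn: "realisation \<tau>\<^sub>2 (\<Omega>n n) (Bn n)"
    and dom_n: "dom (An n) \<subseteq> dom (Bn n)"
    and dom_n': "dom (adjoint (L2_on (\<Omega>n n)) (An n)) \<subseteq> dom (adjoint (L2_on (\<Omega>n n)) (Bn n))"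
    and core': "truncation_core \<Omega>n (adjoint (L2_on \<Omega>) A) (\<lambda>n. adjoint (L2_on (\<Omega>n n)) (An n))"
    and form_dom: "dom_form_closure (dom A) (qform A) \<subseteq> dom_form_closure (dom B) (qform B)"
    and form_n: "f \<in> dom (An n) \<Longrightarrow> f \<in> dom_form_closure (dom A) (qform A)"
      "f \<in> dom (An n) \<Longrightarrow> cinner (app (An n) f) f = form_closure (dom A) (qform A) f"
      "f \<in> dom (An n) \<Longrightarrow> cinner (app (Bn n) f) f = form_closure (dom B) (qform B) f"
begin

abbreviation H :: "'d l2 set" where "H \<equiv> L2_on \<Omega>"
abbreviation Hn :: "nat \<Rightarrow> 'd l2 set" where "Hn n \<equiv> L2_on (\<Omega>n n)"
abbreviation A' :: "'d operator" where "A' \<equiv> adjoint H A"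
abbreviation B' :: "'d operator" where "B' \<equiv> adjoint H B"
abbreviation An' :: "nat \<Rightarrow> 'd operator" where "An' n \<equiv> adjoint (Hn n) (An n)"
abbreviation Bn' :: "nat \<Rightarrow> 'd operator" where "Bn' n \<equiv> adjoint (Hn n) (Bn n)"
abbreviation restr :: "nat \<Rightarrow> 'd l2 \<Rightarrow> 'd l2" where "restr n \<equiv> restrict_l2 (\<Omega>n n)"

lemma meas: "\<Omega> \<in> sets lebesgue" "\<Omega>n n \<in> sets lebesgue"
  using open_\<Omega> by auto

lemmas H = csubspace_L2_on[OF meas(1)] closed_L2_on[OF meas(1)]
lemmas Hn = csubspace_L2_on[OF meas(2)] closed_L2_on[OF meas(2)]

lemma op: "linear_operator H A" "linear_operator H B" "linear_operator (Hn n) (An n)" "linear_operator (Hn n) (Bn n)"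
  using A B An Bn by (auto simp: realisation_def)

lemma op': "linear_operator H A'" "linear_operator H B'" "linear_operator (Hn n) (An' n)" "linear_operator (Hn n) (Bn' n)"
  using A B An Bn by (auto simp: realisation_def intro!: linear_operator_adjoint H Hn)

lemma dense: "closure (dom A) = H" "closure (dom B) = H" "closure (dom (An n)) = Hn n"
  using A B An by (auto simp: realisation_def densely_defined_def)

lemma dom: "dom A \<subseteq> dom B" "dom A' \<subseteq> dom B'"
  using B_rel B_rel' by (auto simp: relatively_bounded_def)

sublocale P: operator_pair H A B
  by unfold_locales (fact op dom)+

lemma Pn: "operator_pair (Hn n) (An n) (Bn n)"
  by unfold_locales (fact op dom_n)+

definition Tn :: "nat \<Rightarrow> complex \<Rightarrow> 'd l2 \<Rightarrow> 'd l2" where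
  "Tn n \<mu> f = app (An n) f - \<mu> *\<^sub>C app (Bn n) f"

lemma Tn_eq: "operator_pair.T (An n) (Bn n) = Tn n"
  by (simp add: fun_eq_iff operator_pair.T_def[OF Pn] Tn_def)

lemmas domD = subsetD[OF linear_operatorD(4)[OF op(1)]]
lemmas domD_n = subsetD[OF linear_operatorD(4)[OF op(3)]]

lemma adjoint_restrict:
  assumes "g \<in> dom A'" "restr n g \<in> dom (An' n)"
  shows "app (An' n) (restr n g) = restr n (app A' g)" "app (Bn' n) (restr n g) = restr n (app B' g)"
proof -
  have "given_by (formal_adjoint \<tau>\<^sub>1) \<Omega> A'" "given_by (formal_adjoint \<tau>\<^sub>1) (\<Omega>n n) (An' n)"
    "given_by (formal_adjoint \<tau>\<^sub>2) \<Omega> B'" "given_by (formal_adjoint \<tau>\<^sub>2) (\<Omega>n n) (Bn' n)"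
    using A B An Bn by (auto simp: realisation_def)
  note g = this
  show "app (An' n) (restr n g) = restr n (app A' g)"
    by (rule app_restrict[OF op'(1) g(1) op'(3) g(2) open_\<Omega>(2) nested(1) assms])
  show "app (Bn' n) (restr n g) = restr n (app B' g)"
    by (rule app_restrict[OF op'(2) g(3) op'(4) g(4) open_\<Omega>(2) nested(1) subsetD[OF dom(2) assms(1)]
          subsetD[OF dom_n' assms(2)]])
qed

lemma restrict_app:
  assumes "f \<in> dom A" "restr n f \<in> dom (An n)"
  shows "app (An n) (restr n f) = restr n (app A f)" "app (Bn n) (restr n f) = restr n (app B f)"
proof -
  have "given_by \<tau>\<^sub>1 \<Omega> A" "given_by \<tau>\<^sub>1 (\<Omega>n n) (An n)" "given_by \<tau>\<^sub>2 \<Omega> B" "given_by \<tau>\<^sub>2 (\<Omega>n n) (Bn n)"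
    using A B An Bn by (auto simp: realisation_def)
  note g = this
  show "app (An n) (restr n f) = restr n (app A f)"
    by (rule app_restrict[OF op(1) g(1) op(3) g(2) open_\<Omega>(2) nested(1) assms])
  show "app (Bn n) (restr n f) = restr n (app B f)"
    by (rule app_restrict[OF op(2) g(3) op(4) g(4) open_\<Omega>(2) nested(1) subsetD[OF dom(1) assms(1)]
          subsetD[OF dom_n assms(2)]])
qed

lemma qform_eq: "qform S = (\<lambda>f. cinner (app S f) f)"
  by (simp add: fun_eq_iff qform_def)

text \<open>The inclusion of the form domains is turned into an inequality of norms; every estimate
  of the form of \<open>B\<close> by the form norm of \<open>A\<close> rests on it.\<close>

lemma form_comparison: "\<exists>K\<ge>0. \<forall>x\<in>dom A. SB.F.nrm x \<le> K * SA.F.nrm x"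
  unfolding SA.F.nrm_def SB.F.nrm_def
  by (rule closable_real_form_comparison[OF SA.F.closable_real_form_axioms SB.F.closable_real_form_axioms _ dom(1)])
    (use form_dom in \<open>simp add: SA.V_eq SB.V_eq qform_eq\<close>)

text \<open>By \<open>form_comparison\<close> a sequence that converges to \<open>f\<close> in the
  form of \<open>A\<close> also converges in that of \<open>B\<close>, so one vector serves both
  forms.\<close>

lemma form_approximation:
  assumes f: "f \<in> dom (An n)" and e: "0 < e"
  shows "\<exists>y\<in>dom A. norm (y - f) < e \<and> cmod (P.a y - cinner (app (An n) f) f) < e \<and>
    cmod (P.b y - cinner (app (Bn n) f) f) < e"
proof -
  obtain X where X: "SA.F.conv X f"
    using form_n(1)[OF f] SA.V_eq unfolding SA.F.V_def qform_eq by blast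
  obtain K where K: "K \<ge> 0" "\<And>x. x \<in> dom A \<Longrightarrow> SB.F.nrm x \<le> K * SA.F.nrm x" using form_comparison by blast
  have XB: "SB.F.conv X f"
    unfolding SB.F.conv_def
  proof (intro conjI allI impI)
    show "X n \<in> dom B" for n by (rule subsetD[OF dom(1) SA.F.convD(1)[OF X]])
    show "X \<longlonglongrightarrow> f" by (rule SA.F.convD(2)[OF X])
    fix d :: real assume d: "0 < d"
    then have "0 < d / (K + 1)" using K(1) by simp
    then obtain N where N: "\<forall>m\<ge>N. \<forall>n\<ge>N. SA.F.nrm (X m - X n) < d / (K + 1)" using SA.F.convD(3)[OF X] by blast
    have "SB.F.nrm (X m - X n) < d" if "m \<ge> N" "n \<ge> N" for m n
    proof -
      have "X m - X n \<in> dom A" by (rule csubspace_diff[OF SA.D SA.F.convD(1)[OF X] SA.F.convD(1)[OF X]])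
      then have "SB.F.nrm (X m - X n) \<le> K * SA.F.nrm (X m - X n)" by (rule K(2))
      also have "\<dots> \<le> K * (d / (K + 1))" using N that K(1) by (intro mult_left_mono) (auto intro: less_imp_le)
      also have "\<dots> < d" using K(1) d by (simp add: field_simps)
      finally show ?thesis .
    qed
    then show "\<exists>N. \<forall>m\<ge>N. \<forall>n\<ge>N. SB.F.nrm (X m - X n) < d" by blast
  qed
  have lim: "(\<lambda>j. P.a (X j)) \<longlonglongrightarrow> cinner (app (An n) f) f" "(\<lambda>j. P.b (X j)) \<longlonglongrightarrow> cinner (app (Bn n) f) f"
    using SA.form_closure_lim[OF X] SB.form_closure_lim[OF XB] form_n(2,3)[OF f] by (simp_all add: qform_eq)
  have "\<forall>\<^sub>F j in sequentially. norm (X j - f) < e \<and> cmod (P.a (X j) - cinner (app (An n) f) f) < e \<and>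
    cmod (P.b (X j) - cinner (app (Bn n) f) f) < e"
    using tendstoD[OF SA.F.convD(2)[OF X] e] tendstoD[OF lim(1) e] tendstoD[OF lim(2) e]
    by eventually_elim (simp add: dist_norm)
  then obtain j where "norm (X j - f) < e" "cmod (P.a (X j) - cinner (app (An n) f) f) < e"
    "cmod (P.b (X j) - cinner (app (Bn n) f) f) < e"
    using eventually_happens'[OF sequentially_bot] by blast
  then show ?thesis using SA.F.convD(1)[OF X] by blast
qed

lemma adjoint_form_dense:
  assumes x: "x \<in> dom A" and e: "0 < e"
  shows "\<exists>g\<in>dom A'. \<exists>X. (\<forall>n. X n \<in> dom A \<and> SA.F.nrm (x - X n) < e) \<and> X \<longlonglongrightarrow> g"
proof -
  obtain g k X where X: "\<forall>n. X n \<in> dom A \<and> SA.F.nrm (x - X n) < e" "X \<longlonglongrightarrow> g"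
    "\<And>y. y \<in> dom A \<Longrightarrow> cinner (app A y) g = cinner y k"
    using SA.adjoint_dense[OF x e] by blast
  have "g \<in> H" by (rule closed_sequentially[OF H(2) _ X(2)]) (use X(1) domD in blast)
  \<comment> \<open>Nothing places \<open>k\<close> in \<open>H\<close>; cutting it off to
    \<open>\<Omega>\<close> does, and leaves its products with \<open>dom A\<close>
    unchanged.\<close>
  moreover have "cinner (app A y) g = cinner y (restrict_l2 \<Omega> k)" if "y \<in> dom A" for y
    using X(3)[OF that] cinner_L2_on_restrict[OF meas(1) domD[OF that]] by simp
  ultimately have "(g, restrict_l2 \<Omega> k) \<in> A'"
    unfolding mem_adjoint_iff[OF op(1)] using restrict_in_L2_on[OF meas(1)] by blast
  then show ?thesis using X(1,2) by blast
qed

text \<open>The form norm dominates the norm, so \<open>adjoint_form_dense\<close> yields ordinary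
  density. \<open>dom A'\<close> will supply the test vectors of
  \<open>removable_point\<close>.\<close>

lemma adjoint_dense: "H \<subseteq> closure (dom A')"
proof -
  have "x \<in> closure (dom A')" if x: "x \<in> dom A" for x
    unfolding closure_approachable
  proof (intro allI impI)
    fix e :: real assume e: "0 < e"
    obtain g X where g: "g \<in> dom A'" "\<forall>n. X n \<in> dom A \<and> SA.F.nrm (x - X n) < e/2" "X \<longlonglongrightarrow> g"
      using adjoint_form_dense[OF x half_gt_zero[OF e]] by blast
    have "norm (x - X n) \<le> e/2" for n
    proof -
      have "x - X n \<in> dom A" using csubspace_diff[OF SA.D x] g(2) by blast
      then have "norm (x - X n) \<le> SA.F.nrm (x - X n)" using SA.norm_le_sqrt_r by (simp add: SA.F.nrm_def)
      then show ?thesis using g(2) by (meson less_imp_le order_trans)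
    qed
    moreover have "(\<lambda>n. norm (x - X n)) \<longlonglongrightarrow> norm (x - g)" by (intro tendsto_intros g(3))
    ultimately have "norm (x - g) \<le> e/2" by (intro LIMSEQ_le_const2) auto
    then show "\<exists>g\<in>dom A'. dist g x < e" using g(1) e by (intro bexI[of _ g]) (auto simp: dist_norm norm_minus_commute)
  qed
  then have "closure (dom A) \<subseteq> closure (dom A')" by (intro closure_minimal) auto
  then show ?thesis using dense(1) by simp
qed

lemma form_limit:
  assumes f: "f \<in> dom (An n)"
  obtains y where "\<And>k. y k \<in> dom A" "y \<longlonglongrightarrow> f" "(\<lambda>k. P.a (y k)) \<longlonglongrightarrow> cinner (app (An n) f) f"
    "(\<lambda>k. P.b (y k)) \<longlonglongrightarrow> cinner (app (Bn n) f) f"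
proof -
  have "\<exists>y. y \<in> dom A \<and> norm (y - f) < inverse (real (Suc k)) \<and>
    cmod (P.a y - cinner (app (An n) f) f) < inverse (real (Suc k)) \<and>
    cmod (P.b y - cinner (app (Bn n) f) f) < inverse (real (Suc k))" for k
    using form_approximation[OF f, of "inverse (real (Suc k))"] by auto
  then obtain y where y: "\<And>k. y k \<in> dom A" "\<And>k. norm (y k - f) < inverse (real (Suc k))"
    "\<And>k. cmod (P.a (y k) - cinner (app (An n) f) f) < inverse (real (Suc k))"
    "\<And>k. cmod (P.b (y k) - cinner (app (Bn n) f) f) < inverse (real (Suc k))" by metis
  have "y \<longlonglongrightarrow> f" "(\<lambda>k. P.a (y k)) \<longlonglongrightarrow> cinner (app (An n) f) f" "(\<lambda>k. P.b (y k)) \<longlonglongrightarrow> cinner (app (Bn n) f) f"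
    by (rule LIM_zero_cancel, rule Lim_null_comparison[OF always_eventually LIMSEQ_inverse_real_of_nat],
      use y in \<open>auto intro: less_imp_le simp del: of_nat_Suc\<close>)+
  then show ?thesis using that y(1) by blast
qed

text \<open>Vectors of \<open>dom (An n)\<close> are reached only through the form closure, but an
  inequality between form and norm survives this limit with the same constants.\<close>

lemma half_plane_n: "f \<in> dom (An n) \<Longrightarrow> \<gamma>B * (norm f)\<^sup>2 \<le> Re (\<omega>B * cinner (app (Bn n) f) f)"
proof -
  assume f: "f \<in> dom (An n)"
  obtain y where y: "\<And>k. y k \<in> dom A" "y \<longlonglongrightarrow> f" "(\<lambda>k. P.b (y k)) \<longlonglongrightarrow> cinner (app (Bn n) f) f"
    using form_limit[OF f] by blast
  have lim: "(\<lambda>k. \<gamma>B * (norm (y k))\<^sup>2) \<longlonglongrightarrow> \<gamma>B * (norm f)\<^sup>2"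
    "(\<lambda>k. Re (\<omega>B * P.b (y k))) \<longlonglongrightarrow> Re (\<omega>B * cinner (app (Bn n) f) f)" by (intro tendsto_intros y)+
  show ?thesis
    by (rule LIMSEQ_le[OF lim]) (use SB.sector(1) y(1) dom(1) in blast)
qed

text \<open>Approximate eigenvectors of the truncated pencils converge weakly, along a subsequence, to an
  element orthogonal to the range of \<open>A\<^sup>* - \<mu>\<^sup>* B\<^sup>*\<close>; their approximants in \<open>dom A\<close> contradict
  \<open>pencil_form.no_approximate_eigenvectors\<close>.\<close>

lemma no_approximate_eigenvectors:
  assumes inv: "binv (dom A) H (P.T \<mu>)" and W: "\<mu> \<notin> P.W"
    and f: "\<And>k. f k \<in> dom (An (n k))" "\<And>k. norm (f k) = 1" and n: "strict_mono n"
    and m: "m \<longlonglongrightarrow> \<mu>" and res: "(\<lambda>k. Tn (n k) (m k) (f k)) \<longlonglongrightarrow> 0"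
  shows False
proof -
  obtain r w where r: "strict_mono r" and w: "weakly_null (\<lambda>k. f (r k) - w)"
    using weakly_convergent_subsequence[of f 1] f(2) by fastforce
  define F N M \<rho> where "F k = f (r k)" and "N k = n (r k)" and "M k = m (r k)" and "\<rho> k = Tn (N k) (M k) (F k)" for k
  have F: "F k \<in> dom (An (N k))" "norm (F k) = 1" for k by (simp_all add: F_def N_def f)
  have N: "strict_mono N" using n r by (auto simp: N_def strict_mono_def)
  have M: "M \<longlonglongrightarrow> \<mu>" using LIMSEQ_subseq_LIMSEQ[OF m r] by (simp add: M_def[abs_def] o_def)
  have \<rho>: "\<rho> \<longlonglongrightarrow> 0" using LIMSEQ_subseq_LIMSEQ[OF res r] by (simp add: \<rho>_def[abs_def] M_def N_def F_def o_def)
  have Fw: "(\<lambda>k. cinner (F k) g) \<longlonglongrightarrow> cinner w g" for g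
    using w unfolding weakly_null_def F_def[symmetric] by (simp add: cinner.diff_left LIM_zero_iff)
  obtain \<Phi> where \<Phi>: "core A' \<Phi>" "\<And>g. g \<in> \<Phi> \<Longrightarrow> \<exists>n0. \<forall>n\<ge>n0. restr n g \<in> dom (An' n)"
    using core' unfolding truncation_core_def by blast
  \<comment> \<open>For large \<open>k\<close> the restriction of a core element \<open>g\<close>
    lies in the domain of the truncated adjoint, which by locality acts on it as the restriction of
    \<open>A' g\<close>; likewise for \<open>B' g\<close>. The pairing thus becomes that of the
    residual \<open>\<rho> k\<close> with \<open>restr (N k) g\<close> and tends to
    \<open>0\<close>.\<close>
  have ortho_\<Phi>: "cinner w (app A' g - cnj \<mu> *\<^sub>C app B' g) = 0" if g: "g \<in> \<Phi>" "g \<in> dom A'" for g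
  proof -
    obtain n0 where n0: "\<And>n. n \<ge> n0 \<Longrightarrow> restr n g \<in> dom (An' n)" using \<Phi>(2)[OF g(1)] by blast
    have eq: "cinner (F k) (app A' g) - M k * cinner (F k) (app B' g) = cinner (\<rho> k) (restr (N k) g)" if "n0 \<le> k" for k
    proof -
      have "n0 \<le> N k" using that seq_suble[OF N, of k] by linarith
      note rg = n0[OF this]
      note ag = linear_operatorD(3)[OF op'(3) rg] linear_operatorD(3)[OF op'(4) subsetD[OF dom_n' rg]]
      have "cinner (app (An (N k)) (F k)) (restr (N k) g) = cinner (F k) (app (An' (N k)) (restr (N k) g))"
        using ag(1) F(1) unfolding mem_adjoint_iff[OF op(3)] by blast
      moreover have "cinner (app (Bn (N k)) (F k)) (restr (N k) g) = cinner (F k) (app (Bn' (N k)) (restr (N k) g))"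
        using ag(2) subsetD[OF dom_n F(1)] unfolding mem_adjoint_iff[OF op(4)] by blast
      ultimately show ?thesis
        unfolding \<rho>_def Tn_def adjoint_restrict[OF g(2) rg]
        by (simp add: cinner.diff_left cinner_scaleC_left cinner_L2_on_restrict[OF meas(2) domD_n[OF F(1)]])
    qed
    have lim0: "(\<lambda>k. norm (\<rho> k) * norm g) \<longlonglongrightarrow> 0" using tendsto_mult_left_zero[OF tendsto_norm_zero[OF \<rho>]] .
    have "(\<lambda>k. cinner (F k) (app A' g) - M k * cinner (F k) (app B' g)) \<longlonglongrightarrow> 0"
    proof (rule Lim_null_comparison[OF eventually_sequentiallyI[of n0] lim0])
      fix k assume "n0 \<le> k"
      have "cmod (cinner (\<rho> k) (restr (N k) g)) \<le> norm (\<rho> k) * norm (restr (N k) g)" by (rule norm_cinner_le)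
      also have "\<dots> \<le> norm (\<rho> k) * norm g" by (intro mult_left_mono norm_restrict_le meas) simp
      finally show "norm (cinner (F k) (app A' g) - M k * cinner (F k) (app B' g)) \<le> norm (\<rho> k) * norm g"
        unfolding eq[OF \<open>n0 \<le> k\<close>] .
    qed
    moreover have "(\<lambda>k. cinner (F k) (app A' g) - M k * cinner (F k) (app B' g)) \<longlonglongrightarrow>
      cinner w (app A' g) - \<mu> * cinner w (app B' g)" by (intro tendsto_intros Fw M)
    ultimately have "cinner w (app A' g) - \<mu> * cinner w (app B' g) = 0" using LIMSEQ_unique by blast
    then show ?thesis by (simp add: cinner.diff_right cinner_scaleC_right)
  qed
  \<comment> \<open>The core approximates \<open>app A' g\<close>, and by relative boundedness of
    the adjoints \<open>app B' g\<close> as well.\<close>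
  have ortho: "cinner w (app A' g - cnj \<mu> *\<^sub>C app B' g) = 0" if g: "g \<in> dom A'" for g
  proof -
    obtain \<phi> where \<phi>: "\<And>j. \<phi> j \<in> \<Phi>" "\<And>j. \<phi> j \<in> dom A'" "(\<lambda>j. app A' (\<phi> j)) \<longlonglongrightarrow> app A' g" "(\<lambda>j. app B' (\<phi> j)) \<longlonglongrightarrow> app B' g"
      using core_approximation[OF op'(1,2) B_rel' \<Phi>(1) g] by blast
    have "(\<lambda>j. cinner w (app A' (\<phi> j) - cnj \<mu> *\<^sub>C app B' (\<phi> j))) \<longlonglongrightarrow> cinner w (app A' g - cnj \<mu> *\<^sub>C app B' g)"
      by (intro cinner.tendsto scaleC.tendsto tendsto_intros \<phi>(3,4))
    then show ?thesis unfolding ortho_\<Phi>[OF \<phi>(1,2)] by (simp add: LIMSEQ_const_iff)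
  qed
  define e where "e k = inverse (real (Suc k))" for k
  have e: "0 < e k" "e \<longlonglongrightarrow> 0" for k unfolding e_def[abs_def] by (simp, rule LIMSEQ_inverse_real_of_nat)
  have "\<exists>y. y \<in> dom A \<and> norm (y - F k) < e k \<and> cmod (P.a y - cinner (app (An (N k)) (F k)) (F k)) < e k \<and>
    cmod (P.b y - cinner (app (Bn (N k)) (F k)) (F k)) < e k" for k
    using form_approximation[OF F(1) e(1)] by blast
  then obtain y where y: "\<And>k. y k \<in> dom A" "\<And>k. norm (y k - F k) < e k"
    "\<And>k. cmod (P.a (y k) - cinner (app (An (N k)) (F k)) (F k)) < e k"
    "\<And>k. cmod (P.b (y k) - cinner (app (Bn (N k)) (F k)) (F k)) < e k" by metis
  have yF: "(\<lambda>k. y k - F k) \<longlonglongrightarrow> 0"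
    by (rule Lim_null_comparison[OF always_eventually e(2)]) (use y(2) in \<open>auto intro: less_imp_le\<close>)
  have "(\<lambda>k. norm (y k) - 1) \<longlonglongrightarrow> 0"
  proof (rule Lim_null_comparison[OF always_eventually e(2)], rule allI)
    show "norm (norm (y k) - 1) \<le> e k" for k
      using norm_triangle_ineq3[of "y k" "F k"] y(2)[of k] F(2)[of k] by simp
  qed
  then have norm1: "(\<lambda>k. norm (y k)) \<longlonglongrightarrow> 1" by (rule LIM_zero_cancel)
  have weak: "weakly_null (\<lambda>k. y k - w)"
    unfolding weakly_null_def
  proof
    fix g
    have "(\<lambda>k. cinner (y k - F k) g + cinner (f (r k) - w) g) \<longlonglongrightarrow> cinner 0 g + 0"
      by (intro tendsto_intros cinner.tendsto yF) (use w in \<open>simp add: weakly_null_def\<close>)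
    then show "(\<lambda>k. cinner (y k - w) g) \<longlonglongrightarrow> 0"
      by (simp add: F_def cinner.add_left[symmetric] cinner.zero_left)
  qed
  \<comment> \<open>Error budget relative to \<open>1 + \<bar>b\<bar>\<close>: passing from
    \<open>F k\<close> to \<open>y k\<close> in the form of \<open>A\<close>, the residual, the
    moving parameter, and passing from \<open>F k\<close> to \<open>y k\<close> in the form of
    \<open>B\<close>.\<close>
  define \<eta> where "\<eta> k = e k + norm (\<rho> k) + cmod (M k - \<mu>) * (1 + e k) + cmod \<mu> * e k" for k
  have "(\<lambda>k. e k + norm (\<rho> k) + cmod (M k - \<mu>) * (1 + e k) + cmod \<mu> * e k) \<longlonglongrightarrow>
    0 + norm (0 :: 'd l2) + cmod (\<mu> - \<mu>) * (1 + 0) + cmod \<mu> * 0"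
    by (intro tendsto_intros e \<rho> M)
  then have \<eta>: "\<eta> \<longlonglongrightarrow> 0" by (simp add: \<eta>_def[abs_def])
  have small: "(\<lambda>k. cmod (cinner (P.T \<mu> (y k)) (y k)) / (1 + cmod (P.b (y k)))) \<longlonglongrightarrow> 0"
  proof (rule Lim_null_comparison[OF always_eventually \<eta>], rule allI)
    fix k
    define \<alpha> \<beta> where "\<alpha> = cinner (app (An (N k)) (F k)) (F k)" and "\<beta> = cinner (app (Bn (N k)) (F k)) (F k)"
    let ?b = "P.b (y k)"
    have res: "cinner (\<rho> k) (F k) = \<alpha> - M k * \<beta>"
      by (simp add: \<rho>_def Tn_def \<alpha>_def \<beta>_def cinner.diff_left cinner_scaleC_left)
    have "cinner (P.T \<mu> (y k)) (y k) = (P.a (y k) - \<alpha>) + cinner (\<rho> k) (F k) + (M k - \<mu>) * \<beta> - \<mu> * (?b - \<beta>)"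
      unfolding res P.t_eq by (simp add: algebra_simps)
    then have "cmod (cinner (P.T \<mu> (y k)) (y k)) \<le> cmod (P.a (y k) - \<alpha>) + cmod (cinner (\<rho> k) (F k)) + cmod ((M k - \<mu>) * \<beta>) + cmod (\<mu> * (?b - \<beta>))"
      by (metis norm_triangle_le norm_triangle_le_diff norm_triangle_ineq order_refl add_mono)
    also have "\<dots> \<le> e k + norm (\<rho> k) + cmod (M k - \<mu>) * (cmod ?b + e k) + cmod \<mu> * e k"
    proof (intro add_mono)
      show "cmod (P.a (y k) - \<alpha>) \<le> e k" using y(3)[of k] by (simp add: \<alpha>_def)
      show "cmod (cinner (\<rho> k) (F k)) \<le> norm (\<rho> k)" using norm_cinner_le[of "\<rho> k" "F k"] F(2) by simp
      have b: "cmod (?b - \<beta>) \<le> e k" using y(4)[of k] by (simp add: \<beta>_def)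
      show "cmod (\<mu> * (?b - \<beta>)) \<le> cmod \<mu> * e k" unfolding norm_mult by (rule mult_left_mono[OF b]) simp
      have "cmod \<beta> \<le> cmod ?b + e k" using norm_triangle_ineq4[of ?b "?b - \<beta>"] b by simp
      then show "cmod ((M k - \<mu>) * \<beta>) \<le> cmod (M k - \<mu>) * (cmod ?b + e k)" unfolding norm_mult by (rule mult_left_mono) simp
    qed
    also have "\<dots> \<le> \<eta> k * (1 + cmod ?b)"
    proof -
      have "0 \<le> (e k + norm (\<rho> k) + cmod (M k - \<mu>) * e k + cmod \<mu> * e k) * cmod ?b + cmod (M k - \<mu>)"
        using less_imp_le[OF e(1)[of k]] by (intro add_nonneg_nonneg mult_nonneg_nonneg) auto
      then show ?thesis by (simp add: \<eta>_def algebra_simps)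
    qed
    finally show "norm (cmod (cinner (P.T \<mu> (y k)) (y k)) / (1 + cmod ?b)) \<le> \<eta> k"
      using P.one_plus_cmod_pos[of ?b] by (simp add: divide_le_eq)
  qed
  obtain K where K: "K \<ge> 0" "\<And>x. x \<in> dom A \<Longrightarrow> SB.F.nrm x \<le> K * SA.F.nrm x" using form_comparison by blast
  have nn: "0 \<le> SA.F.nrm x" if "x \<in> dom A" for x using SA.F.nrm_nonneg[OF that] .
  have nnB: "0 \<le> SB.F.nrm x" if "x \<in> dom A" for x using SB.F.nrm_nonneg[OF subsetD[OF dom(1) that]] .
  have Bxy: "cmod (cinner (app B x) z) \<le> SB.C * K\<^sup>2 * (SA.F.nrm x * SA.F.nrm z)" if "x \<in> dom A" "z \<in> dom A" for x z
  proof -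
    have "cmod (cinner (app B x) z) \<le> SB.C * SB.F.nrm x * SB.F.nrm z"
      by (rule SB.A_nrm[OF subsetD[OF dom(1) that(1)] subsetD[OF dom(1) that(2)]])
    also have "\<dots> \<le> SB.C * ((K * SA.F.nrm x) * (K * SA.F.nrm z))"
      unfolding mult.assoc[of SB.C] using K(1) nn[OF that(1)] nnB[OF that(2)] SB.C_nonneg
      by (intro mult_left_mono mult_mono K(2) that) auto
    finally show ?thesis by (simp add: power2_eq_square algebra_simps)
  qed
  define C where "C = SA.C + (1 + cmod \<mu>) * (SB.C * K\<^sup>2)"
  have C: "0 \<le> C" "SB.C * K\<^sup>2 \<le> C" "SA.C + cmod \<mu> * (SB.C * K\<^sup>2) \<le> C"
    using SA.C_nonneg SB.C_nonneg by (auto simp: C_def algebra_simps)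
  interpret K: pencil_form "dom A" H "P.T \<mu>" "app B" SA.F.nrm C "(1 + \<bar>1 - \<gamma>A\<bar>) * (1 + cmod \<mu>)"
  proof
    show "clinear_on (dom A) (P.T \<mu>)" by (rule P.clin_T)
    show "bij_betw (P.T \<mu>) (dom A) H" using inv by (simp add: binv_def)
    show "closure (dom A) = H" by (rule dense(1))
    show "0 \<le> C" by (rule C(1))
    show "0 \<le> (1 + \<bar>1 - \<gamma>A\<bar>) * (1 + cmod \<mu>)" by simp
    show "app B (c *\<^sub>C x) = c *\<^sub>C app B x" if "x \<in> dom A" for x c by (rule clinear_onD(3)[OF P.clin_B that])
    show "\<not> (\<lambda>n. cmod (cinner (P.T \<mu> (x n)) (x n)) / (1 + cmod (P.b (x n)))) \<longlonglongrightarrow> 0"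
      if "\<And>n. x n \<in> dom A" "\<And>n. norm (x n) = 1" "weakly_null x" for x
      using W P.W_iff that by blast
    fix x assume x: "x \<in> dom A"
    show "norm x \<le> SA.F.nrm x" using SA.norm_le_sqrt_r[OF x] by (simp add: SA.F.nrm_def)
    show "SA.F.nrm (c *\<^sub>C x) = cmod c * SA.F.nrm x" for c by (rule SA.nrm_scaleC[OF x])
    show "cmod (P.b x) \<le> C * (SA.F.nrm x)\<^sup>2"
      using order_trans[OF Bxy[OF x x] mult_right_mono[OF C(2), of "SA.F.nrm x * SA.F.nrm x"]]
      by (simp add: power2_eq_square)
    show "(SA.F.nrm x)\<^sup>2 \<le> (1 + \<bar>1 - \<gamma>A\<bar>) * (1 + cmod \<mu>) * (cmod (cinner (P.T \<mu> x) x) + cmod (P.b x) + (norm x)\<^sup>2)"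
    proof -
      have "P.a x = cinner (P.T \<mu> x) x + \<mu> * P.b x" by (simp add: P.t_eq)
      then have "cmod (P.a x) \<le> cmod (cinner (P.T \<mu> x) x) + cmod \<mu> * cmod (P.b x)"
        by (metis norm_mult norm_triangle_ineq)
      also have "\<dots> + (norm x)\<^sup>2 \<le> (1 + cmod \<mu>) * (cmod (cinner (P.T \<mu> x) x) + cmod (P.b x) + (norm x)\<^sup>2)"
      proof -
        have "0 \<le> cmod (P.b x) + cmod \<mu> * (cmod (cinner (P.T \<mu> x) x) + (norm x)\<^sup>2)"
          by (intro add_nonneg_nonneg mult_nonneg_nonneg) auto
        then show ?thesis by (simp add: algebra_simps)
      qed
      finally have "cmod (P.a x) + (norm x)\<^sup>2 \<le> (1 + cmod \<mu>) * (cmod (cinner (P.T \<mu> x) x) + cmod (P.b x) + (norm x)\<^sup>2)" by simp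
      then have "(1 + \<bar>1 - \<gamma>A\<bar>) * (cmod (P.a x) + (norm x)\<^sup>2) \<le>
          (1 + \<bar>1 - \<gamma>A\<bar>) * ((1 + cmod \<mu>) * (cmod (cinner (P.T \<mu> x) x) + cmod (P.b x) + (norm x)\<^sup>2))"
        by (rule mult_left_mono) simp
      then show ?thesis using SA.s_ge_nrm[OF x] by (simp add: mult.assoc)
    qed
    fix z assume z: "z \<in> dom A"
    show "SA.F.nrm (x + z) \<le> SA.F.nrm x + SA.F.nrm z" by (rule SA.F.nrm_triangle[OF x z])
    show "cmod (cinner (P.T \<mu> x) z) \<le> C * SA.F.nrm x * SA.F.nrm z"
    proof -
      have "cmod (cinner (P.T \<mu> x) z) \<le> cmod (cinner (app A x) z) + cmod \<mu> * cmod (cinner (app B x) z)"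
        unfolding P.t_eq by (metis norm_mult norm_triangle_ineq4)
      also have "\<dots> \<le> SA.C * SA.F.nrm x * SA.F.nrm z + cmod \<mu> * (SB.C * K\<^sup>2 * (SA.F.nrm x * SA.F.nrm z))"
        by (intro add_mono mult_left_mono SA.A_nrm Bxy x z) simp
      also have "\<dots> = (SA.C + cmod \<mu> * (SB.C * K\<^sup>2)) * (SA.F.nrm x * SA.F.nrm z)" by (simp add: algebra_simps)
      also have "\<dots> \<le> C * (SA.F.nrm x * SA.F.nrm z)" using nn[OF x] nn[OF z] by (intro mult_right_mono C(3)) auto
      finally show ?thesis by (simp add: mult.assoc)
    qed
  qed
  show False
  proof (rule K.no_approximate_eigenvectors[OF y(1) norm1 weak small])
    fix x and d :: real assume x: "x \<in> dom A" and d: "0 < d"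
    obtain g X where g: "g \<in> dom A'" "\<forall>n. X n \<in> dom A \<and> SA.F.nrm (x - X n) < d" "X \<longlonglongrightarrow> g"
      using adjoint_form_dense[OF x d] by blast
    note ag = linear_operatorD(3)[OF op'(1) g(1)] linear_operatorD(3)[OF op'(2) subsetD[OF dom(2) g(1)]]
    have "cinner (P.T \<mu> z) g = cinner z (app A' g - cnj \<mu> *\<^sub>C app B' g)" if "z \<in> dom A" for z
    proof -
      have "cinner (app A z) g = cinner z (app A' g)" "cinner (app B z) g = cinner z (app B' g)"
        using ag that subsetD[OF dom(1) that] unfolding mem_adjoint_iff[OF op(1)] mem_adjoint_iff[OF op(2)] by blast+
      then show ?thesis by (simp add: P.t_eq cinner.diff_right cinner_scaleC_right)
    qed
    then show "\<exists>g k X. (\<forall>n. X n \<in> dom A \<and> SA.F.nrm (x - X n) < d) \<and> X \<longlonglongrightarrow> g \<and>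
      (\<forall>z\<in>dom A. cinner (P.T \<mu> z) g = cinner z k) \<and> cinner w k = 0"
      using g(2,3) ortho[OF g(1)] by blast
  qed
qed

end

text \<open>If every ball around \<open>p\<close> met \<open>\<sigma>n n\<close> for all large
  \<open>n\<close>, points of \<open>\<sigma>n n\<close> nearest to \<open>p\<close> up to
  \<open>1 / Suc n\<close> would converge to \<open>p\<close>. The slack covers sets in which the
  distance is not attained.\<close>

lemma not_approximated:
  assumes "\<not> approximated \<sigma>n p"
  shows "\<exists>\<delta>>0. \<forall>N. \<exists>n\<ge>N. \<sigma>n n \<inter> ball p \<delta> = {}"
proof (rule ccontr)
  assume "\<not> ?thesis"
  then have near: "\<exists>N. \<forall>n\<ge>N. \<sigma>n n \<inter> ball p \<delta> \<noteq> {}" if "0 < \<delta>" for \<delta> using that by blast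
  have "\<exists>l. (\<sigma>n n \<noteq> {} \<longrightarrow> l \<in> \<sigma>n n \<and> dist p l < infdist p (\<sigma>n n) + inverse (real (Suc n)))" for n
  proof (cases "\<sigma>n n = {}")
    case False
    have "(INF a\<in>\<sigma>n n. dist p a) < infdist p (\<sigma>n n) + inverse (real (Suc n))"
      using False by (simp add: infdist_notempty)
    then show ?thesis by (metis False cINF_less_iff bdd_belowI2 zero_le_dist)
  qed simp
  then obtain l where l: "\<And>n. \<sigma>n n \<noteq> {} \<Longrightarrow> l n \<in> \<sigma>n n \<and> dist p (l n) < infdist p (\<sigma>n n) + inverse (real (Suc n))"
    by metis
  have "\<forall>\<^sub>F n in sequentially. l n \<in> \<sigma>n n"
  proof -
    obtain N where N: "\<And>n. n \<ge> N \<Longrightarrow> \<sigma>n n \<inter> ball p 1 \<noteq> {}" using near[of 1] by auto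
    have "l n \<in> \<sigma>n n" if "N \<le> n" for n using N[OF that] l[of n] by auto
    then show ?thesis by (rule eventually_sequentiallyI)
  qed
  moreover have "l \<longlonglongrightarrow> p"
  proof (rule tendstoI)
    fix e :: real assume e: "0 < e"
    have "\<forall>\<^sub>F n in sequentially. \<sigma>n n \<inter> ball p (e/2) \<noteq> {}"
      using near[OF half_gt_zero[OF e]] unfolding eventually_sequentially .
    moreover have "\<forall>\<^sub>F n in sequentially. inverse (real (Suc n)) < e/2"
      by (rule order_tendstoD(2)[OF LIMSEQ_inverse_real_of_nat half_gt_zero[OF e]])
    ultimately show "\<forall>\<^sub>F n in sequentially. dist (l n) p < e"
    proof eventually_elim
      case (elim n)
      then obtain z where z: "z \<in> \<sigma>n n" "dist p z < e/2" by auto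
      have "infdist p (\<sigma>n n) \<le> dist p z" by (rule infdist_le[OF z(1)])
      moreover have "dist p (l n) < infdist p (\<sigma>n n) + inverse (real (Suc n))" using l z(1) by blast
      ultimately show ?case using z(2) elim(2) by (simp add: dist_commute)
    qed
  qed
  ultimately show False using assms unfolding approximated_def by blast
qed

lemma binv_cong: "(\<And>x. x \<in> D \<Longrightarrow> T x = T' x) \<Longrightarrow> binv D H T \<longleftrightarrow> binv D H T'"
  unfolding binv_def by (simp cong: bij_betw_cong)

lemma binv_scaleC:
  assumes H: "csubspace H" and c: "c \<noteq> 0" and T: "binv D H T"
  shows "binv D H (\<lambda>x. c *\<^sub>C T x)"
proof -
  obtain C where bij: "bij_betw T D H" and C: "\<And>x. x \<in> D \<Longrightarrow> norm x \<le> C * norm (T x)"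
    using T by (auto simp: binv_def)
  have inv: "inverse c *\<^sub>C c *\<^sub>C z = z" "c *\<^sub>C inverse c *\<^sub>C z = z" for z :: "'a l2" using c by simp_all
  have "bij_betw (\<lambda>z. c *\<^sub>C z) H H"
    by (rule bij_betw_byWitness[where f'="\<lambda>z. inverse c *\<^sub>C z"]) (use csubspace_scale[OF H] inv in auto)
  then have "bij_betw (\<lambda>x. c *\<^sub>C T x) D H" using bij_betw_trans[OF bij] by (simp add: o_def)
  moreover have "norm x \<le> (C / cmod c) * norm (c *\<^sub>C T x)" if "x \<in> D" for x
    using C[OF that] c by (simp add: norm_scaleC)
  ultimately show ?thesis unfolding binv_def by blast
qed

lemma selfadjoint_symmetric:
  assumes S: "linear_operator H S" "selfadjoint H S" and xy: "x \<in> dom S" "y \<in> dom S"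
  shows "cinner (app S x) y = cinner x (app S y)"
proof -
  have "(y, app S y) \<in> adjoint H S"
    using linear_operatorD(3)[OF S(1) xy(2)] S(2) by (simp add: selfadjoint_def)
  then show ?thesis using xy(1) unfolding mem_adjoint_iff[OF S(1)] by blast
qed

lemma symmetric_form_real: "cinner u x = cinner x u \<Longrightarrow> Im (cinner u x) = 0"
  using cinner_commute[of u x] by (simp add: complex_eq_iff)

context operator_pair
begin

text \<open>The second alternative of \<open>W_I\<close> would put \<open>0\<close> into both
  essential numerical ranges and every \<open>\<mu>\<close> into that of the pencil, against the
  hypothesis.\<close>

lemma W_eq_quotient_range:
  assumes "0 \<notin> ess_num_range A \<inter> ess_num_range B \<or> pencil_ess_num_range A B \<noteq> UNIV"
  shows "W = pencil_ess_quotient_range A B"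
proof -
  have "\<mu> \<in> pencil_ess_quotient_range A B" if \<mu>: "\<mu> \<in> W" for \<mu>
  proof -
    obtain x where x: "\<And>n. x n \<in> dom A" "\<And>n. norm (x n) = 1" "weakly_null x"
      "(\<lambda>n. cmod (cinner (T \<mu> (x n)) (x n)) / (1 + cmod (b (x n)))) \<longlonglongrightarrow> 0"
      using \<mu> unfolding W_iff by blast
    show ?thesis
    proof (rule ccontr)
      assume "\<mu> \<notin> pencil_ess_quotient_range A B"
      then obtain r where r: "strict_mono r" "(\<lambda>n. b (x (r n))) \<longlonglongrightarrow> 0" "(\<lambda>n. a (x (r n))) \<longlonglongrightarrow> 0"
        using W_I[OF x] by blast
      note n = null_forms_imp_ess_num_range[of "\<lambda>n. x (r n)", OF x(1,2) weakly_null_subseq[OF x(3) r(1)] r(3,2)]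
      show False using n assms by blast
    qed
  qed
  then show ?thesis by (auto simp: W_def)
qed

text \<open>For bounded \<open>B\<close> the numbers \<open>b (x n)\<close> are bounded, so the
  convergence of the quotients can be multiplied by them.\<close>

lemma quotient_range_subset:
  assumes "bounded_operator B"
  shows "pencil_ess_quotient_range A B \<subseteq> pencil_ess_num_range A B"
proof
  fix \<mu> assume "\<mu> \<in> pencil_ess_quotient_range A B"
  then obtain x where x: "\<forall>n. x n \<in> dom A \<and> b (x n) \<noteq> 0 \<and> norm (x n) = 1" "weakly_null x"
    "(\<lambda>n. a (x n) / b (x n)) \<longlonglongrightarrow> \<mu>" unfolding pencil_ess_quotient_range_def by blast
  obtain C where C: "\<And>f. f \<in> dom B \<Longrightarrow> norm (app B f) \<le> C * norm f"
    using assms by (auto simp: bounded_operator_def)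
  have b: "cmod (b (x n)) \<le> C" for n
    using norm_cinner_le[of "app B (x n)" "x n"] C[OF subsetD[OF dom]] x(1) by (metis mult.right_neutral order_trans)
  have lim: "(\<lambda>n. cmod (a (x n) / b (x n) - \<mu>) * C) \<longlonglongrightarrow> 0"
    by (rule tendsto_mult_left_zero[OF tendsto_norm_zero[OF LIM_zero[OF x(3)]]])
  have "(\<lambda>n. cinner (T \<mu> (x n)) (x n)) \<longlonglongrightarrow> 0"
  proof (rule Lim_null_comparison[OF always_eventually lim], rule allI)
    fix n
    have "cinner (T \<mu> (x n)) (x n) = (a (x n) / b (x n) - \<mu>) * b (x n)"
      using x(1) by (simp add: t_eq field_simps)
    then show "norm (cinner (T \<mu> (x n)) (x n)) \<le> cmod (a (x n) / b (x n) - \<mu>) * C"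
      using b by (simp add: norm_mult mult_left_mono)
  qed
  then show "\<mu> \<in> pencil_ess_num_range A B" unfolding pencil_ess_num_range_iff using x by blast
qed

end

section \<open>Spurious eigenvalues and approximation of the spectrum\<close>

context truncation
begin

abbreviation \<sigma>n :: "nat \<Rightarrow> complex set" where
  "\<sigma>n n \<equiv> pencil_spectrum (Hn n) (An n) (Bn n)"

lemma spectrum_n_iff: "\<mu> \<in> \<sigma>n n \<longleftrightarrow> \<not> binv (dom (An n)) (Hn n) (Tn n \<mu>)"
  using operator_pair.pencil_spectrum_iff[OF Pn] unfolding Tn_eq .

lemma clin_Tn: "clinear_on (dom (An n)) (Tn n \<mu>)"
  using operator_pair.clin_T[OF Pn] unfolding Tn_eq .

lemma normalised:
  assumes "f \<in> dom (An n)" "f \<noteq> 0"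
  shows "f /\<^sub>R norm f \<in> dom (An n)" "norm (f /\<^sub>R norm f) = 1" "Tn n \<mu> (f /\<^sub>R norm f) = Tn n \<mu> f /\<^sub>R norm f"
proof -
  show "f /\<^sub>R norm f \<in> dom (An n)"
    by (rule subspace_scale[OF csubspace_imp_subspace[OF clinear_onD(1)[OF clin_Tn]] assms(1)])
  show "norm (f /\<^sub>R norm f) = 1" using assms(2) by simp
  show "Tn n \<mu> (f /\<^sub>R norm f) = Tn n \<mu> f /\<^sub>R norm f" by (rule clinear_on_scaleR[OF clin_Tn assms(1)])
qed

lemma spurious_in_W:
  assumes eig: "\<And>n \<nu>. \<nu> \<in> \<sigma>n n \<Longrightarrow> pencil_eigenvalue (An n) (Bn n) \<nu>"
    and sp: "spurious (pencil_spectrum H A B) \<sigma>n \<mu>"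
  shows "\<mu> \<in> P.W"
proof (rule ccontr)
  assume W: "\<mu> \<notin> P.W"
  obtain I l where I: "infinite I" "\<And>n. n \<in> I \<Longrightarrow> l n \<in> \<sigma>n n" "(l \<longlongrightarrow> \<mu>) (inf sequentially (principal I))"
    and \<mu>: "\<mu> \<notin> pencil_spectrum H A B" using sp unfolding spurious_def by blast
  \<comment> \<open>Convergence along the infinite set \<open>I\<close> becomes ordinary convergence
    along its increasing enumeration.\<close>
  define n where "n = enumerate I"
  have n: "strict_mono n" "\<And>k. n k \<in> I"
    unfolding n_def using strict_mono_enumerate[OF I(1)] enumerate_in_set[OF I(1)] by auto
  have "filterlim n (inf sequentially (principal I)) sequentially"
    unfolding filterlim_inf filterlim_principal using filterlim_subseq[OF n(1)] n(2) by simp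
  then have lim: "(\<lambda>k. l (n k)) \<longlonglongrightarrow> \<mu>" by (rule filterlim_compose[OF I(3)])
  have "\<exists>f. f \<in> dom (An (n k)) \<and> f \<noteq> 0 \<and> Tn (n k) (l (n k)) f = 0" for k
    using eig[OF I(2)[OF n(2)]] unfolding operator_pair.pencil_eigenvalue_iff[OF Pn] Tn_eq by blast
  then obtain f where f: "\<And>k. f k \<in> dom (An (n k))" "\<And>k. f k \<noteq> 0" "\<And>k. Tn (n k) (l (n k)) (f k) = 0" by metis
  show False
    by (rule no_approximate_eigenvectors[of \<mu> "\<lambda>k. f k /\<^sub>R norm (f k)" n "\<lambda>k. l (n k)"])
      (use \<mu> W n lim normalised[OF f(1,2)] f(3) in \<open>simp_all add: P.pencil_spectrum_iff\<close>)
qed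

text \<open>A failure at arbitrarily large \<open>n\<close> yields, after normalisation and by
  compactness of \<open>S\<close>, approximate eigenvectors at some point of \<open>S\<close>, which
  \<open>no_approximate_eigenvectors\<close> excludes.\<close>

lemma uniform_lower_bound:
  assumes S: "compact S" "\<And>\<mu>. \<mu> \<in> S \<Longrightarrow> binv (dom A) H (P.T \<mu>)" "\<And>\<mu>. \<mu> \<in> S \<Longrightarrow> \<mu> \<notin> P.W"
  shows "\<exists>N C. \<forall>n\<ge>N. \<forall>\<mu>\<in>S. \<forall>f\<in>dom (An n). norm f \<le> C * norm (Tn n \<mu> f)"
proof (rule ccontr)
  assume "\<not> ?thesis"
  then have neg: "\<exists>n\<ge>N. \<exists>\<mu>\<in>S. \<exists>f\<in>dom (An n). C * norm (Tn n \<mu> f) < norm f" for N C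
    by (meson not_le)
  let ?P = "\<lambda>k (n, \<mu>, f). \<mu> \<in> S \<and> f \<in> dom (An n) \<and> real (Suc k) * norm (Tn n \<mu> f) < norm f"
  have "\<exists>z. \<forall>k. ?P k (z k) \<and> fst (z k) < fst (z (Suc k))"
  proof (rule dependent_nat_choice)
    show "\<exists>z. ?P 0 z"
    proof -
      obtain n \<mu> f where "\<mu> \<in> S" "f \<in> dom (An n)" "real (Suc 0) * norm (Tn n \<mu> f) < norm f"
        using neg[of 0 "real (Suc 0)"] by blast
      then show ?thesis by (intro exI[of _ "(n, \<mu>, f)"]) simp
    qed
    show "\<exists>z'. ?P (Suc k) z' \<and> fst z < fst z'" for z k
    proof -
      obtain n \<mu> f where "n \<ge> Suc (fst z)" "\<mu> \<in> S" "f \<in> dom (An n)" "real (Suc (Suc k)) * norm (Tn n \<mu> f) < norm f"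
        using neg[of "Suc (fst z)" "real (Suc (Suc k))"] by blast
      then show ?thesis by (intro exI[of _ "(n, \<mu>, f)"]) simp
    qed
  qed
  then obtain z where z: "\<forall>k. ?P k (z k) \<and> fst (z k) < fst (z (Suc k))" by (elim exE)
  define n m f where "n k = fst (z k)" and "m k = fst (snd (z k))" and "f k = snd (snd (z k))" for k
  have P: "m k \<in> S" "f k \<in> dom (An (n k))" "real (Suc k) * norm (Tn (n k) (m k) (f k)) < norm (f k)" "n k < n (Suc k)" for k
    using spec[OF z, of k] by (auto simp: n_def m_def f_def split: prod.splits)
  have n: "strict_mono n" using P(4) by (simp add: strict_mono_Suc_iff)
  have f0: "f k \<noteq> 0" for k
  proof
    assume "f k = 0"
    then have "real (Suc k) * norm (Tn (n k) (m k) (f k)) < 0" using P(3)[of k] by simp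
    moreover have "0 \<le> real (Suc k) * norm (Tn (n k) (m k) (f k))" by simp
    ultimately show False by linarith
  qed
  obtain l r where l: "l \<in> S" "strict_mono r" "(m \<circ> r) \<longlonglongrightarrow> l" using S(1) P(1) unfolding compact_def by metis
  define g where "g k = f k /\<^sub>R norm (f k)" for k
  have g: "g k \<in> dom (An (n k))" "norm (g k) = 1" for k unfolding g_def using normalised[OF P(2) f0] by blast+
  have "(\<lambda>k. Tn (n k) (m k) (g k)) \<longlonglongrightarrow> 0"
  proof (rule Lim_null_comparison[OF always_eventually LIMSEQ_inverse_real_of_nat], rule allI)
    fix k
    have "norm (Tn (n k) (m k) (f k)) \<le> inverse (real (Suc k)) * norm (f k)"
      using P(3)[of k] by (simp add: field_simps)
    then show "norm (Tn (n k) (m k) (g k)) \<le> inverse (real (Suc k))"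
      unfolding g_def normalised(3)[OF P(2) f0] using f0[of k] by (simp add: field_simps)
  qed
  then have res: "(\<lambda>k. Tn (n (r k)) (m (r k)) (g (r k))) \<longlonglongrightarrow> 0"
    using LIMSEQ_subseq_LIMSEQ[OF _ l(2)] by (fastforce simp: o_def)
  show False
    by (rule no_approximate_eigenvectors[OF S(2)[OF l(1)] S(3)[OF l(1)] g(1)[of "r _"] g(2) _ _ res])
      (use n l(2,3) in \<open>simp_all add: strict_mono_def o_def\<close>)
qed

lemma closable_pencil_n: "closable_pencil (Hn n) (An n) (Bn n) \<omega>B \<gamma>B"
  using Pn by (intro closable_pencil.intro closable_pencil_axioms.intro Hn dense SB.omega half_plane_n)

lemma closable_pencil: "closable_pencil H A B \<omega>B \<gamma>B"
  by (intro closable_pencil.intro closable_pencil_axioms.intro P.operator_pair_axioms H dense SB.omega)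
    (rule SB.sector(1)[OF subsetD[OF dom(1)]])

text \<open>By locality the truncated pencils act on restrictions of a core element as on the
  element itself, and restrictions converge. A bound for infinitely many \<open>n\<close> therefore
  suffices on the core, and graph convergence extends it to \<open>dom A\<close>.\<close>

lemma lower_bound_transfer:
  assumes star: "truncation_core \<Omega>n A An"
    and bound: "\<And>N. \<exists>n\<ge>N. \<forall>f\<in>dom (An n). norm f \<le> C * norm (Tn n \<mu> f)" and x: "x \<in> dom A"
  shows "norm x \<le> C * norm (P.T \<mu> x)"
proof -
  obtain \<Phi> where \<Phi>: "core A \<Phi>" "\<And>f. f \<in> \<Phi> \<Longrightarrow> \<exists>n0. \<forall>n\<ge>n0. restr n f \<in> dom (An n)"
    using star unfolding truncation_core_def by blast
  have bound_\<Phi>: "norm f \<le> C * norm (P.T \<mu> f)" if f: "f \<in> \<Phi>" "f \<in> dom A" for f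
  proof (rule ccontr)
    assume "\<not> ?thesis"
    \<comment> \<open>A strict violation survives restriction to all large
      \<open>\<Omega>n n\<close> and so meets one of the \<open>n\<close> for which the bound
      holds.\<close>
    then have less: "0 < norm f - C * norm (P.T \<mu> f)" by simp
    have TH: "P.T \<mu> f \<in> H"
      unfolding P.T_def by (rule csubspace_diff[OF H(1) linear_operatorD(5)[OF op(1) f(2)]
        csubspace_scale[OF H(1) linear_operatorD(5)[OF op(2) subsetD[OF dom(1) f(2)]]]])
    have "(\<lambda>n. norm (restr n f) - C * norm (restr n (P.T \<mu> f))) \<longlonglongrightarrow> norm f - C * norm (P.T \<mu> f)"
      by (intro tendsto_intros restrict_tendsto[OF meas(2) nested(2) exhaust] TH domD f)
    then have "\<forall>\<^sub>F n in sequentially. 0 < norm (restr n f) - C * norm (restr n (P.T \<mu> f))"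
      by (rule order_tendstoD(1)[OF _ less])
    then obtain N where N: "\<And>n. n \<ge> N \<Longrightarrow> 0 < norm (restr n f) - C * norm (restr n (P.T \<mu> f))"
      by (auto simp: eventually_sequentially)
    obtain n0 where n0: "\<And>n. n \<ge> n0 \<Longrightarrow> restr n f \<in> dom (An n)" using \<Phi>(2)[OF f(1)] by blast
    obtain n where n: "n \<ge> max N n0" "\<forall>f\<in>dom (An n). norm f \<le> C * norm (Tn n \<mu> f)" using bound by blast
    have rf: "restr n f \<in> dom (An n)" using n0 n(1) by simp
    have "Tn n \<mu> (restr n f) = restr n (P.T \<mu> f)"
      unfolding Tn_def P.T_def restrict_app[OF f(2) rf]
      by (simp add: restrict_diff[OF meas(2)] restrict_scaleC[OF meas(2)])
    then have "norm (restr n f) \<le> C * norm (restr n (P.T \<mu> f))" using n(2) rf by metis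
    moreover have "0 < norm (restr n f) - C * norm (restr n (P.T \<mu> f))" using N n(1) by simp
    ultimately show False by linarith
  qed
  obtain \<phi> where \<phi>: "\<And>j. \<phi> j \<in> \<Phi>" "\<And>j. \<phi> j \<in> dom A" "\<phi> \<longlonglongrightarrow> x" "(\<lambda>j. app A (\<phi> j)) \<longlonglongrightarrow> app A x" "(\<lambda>j. app B (\<phi> j)) \<longlonglongrightarrow> app B x"
    using core_approximation[OF op(1,2) B_rel \<Phi>(1) x] by blast
  have lim: "(\<lambda>j. norm (\<phi> j)) \<longlonglongrightarrow> norm x" by (intro tendsto_intros \<phi>)
  have lim': "(\<lambda>j. C * norm (P.T \<mu> (\<phi> j))) \<longlonglongrightarrow> C * norm (P.T \<mu> x)"
    unfolding P.T_def by (intro tendsto_intros scaleC.tendsto \<phi>)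
  show ?thesis by (rule LIMSEQ_le[OF lim lim']) (use bound_\<Phi> \<phi>(1,2) in blast)
qed

lemma isolated_approximated:
  assumes star: "truncation_core \<Omega>n A An" and iso: "p isolated_in pencil_spectrum H A B" and W: "p \<notin> P.W"
  shows "approximated \<sigma>n p"
proof (rule ccontr)
  assume "\<not> approximated \<sigma>n p"
  then obtain \<delta>1 where \<delta>1: "0 < \<delta>1" "\<And>N. \<exists>n\<ge>N. \<sigma>n n \<inter> ball p \<delta>1 = {}" using not_approximated by blast
  have p: "p \<in> pencil_spectrum H A B" using iso by (simp add: isolated_in_def)
  obtain U where U: "open U" "U \<inter> pencil_spectrum H A B = {p}" using iso by (auto simp: isolated_in_def)
  then have "p \<in> U" by blast
  then obtain \<delta>2 where \<delta>2: "0 < \<delta>2" "ball p \<delta>2 \<subseteq> U" using U(1) openE by blast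
  have "p \<in> - P.W" using W by simp
  then obtain \<delta>3 where \<delta>3: "0 < \<delta>3" "ball p \<delta>3 \<subseteq> - P.W"
    using openE[OF open_Compl[OF P.closed_W]] by blast
  \<comment> \<open>On this disc three things hold: infinitely many truncated pencils have no
    spectrum, \<open>p\<close> is the only spectral point of the limit pencil, and \<open>W\<close>
    is avoided.\<close>
  define \<delta> where "\<delta> = min \<delta>1 (min \<delta>2 \<delta>3)"
  define r where "r = \<delta> / 2"
  have \<delta>: "0 < \<delta>" "ball p \<delta> \<subseteq> ball p \<delta>1" "ball p \<delta> \<subseteq> ball p \<delta>2" "ball p \<delta> \<subseteq> ball p \<delta>3"
    using \<delta>1(1) \<delta>2(1) \<delta>3(1) by (auto simp: \<delta>_def)
  have r: "0 < r" "r < \<delta>" using \<delta>(1) by (auto simp: r_def)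
  have inv: "binv (dom A) H (P.T \<mu>)" if "\<mu> \<in> ball p \<delta> - {p}" for \<mu>
    using that U(2) \<delta>2(2) \<delta>(3) P.pencil_spectrum_iff by blast
  have sph: "\<mu> \<in> ball p \<delta> - {p}" if "\<mu> \<in> sphere p r" for \<mu> using that r by auto
  obtain N C where C: "\<And>n \<mu> f. n \<ge> N \<Longrightarrow> \<mu> \<in> sphere p r \<Longrightarrow> f \<in> dom (An n) \<Longrightarrow> norm f \<le> C * norm (Tn n \<mu> f)"
  proof -
    have "\<mu> \<notin> P.W" if "\<mu> \<in> sphere p r" for \<mu> using sph[OF that] \<delta>3(2) \<delta>(4) by blast
    then show ?thesis using uniform_lower_bound[OF compact_sphere inv[OF sph]] that by blast
  qed
  \<comment> \<open>The bound on the circle holds for all \<open>n \<ge> N\<close>. For the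
    infinitely many \<open>n\<close> without spectrum in the disc the maximum principle carries it
    inside, and the core carries it over to the limit pencil.\<close>
  have bound: "norm x \<le> C * norm (P.T \<mu> x)" if \<mu>: "\<mu> \<in> cball p r" and x: "x \<in> dom A" for \<mu> x
  proof (rule lower_bound_transfer[OF star _ x])
    fix M
    obtain n where n: "n \<ge> max N M" "\<sigma>n n \<inter> ball p \<delta>1 = {}" using \<delta>1(2) by blast
    have invn: "binv (dom (An n)) (Hn n) (Tn n \<nu>)" if "\<nu> \<in> ball p \<delta>" for \<nu>
      using n(2) that \<delta>(2) spectrum_n_iff by blast
    have "norm f \<le> C * norm (Tn n \<mu> f)" if "f \<in> dom (An n)" for f
      using closable_pencil.disc_bound[OF closable_pencil_n[of n] r, unfolded Tn_eq, OF invn _ \<mu> that] C n(1) by simp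
    then show "\<exists>n\<ge>M. \<forall>f\<in>dom (An n). norm f \<le> C * norm (Tn n \<mu> f)" using n(1) by auto
  qed
  \<comment> \<open>The dense set of test vectors is \<open>dom A'\<close>, which lies in
    \<open>dom B'\<close>.\<close>
  have "binv (dom A) H (P.T p)"
  proof (rule closable_pencil.removable_point[OF closable_pencil r inv bound _ adjoint_dense])
    fix g assume g: "g \<in> dom A'"
    have "(g, app B' g) \<in> B'" by (rule linear_operatorD(3)[OF op'(2) subsetD[OF dom(2) g]])
    then show "\<exists>k. \<forall>x\<in>dom A. cinner (app B x) g = cinner x k"
      unfolding mem_adjoint_iff[OF op(2)] using dom(1) by blast
  qed
  then show False using p P.pencil_spectrum_iff by blast
qed

lemma lower_bound_not_approx_spectrum:
  assumes "truncation_core \<Omega>n A An" "\<And>N. \<exists>n\<ge>N. \<forall>f\<in>dom (An n). norm f \<le> C * norm (Tn n \<mu> f)"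
  shows "\<mu> \<notin> pencil_approx_spectrum A B"
proof
  assume "\<mu> \<in> pencil_approx_spectrum A B"
  then obtain x where x: "\<And>n. x n \<in> dom A" "\<And>n. norm (x n) = 1" "(\<lambda>n. P.T \<mu> (x n)) \<longlonglongrightarrow> 0"
    unfolding P.pencil_approx_spectrum_iff by blast
  have lim: "(\<lambda>n. C * norm (P.T \<mu> (x n))) \<longlonglongrightarrow> 0"
    by (rule tendsto_mult_right_zero[OF tendsto_norm_zero[OF x(3)]])
  have "1 \<le> C * norm (P.T \<mu> (x n))" for n using lower_bound_transfer[OF assms x(1)] x(2) by metis
  then have "1 \<le> (0::real)" by (intro LIMSEQ_le_const[OF lim]) blast
  then show False by simp
qed

section \<open>The selfadjoint case\<close>

lemma positive_n:
  assumes f: "f \<in> dom (An n)"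
  shows "(\<And>x. x \<in> dom A \<Longrightarrow> c * (norm x)\<^sup>2 \<le> Re (P.a x)) \<Longrightarrow> c * (norm f)\<^sup>2 \<le> Re (cinner (app (An n) f) f)"
    and "(\<And>x. x \<in> dom A \<Longrightarrow> c * (norm x)\<^sup>2 \<le> Re (P.b x)) \<Longrightarrow> c * (norm f)\<^sup>2 \<le> Re (cinner (app (Bn n) f) f)"
proof -
  obtain y where y: "\<And>k. y k \<in> dom A" "y \<longlonglongrightarrow> f" "(\<lambda>k. P.a (y k)) \<longlonglongrightarrow> cinner (app (An n) f) f"
    "(\<lambda>k. P.b (y k)) \<longlonglongrightarrow> cinner (app (Bn n) f) f"
    using form_limit[OF f] by blast
  have lim: "(\<lambda>k. c * (norm (y k))\<^sup>2) \<longlonglongrightarrow> c * (norm f)\<^sup>2"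
    "(\<lambda>k. Re (P.a (y k))) \<longlonglongrightarrow> Re (cinner (app (An n) f) f)"
    "(\<lambda>k. Re (P.b (y k))) \<longlonglongrightarrow> Re (cinner (app (Bn n) f) f)" by (intro tendsto_intros y)+
  show "c * (norm f)\<^sup>2 \<le> Re (cinner (app (An n) f) f)" if "\<And>x. x \<in> dom A \<Longrightarrow> c * (norm x)\<^sup>2 \<le> Re (P.a x)"
    by (rule LIMSEQ_le[OF lim(1,2)]) (use that y(1) in blast)
  show "c * (norm f)\<^sup>2 \<le> Re (cinner (app (Bn n) f) f)" if "\<And>x. x \<in> dom A \<Longrightarrow> c * (norm x)\<^sup>2 \<le> Re (P.b x)"
    by (rule LIMSEQ_le[OF lim(1,3)]) (use that y(1) in blast)
qed

text \<open>For infinitely many \<open>n\<close> the disc of radius \<open>\<delta>\<close> around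
  \<open>l\<close> is free of spectrum. \<open>symmetric_gap\<close> turns this into a lower bound
  with the constant \<open>c * \<delta>\<close>, which does not depend on \<open>n\<close> because
  positivity passes to \<open>Bn n\<close> with the same \<open>c\<close>.\<close>

lemma selfadjoint_approximated_B:
  assumes star: "truncation_core \<Omega>n A An"
    and sa: "\<And>n. selfadjoint (Hn n) (An n)" "\<And>n. selfadjoint (Hn n) (Bn n)"
    and c: "0 < c" "\<And>x. x \<in> dom A \<Longrightarrow> c * (norm x)\<^sup>2 \<le> Re (P.b x)"
    and l: "complex_of_real l \<in> pencil_approx_spectrum A B"
  shows "approximated \<sigma>n (of_real l)"
proof (rule ccontr)
  assume "\<not> ?thesis"
  then obtain \<delta> where \<delta>: "0 < \<delta>" "\<And>N. \<exists>n\<ge>N. \<sigma>n n \<inter> ball (of_real l) \<delta> = {}" using not_approximated by blast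
  show False
  proof (rule notE[OF lower_bound_not_approx_spectrum[OF star] l])
    fix N
    obtain n where n: "n \<ge> N" "\<sigma>n n \<inter> ball (complex_of_real l) \<delta> = {}" using \<delta>(2) by blast
    have inv: "binv (dom (An n)) (Hn n) (Tn n (of_real (l + s)))" if "\<bar>s\<bar> < \<delta>" for s
    proof -
      have "complex_of_real (l + s) \<in> ball (of_real l) \<delta>" using that by (simp add: dist_norm)
      then show ?thesis using n(2) spectrum_n_iff by blast
    qed
    have "norm f \<le> inverse (c * \<delta>) * norm (Tn n (of_real l) f)" if f: "f \<in> dom (An n)" for f
    proof -
      have "c * \<delta> * norm f \<le> norm (Tn n (of_real l) f)"
      proof (rule closable_pencil.symmetric_gap[OF closable_pencil_n, of n c \<delta> l f, unfolded Tn_eq, OF _ _ c(1) _ \<delta>(1) inv f])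
        show "c * (norm x)\<^sup>2 \<le> Re (cinner (app (Bn n) x) x)" if "x \<in> dom (An n)" for x
          by (rule positive_n(2)[OF that c(2)])
        show "cinner (app (An n) x) y = cinner x (app (An n) y)" "cinner (app (Bn n) x) y = cinner x (app (Bn n) y)"
          if "x \<in> dom (An n)" "y \<in> dom (An n)" for x y
          by (rule selfadjoint_symmetric[OF op(3) sa(1) that])
            (rule selfadjoint_symmetric[OF op(4) sa(2) subsetD[OF dom_n that(1)] subsetD[OF dom_n that(2)]])
      qed
      then show ?thesis using c(1) \<delta>(1) by (simp add: field_simps)
    qed
    then show "\<exists>n\<ge>N. \<forall>f\<in>dom (An n). norm f \<le> inverse (c * \<delta>) * norm (Tn n (of_real l) f)" using n(1) by blast
  qed
qed

text \<open>If \<open>A\<close> is the positive operator, the roles of \<open>A\<close> and \<open>B\<close> are exchanged: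
  \<open>B - \<nu>A = -\<nu>(A - \<nu>\<^sup>-\<^sup>1 B)\<close>.\<close>

lemma selfadjoint_approximated_A:
  assumes star: "truncation_core \<Omega>n A An"
    and sa: "\<And>n. selfadjoint (Hn n) (An n)" "\<And>n. selfadjoint (Hn n) (Bn n)"
    and c: "0 < c" "\<And>x. x \<in> dom A \<Longrightarrow> c * (norm x)\<^sup>2 \<le> Re (P.a x)"
    and l: "complex_of_real l \<in> pencil_approx_spectrum A B" "l \<noteq> 0"
  shows "approximated \<sigma>n (of_real l)"
proof (rule ccontr)
  assume "\<not> ?thesis"
  then obtain \<delta> where \<delta>: "0 < \<delta>" "\<And>N. \<exists>n\<ge>N. \<sigma>n n \<inter> ball (of_real l) \<delta> = {}" using not_approximated by blast
  \<comment> \<open>The exchanged pencil has the reciprocal spectral parameter, so the gap around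
    \<open>l\<close> is pulled back to a gap around \<open>1 / l\<close>.\<close>
  have "((\<lambda>s. inverse (1 / l + s)) \<longlongrightarrow> inverse (1 / l + 0)) (at 0)"
    using l(2) by (intro tendsto_intros) auto
  then obtain \<delta>1 where \<delta>1: "0 < \<delta>1" "\<And>s. s \<noteq> 0 \<Longrightarrow> \<bar>s\<bar> < \<delta>1 \<Longrightarrow> \<bar>inverse (1 / l + s) - l\<bar> < \<delta>"
    unfolding tendsto_iff eventually_at using \<delta>(1) l(2) by (auto simp: dist_real_def)
  \<comment> \<open>The second bound prevents \<open>1 / l + s\<close> from reaching
    \<open>0\<close>.\<close>
  define \<epsilon> where "\<epsilon> = min \<delta>1 \<bar>1 / l\<bar>"
  have \<epsilon>: "0 < \<epsilon>" using \<delta>1(1) l(2) by (simp add: \<epsilon>_def)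
  have near: "1 / l + s \<noteq> 0" "\<bar>inverse (1 / l + s) - l\<bar> < \<delta>" if s: "\<bar>s\<bar> < \<epsilon>" for s
  proof -
    show "1 / l + s \<noteq> 0" using s unfolding \<epsilon>_def by (auto simp: abs_if split: if_splits)
    show "\<bar>inverse (1 / l + s) - l\<bar> < \<delta>" using \<delta>1(2)[of s] s \<delta>(1) by (cases "s = 0") (auto simp: \<epsilon>_def)
  qed
  show False
  proof (rule notE[OF lower_bound_not_approx_spectrum[OF star] l(1)])
    fix N
    obtain n where n: "n \<ge> N" "\<sigma>n n \<inter> ball (complex_of_real l) \<delta> = {}" using \<delta>(2) by blast
    \<comment> \<open>\<open>operator_pair\<close> wants the domain of its first operator inside
      that of the second. \<open>Bn n\<close> may have the larger domain and is cut down to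
      \<open>dom (An n)\<close>.\<close>
    define B0 where "B0 = Bn n \<inter> dom (An n) \<times> UNIV"
    note sub = clinear_onD(1)[OF linear_operator_clinear_on[OF op(3)[of n]]]
    have B0: "(f, g) \<in> B0 \<longleftrightarrow> f \<in> dom (An n) \<and> g = app (Bn n) f" for f g
      unfolding B0_def using mem_graph_iff[OF op(4)] dom_n by blast
    have dom0: "dom B0 = dom (An n)" unfolding set_eq_iff Domain_iff[of _ B0] B0 by blast
    have lin0: "linear_operator (Hn n) B0"
    proof -
      have "B0 \<subseteq> Hn n \<times> Hn n" "single_valued B0"
        using linear_operatorD(1,2)[OF op(4)[of n]] unfolding B0_def single_valued_def by blast+
      moreover have "(0, 0) \<in> B0" using op(4)[of n] csubspace_0[OF sub] unfolding B0_def linear_operator_def by blast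
      moreover have "(f + f', g + g') \<in> B0" if "(f, g) \<in> B0" "(f', g') \<in> B0" for f g f' g'
        using that unfolding B0 by (simp add: csubspace_add[OF sub] clinear_onD(2)[OF operator_pair.clin_B[OF Pn]])
      moreover have "(k *\<^sub>C f, k *\<^sub>C g) \<in> B0" if "(f, g) \<in> B0" for f g k
        using that unfolding B0 by (simp add: csubspace_scale[OF sub] clinear_onD(3)[OF operator_pair.clin_B[OF Pn]])
      ultimately show ?thesis unfolding linear_operator_def by blast
    qed
    have app0: "app B0 f = app (Bn n) f" if "f \<in> dom (An n)" for f
      by (rule app_eq[OF linear_operatorD(1)[OF lin0]]) (use that B0 in blast)
    interpret Q: closable_pencil "Hn n" B0 "An n" 1 c
    proof (intro closable_pencil.intro closable_pencil_axioms.intro operator_pair.intro lin0 op(3) Hn)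
      show "dom B0 \<subseteq> dom (An n)" "closure (dom B0) = Hn n" unfolding dom0 by (simp_all add: dense(3))
      show "c * (norm x)\<^sup>2 \<le> Re (1 * cinner (app (An n) x) x)" if "x \<in> dom B0" for x
        using positive_n(1)[OF that[unfolded dom0] c(2)] by simp
    qed simp
    have QT: "Q.T (of_real \<nu>) f = (- of_real \<nu>) *\<^sub>C Tn n (of_real (inverse \<nu>)) f" if "\<nu> \<noteq> 0" "f \<in> dom (An n)" for \<nu> f
      using that by (simp add: Q.T_def Tn_def app0 scaleC.diff_right scaleC.minus_left)
    have inv: "binv (dom B0) (Hn n) (Q.T (of_real (1 / l + s)))" if s: "\<bar>s\<bar> < \<epsilon>" for s
    proof -
      let ?\<nu> = "1 / l + s"
      have "cmod (complex_of_real (inverse ?\<nu>) - of_real l) < \<delta>"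
        using near(2)[OF s] unfolding of_real_diff[symmetric] norm_of_real .
      then have "complex_of_real (inverse ?\<nu>) \<in> ball (of_real l) \<delta>" by (simp only: mem_ball dist_norm norm_minus_commute)
      then have "binv (dom (An n)) (Hn n) (Tn n (of_real (inverse ?\<nu>)))" using n(2) spectrum_n_iff by blast
      then have "binv (dom (An n)) (Hn n) (\<lambda>f. (- of_real ?\<nu>) *\<^sub>C Tn n (of_real (inverse ?\<nu>)) f)"
        by (rule binv_scaleC[OF Hn(1), rotated]) (use near(1)[OF s] in \<open>simp only: neg_equal_0_iff_equal of_real_eq_0_iff not_False_eq_True\<close>)
      moreover have "binv (dom (An n)) (Hn n) (Q.T (of_real ?\<nu>)) \<longleftrightarrow>
          binv (dom (An n)) (Hn n) (\<lambda>f. (- of_real ?\<nu>) *\<^sub>C Tn n (of_real (inverse ?\<nu>)) f)"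
        by (rule binv_cong) (rule QT[OF near(1)[OF s]])
      ultimately show ?thesis unfolding dom0 by (rule iffD2[rotated])
    qed
    have "norm f \<le> \<bar>1 / l\<bar> / (c * \<epsilon>) * norm (Tn n (of_real l) f)" if f: "f \<in> dom (An n)" for f
    proof -
      have "c * \<epsilon> * norm f \<le> norm (Q.T (of_real (1 / l)) f)"
      proof (rule Q.symmetric_gap[OF _ _ c(1) _ \<epsilon> inv])
        show "f \<in> dom B0" using f dom0 by simp
        fix x assume x: "x \<in> dom B0"
        then have x: "x \<in> dom (An n)" by (simp add: dom0)
        show "c * (norm x)\<^sup>2 \<le> Re (cinner (app (An n) x) x)" by (rule positive_n(1)[OF x c(2)])
        fix y assume "y \<in> dom B0"
        then have y: "y \<in> dom (An n)" by (simp add: dom0)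
        show "cinner (app (An n) x) y = cinner x (app (An n) y)" by (rule selfadjoint_symmetric[OF op(3) sa(1) x y])
        show "cinner (app B0 x) y = cinner x (app B0 y)"
          unfolding app0[OF x] app0[OF y]
          by (rule selfadjoint_symmetric[OF op(4) sa(2) subsetD[OF dom_n x] subsetD[OF dom_n y]])
      qed
      also have "\<dots> = \<bar>1 / l\<bar> * norm (Tn n (of_real l) f)"
        using QT[of "1 / l" f] f l(2) by (simp add: norm_scaleC norm_divide)
      finally have "norm f * (c * \<epsilon>) \<le> \<bar>1 / l\<bar> * norm (Tn n (of_real l) f)" by (simp only: mult.commute)
      then have "norm f \<le> (\<bar>1 / l\<bar> * norm (Tn n (of_real l) f)) / (c * \<epsilon>)"
        by (simp only: pos_le_divide_eq[OF mult_pos_pos[OF c(1) \<epsilon>]])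
      then show ?thesis by simp
    qed
    then show "\<exists>n\<ge>N. \<forall>f\<in>dom (An n). norm f \<le> \<bar>1 / l\<bar> / (c * \<epsilon>) * norm (Tn n (of_real l) f)" using n(1) by blast
  qed
qed

text \<open>The forms are real, so the imaginary part of the form of the pencil shows that
  \<open>Im \<mu>\<close> times \<open>b\<close> tends to \<open>0\<close>. If
  \<open>Im \<mu> \<noteq> 0\<close>, then \<open>b\<close> and with it \<open>a\<close> tends to
  \<open>0\<close>, against the positivity of one of them. Hence \<open>\<mu>\<close> is
  real.\<close>

lemma selfadjoint_approximated:
  assumes star: "truncation_core \<Omega>n A An" and sa: "selfadjoint H A" "selfadjoint H B"
    and san: "\<And>n. selfadjoint (Hn n) (An n)" "\<And>n. selfadjoint (Hn n) (Bn n)"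
    and pos: "uniformly_positive A \<or> uniformly_positive B" and \<mu>: "\<mu> \<in> pencil_approx_spectrum A B"
  shows "approximated \<sigma>n \<mu>"
proof -
  obtain x where x: "\<And>n. x n \<in> dom A" "\<And>n. norm (x n) = 1" "(\<lambda>n. P.T \<mu> (x n)) \<longlonglongrightarrow> 0"
    using \<mu> unfolding P.pencil_approx_spectrum_iff by blast
  have t: "(\<lambda>n. cinner (P.T \<mu> (x n)) (x n)) \<longlonglongrightarrow> 0"
  proof (rule Lim_null_comparison[OF always_eventually tendsto_norm_zero[OF x(3)]], rule allI)
    show "norm (cinner (P.T \<mu> (x n)) (x n)) \<le> norm (P.T \<mu> (x n))" for n
      using norm_cinner_le[of "P.T \<mu> (x n)" "x n"] x(2) by simp
  qed
  have xB: "x n \<in> dom B" for n by (rule subsetD[OF dom(1) x(1)])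
  have im: "Im (P.a (x n)) = 0" "Im (P.b (x n)) = 0" for n
    using symmetric_form_real[OF selfadjoint_symmetric[OF op(1) sa(1) x(1) x(1)]]
      symmetric_form_real[OF selfadjoint_symmetric[OF op(2) sa(2) xB xB]] by blast+
  have Im: "(\<lambda>n. Im \<mu> * Re (P.b (x n))) \<longlonglongrightarrow> 0"
    using tendsto_minus[OF tendsto_Im[OF t]] im by (simp add: P.t_eq)
  have Re: "(\<lambda>n. Re (P.a (x n)) - Re \<mu> * Re (P.b (x n))) \<longlonglongrightarrow> 0"
    using tendsto_Re[OF t] im by (simp add: P.t_eq)
  have no: False if "0 < c" "\<And>n. c \<le> u n" "u \<longlonglongrightarrow> 0" for c :: real and u
    using LIMSEQ_le_const[OF that(3)] that(1,2) by force
  show ?thesis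
    using pos
  proof
    assume "uniformly_positive B"
    then obtain c where c: "0 < c" "\<And>f. f \<in> dom B \<Longrightarrow> c * (norm f)\<^sup>2 \<le> Re (P.b f)" unfolding uniformly_positive_def by blast
    have "Im \<mu> = 0"
    proof (rule ccontr)
      assume "Im \<mu> \<noteq> 0"
      then have lim: "(\<lambda>n. Re (P.b (x n))) \<longlonglongrightarrow> 0" using tendsto_mult_left_iff[of "Im \<mu>" _ 0] Im by simp
      have "c \<le> Re (P.b (x n))" for n using c(2)[OF xB[of n]] x(2)[of n] by simp
      then show False by (rule no[OF c(1) _ lim])
    qed
    then have \<mu>: "complex_of_real (Re \<mu>) = \<mu>" by (simp add: complex_eq_iff)
    show ?thesis
      using selfadjoint_approximated_B[OF star san c(1) c(2)[OF subsetD[OF dom(1)]], of "Re \<mu>"] assms(7) unfolding \<mu> by simp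
  next
    assume "uniformly_positive A"
    then obtain c where c: "0 < c" "\<And>f. f \<in> dom A \<Longrightarrow> c * (norm f)\<^sup>2 \<le> Re (P.a f)" unfolding uniformly_positive_def by blast
    have "c \<le> Re (P.a (x n))" for n using c(2)[OF x(1)[of n]] x(2)[of n] by simp
    note not0 = no[OF c(1) this]
    have "Im \<mu> = 0"
    proof (rule ccontr)
      assume "Im \<mu> \<noteq> 0"
      then have b: "(\<lambda>n. Re (P.b (x n))) \<longlonglongrightarrow> 0" using tendsto_mult_left_iff[of "Im \<mu>" _ 0] Im by simp
      have "(\<lambda>n. Re (P.a (x n)) - Re \<mu> * Re (P.b (x n)) + Re \<mu> * Re (P.b (x n))) \<longlonglongrightarrow> 0 + Re \<mu> * 0"
        by (intro tendsto_intros Re b)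
      then show False using not0 by simp
    qed
    then have \<mu>: "complex_of_real (Re \<mu>) = \<mu>" by (simp add: complex_eq_iff)
    \<comment> \<open>Otherwise the form of \<open>A\<close> would tend to \<open>0\<close>. The
      exchange of roles divides by \<open>\<mu>\<close>.\<close>
    have "Re \<mu> \<noteq> 0" using Re not0 by auto
    then show ?thesis
      using selfadjoint_approximated_A[OF star san c, of "Re \<mu>"] assms(7) unfolding \<mu> by simp
  qed
qed

end

theorem theorem3p5:
  fixes \<Omega> :: "(real^'d) set" and \<Omega>n :: "nat \<Rightarrow> (real^'d) set"
    and \<tau>\<^sub>1 \<tau>\<^sub>2 :: "'d diff_expr"
    and A B :: "'d operator" and An Bn :: "nat \<Rightarrow> 'd operator"
  assumes "domain \<Omega>"
    and "\<forall>n. domain (\<Omega>n n) \<and> bounded (\<Omega>n n) \<and> \<Omega>n n \<subseteq> \<Omega> \<and> \<Omega>n n \<subseteq> \<Omega>n (Suc n)"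
    and "(\<Union>n. \<Omega>n n) = \<Omega>"
    and "realisation \<tau>\<^sub>1 \<Omega> A" and "realisation \<tau>\<^sub>2 \<Omega> B"
    and "relatively_bounded B A"
    and "relatively_bounded (adjoint (L2_on \<Omega>) B) (adjoint (L2_on \<Omega>) A)"
    and "\<forall>n. realisation \<tau>\<^sub>1 (\<Omega>n n) (An n)" and "\<forall>n. realisation \<tau>\<^sub>2 (\<Omega>n n) (Bn n)"
    and "\<forall>n. dom (An n) \<subseteq> dom (Bn n)"
    and "\<forall>n. dom (adjoint (L2_on (\<Omega>n n)) (An n)) \<subseteq> dom (adjoint (L2_on (\<Omega>n n)) (Bn n))"
    and a: "truncation_core \<Omega>n (adjoint (L2_on \<Omega>) A) (\<lambda>n. adjoint (L2_on (\<Omega>n n)) (An n))"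
    and b: "closable_form (dom A) (qform A)" "closable_form (dom B) (qform B)"
      "dom_form_closure (dom A) (qform A) \<subseteq> dom_form_closure (dom B) (qform B)"
      "\<forall>n. \<forall>f\<in>dom (An n). f \<in> dom_form_closure (dom A) (qform A) \<and>
         cinner (app (An n) f) f = form_closure (dom A) (qform A) f \<and>
         cinner (app (Bn n) f) f = form_closure (dom B) (qform B) f"
    and c: "\<forall>n. \<forall>\<mu>\<in>pencil_spectrum (L2_on (\<Omega>n n)) (An n) (Bn n).
         pencil_eigenvalue (An n) (Bn n) \<mu>"
      "\<forall>n. \<forall>\<mu>\<in>pencil_spectrum (L2_on (\<Omega>n n))
           (adjoint (L2_on (\<Omega>n n)) (An n)) (adjoint (L2_on (\<Omega>n n)) (Bn n)).
         pencil_eigenvalue (adjoint (L2_on (\<Omega>n n)) (An n)) (adjoint (L2_on (\<Omega>n n)) (Bn n)) \<mu>"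
  shows "let \<sigma> = pencil_spectrum (L2_on \<Omega>) A B;
             \<sigma>n = \<lambda>n. pencil_spectrum (L2_on (\<Omega>n n)) (An n) (Bn n);
             W\<^sub>e = pencil_ess_num_range A B;
             w\<^sub>e = pencil_ess_quotient_range A B;
             star = truncation_core \<Omega>n A An
         in
      (0 \<notin> ess_num_range A \<inter> ess_num_range B \<or> W\<^sub>e \<noteq> UNIV \<longrightarrow>
         (\<forall>\<mu>. spurious \<sigma> \<sigma>n \<mu> \<longrightarrow> \<mu> \<in> w\<^sub>e) \<and> closure W\<^sub>e \<subseteq> w\<^sub>e \<and>
         (star \<longrightarrow> (\<forall>\<mu>. \<mu> isolated_in \<sigma> \<and> \<mu> \<notin> w\<^sub>e \<longrightarrow> approximated \<sigma>n \<mu>)))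
    \<and> (bounded_operator B \<longrightarrow>
         (\<forall>\<mu>. spurious \<sigma> \<sigma>n \<mu> \<longrightarrow> \<mu> \<in> W\<^sub>e) \<and> w\<^sub>e \<subseteq> W\<^sub>e \<and>
         (star \<longrightarrow> (\<forall>\<mu>. \<mu> isolated_in \<sigma> \<and> \<mu> \<notin> W\<^sub>e \<longrightarrow> approximated \<sigma>n \<mu>)))
    \<and> (selfadjoint (L2_on \<Omega>) A \<and> selfadjoint (L2_on \<Omega>) B \<and>
         (uniformly_positive A \<or> uniformly_positive B) \<and>
         (\<forall>n. selfadjoint (L2_on (\<Omega>n n)) (An n) \<and> selfadjoint (L2_on (\<Omega>n n)) (Bn n)) \<and> star \<longrightarrow>
         (\<forall>\<mu>\<in>pencil_approx_spectrum A B. approximated \<sigma>n \<mu>))"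
proof -
  note opA = assms(4) and opB = assms(5)
  have "linear_operator (L2_on \<Omega>) A" "linear_operator (L2_on \<Omega>) B"
    using assms(4,5) by (auto simp: realisation_def)
  note lin = this
  obtain \<omega>A \<gamma>A MA where SA: "sectorial_operator (dom A) (app A) \<omega>A \<gamma>A MA"
    by (rule closable_form_sectorial[OF lin(1) b(1)])
  obtain \<omega>B \<gamma>B MB where SB: "sectorial_operator (dom B) (app B) \<omega>B \<gamma>B MB"
    by (rule closable_form_sectorial[OF lin(2) b(2)])
  interpret truncation A B \<omega>A \<omega>B \<gamma>A MA \<gamma>B MB \<Omega> \<Omega>n \<tau>\<^sub>1 \<tau>\<^sub>2 An Bn
    using assms(1-11) a b(3,4)
    by (intro truncation.intro truncation_axioms.intro SA SB) (auto simp: domain_def)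
  have spurious: "\<mu> \<in> P.W" if "spurious (pencil_spectrum H A B) \<sigma>n \<mu>" for \<mu>
    by (rule spurious_in_W[OF _ that]) (use c(1) in blast)
  have W: "P.W = pencil_ess_quotient_range A B" "closure (pencil_ess_num_range A B) \<subseteq> pencil_ess_quotient_range A B"
    if "0 \<notin> ess_num_range A \<inter> ess_num_range B \<or> pencil_ess_num_range A B \<noteq> UNIV"
  proof -
    show W: "P.W = pencil_ess_quotient_range A B" by (rule P.W_eq_quotient_range[OF that])
    have "pencil_ess_num_range A B \<subseteq> P.W" by (simp add: P.W_def)
    then show "closure (pencil_ess_num_range A B) \<subseteq> pencil_ess_quotient_range A B"
      using closure_minimal[OF _ P.closed_W] unfolding W by blast
  qed
  have W': "P.W = pencil_ess_num_range A B" "pencil_ess_quotient_range A B \<subseteq> pencil_ess_num_range A B"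
    if "bounded_operator B"
    using P.quotient_range_subset[OF that] by (auto simp: P.W_def)
  show ?thesis
    unfolding Let_def
  proof (intro conjI impI)
    assume "0 \<notin> ess_num_range A \<inter> ess_num_range B \<or> pencil_ess_num_range A B \<noteq> UNIV"
    note W = W[OF this]
    show "\<forall>\<mu>. spurious (pencil_spectrum H A B) \<sigma>n \<mu> \<longrightarrow> \<mu> \<in> pencil_ess_quotient_range A B"
      using spurious unfolding W(1) by blast
    show "closure (pencil_ess_num_range A B) \<subseteq> pencil_ess_quotient_range A B" by (rule W(2))
    show "\<forall>\<mu>. \<mu> isolated_in pencil_spectrum H A B \<and> \<mu> \<notin> pencil_ess_quotient_range A B \<longrightarrow> approximated \<sigma>n \<mu>"
      if "truncation_core \<Omega>n A An"
      using isolated_approximated[OF that] unfolding W(1) by blast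
  next
    assume "bounded_operator B"
    note W = W'[OF this]
    show "\<forall>\<mu>. spurious (pencil_spectrum H A B) \<sigma>n \<mu> \<longrightarrow> \<mu> \<in> pencil_ess_num_range A B"
      using spurious unfolding W(1) by blast
    show "pencil_ess_quotient_range A B \<subseteq> pencil_ess_num_range A B" by (rule W(2))
    show "\<forall>\<mu>. \<mu> isolated_in pencil_spectrum H A B \<and> \<mu> \<notin> pencil_ess_num_range A B \<longrightarrow> approximated \<sigma>n \<mu>"
      if "truncation_core \<Omega>n A An"
      using isolated_approximated[OF that] unfolding W(1) by blast
  next
    assume "selfadjoint H A \<and> selfadjoint H B \<and> (uniformly_positive A \<or> uniformly_positive B) \<and>
      (\<forall>n. selfadjoint (Hn n) (An n) \<and> selfadjoint (Hn n) (Bn n)) \<and> truncation_core \<Omega>n A An"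
    then show "\<forall>\<mu>\<in>pencil_approx_spectrum A B. approximated \<sigma>n \<mu>"
      using selfadjoint_approximated by blast
  qed
qed

end
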